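(* Let $\mathfrak L$ be a 2-pointed 2-category, with a fixed choice $0$ of a representative for a bizero object. The following conditions are equivalent: (i) There exist a $(1,1)$-proper factorization system $(\mathcal E,\mathcal M)$ on $\mathfrak L$ and a biequivalence over $\mathfrak L$, given by normal pseudofunctors $K\colon\mathfrak E\to\mathfrak M$ and $C\colon\mathfrak M\to\mathfrak E$, between $\operatorname{dom}\colon\mathfrak E\to\mathfrak L$ and $\operatorname{cod}\colon\mathfrak M\to\mathfrak L$, such that $K$ sends identities $\mathrm{id}_A$ to morphisms with domain $0$ and $C$ sends identities $\mathrm{id}_A$ to morphisms with codomain $0$. (ii) The 2-ideal $\mathcal N=(0)$ canonically associated to $\mathfrak L$ is such that - $\mathfrak L$ has all $\mathcal N$-2-kernels and all $\mathcal N$-2-cokernels; - $\mathcal N$ is a closed 2-ideal; - every $\mathcal N$-2-kernel $m$ is an $\mathcal N$-2-kernel of its $\mathcal N$-2-cokernel $c_m$, with structure invertible 2-cell between $c_m\circ m$ and a null morphism given, up to an invertible null 2-cell, by the structure 2-cell of the $\mathcal N$-2-cokernel $c_m$ of $m$; and dually for $\mathcal N$-2-cokernels; - every morphism $f$ of $\mathfrak L$ is isomorphic (via an invertible 2-cell) to a composite of an $\mathcal N$-2-cokernel followed by an $\mathcal N$-2-kernel.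
   Context: Conventions. 2-categories are strict. Whiskering is written by juxtaposition; a chain $x\Rightarrow y\Rightarrow z$ of 2-cells denotes the vertical composite. 2-pointed. $\mathfrak L$ is 2-pointed if it has a bizero object $0$, i.e. all $\mathfrak L(A,0)$ and $\mathfrak L(0,A)$ are equivalent to the terminal category. 2-ideals. A 2-ideal $\mathcal N=(N,\nu)$ in $\mathfrak L$ is a normal pseudofunctor $N\colon\mathfrak L^{op}\times\mathfrak L\to\mathbf{Cat}$ with a pseudonatural transformation $\nu\colon N\Rightarrow\mathrm{Hom}(-,-)$ whose components $N(A,B)\to\mathrm{Hom}_{\mathfrak L}(A,B)$ are injective on objects and faithful. View $N(A,B)$ as a subcategory of $\mathrm{Hom}(A,B)$: its objects are the null morphisms, its morphisms the null 2-cells; an invertible null 2-cell is an isomorphism of $N(A,B)$. For $n\colon A\to B$ null, $a\colon A'\to A$, $b\colon B\to B'$, put $\widetilde{bna}:=N(a,b)(n)$ and let $\nu=\nu_{a,b,n}\colon bna\Rightarrow\widetilde{bna}$ be the invertible 2-cell given by pseudonaturality (identities among $a,b$ are omitted from the notation). The 2-ideal $(0)$. Null morphisms are those that factor as $A\xrightarrow{t}0\xrightarrow{i}B$; null 2-cells $it\Rightarrow i't'$ are those obtained by pasting the unique (invertible) 2-cells $t\Rightarrow t'$ and $i\Rightarrow i'$; $\widetilde{bna}$ is $bna$ and $\nu_{a,b,n}$ is the identity. 2-kernels. An $\mathcal N$-2-kernel of $f\colon A\to B$ is $k\colon K\to A$ with a null $n\colon K\to B$ and an invertible 2-cell $\alpha\colon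 fk\Rightarrow n$ (structure 2-cell) such that: (1) for every $z\colon Z\to A$, null $p\colon Z\to B$ and invertible $\beta\colon fz\Rightarrow p$ there are $u\colon Z\to K$ and an invertible $\gamma\colon z\Rightarrow ku$ such that $p\xrightarrow{\beta^{-1}}fz\xrightarrow{f\gamma}fku\xrightarrow{\alpha u}nu\xrightarrow{\nu}\widetilde{nu}$ is an invertible null 2-cell; (2) for all $u,v\colon Z\to K$ and $\lambda\colon ku\Rightarrow kv$ such that $\widetilde{nu}\xrightarrow{\nu^{-1}}nu\xrightarrow{\alpha^{-1}u}fku\xrightarrow{f\lambda}fkv\xrightarrow{\alpha v}nv\xrightarrow{\nu}\widetilde{nv}$ is a null 2-cell, there is a unique $\mu\colon u\Rightarrow v$ with $k\mu=\lambda$. $\mathcal N$-2-cokernels are defined dually (reversing morphisms). Closed 2-ideals. $k\colon K\to A$ reflects null morphisms if for all $s\colon D\to K$, null $n\colon D\to A$ and invertible $\delta\colon ks\Rightarrow n$ there are a null $\hat\psi\colon D\to K$ and an invertible $\psi\colon s\Rightarrow\hat\psi$ such that $n\xrightarrow{\delta^{-1}}ks\xrightarrow{k\psi}k\hat\psi\xrightarrow{\nu}\widetilde{k\hat\psi}$ is an invertible null 2-cell. $k$ reflects null 2-cells if for every 2-cell $\mu\colon s\Rightarrow s'\colon D\to K$ between null morphisms, if $\widetilde{ks}\xrightarrow{\nu^{-1}}ks\xrightarrow{k\mu}ks'\xrightarrow{\nu}\widetilde{ks'}$ is null then $\mu$ is null. "Coreflects" is dual. If $\mathfrak L$ has all $\mathcal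 N$-2-kernels and $\mathcal N$-2-cokernels, $\mathcal N$ is closed if all $\mathcal N$-2-kernels reflect null morphisms and null 2-cells and all $\mathcal N$-2-cokernels coreflect null morphisms and null 2-cells. Factorization systems (Dupont–Vitale). A factorization system $(\mathcal E,\mathcal M)$ on $\mathfrak L$ consists of two classes of morphisms such that: if $m\in\mathcal M$ and $i$ is an equivalence then $mi\in\mathcal M$, and dually $ie\in\mathcal E$ for $e\in\mathcal E$; both classes are closed under invertible 2-cells; every morphism is isomorphic to $me$ with $e\in\mathcal E$, $m\in\mathcal M$; and orthogonality holds: for $e\colon D\to R$ in $\mathcal E$, $m\colon Q\to A$ in $\mathcal M$, $s\colon D\to Q$, $t\colon R\to A$ and invertible $\phi\colon ms\Rightarrow te$ there are $d\colon R\to Q$ and invertible $\sigma\colon s\Rightarrow de$, $\rho\colon md\Rightarrow t$ with $\phi=(\rho e)\circ(m\sigma)$; and given two such squares with fillings $(s,t,\phi;d,\sigma,\rho)$, $(s',t',\phi';d',\sigma',\rho')$ and 2-cells $\lambda\colon s\Rightarrow s'$, $\mu\colon t\Rightarrow t'$ with $\phi'\circ(m\lambda)=(\mu e)\circ\phi$, there is a unique $\iota\colon d\Rightarrow d'$ with $\rho'\circ(m\iota)=\mu\circ\rho$ and $(\iota e)\circ\sigma=\sigma'\circ\lambda$. It is $(1,1)$-proper if every $e\in\mathcal E$ is cofaithful (precomposition with $e$ is faithful on hom-categories) and every $m\in\mathcal M$ is faithful (postcomposition with $m$ is faithful on hom-categories). The 2-functors dom and cod. The pseudo arrow 2-category of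 $\mathfrak L$ has as objects the morphisms of $\mathfrak L$, as morphisms the squares filled with an invertible 2-cell, as 2-cells the pairs of 2-cells of $\mathfrak L$ (between the two horizontal sides) compatible with the filling 2-cells. $\mathfrak E$ and $\mathfrak M$ are its full sub-2-categories on morphisms in $\mathcal E$ and in $\mathcal M$, with domain and codomain 2-functors $\operatorname{dom}\colon\mathfrak E\to\mathfrak L$, $\operatorname{cod}\colon\mathfrak M\to\mathfrak L$. A biequivalence over $\mathfrak L$ between them consists of pseudofunctors $K,C$ with $\operatorname{cod}\circ K=\operatorname{dom}$, $\operatorname{dom}\circ C=\operatorname{cod}$ and pseudonatural equivalences $\eta\colon\mathrm{Id}\Rightarrow K C$, $\epsilon\colon CK\Rightarrow\mathrm{Id}$ lying over $\mathfrak L$ (components and structure 2-cells are sent to identities in $\mathfrak L$). A pseudofunctor is normal if it strictly preserves identities. *)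

theory Defs
  imports Main
begin

section \<open>Strict 2-categories\<close>

record ('o, 'a, 'c) twocat =
  Ob :: "'o set"
  Mor :: "'a set"
  Cell :: "'c set"
  src :: "'a \<Rightarrow> 'o"
  tgt :: "'a \<Rightarrow> 'o"
  dom2 :: "'c \<Rightarrow> 'a"
  cod2 :: "'c \<Rightarrow> 'a"
  id1 :: "'o \<Rightarrow> 'a"
  id2 :: "'a \<Rightarrow> 'c"
  comp1 :: "'a \<Rightarrow> 'a \<Rightarrow> 'a" (infixr "\<odot>\<index>" 75)
  vcomp :: "'c \<Rightarrow> 'c \<Rightarrow> 'c" (infixr "\<bullet>\<index>" 65)
  hcomp :: "'c \<Rightarrow> 'c \<Rightarrow> 'c" (infixr "\<star>\<index>" 70)

definition hom1 :: "('o, 'a, 'c) twocat \<Rightarrow> 'o \<Rightarrow> 'o \<Rightarrow> 'a set" where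
  "hom1 L A B = {f \<in> Mor L. src L f = A \<and> tgt L f = B}"

definition hom2 :: "('o, 'a, 'c) twocat \<Rightarrow> 'a \<Rightarrow> 'a \<Rightarrow> 'c set" where
  "hom2 L f g = {\<alpha> \<in> Cell L. dom2 L \<alpha> = f \<and> cod2 L \<alpha> = g}"

abbreviation lwhisker :: "('o, 'a, 'c) twocat \<Rightarrow> 'a \<Rightarrow> 'c \<Rightarrow> 'c" (infixr "\<rhd>\<index>" 70) where
  "lwhisker L f \<alpha> \<equiv> hcomp L (id2 L f) \<alpha>"

abbreviation rwhisker :: "('o, 'a, 'c) twocat \<Rightarrow> 'c \<Rightarrow> 'a \<Rightarrow> 'c" (infixl "\<lhd>\<index>" 72) where
  "rwhisker L \<alpha> f \<equiv> hcomp L \<alpha> (id2 L f)"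

locale two_category =
  fixes L :: "('o, 'a, 'c) twocat" (structure)
  assumes src_Ob: "f \<in> Mor L \<Longrightarrow> src L f \<in> Ob L"
    and tgt_Ob: "f \<in> Mor L \<Longrightarrow> tgt L f \<in> Ob L"
    and id1_hom: "A \<in> Ob L \<Longrightarrow> id1 L A \<in> hom1 L A A"
    and comp1_hom: "\<lbrakk>f \<in> hom1 L A B; g \<in> hom1 L B C\<rbrakk> \<Longrightarrow> g \<odot> f \<in> hom1 L A C"
    and comp1_assoc: "\<lbrakk>f \<in> hom1 L A B; g \<in> hom1 L B C; h \<in> hom1 L C D\<rbrakk>
      \<Longrightarrow> (h \<odot> g) \<odot> f = h \<odot> (g \<odot> f)"
    and comp1_id_right: "f \<in> hom1 L A B \<Longrightarrow> f \<odot> id1 L A = f"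
    and comp1_id_left: "f \<in> hom1 L A B \<Longrightarrow> id1 L B \<odot> f = f"
    and dom2_Mor: "\<alpha> \<in> Cell L \<Longrightarrow> dom2 L \<alpha> \<in> Mor L"
    and cod2_Mor: "\<alpha> \<in> Cell L \<Longrightarrow> cod2 L \<alpha> \<in> Mor L"
    and cell_src: "\<alpha> \<in> Cell L \<Longrightarrow> src L (cod2 L \<alpha>) = src L (dom2 L \<alpha>)"
    and cell_tgt: "\<alpha> \<in> Cell L \<Longrightarrow> tgt L (cod2 L \<alpha>) = tgt L (dom2 L \<alpha>)"
    and id2_hom: "f \<in> Mor L \<Longrightarrow> id2 L f \<in> hom2 L f f"
    and vcomp_hom: "\<lbrakk>\<alpha> \<in> hom2 L f g; \<beta> \<in> hom2 L g h\<rbrakk> \<Longrightarrow> \<beta> \<bullet> \<alpha> \<in> hom2 L f h"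
    and vcomp_assoc: "\<lbrakk>\<alpha> \<in> hom2 L f g; \<beta> \<in> hom2 L g h; \<gamma> \<in> hom2 L h k\<rbrakk>
      \<Longrightarrow> (\<gamma> \<bullet> \<beta>) \<bullet> \<alpha> = \<gamma> \<bullet> (\<beta> \<bullet> \<alpha>)"
    and vcomp_id_right: "\<alpha> \<in> hom2 L f g \<Longrightarrow> \<alpha> \<bullet> id2 L f = \<alpha>"
    and vcomp_id_left: "\<alpha> \<in> hom2 L f g \<Longrightarrow> id2 L g \<bullet> \<alpha> = \<alpha>"
    and hcomp_hom: "\<lbrakk>f \<in> hom1 L A B; g \<in> hom1 L B C; \<alpha> \<in> hom2 L f f'; \<beta> \<in> hom2 L g g'\<rbrakk>
      \<Longrightarrow> \<beta> \<star> \<alpha> \<in> hom2 L (g \<odot> f) (g' \<odot> f')"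
    and hcomp_assoc: "\<lbrakk>f \<in> hom1 L A B; g \<in> hom1 L B C; h \<in> hom1 L C D;
      \<alpha> \<in> hom2 L f f'; \<beta> \<in> hom2 L g g'; \<gamma> \<in> hom2 L h h'\<rbrakk>
      \<Longrightarrow> (\<gamma> \<star> \<beta>) \<star> \<alpha> = \<gamma> \<star> (\<beta> \<star> \<alpha>)"
    and hcomp_id_right: "\<lbrakk>f \<in> hom1 L A B; \<alpha> \<in> hom2 L f f'\<rbrakk> \<Longrightarrow> \<alpha> \<star> id2 L (id1 L A) = \<alpha>"
    and hcomp_id_left: "\<lbrakk>f \<in> hom1 L A B; \<alpha> \<in> hom2 L f f'\<rbrakk> \<Longrightarrow> id2 L (id1 L B) \<star> \<alpha> = \<alpha>"
    and hcomp_id2: "\<lbrakk>f \<in> hom1 L A B; g \<in> hom1 L B C\<rbrakk> \<Longrightarrow> id2 L g \<star> id2 L f = id2 L (g \<odot> f)"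
    and interchange: "\<lbrakk>f \<in> hom1 L A B; g \<in> hom1 L B C; \<alpha> \<in> hom2 L f f'; \<alpha>' \<in> hom2 L f' f'';
      \<beta> \<in> hom2 L g g'; \<beta>' \<in> hom2 L g' g''\<rbrakk>
      \<Longrightarrow> (\<beta>' \<bullet> \<beta>) \<star> (\<alpha>' \<bullet> \<alpha>) = (\<beta>' \<star> \<alpha>') \<bullet> (\<beta> \<star> \<alpha>)"

text \<open>The dual reverses 1-cells but not 2-cells.\<close>

definition op :: "('o, 'a, 'c) twocat \<Rightarrow> ('o, 'a, 'c) twocat" where
  "op L = L\<lparr>src := tgt L, tgt := src L,
     comp1 := \<lambda>g f. comp1 L f g, hcomp := \<lambda>\<beta> \<alpha>. hcomp L \<alpha> \<beta>\<rparr>"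

context
  fixes L :: "('o, 'a, 'c) twocat" (structure)
begin

definition inverse2 :: "'c \<Rightarrow> 'c \<Rightarrow> bool" where
  "inverse2 \<alpha> \<beta> \<longleftrightarrow> \<alpha> \<in> Cell L \<and> \<beta> \<in> hom2 L (cod2 L \<alpha>) (dom2 L \<alpha>) \<and>
     \<beta> \<bullet> \<alpha> = id2 L (dom2 L \<alpha>) \<and> \<alpha> \<bullet> \<beta> = id2 L (cod2 L \<alpha>)"

definition inv2 :: "'c \<Rightarrow> 'c" where
  "inv2 \<alpha> = (THE \<beta>. inverse2 \<alpha> \<beta>)"

definition iso2 :: "'a \<Rightarrow> 'a \<Rightarrow> 'c set" where
  "iso2 f g = {\<alpha> \<in> hom2 L f g. \<exists>\<beta>. inverse2 \<alpha> \<beta>}"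

definition equivalence1 :: "'a \<Rightarrow> bool" where
  "equivalence1 f \<longleftrightarrow> f \<in> Mor L \<and> (\<exists>g \<in> hom1 L (tgt L f) (src L f).
     iso2 (g \<odot> f) (id1 L (src L f)) \<noteq> {} \<and> iso2 (f \<odot> g) (id1 L (tgt L f)) \<noteq> {})"

definition faithful1 :: "'a \<Rightarrow> bool" where
  "faithful1 m \<longleftrightarrow> m \<in> Mor L \<and>
     (\<forall>D. \<forall>u \<in> hom1 L D (src L m). \<forall>v \<in> hom1 L D (src L m).
        \<forall>\<alpha> \<in> hom2 L u v. \<forall>\<beta> \<in> hom2 L u v. m \<rhd> \<alpha> = m \<rhd> \<beta> \<longrightarrow> \<alpha> = \<beta>)"

end

definition cofaithful1 :: "('o, 'a, 'c) twocat \<Rightarrow> 'a \<Rightarrow> bool" where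
  "cofaithful1 L e \<longleftrightarrow> faithful1 (op L) e"


section \<open>Bizero objects\<close>

record ('x, 'm) cat =
  CObj :: "'x set"
  CArr :: "'m set"
  cdom :: "'m \<Rightarrow> 'x"
  ccod :: "'m \<Rightarrow> 'x"
  cid :: "'x \<Rightarrow> 'm"
  ccomp :: "'m \<Rightarrow> 'm \<Rightarrow> 'm"

definition chom :: "('x, 'm) cat \<Rightarrow> 'x \<Rightarrow> 'x \<Rightarrow> 'm set" where
  "chom C x y = {m \<in> CArr C. cdom C m = x \<and> ccod C m = y}"

definition functor_between ::
  "('x, 'm) cat \<Rightarrow> ('y, 'n) cat \<Rightarrow> ('x \<Rightarrow> 'y) \<Rightarrow> ('m \<Rightarrow> 'n) \<Rightarrow> bool" where
  "functor_between C D F0 F1 \<longleftrightarrow>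
     (\<forall>x \<in> CObj C. F0 x \<in> CObj D \<and> F1 (cid C x) = cid D (F0 x)) \<and>
     (\<forall>x \<in> CObj C. \<forall>y \<in> CObj C. \<forall>m \<in> chom C x y. F1 m \<in> chom D (F0 x) (F0 y)) \<and>
     (\<forall>x \<in> CObj C. \<forall>y \<in> CObj C. \<forall>z \<in> CObj C. \<forall>m \<in> chom C x y. \<forall>n \<in> chom C y z.
        F1 (ccomp C n m) = ccomp D (F1 n) (F1 m))"

definition natural_iso ::
  "('x, 'm) cat \<Rightarrow> ('y, 'n) cat \<Rightarrow> ('x \<Rightarrow> 'y) \<Rightarrow> ('m \<Rightarrow> 'n) \<Rightarrow> ('x \<Rightarrow> 'y) \<Rightarrow> ('m \<Rightarrow> 'n) \<Rightarrow> ('x \<Rightarrow> 'n) \<Rightarrow> bool"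
where
  "natural_iso C D F0 F1 G0 G1 \<theta> \<longleftrightarrow>
     (\<forall>x \<in> CObj C. \<theta> x \<in> chom D (F0 x) (G0 x) \<and>
        (\<exists>\<theta>' \<in> chom D (G0 x) (F0 x).
           ccomp D \<theta>' (\<theta> x) = cid D (F0 x) \<and> ccomp D (\<theta> x) \<theta>' = cid D (G0 x))) \<and>
     (\<forall>x \<in> CObj C. \<forall>y \<in> CObj C. \<forall>m \<in> chom C x y.
        ccomp D (\<theta> y) (F1 m) = ccomp D (G1 m) (\<theta> x))"

definition equivalent_cats :: "('x, 'm) cat \<Rightarrow> ('y, 'n) cat \<Rightarrow> bool" where
  "equivalent_cats C D \<longleftrightarrow> (\<exists>F0 F1 G0 G1 \<eta> \<epsilon>.
     functor_between C D F0 F1 \<and> functor_between D C G0 G1 \<and>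
     natural_iso C C id id (G0 \<circ> F0) (G1 \<circ> F1) \<eta> \<and>
     natural_iso D D (F0 \<circ> G0) (F1 \<circ> G1) id id \<epsilon>)"

definition terminal_cat :: "(unit, unit) cat" where
  "terminal_cat = \<lparr>CObj = {()}, CArr = {()}, cdom = id, ccod = id, cid = id, ccomp = \<lambda>_ _. ()\<rparr>"

definition hom_cat :: "('o, 'a, 'c) twocat \<Rightarrow> 'o \<Rightarrow> 'o \<Rightarrow> ('a, 'c) cat" where
  "hom_cat L A B = \<lparr>CObj = hom1 L A B, CArr = {\<alpha> \<in> Cell L. dom2 L \<alpha> \<in> hom1 L A B},
     cdom = dom2 L, ccod = cod2 L, cid = id2 L, ccomp = vcomp L\<rparr>"

definition bizero :: "('o, 'a, 'c) twocat \<Rightarrow> 'o \<Rightarrow> bool" where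
  "bizero L Z \<longleftrightarrow> Z \<in> Ob L \<and>
     (\<forall>A \<in> Ob L. equivalent_cats (hom_cat L A Z) terminal_cat \<and>
                 equivalent_cats (hom_cat L Z A) terminal_cat)"


section \<open>2-ideals, 2-kernels and closedness\<close>

text \<open>Since the components of \<open>\<nu> : N \<Rightarrow> Hom\<close> are injective on objects and faithful, \<open>N(A,B)\<close> is given
  by a set of null morphisms and a set of null 2-cells. \<open>til N b n a\<close> is the null morphism
  \<open>N(a,b)(n)\<close> and \<open>nu N b n a\<close> is the 2-cell from \<open>b n a\<close> to it.\<close>

record ('a, 'c) ideal =
  null1 :: "'a set"
  null2 :: "'c set"
  til :: "'a \<Rightarrow> 'a \<Rightarrow> 'a \<Rightarrow> 'a"
  nu :: "'a \<Rightarrow> 'a \<Rightarrow> 'a \<Rightarrow> 'c"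

definition op_ideal :: "('a, 'c) ideal \<Rightarrow> ('a, 'c) ideal" where
  "op_ideal N = N\<lparr>til := \<lambda>b n a. til N a n b, nu := \<lambda>b n a. nu N a n b\<rparr>"

context
  fixes L :: "('o, 'a, 'c) twocat" (structure) and N :: "('a, 'c) ideal"
begin

definition null_iso :: "'a \<Rightarrow> 'a \<Rightarrow> 'c set" where
  "null_iso p q = {\<theta> \<in> iso2 L p q. \<theta> \<in> null2 N \<and> inv2 L \<theta> \<in> null2 N}"

text \<open>By faithfulness of \<open>\<nu>\<close>, the action of \<open>N\<close> on null 2-cells, its action on 2-cells of
  \<open>L\<^sup>o\<^sup>p \<times> L\<close> and its coherence isomorphisms are forced to be the conjugates by \<open>\<nu>\<close> below, and the
  pseudofunctor and pseudonaturality equations then hold automatically. What remains is that these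
  conjugates are null (and that \<open>N\<close> is normal).\<close>

definition two_ideal :: bool where
  "two_ideal \<longleftrightarrow>
     null1 N \<subseteq> Mor L \<and>
     (\<forall>\<theta> \<in> null2 N. \<theta> \<in> Cell L \<and> dom2 L \<theta> \<in> null1 N \<and> cod2 L \<theta> \<in> null1 N) \<and>
     (\<forall>n \<in> null1 N. id2 L n \<in> null2 N) \<and>
     (\<forall>\<theta> \<in> null2 N. \<forall>\<theta>' \<in> null2 N. dom2 L \<theta>' = cod2 L \<theta> \<longrightarrow> \<theta>' \<bullet> \<theta> \<in> null2 N) \<and>
     (\<forall>a n b. a \<in> Mor L \<and> n \<in> null1 N \<and> b \<in> Mor L \<and> tgt L a = src L n \<and> tgt L n = src L b \<longrightarrow>
        til N b n a \<in> null1 N \<and> nu N b n a \<in> iso2 L (b \<odot> n \<odot> a) (til N b n a)) \<and>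
     (\<forall>a n n' \<theta> b. a \<in> Mor L \<and> b \<in> Mor L \<and> \<theta> \<in> null2 N \<and> \<theta> \<in> hom2 L n n' \<and>
        tgt L a = src L n \<and> tgt L n = src L b \<longrightarrow>
        nu N b n' a \<bullet> (b \<rhd> \<theta> \<lhd> a) \<bullet> inv2 L (nu N b n a) \<in> null2 N) \<and>
     (\<forall>a a' \<alpha> n b b' \<beta>. \<alpha> \<in> hom2 L a a' \<and> n \<in> null1 N \<and> \<beta> \<in> hom2 L b b' \<and>
        tgt L a = src L n \<and> tgt L n = src L b \<longrightarrow>
        nu N b' n a' \<bullet> (\<beta> \<star> id2 L n \<star> \<alpha>) \<bullet> inv2 L (nu N b n a) \<in> null2 N) \<and>
     (\<forall>a' a n b b'. a' \<in> Mor L \<and> a \<in> Mor L \<and> n \<in> null1 N \<and> b \<in> Mor L \<and> b' \<in> Mor L \<and>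
        tgt L a' = src L a \<and> tgt L a = src L n \<and> tgt L n = src L b \<and> tgt L b = src L b' \<longrightarrow>
        nu N (b' \<odot> b) n (a \<odot> a') \<bullet> (b' \<rhd> inv2 L (nu N b n a) \<lhd> a')
          \<bullet> inv2 L (nu N b' (til N b n a) a')
        \<in> null_iso (til N b' (til N b n a) a') (til N (b' \<odot> b) n (a \<odot> a'))) \<and>
     (\<forall>n \<in> null1 N. til N (id1 L (tgt L n)) n (id1 L (src L n)) = n \<and>
        nu N (id1 L (tgt L n)) n (id1 L (src L n)) = id2 L n)"

text \<open>\<open>kernel2 f k n \<alpha>\<close>: \<open>k\<close> with null morphism \<open>n\<close> and structure 2-cell \<open>\<alpha> : f k \<Rightarrow> n\<close> is a 2-kernel
  of \<open>f\<close>. Here \<open>\<nu> : n u \<Rightarrow> n u~\<close> is the 2-cell \<open>nu N (id1 L (tgt L n)) n u\<close>.\<close>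

definition kernel2 :: "'a \<Rightarrow> 'a \<Rightarrow> 'a \<Rightarrow> 'c \<Rightarrow> bool" where
  "kernel2 f k n \<alpha> \<longleftrightarrow>
     f \<in> Mor L \<and> k \<in> Mor L \<and> tgt L k = src L f \<and> n \<in> null1 N \<and> \<alpha> \<in> iso2 L (f \<odot> k) n \<and>
     (\<forall>Z z p \<beta>. z \<in> hom1 L Z (src L f) \<and> p \<in> null1 N \<and> \<beta> \<in> iso2 L (f \<odot> z) p \<longrightarrow>
        (\<exists>u \<in> hom1 L Z (src L k). \<exists>\<gamma> \<in> iso2 L z (k \<odot> u).
           nu N (id1 L (tgt L n)) n u \<bullet> (\<alpha> \<lhd> u) \<bullet> (f \<rhd> \<gamma>) \<bullet> inv2 L \<beta>
           \<in> null_iso p (til N (id1 L (tgt L n)) n u))) \<and>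
     (\<forall>Z u v \<xi>. u \<in> hom1 L Z (src L k) \<and> v \<in> hom1 L Z (src L k) \<and> \<xi> \<in> hom2 L (k \<odot> u) (k \<odot> v) \<and>
        nu N (id1 L (tgt L n)) n v \<bullet> (\<alpha> \<lhd> v) \<bullet> (f \<rhd> \<xi>) \<bullet> (inv2 L \<alpha> \<lhd> u)
          \<bullet> inv2 L (nu N (id1 L (tgt L n)) n u) \<in> null2 N \<longrightarrow>
        (\<exists>!\<mu>. \<mu> \<in> hom2 L u v \<and> k \<rhd> \<mu> = \<xi>))"

definition reflects_null_morphisms :: "'a \<Rightarrow> bool" where
  "reflects_null_morphisms k \<longleftrightarrow>
     (\<forall>D s n \<delta>. s \<in> hom1 L D (src L k) \<and> n \<in> null1 N \<and> \<delta> \<in> iso2 L (k \<odot> s) n \<longrightarrow>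
        (\<exists>s' \<in> null1 N. \<exists>\<psi> \<in> iso2 L s s'.
           nu N k s' (id1 L D) \<bullet> (k \<rhd> \<psi>) \<bullet> inv2 L \<delta> \<in> null_iso n (til N k s' (id1 L D))))"

definition reflects_null_cells :: "'a \<Rightarrow> bool" where
  "reflects_null_cells k \<longleftrightarrow>
     (\<forall>D s s' \<mu>. s \<in> hom1 L D (src L k) \<and> s \<in> null1 N \<and> s' \<in> hom1 L D (src L k) \<and> s' \<in> null1 N \<and>
        \<mu> \<in> hom2 L s s' \<and>
        nu N k s' (id1 L D) \<bullet> (k \<rhd> \<mu>) \<bullet> inv2 L (nu N k s (id1 L D)) \<in> null2 N \<longrightarrow>
        \<mu> \<in> null2 N)"

definition is_kernel2 :: "'a \<Rightarrow> bool" where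
  "is_kernel2 k \<longleftrightarrow> (\<exists>f n \<alpha>. kernel2 f k n \<alpha>)"

definition has_kernels2 :: bool where
  "has_kernels2 \<longleftrightarrow> (\<forall>f \<in> Mor L. \<exists>k n \<alpha>. kernel2 f k n \<alpha>)"

end

context
  fixes L :: "('o, 'a, 'c) twocat" (structure) and N :: "('a, 'c) ideal"
begin

definition cokernel2 :: "'a \<Rightarrow> 'a \<Rightarrow> 'a \<Rightarrow> 'c \<Rightarrow> bool" where
  "cokernel2 = kernel2 (op L) (op_ideal N)"

definition is_cokernel2 :: "'a \<Rightarrow> bool" where
  "is_cokernel2 = is_kernel2 (op L) (op_ideal N)"

definition has_cokernels2 :: bool where
  "has_cokernels2 \<longleftrightarrow> has_kernels2 (op L) (op_ideal N)"

definition coreflects_null_morphisms :: "'a \<Rightarrow> bool" where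
  "coreflects_null_morphisms = reflects_null_morphisms (op L) (op_ideal N)"

definition coreflects_null_cells :: "'a \<Rightarrow> bool" where
  "coreflects_null_cells = reflects_null_cells (op L) (op_ideal N)"

definition closed_ideal :: bool where
  "closed_ideal \<longleftrightarrow>
     (\<forall>k. is_kernel2 L N k \<longrightarrow> reflects_null_morphisms L N k \<and> reflects_null_cells L N k) \<and>
     (\<forall>c. is_cokernel2 c \<longrightarrow> coreflects_null_morphisms c \<and> coreflects_null_cells c)"

definition kernels2_normal :: bool where
  "kernels2_normal \<longleftrightarrow>
     (\<forall>m c n \<gamma>. is_kernel2 L N m \<and> cokernel2 m c n \<gamma> \<longrightarrow>
        (\<exists>n' \<in> null1 N. \<exists>\<theta> \<in> null_iso L N n n'. kernel2 L N c m n' (\<theta> \<bullet> \<gamma>)))"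

definition kernel_cokernel_factorizations :: bool where
  "kernel_cokernel_factorizations \<longleftrightarrow>
     (\<forall>f \<in> Mor L. \<exists>c m. is_cokernel2 c \<and> is_kernel2 L N m \<and> tgt L c = src L m \<and>
        iso2 L f (m \<odot> c) \<noteq> {})"

end

definition cokernels2_normal :: "('o, 'a, 'c) twocat \<Rightarrow> ('a, 'c) ideal \<Rightarrow> bool" where
  "cokernels2_normal L N \<longleftrightarrow> kernels2_normal (op L) (op_ideal N)"

text \<open>The 2-ideal of the bizero object \<open>Z\<close>. A morphism may factor through \<open>Z\<close> in several ways, so
  pasted 2-cells \<open>i t \<Rightarrow> i' t' = j r \<Rightarrow> j' r'\<close> with different factorizations in the middle can be
  vertically composable without the composite being obtained from a single pasting. As the null
  2-cells have to form a subcategory, we close under vertical composition.\<close>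

inductive_set zero_null2 :: "('o, 'a, 'c) twocat \<Rightarrow> 'o \<Rightarrow> 'c set"
  for L :: "('o, 'a, 'c) twocat" and Z :: 'o where
  paste: "\<lbrakk>t \<in> hom1 L A Z; t' \<in> hom1 L A Z; i \<in> hom1 L Z B; i' \<in> hom1 L Z B;
    \<tau> \<in> hom2 L t t'; \<iota> \<in> hom2 L i i'\<rbrakk> \<Longrightarrow> hcomp L \<iota> \<tau> \<in> zero_null2 L Z"
| vcomp: "\<lbrakk>\<alpha> \<in> zero_null2 L Z; \<beta> \<in> zero_null2 L Z; dom2 L \<beta> = cod2 L \<alpha>\<rbrakk>
    \<Longrightarrow> vcomp L \<beta> \<alpha> \<in> zero_null2 L Z"

definition zero_ideal :: "('o, 'a, 'c) twocat \<Rightarrow> 'o \<Rightarrow> ('a, 'c) ideal" where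
  "zero_ideal L Z = \<lparr>
     null1 = {comp1 L i t | A B t i. t \<in> hom1 L A Z \<and> i \<in> hom1 L Z B},
     null2 = zero_null2 L Z,
     til = \<lambda>b n a. comp1 L b (comp1 L n a),
     nu = \<lambda>b n a. id2 L (comp1 L b (comp1 L n a))\<rparr>"


section \<open>Factorization systems\<close>

context
  fixes L :: "('o, 'a, 'c) twocat" (structure)
begin

text \<open>A filling \<open>(d, \<sigma>, \<rho>)\<close> of the square \<open>\<phi> : m s \<Rightarrow> t e\<close>.\<close>

definition filling :: "'a \<Rightarrow> 'a \<Rightarrow> 'a \<Rightarrow> 'a \<Rightarrow> 'c \<Rightarrow> 'a \<Rightarrow> 'c \<Rightarrow> 'c \<Rightarrow> bool" where
  "filling e m s t \<phi> d \<sigma> \<rho> \<longleftrightarrow>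
     s \<in> hom1 L (src L e) (src L m) \<and> t \<in> hom1 L (tgt L e) (tgt L m) \<and>
     \<phi> \<in> iso2 L (m \<odot> s) (t \<odot> e) \<and>
     d \<in> hom1 L (tgt L e) (src L m) \<and> \<sigma> \<in> iso2 L s (d \<odot> e) \<and> \<rho> \<in> iso2 L (m \<odot> d) t \<and>
     \<phi> = (\<rho> \<lhd> e) \<bullet> (m \<rhd> \<sigma>)"

definition orthogonal :: "'a \<Rightarrow> 'a \<Rightarrow> bool" where
  "orthogonal e m \<longleftrightarrow>
     (\<forall>s \<in> hom1 L (src L e) (src L m). \<forall>t \<in> hom1 L (tgt L e) (tgt L m).
        \<forall>\<phi> \<in> iso2 L (m \<odot> s) (t \<odot> e). \<exists>d \<sigma> \<rho>. filling e m s t \<phi> d \<sigma> \<rho>) \<and>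
     (\<forall>s t \<phi> d \<sigma> \<rho> s' t' \<phi>' d' \<sigma>' \<rho>' \<xi> \<mu>.
        filling e m s t \<phi> d \<sigma> \<rho> \<and> filling e m s' t' \<phi>' d' \<sigma>' \<rho>' \<and>
        \<xi> \<in> hom2 L s s' \<and> \<mu> \<in> hom2 L t t' \<and> \<phi>' \<bullet> (m \<rhd> \<xi>) = (\<mu> \<lhd> e) \<bullet> \<phi> \<longrightarrow>
        (\<exists>!\<iota>. \<iota> \<in> hom2 L d d' \<and> \<rho>' \<bullet> (m \<rhd> \<iota>) = \<mu> \<bullet> \<rho> \<and> (\<iota> \<lhd> e) \<bullet> \<sigma> = \<sigma>' \<bullet> \<xi>))"

definition factorization_system :: "'a set \<Rightarrow> 'a set \<Rightarrow> bool" where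
  "factorization_system E M \<longleftrightarrow>
     E \<subseteq> Mor L \<and> M \<subseteq> Mor L \<and>
     (\<forall>m \<in> M. \<forall>i. equivalence1 L i \<and> tgt L i = src L m \<longrightarrow> m \<odot> i \<in> M) \<and>
     (\<forall>e \<in> E. \<forall>i. equivalence1 L i \<and> src L i = tgt L e \<longrightarrow> i \<odot> e \<in> E) \<and>
     (\<forall>f g. f \<in> E \<and> iso2 L f g \<noteq> {} \<longrightarrow> g \<in> E) \<and>
     (\<forall>f g. f \<in> M \<and> iso2 L f g \<noteq> {} \<longrightarrow> g \<in> M) \<and>
     (\<forall>f \<in> Mor L. \<exists>e \<in> E. \<exists>m \<in> M. tgt L e = src L m \<and> iso2 L f (m \<odot> e) \<noteq> {}) \<and>
     (\<forall>e \<in> E. \<forall>m \<in> M. orthogonal e m)"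

definition proper11 :: "'a set \<Rightarrow> 'a set \<Rightarrow> bool" where
  "proper11 E M \<longleftrightarrow> (\<forall>e \<in> E. cofaithful1 L e) \<and> (\<forall>m \<in> M. faithful1 L m)"

end


section \<open>Pseudofunctors and biequivalences over a base\<close>

record ('o1, 'a1, 'c1, 'o2, 'a2, 'c2) psfun =
  F0 :: "'o1 \<Rightarrow> 'o2"
  F1 :: "'a1 \<Rightarrow> 'a2"
  F2 :: "'c1 \<Rightarrow> 'c2"
  Fcomp :: "'a1 \<Rightarrow> 'a1 \<Rightarrow> 'c2"  \<comment> \<open>\<open>Fcomp F g f : F g \<circ> F f \<Rightarrow> F (g \<circ> f)\<close>\<close>
  Funit :: "'o1 \<Rightarrow> 'c2"  \<comment> \<open>\<open>Funit F A : id (F A) \<Rightarrow> F (id A)\<close>\<close>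

definition pseudofunctor ::
  "('o1, 'a1, 'c1) twocat \<Rightarrow> ('o2, 'a2, 'c2) twocat \<Rightarrow> ('o1, 'a1, 'c1, 'o2, 'a2, 'c2) psfun \<Rightarrow> bool"
where
  "pseudofunctor X Y F \<longleftrightarrow>
     (\<forall>A \<in> Ob X. F0 F A \<in> Ob Y) \<and>
     (\<forall>A B. \<forall>f \<in> hom1 X A B. F1 F f \<in> hom1 Y (F0 F A) (F0 F B)) \<and>
     (\<forall>f g. \<forall>\<alpha> \<in> hom2 X f g. F2 F \<alpha> \<in> hom2 Y (F1 F f) (F1 F g)) \<and>
     (\<forall>f \<in> Mor X. F2 F (id2 X f) = id2 Y (F1 F f)) \<and>
     (\<forall>f g h. \<forall>\<alpha> \<in> hom2 X f g. \<forall>\<beta> \<in> hom2 X g h.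
        F2 F (\<beta> \<bullet>\<^bsub>X\<^esub> \<alpha>) = F2 F \<beta> \<bullet>\<^bsub>Y\<^esub> F2 F \<alpha>) \<and>
     (\<forall>A B C. \<forall>f \<in> hom1 X A B. \<forall>g \<in> hom1 X B C.
        Fcomp F g f \<in> iso2 Y (F1 F g \<odot>\<^bsub>Y\<^esub> F1 F f) (F1 F (g \<odot>\<^bsub>X\<^esub> f))) \<and>
     (\<forall>A \<in> Ob X. Funit F A \<in> iso2 Y (id1 Y (F0 F A)) (F1 F (id1 X A))) \<and>
     (\<forall>A B C f f' g g' \<alpha> \<beta>. f \<in> hom1 X A B \<and> g \<in> hom1 X B C \<and> \<alpha> \<in> hom2 X f f' \<and> \<beta> \<in> hom2 X g g' \<longrightarrow>
        Fcomp F g' f' \<bullet>\<^bsub>Y\<^esub> (F2 F \<beta> \<star>\<^bsub>Y\<^esub> F2 F \<alpha>) = F2 F (\<beta> \<star>\<^bsub>X\<^esub> \<alpha>) \<bullet>\<^bsub>Y\<^esub> Fcomp F g f) \<and>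
     (\<forall>A B C D. \<forall>f \<in> hom1 X A B. \<forall>g \<in> hom1 X B C. \<forall>h \<in> hom1 X C D.
        Fcomp F (h \<odot>\<^bsub>X\<^esub> g) f \<bullet>\<^bsub>Y\<^esub> (Fcomp F h g \<lhd>\<^bsub>Y\<^esub> F1 F f)
        = Fcomp F h (g \<odot>\<^bsub>X\<^esub> f) \<bullet>\<^bsub>Y\<^esub> (F1 F h \<rhd>\<^bsub>Y\<^esub> Fcomp F g f)) \<and>
     (\<forall>A B. \<forall>f \<in> hom1 X A B.
        Fcomp F f (id1 X A) \<bullet>\<^bsub>Y\<^esub> (F1 F f \<rhd>\<^bsub>Y\<^esub> Funit F A) = id2 Y (F1 F f) \<and>
        Fcomp F (id1 X B) f \<bullet>\<^bsub>Y\<^esub> (Funit F B \<lhd>\<^bsub>Y\<^esub> F1 F f) = id2 Y (F1 F f))"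

definition normal_psfun ::
  "('o1, 'a1, 'c1) twocat \<Rightarrow> ('o2, 'a2, 'c2) twocat \<Rightarrow> ('o1, 'a1, 'c1, 'o2, 'a2, 'c2) psfun \<Rightarrow> bool"
where
  "normal_psfun X Y F \<longleftrightarrow>
     (\<forall>A \<in> Ob X. F1 F (id1 X A) = id1 Y (F0 F A) \<and> Funit F A = id2 Y (id1 Y (F0 F A)))"

definition id_psfun :: "('o, 'a, 'c) twocat \<Rightarrow> ('o, 'a, 'c, 'o, 'a, 'c) psfun" where
  "id_psfun X = \<lparr>F0 = id, F1 = id, F2 = id,
     Fcomp = \<lambda>g f. id2 X (g \<odot>\<^bsub>X\<^esub> f), Funit = \<lambda>A. id2 X (id1 X A)\<rparr>"

definition comp_psfun ::
  "('o3, 'a3, 'c3) twocat \<Rightarrow> ('o2, 'a2, 'c2, 'o3, 'a3, 'c3) psfun \<Rightarrow>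
   ('o1, 'a1, 'c1, 'o2, 'a2, 'c2) psfun \<Rightarrow> ('o1, 'a1, 'c1, 'o3, 'a3, 'c3) psfun" where
  "comp_psfun W G F = \<lparr>F0 = F0 G \<circ> F0 F, F1 = F1 G \<circ> F1 F, F2 = F2 G \<circ> F2 F,
     Fcomp = \<lambda>g f. F2 G (Fcomp F g f) \<bullet>\<^bsub>W\<^esub> Fcomp G (F1 F g) (F1 F f),
     Funit = \<lambda>A. F2 G (Funit F A) \<bullet>\<^bsub>W\<^esub> Funit G (F0 F A)\<rparr>"

text \<open>Equality of pseudofunctors with domain \<open>X\<close>; values outside \<open>X\<close> are irrelevant.\<close>

definition eq_psfun ::
  "('o1, 'a1, 'c1) twocat \<Rightarrow> ('o1, 'a1, 'c1, 'o2, 'a2, 'c2) psfun \<Rightarrow>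
   ('o1, 'a1, 'c1, 'o2, 'a2, 'c2) psfun \<Rightarrow> bool" where
  "eq_psfun X F G \<longleftrightarrow>
     (\<forall>A \<in> Ob X. F0 F A = F0 G A \<and> Funit F A = Funit G A) \<and>
     (\<forall>f \<in> Mor X. F1 F f = F1 G f) \<and>
     (\<forall>\<alpha> \<in> Cell X. F2 F \<alpha> = F2 G \<alpha>) \<and>
     (\<forall>f \<in> Mor X. \<forall>g \<in> Mor X. tgt X f = src X g \<longrightarrow> Fcomp F g f = Fcomp G g f)"

text \<open>\<open>pseudonat X Y F G \<eta> \<eta>1\<close>: pseudonatural transformation \<open>F \<Rightarrow> G\<close> with components \<open>\<eta> A\<close> and
  structure 2-cells \<open>\<eta>1 f : G f \<circ> \<eta> A \<Rightarrow> \<eta> B \<circ> F f\<close> for \<open>f : A \<rightarrow> B\<close>.\<close>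

definition pseudonat ::
  "('o1, 'a1, 'c1) twocat \<Rightarrow> ('o2, 'a2, 'c2) twocat \<Rightarrow>
   ('o1, 'a1, 'c1, 'o2, 'a2, 'c2) psfun \<Rightarrow> ('o1, 'a1, 'c1, 'o2, 'a2, 'c2) psfun \<Rightarrow>
   ('o1 \<Rightarrow> 'a2) \<Rightarrow> ('a1 \<Rightarrow> 'c2) \<Rightarrow> bool" where
  "pseudonat X Y F G \<eta> \<eta>1 \<longleftrightarrow>
     (\<forall>A \<in> Ob X. \<eta> A \<in> hom1 Y (F0 F A) (F0 G A)) \<and>
     (\<forall>A B. \<forall>f \<in> hom1 X A B. \<eta>1 f \<in> iso2 Y (F1 G f \<odot>\<^bsub>Y\<^esub> \<eta> A) (\<eta> B \<odot>\<^bsub>Y\<^esub> F1 F f)) \<and>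
     (\<forall>A B. \<forall>f \<in> hom1 X A B. \<forall>g \<in> hom1 X A B. \<forall>\<alpha> \<in> hom2 X f g.
        \<eta>1 g \<bullet>\<^bsub>Y\<^esub> (F2 G \<alpha> \<lhd>\<^bsub>Y\<^esub> \<eta> A) = (\<eta> B \<rhd>\<^bsub>Y\<^esub> F2 F \<alpha>) \<bullet>\<^bsub>Y\<^esub> \<eta>1 f) \<and>
     (\<forall>A B C. \<forall>f \<in> hom1 X A B. \<forall>g \<in> hom1 X B C.
        \<eta>1 (g \<odot>\<^bsub>X\<^esub> f) \<bullet>\<^bsub>Y\<^esub> (Fcomp G g f \<lhd>\<^bsub>Y\<^esub> \<eta> A)
        = (\<eta> C \<rhd>\<^bsub>Y\<^esub> Fcomp F g f) \<bullet>\<^bsub>Y\<^esub> (\<eta>1 g \<lhd>\<^bsub>Y\<^esub> F1 F f) \<bullet>\<^bsub>Y\<^esub> (F1 G g \<rhd>\<^bsub>Y\<^esub> \<eta>1 f)) \<and>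
     (\<forall>A \<in> Ob X. \<eta>1 (id1 X A) \<bullet>\<^bsub>Y\<^esub> (Funit G A \<lhd>\<^bsub>Y\<^esub> \<eta> A) = \<eta> A \<rhd>\<^bsub>Y\<^esub> Funit F A)"

definition pseudonat_equivalence ::
  "('o1, 'a1, 'c1) twocat \<Rightarrow> ('o2, 'a2, 'c2) twocat \<Rightarrow>
   ('o1, 'a1, 'c1, 'o2, 'a2, 'c2) psfun \<Rightarrow> ('o1, 'a1, 'c1, 'o2, 'a2, 'c2) psfun \<Rightarrow>
   ('o1 \<Rightarrow> 'a2) \<Rightarrow> ('a1 \<Rightarrow> 'c2) \<Rightarrow> bool" where
  "pseudonat_equivalence X Y F G \<eta> \<eta>1 \<longleftrightarrow>
     pseudonat X Y F G \<eta> \<eta>1 \<and> (\<forall>A \<in> Ob X. equivalence1 Y (\<eta> A))"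

text \<open>A transformation between endo-pseudofunctors of \<open>X\<close> over \<open>L\<close>, for a 2-functor \<open>P : X \<rightarrow> L\<close>.\<close>

definition lies_over ::
  "('o1, 'a1, 'c1) twocat \<Rightarrow> ('o, 'a, 'c) twocat \<Rightarrow> ('o1, 'a1, 'c1, 'o, 'a, 'c) psfun \<Rightarrow>
   ('o1 \<Rightarrow> 'a1) \<Rightarrow> ('a1 \<Rightarrow> 'c1) \<Rightarrow> bool" where
  "lies_over X L P \<eta> \<eta>1 \<longleftrightarrow>
     (\<forall>A \<in> Ob X. F1 P (\<eta> A) = id1 L (F0 P A)) \<and>
     (\<forall>f \<in> Mor X. F2 P (\<eta>1 f) = id2 L (F1 P f))"

definition biequivalence_over ::
  "('o, 'a, 'c) twocat \<Rightarrow>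
   ('o1, 'a1, 'c1) twocat \<Rightarrow> ('o1, 'a1, 'c1, 'o, 'a, 'c) psfun \<Rightarrow>
   ('o2, 'a2, 'c2) twocat \<Rightarrow> ('o2, 'a2, 'c2, 'o, 'a, 'c) psfun \<Rightarrow>
   ('o1, 'a1, 'c1, 'o2, 'a2, 'c2) psfun \<Rightarrow> ('o2, 'a2, 'c2, 'o1, 'a1, 'c1) psfun \<Rightarrow> bool" where
  "biequivalence_over L X P Y Q K C \<longleftrightarrow>
     pseudofunctor X Y K \<and> pseudofunctor Y X C \<and>
     eq_psfun X (comp_psfun L Q K) P \<and> eq_psfun Y (comp_psfun L P C) Q \<and>
     (\<exists>\<eta> \<eta>1. pseudonat_equivalence Y Y (id_psfun Y) (comp_psfun Y K C) \<eta> \<eta>1 \<and> lies_over Y L Q \<eta> \<eta>1) \<and>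
     (\<exists>\<epsilon> \<epsilon>1. pseudonat_equivalence X X (comp_psfun X C K) (id_psfun X) \<epsilon> \<epsilon>1 \<and> lies_over X L P \<epsilon> \<epsilon>1)"


section \<open>The pseudo arrow 2-category\<close>

text \<open>\<open>Sq f g s t \<phi>\<close> is the morphism \<open>f \<rightarrow> g\<close> with \<open>s\<close> between the domains, \<open>t\<close> between the codomains and
  \<open>\<phi> : g s \<Rightarrow> t f\<close>.\<close>

datatype ('a, 'c) sq = Sq (sq_src: 'a) (sq_tgt: 'a) (sq_top: 'a) (sq_bot: 'a) (sq_fill: 'c)

datatype ('a, 'c) sqcell =
  SqCell (sqc_dom: "('a, 'c) sq") (sqc_cod: "('a, 'c) sq") (sqc_top: 'c) (sqc_bot: 'c)

context
  fixes L :: "('o, 'a, 'c) twocat" (structure)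
begin

definition squares :: "'a set \<Rightarrow> ('a, 'c) sq set" where
  "squares S = {Sq f g s t \<phi> | f g s t \<phi>. f \<in> S \<inter> Mor L \<and> g \<in> S \<inter> Mor L \<and>
     s \<in> hom1 L (src L f) (src L g) \<and> t \<in> hom1 L (tgt L f) (tgt L g) \<and> \<phi> \<in> iso2 L (g \<odot> s) (t \<odot> f)}"

definition square_cells :: "'a set \<Rightarrow> ('a, 'c) sqcell set" where
  "square_cells S = {SqCell (Sq f g s t \<phi>) (Sq f g s' t' \<phi>') \<xi> \<mu> | f g s t \<phi> s' t' \<phi>' \<xi> \<mu>.
     Sq f g s t \<phi> \<in> squares S \<and> Sq f g s' t' \<phi>' \<in> squares S \<and>
     \<xi> \<in> hom2 L s s' \<and> \<mu> \<in> hom2 L t t' \<and> \<phi>' \<bullet> (g \<rhd> \<xi>) = (\<mu> \<lhd> f) \<bullet> \<phi>}"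

definition sq_id :: "'a \<Rightarrow> ('a, 'c) sq" where
  "sq_id f = Sq f f (id1 L (src L f)) (id1 L (tgt L f)) (id2 L f)"

definition sq_comp :: "('a, 'c) sq \<Rightarrow> ('a, 'c) sq \<Rightarrow> ('a, 'c) sq" where
  "sq_comp q p = Sq (sq_src p) (sq_tgt q) (sq_top q \<odot> sq_top p) (sq_bot q \<odot> sq_bot p)
     ((sq_bot q \<rhd> sq_fill p) \<bullet> (sq_fill q \<lhd> sq_top p))"

text \<open>The full sub-2-category of the pseudo arrow 2-category on the morphisms in \<open>S\<close>.\<close>

definition arrow2 :: "'a set \<Rightarrow> ('a, ('a, 'c) sq, ('a, 'c) sqcell) twocat" where
  "arrow2 S = \<lparr>Ob = S \<inter> Mor L, Mor = squares S, Cell = square_cells S,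
     src = sq_src, tgt = sq_tgt, dom2 = sqc_dom, cod2 = sqc_cod,
     id1 = sq_id, id2 = \<lambda>p. SqCell p p (id2 L (sq_top p)) (id2 L (sq_bot p)),
     comp1 = sq_comp,
     vcomp = \<lambda>y x. SqCell (sqc_dom x) (sqc_cod y) (sqc_top y \<bullet> sqc_top x) (sqc_bot y \<bullet> sqc_bot x),
     hcomp = \<lambda>y x. SqCell (sq_comp (sqc_dom y) (sqc_dom x)) (sq_comp (sqc_cod y) (sqc_cod x))
       (sqc_top y \<star> sqc_top x) (sqc_bot y \<star> sqc_bot x)\<rparr>"

definition dom_psfun :: "('a, ('a, 'c) sq, ('a, 'c) sqcell, 'o, 'a, 'c) psfun" where
  "dom_psfun = \<lparr>F0 = src L, F1 = sq_top, F2 = sqc_top,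
     Fcomp = \<lambda>q p. id2 L (sq_top q \<odot> sq_top p), Funit = \<lambda>f. id2 L (id1 L (src L f))\<rparr>"

definition cod_psfun :: "('a, ('a, 'c) sq, ('a, 'c) sqcell, 'o, 'a, 'c) psfun" where
  "cod_psfun = \<lparr>F0 = tgt L, F1 = sq_bot, F2 = sqc_bot,
     Fcomp = \<lambda>q p. id2 L (sq_bot q \<odot> sq_bot p), Funit = \<lambda>f. id2 L (id1 L (tgt L f))\<rparr>"

end


section \<open>Well-definedness: duals, \<open>zero_ideal\<close> is a 2-ideal, arrow 2-categories\<close>

lemma hom1_op [simp]: "hom1 (op L) A B = hom1 L B A"
  by (auto simp: hom1_def op_def)

lemma hom2_op [simp]: "hom2 (op L) f g = hom2 L f g"
  by (auto simp: hom2_def op_def)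

lemma two_category_op:
  assumes "two_category L"
  shows "two_category (op L)"
proof -
  interpret two_category L by fact
  have sel [simp]: "Ob (op L) = Ob L" "Mor (op L) = Mor L" "Cell (op L) = Cell L"
    "src (op L) = tgt L" "tgt (op L) = src L" "dom2 (op L) = dom2 L" "cod2 (op L) = cod2 L"
    "id1 (op L) = id1 L" "id2 (op L) = id2 L" "comp1 (op L) g f = comp1 L f g"
    "vcomp (op L) = vcomp L" "hcomp (op L) \<beta> \<alpha> = hcomp L \<alpha> \<beta>" for f g \<alpha> \<beta>
    by (simp_all add: op_def)
  show ?thesis
  proof (unfold_locales, goal_cases)
    case (17 f A B g C \<alpha> f' \<beta> g')
    then show ?case using hcomp_hom by simp
  next
    case (18 f A B g C h D \<alpha> f' \<beta> g' \<gamma> h')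
    then show ?case using hcomp_assoc[of h D C g B f A \<gamma> h' \<beta> g' \<alpha> f'] by simp
  next
    case (22 f A B g C \<alpha> f' \<alpha>' f'' \<beta> g' \<beta>' g'')
    then show ?case using interchange[of g C B f A \<beta> g' \<beta>' g'' \<alpha> f' \<alpha>' f''] by simp
  qed (auto simp: src_Ob tgt_Ob id1_hom comp1_hom comp1_assoc comp1_id_right comp1_id_left dom2_Mor
      cod2_Mor cell_src cell_tgt id2_hom vcomp_hom vcomp_assoc vcomp_id_right vcomp_id_left
      hcomp_id_right hcomp_id_left hcomp_id2)
qed

context two_category begin

lemma terminal_hom:
  assumes "equivalent_cats (hom_cat L A B) terminal_cat"
  shows "hom1 L A B \<noteq> {}"
    and "\<lbrakk>f \<in> hom1 L A B; g \<in> hom1 L A B\<rbrakk> \<Longrightarrow> \<exists>!\<alpha>. \<alpha> \<in> hom2 L f g"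
proof -
  obtain F0 F1 and G0 :: "unit \<Rightarrow> 'a" and G1 :: "unit \<Rightarrow> 'c" and \<eta> where
    G: "functor_between terminal_cat (hom_cat L A B) G0 G1"
    and \<eta>: "natural_iso (hom_cat L A B) (hom_cat L A B) id id (G0 \<circ> F0) (G1 \<circ> F1) \<eta>"
    using assms unfolding equivalent_cats_def by blast
  have G0: "G0 () \<in> hom1 L A B" and G1: "G1 () = id2 L (G0 ())"
    using G by (auto simp: functor_between_def terminal_cat_def hom_cat_def)
  show "hom1 L A B \<noteq> {}" using G0 by blast
  have ch: "chom (hom_cat L A B) f g = hom2 L f g" if "f \<in> hom1 L A B" "g \<in> hom1 L A B" for f g
    using that by (auto simp: chom_def hom_cat_def hom2_def)
  let ?c = "G0 ()"
  have N1: "\<exists>\<theta>'. \<eta> f \<in> hom2 L f ?c \<and> \<theta>' \<in> hom2 L ?c f \<and> \<theta>' \<bullet> \<eta> f = id2 L f \<and> \<eta> f \<bullet> \<theta>' = id2 L ?c"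
    if f: "f \<in> hom1 L A B" for f
  proof -
    have "f \<in> CObj (hom_cat L A B)" "cid (hom_cat L A B) = id2 L" "ccomp (hom_cat L A B) = vcomp L"
      using f by (simp_all add: hom_cat_def)
    moreover have "(G0 \<circ> F0) f = ?c" by simp
    ultimately show ?thesis using \<eta> ch[OF f G0] ch[OF G0 f] unfolding natural_iso_def id_def
      by (metis (no_types, lifting))
  qed
  have N2: "\<eta> g \<bullet> \<alpha> = id2 L ?c \<bullet> \<eta> f"
    if "f \<in> hom1 L A B" "g \<in> hom1 L A B" "\<alpha> \<in> hom2 L f g" for f g \<alpha>
  proof -
    have "f \<in> CObj (hom_cat L A B)" "g \<in> CObj (hom_cat L A B)" "ccomp (hom_cat L A B) = vcomp L"
      using that by (simp_all add: hom_cat_def)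
    moreover have "(G1 \<circ> F1) \<alpha> = id2 L ?c" using G1 by simp
    ultimately show ?thesis using \<eta> ch[OF that(1,2)] that(3) unfolding natural_iso_def id_def
      by (metis (no_types, lifting))
  qed
  assume f: "f \<in> hom1 L A B" and g: "g \<in> hom1 L A B"
  obtain \<gamma> where \<gamma>: "\<eta> g \<in> hom2 L g ?c" "\<gamma> \<in> hom2 L ?c g" "\<gamma> \<bullet> \<eta> g = id2 L g"
    using N1[OF g] by blast
  have \<eta>f: "\<eta> f \<in> hom2 L f ?c" using N1[OF f] by blast
  have "\<alpha> = \<gamma> \<bullet> \<eta> f" if a: "\<alpha> \<in> hom2 L f g" for \<alpha>
    using N2[OF f g a] vcomp_assoc[OF a \<gamma>(1,2)] vcomp_id_left[OF a] vcomp_id_left[OF \<eta>f] \<gamma>(3) by simp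
  moreover have "\<gamma> \<bullet> \<eta> f \<in> hom2 L f g" using \<eta>f \<gamma> by (blast intro: vcomp_hom)
  ultimately show "\<exists>!\<alpha>. \<alpha> \<in> hom2 L f g" by blast
qed

lemma inverse2_unique:
  assumes "inverse2 L \<alpha> \<beta>" "inverse2 L \<alpha> \<gamma>"
  shows "\<beta> = \<gamma>"
proof -
  have a: "\<alpha> \<in> hom2 L (dom2 L \<alpha>) (cod2 L \<alpha>)" and b: "\<beta> \<in> hom2 L (cod2 L \<alpha>) (dom2 L \<alpha>)"
    and c: "\<gamma> \<in> hom2 L (cod2 L \<alpha>) (dom2 L \<alpha>)"
    using assms by (auto simp: inverse2_def hom2_def)
  have "\<beta> = (\<gamma> \<bullet> \<alpha>) \<bullet> \<beta>" using assms(2) vcomp_id_left[OF b] by (simp add: inverse2_def)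
  also have "\<dots> = \<gamma> \<bullet> (\<alpha> \<bullet> \<beta>)" using vcomp_assoc[OF b a c] .
  also have "\<dots> = \<gamma>" using assms(1) vcomp_id_right[OF c] by (simp add: inverse2_def)
  finally show ?thesis .
qed

lemma inv2_eq: "inverse2 L \<alpha> \<beta> \<Longrightarrow> inv2 L \<alpha> = \<beta>"
  unfolding inv2_def using inverse2_unique by blast

lemma inverse2_id: "f \<in> Mor L \<Longrightarrow> inverse2 L (id2 L f) (id2 L f)"
  using id2_hom[of f] vcomp_id_left[OF id2_hom] by (auto simp: inverse2_def hom2_def)

lemma inv2_id [simp]: "f \<in> Mor L \<Longrightarrow> inv2 L (id2 L f) = id2 L f"
  by (rule inv2_eq[OF inverse2_id])

lemma iso2_id [simp]: "f \<in> Mor L \<Longrightarrow> id2 L f \<in> iso2 L f f"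
  using inverse2_id id2_hom by (auto simp: iso2_def)

lemma zero_null2_hom:
  assumes "\<theta> \<in> zero_null2 L Z"
  shows "\<theta> \<in> Cell L \<and> dom2 L \<theta> \<in> null1 (zero_ideal L Z) \<and> cod2 L \<theta> \<in> null1 (zero_ideal L Z)"
  using assms
proof induction
  case (paste t A t' i B i' \<tau> \<iota>)
  have "\<iota> \<star> \<tau> \<in> hom2 L (i \<odot> t) (i' \<odot> t')" using hcomp_hom paste by blast
  then show ?case using paste by (auto simp: hom2_def zero_ideal_def)
next
  case (vcomp \<alpha> \<beta>)
  then have "\<beta> \<bullet> \<alpha> \<in> hom2 L (dom2 L \<alpha>) (cod2 L \<beta>)"
    by (intro vcomp_hom) (auto simp: hom2_def)
  then show ?case using vcomp by (auto simp: hom2_def)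
qed

lemma cell_hom1:
  assumes "\<alpha> \<in> hom2 L f g" "f \<in> hom1 L A B"
  shows "g \<in> hom1 L A B"
  using assms cod2_Mor cell_src cell_tgt by (auto simp: hom1_def hom2_def)

lemma zero_null2_whisker:
  assumes "\<theta> \<in> zero_null2 L Z"
    and "dom2 L \<theta> \<in> hom1 L A B" "a \<in> hom1 L A' A" "b \<in> hom1 L B B'"
  shows "b \<rhd> \<theta> \<lhd> a \<in> zero_null2 L Z"
  using assms
proof induction
  case (paste t A1 t' i B1 i' \<tau> \<iota>)
  have "i \<odot> t \<in> hom1 L A1 B1" using paste comp1_hom by blast
  moreover have "dom2 L (\<iota> \<star> \<tau>) = i \<odot> t"
    using hcomp_hom[of t A1 Z i B1 \<tau> t' \<iota> i'] paste by (auto simp: hom2_def)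
  ultimately have [simp]: "A1 = A" "B1 = B" using paste by (auto simp: hom1_def)
  have ia: "id2 L a \<in> hom2 L a a" and ib: "id2 L b \<in> hom2 L b b"
    using paste id2_hom by (auto simp: hom1_def)
  have \<tau>: "\<tau> \<lhd> a \<in> hom2 L (t \<odot> a) (t' \<odot> a)" and \<iota>: "b \<rhd> \<iota> \<in> hom2 L (b \<odot> i) (b \<odot> i')"
    using paste ia ib hcomp_hom by auto
  have "b \<rhd> (\<iota> \<star> \<tau>) \<lhd> a = b \<rhd> (\<iota> \<star> (\<tau> \<lhd> a))"
    using hcomp_assoc[of a A' A t Z i B] paste ia by simp
  also have "\<dots> = (b \<rhd> \<iota>) \<star> (\<tau> \<lhd> a)"
    using hcomp_assoc[of "t \<odot> a" A' Z i B b B'] paste ib \<tau> comp1_hom by simp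
  also have "\<dots> \<in> zero_null2 L Z"
    by (rule zero_null2.paste[OF _ _ _ _ \<tau> \<iota>]) (use paste in \<open>auto intro: comp1_hom\<close>)
  finally show ?case .
next
  case (vcomp \<alpha> \<beta>)
  have \<alpha>: "\<alpha> \<in> hom2 L (dom2 L \<alpha>) (dom2 L \<beta>)" and \<beta>: "\<beta> \<in> hom2 L (dom2 L \<beta>) (cod2 L \<beta>)"
    using vcomp zero_null2_hom by (auto simp: hom2_def)
  have dd: "dom2 L (\<beta> \<bullet> \<alpha>) = dom2 L \<alpha>" using vcomp_hom[OF \<alpha> \<beta>] by (simp add: hom2_def)
  then have d\<alpha>: "dom2 L \<alpha> \<in> hom1 L A B" using vcomp by simp
  have d\<beta>: "dom2 L \<beta> \<in> hom1 L A B" using cell_hom1[OF \<alpha> d\<alpha>] .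
  have ia: "id2 L a \<in> hom2 L a a" and ib: "id2 L b \<in> hom2 L b b"
    using vcomp id2_hom by (auto simp: hom1_def)
  have \<alpha>a: "\<alpha> \<lhd> a \<in> hom2 L (dom2 L \<alpha> \<odot> a) (dom2 L \<beta> \<odot> a)"
    and \<beta>a: "\<beta> \<lhd> a \<in> hom2 L (dom2 L \<beta> \<odot> a) (cod2 L \<beta> \<odot> a)"
    using hcomp_hom[OF vcomp(7)] ia \<alpha> \<beta> d\<alpha> d\<beta> by auto
  have "(\<beta> \<bullet> \<alpha>) \<lhd> a = (\<beta> \<lhd> a) \<bullet> (\<alpha> \<lhd> a)"
    using interchange[OF vcomp(7) d\<alpha> ia ia \<alpha> \<beta>] vcomp_id_left[OF ia] by simp
  then have "b \<rhd> (\<beta> \<bullet> \<alpha>) \<lhd> a = (b \<rhd> \<beta> \<lhd> a) \<bullet> (b \<rhd> \<alpha> \<lhd> a)"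
    using interchange[OF comp1_hom[OF vcomp(7) d\<alpha>] vcomp(8) \<alpha>a \<beta>a ib ib] vcomp_id_left[OF ib] by simp
  moreover have "dom2 L (b \<rhd> \<beta> \<lhd> a) = cod2 L (b \<rhd> \<alpha> \<lhd> a)"
    using hcomp_hom[OF comp1_hom[OF vcomp(7) d\<alpha>] vcomp(8) \<alpha>a ib]
      hcomp_hom[OF comp1_hom[OF vcomp(7) d\<beta>] vcomp(8) \<beta>a ib] by (simp add: hom2_def)
  ultimately show ?case using vcomp d\<alpha> d\<beta> zero_null2.vcomp by simp
qed

theorem two_ideal_zero_ideal: "two_ideal L (zero_ideal L Z)"
proof -
  let ?N = "zero_ideal L Z"
  have sel: "null2 ?N = zero_null2 L Z" "til ?N b n a = b \<odot> n \<odot> a"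
    "nu ?N b n a = id2 L (b \<odot> n \<odot> a)" for b n a
    by (simp_all add: zero_ideal_def)
  have null1E: "\<exists>t i. t \<in> hom1 L (src L n) Z \<and> i \<in> hom1 L Z (tgt L n) \<and> n = i \<odot> t"
    if "n \<in> null1 ?N" for n
  proof -
    obtain A B t i where ti: "t \<in> hom1 L A Z" "i \<in> hom1 L Z B" "n = i \<odot> t"
      using \<open>n \<in> null1 ?N\<close> by (auto simp: zero_ideal_def)
    moreover have "n \<in> hom1 L A B" using comp1_hom[OF ti(1,2)] ti(3) by simp
    ultimately show ?thesis by (auto simp: hom1_def)
  qed
  have null_Mor: "n \<in> hom1 L (src L n) (tgt L n)" if n: "n \<in> null1 ?N" for n
    using null1E[OF n] comp1_hom by metis
  have id_null: "id2 L n \<in> zero_null2 L Z" if n: "n \<in> null1 ?N" for n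
  proof -
    obtain t i where ti: "t \<in> hom1 L (src L n) Z" "i \<in> hom1 L Z (tgt L n)" "n = i \<odot> t"
      using null1E[OF n] by blast
    have "id2 L i \<star> id2 L t \<in> zero_null2 L Z"
      by (rule zero_null2.paste[OF ti(1) ti(1) ti(2) ti(2)]) (use ti id2_hom in \<open>auto simp: hom1_def\<close>)
    then show ?thesis using hcomp_id2[OF ti(1,2)] ti(3) by simp
  qed
  have whisk: "b \<odot> n \<odot> a \<in> null1 ?N \<and> b \<odot> n \<odot> a \<in> hom1 L (src L a) (tgt L b)"
    if w: "a \<in> Mor L" "n \<in> null1 ?N" "b \<in> Mor L" "tgt L a = src L n" "tgt L n = src L b" for a n b
  proof -
    have a: "a \<in> hom1 L (src L a) (src L n)" and b: "b \<in> hom1 L (tgt L n) (tgt L b)"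
      using that by (auto simp: hom1_def)
    obtain t i where ti: "t \<in> hom1 L (src L n) Z" "i \<in> hom1 L Z (tgt L n)" "n = i \<odot> t"
      using null1E[OF w(2)] by blast
    have ta: "t \<odot> a \<in> hom1 L (src L a) Z" and bi: "b \<odot> i \<in> hom1 L Z (tgt L b)"
      using comp1_hom[OF a ti(1)] comp1_hom[OF ti(2) b] by auto
    have "b \<odot> n \<odot> a = (b \<odot> i) \<odot> (t \<odot> a)"
      using comp1_assoc[OF a ti(1,2)] comp1_assoc[OF ta ti(2) b] ti(3) by simp
    then show ?thesis using ta bi comp1_hom[OF ta bi] by (auto simp: zero_ideal_def)
  qed
  have absorb: "id2 L g \<bullet> \<alpha> \<bullet> inv2 L (id2 L f) = \<alpha>" if "\<alpha> \<in> hom2 L f g" "f \<in> Mor L" for f g \<alpha>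
    using that vcomp_id_left vcomp_id_right by simp
  show ?thesis
    unfolding two_ideal_def sel
  proof (intro conjI allI ballI impI, goal_cases)
    case 1
    then show ?case using null_Mor by (auto simp: hom1_def)
  next
    case (2 \<theta>)
    then show ?case using zero_null2_hom by blast
  next
    case (3 \<theta>)
    then show ?case using zero_null2_hom by blast
  next
    case (4 \<theta>)
    then show ?case using zero_null2_hom by blast
  next
    case (5 n)
    then show ?case using id_null by blast
  next
    case (6 \<theta> \<theta>')
    show ?case by (rule zero_null2.vcomp[OF 6])
  next
    case (7 a n b)
    then show ?case using whisk[of a n b] by simp
  next
    case (8 a n b)
    then show ?case using whisk[of a n b] by (simp add: hom1_def)
  next
    case (9 a n n' \<theta> b)
    then have n: "n \<in> null1 ?N" "n' \<in> null1 ?N" using zero_null2_hom by (auto simp: hom2_def)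
    have n1: "n \<in> hom1 L (src L n) (tgt L n)" using null_Mor[OF n(1)] .
    have a: "a \<in> hom1 L (src L a) (src L n)" and b: "b \<in> hom1 L (tgt L n) (tgt L b)"
      using 9 by (auto simp: hom1_def)
    have ia: "id2 L a \<in> hom2 L a a" and ib: "id2 L b \<in> hom2 L b b" using 9 id2_hom by auto
    have "b \<rhd> \<theta> \<lhd> a \<in> hom2 L (b \<odot> n \<odot> a) (b \<odot> n' \<odot> a)"
      using 9 hcomp_hom[OF comp1_hom[OF a n1] b hcomp_hom[OF a n1 ia] ib] by blast
    moreover have "b \<rhd> \<theta> \<lhd> a \<in> zero_null2 L Z"
      using zero_null2_whisker[OF _ _ a b] 9 n1 by (auto simp: hom2_def)
    ultimately show ?case using absorb whisk[of a n b] n 9 by (simp add: hom1_def)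
  next
    case (10 a a' \<alpha> n b b' \<beta>)
    then have A: "\<alpha> \<in> hom2 L a a'" and B: "\<beta> \<in> hom2 L b b'" and n: "n \<in> null1 ?N" by auto
    have a: "a \<in> hom1 L (src L a) (src L n)" and b: "b \<in> hom1 L (tgt L n) (tgt L b)"
      using 10 dom2_Mor by (auto simp: hom1_def hom2_def)
    have n1: "n \<in> hom1 L (src L n) (tgt L n)" using null_Mor[OF n] .
    obtain t i where ti: "t \<in> hom1 L (src L n) Z" "i \<in> hom1 L Z (tgt L n)" "n = i \<odot> t"
      using null1E[OF n] by blast
    have it: "id2 L t \<in> hom2 L t t" and ii: "id2 L i \<in> hom2 L i i" and nn: "id2 L n \<in> hom2 L n n"
      using ti n1 id2_hom by (auto simp: hom1_def)
    have t\<alpha>: "t \<rhd> \<alpha> \<in> hom2 L (t \<odot> a) (t \<odot> a')" and \<beta>i: "\<beta> \<lhd> i \<in> hom2 L (b \<odot> i) (b' \<odot> i)"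
      using hcomp_hom[OF a ti(1) A it] hcomp_hom[OF ti(2) b ii B] by auto
    have ta: "t \<odot> a \<in> hom1 L (src L a) Z" and bi: "b \<odot> i \<in> hom1 L Z (tgt L b)"
      using comp1_hom[OF a ti(1)] comp1_hom[OF ti(2) b] by auto
    have "\<beta> \<star> id2 L n \<star> \<alpha> = \<beta> \<star> (id2 L i \<star> id2 L t) \<star> \<alpha>"
      using hcomp_id2[OF ti(1,2)] ti(3) by simp
    also have "\<dots> = \<beta> \<star> (id2 L i \<star> (id2 L t \<star> \<alpha>))"
      using hcomp_assoc[OF a ti(1,2) A it ii] by simp
    also have "\<dots> = (\<beta> \<lhd> i) \<star> (t \<rhd> \<alpha>)"
      using hcomp_assoc[OF ta ti(2) b t\<alpha> ii B] by simp
    also have "\<dots> \<in> zero_null2 L Z"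
      using zero_null2.paste[OF ta cell_hom1[OF t\<alpha> ta] bi cell_hom1[OF \<beta>i bi] t\<alpha> \<beta>i] .
    finally have "\<beta> \<star> id2 L n \<star> \<alpha> \<in> zero_null2 L Z" .
    moreover have "\<beta> \<star> id2 L n \<star> \<alpha> \<in> hom2 L (b \<odot> n \<odot> a) (b' \<odot> n \<odot> a')"
      using hcomp_hom[OF comp1_hom[OF a n1] b hcomp_hom[OF a n1 A nn] B] .
    moreover have "b \<odot> n \<odot> a \<in> Mor L" using comp1_hom[OF comp1_hom[OF a n1] b] by (simp add: hom1_def)
    ultimately show ?case using absorb by simp
  next
    case (11 a' a n b b')
    then have n: "n \<in> null1 ?N" and a: "a \<in> hom1 L (src L a) (src L n)"
      and b: "b \<in> hom1 L (tgt L n) (tgt L b)" and a': "a' \<in> hom1 L (src L a') (src L a)"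
      and b': "b' \<in> hom1 L (tgt L b) (tgt L b')"
      by (auto simp: hom1_def)
    have n1: "n \<in> hom1 L (src L n) (tgt L n)" using null_Mor[OF n] .
    let ?m = "b \<odot> n \<odot> a"
    have m: "?m \<in> null1 ?N" "?m \<in> hom1 L (src L a) (tgt L b)" using whisk[of a n b] 11 by auto
    have q: "b' \<odot> ?m \<odot> a' \<in> null1 ?N" "b' \<odot> ?m \<odot> a' \<in> Mor L"
      using whisk[of a' ?m b'] 11 m by (auto simp: hom1_def)
    have eq: "(b' \<odot> b) \<odot> n \<odot> (a \<odot> a') = b' \<odot> ?m \<odot> a'"
    proof -
      have "(b' \<odot> b) \<odot> n \<odot> (a \<odot> a') = b' \<odot> (b \<odot> (n \<odot> (a \<odot> a')))"
        using comp1_assoc[OF comp1_hom[OF comp1_hom[OF a' a] n1] b b'] .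
      also have "\<dots> = b' \<odot> (b \<odot> ((n \<odot> a) \<odot> a'))" using comp1_assoc[OF a' a n1] by simp
      also have "\<dots> = b' \<odot> (?m \<odot> a')" using comp1_assoc[OF a' comp1_hom[OF a n1] b] by simp
      finally show ?thesis .
    qed
    have "b' \<rhd> inv2 L (id2 L ?m) \<lhd> a' = id2 L (b' \<odot> ?m \<odot> a')"
      using hcomp_id2[OF a' m(2)] hcomp_id2[OF comp1_hom[OF a' m(2)] b'] m(2) by (simp add: hom1_def)
    then have "id2 L ((b' \<odot> b) \<odot> n \<odot> (a \<odot> a')) \<bullet> (b' \<rhd> inv2 L (id2 L ?m) \<lhd> a')
        \<bullet> inv2 L (id2 L (b' \<odot> ?m \<odot> a')) = id2 L (b' \<odot> ?m \<odot> a')"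
      using eq q absorb[OF id2_hom[OF q(2)] q(2)] by simp
    then show ?case using id_null[OF q(1)] q(2) eq by (simp add: null_iso_def sel)
  next
    case (12 n)
    then show ?case using null_Mor[OF 12] comp1_id_left comp1_id_right by simp
  next
    case (13 n)
    then show ?case using null_Mor[OF 13] comp1_id_left comp1_id_right by simp
  qed
qed


lemma inverse2_vcomp:
  assumes "\<alpha> \<in> hom2 L f g" "\<beta> \<in> hom2 L g h" "inverse2 L \<alpha> \<alpha>'" "inverse2 L \<beta> \<beta>'"
  shows "inverse2 L (\<beta> \<bullet> \<alpha>) (\<alpha>' \<bullet> \<beta>')"
proof -
  have h: "\<alpha>' \<in> hom2 L g f" "\<beta>' \<in> hom2 L h g" "\<alpha>' \<bullet> \<alpha> = id2 L f" "\<alpha> \<bullet> \<alpha>' = id2 L g"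
    "\<beta>' \<bullet> \<beta> = id2 L g" "\<beta> \<bullet> \<beta>' = id2 L h"
    using assms by (auto simp: inverse2_def hom2_def)
  have "(\<alpha>' \<bullet> \<beta>') \<bullet> (\<beta> \<bullet> \<alpha>) = \<alpha>' \<bullet> (\<beta>' \<bullet> \<beta>) \<bullet> \<alpha>"
    using vcomp_assoc[OF vcomp_hom[OF assms(1,2)] h(2,1)] vcomp_assoc[OF assms(1,2) h(2)] by simp
  also have "\<dots> = id2 L f" using h vcomp_id_left[OF assms(1)] by simp
  finally have 1: "(\<alpha>' \<bullet> \<beta>') \<bullet> (\<beta> \<bullet> \<alpha>) = id2 L f" .
  have "(\<beta> \<bullet> \<alpha>) \<bullet> (\<alpha>' \<bullet> \<beta>') = \<beta> \<bullet> (\<alpha> \<bullet> \<alpha>') \<bullet> \<beta>'"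
    using vcomp_assoc[OF vcomp_hom[OF h(2,1)] assms(1,2)] vcomp_assoc[OF h(2,1) assms(1)] by simp
  also have "\<dots> = id2 L h" using h vcomp_id_left[OF h(2)] by simp
  finally have 2: "(\<beta> \<bullet> \<alpha>) \<bullet> (\<alpha>' \<bullet> \<beta>') = id2 L h" .
  have "\<beta> \<bullet> \<alpha> \<in> hom2 L f h" "\<alpha>' \<bullet> \<beta>' \<in> hom2 L h f" using vcomp_hom assms h by auto
  then show ?thesis using 1 2 by (auto simp: inverse2_def hom2_def)
qed

lemma inverse2_hcomp:
  assumes "f \<in> hom1 L A B" "g \<in> hom1 L B C" "\<alpha> \<in> hom2 L f f'" "\<beta> \<in> hom2 L g g'"
    "inverse2 L \<alpha> \<alpha>'" "inverse2 L \<beta> \<beta>'"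
  shows "inverse2 L (\<beta> \<star> \<alpha>) (\<beta>' \<star> \<alpha>')"
proof -
  have h: "\<alpha>' \<in> hom2 L f' f" "\<beta>' \<in> hom2 L g' g" "\<alpha>' \<bullet> \<alpha> = id2 L f" "\<alpha> \<bullet> \<alpha>' = id2 L f'"
    "\<beta>' \<bullet> \<beta> = id2 L g" "\<beta> \<bullet> \<beta>' = id2 L g'"
    using assms by (auto simp: inverse2_def hom2_def)
  have f': "f' \<in> hom1 L A B" and g': "g' \<in> hom1 L B C" using cell_hom1 assms by auto
  have "\<beta> \<star> \<alpha> \<in> hom2 L (g \<odot> f) (g' \<odot> f')" "\<beta>' \<star> \<alpha>' \<in> hom2 L (g' \<odot> f') (g \<odot> f)"
    using hcomp_hom[OF assms(1-4)] hcomp_hom[OF f' g' h(1,2)] by auto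
  moreover have "(\<beta>' \<star> \<alpha>') \<bullet> (\<beta> \<star> \<alpha>) = id2 L (g \<odot> f)" "(\<beta> \<star> \<alpha>) \<bullet> (\<beta>' \<star> \<alpha>') = id2 L (g' \<odot> f')"
    using interchange[OF assms(1,2,3) h(1) assms(4) h(2)] interchange[OF f' g' h(1) assms(3) h(2) assms(4)]
      h hcomp_id2[OF assms(1,2)] hcomp_id2[OF f' g'] by auto
  ultimately show ?thesis by (auto simp: inverse2_def hom2_def)
qed

lemma iso2_vcomp: "\<lbrakk>\<alpha> \<in> iso2 L f g; \<beta> \<in> iso2 L g h\<rbrakk> \<Longrightarrow> \<beta> \<bullet> \<alpha> \<in> iso2 L f h"
  using inverse2_vcomp vcomp_hom unfolding iso2_def by blast

lemma iso2_hcomp: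
  "\<lbrakk>f \<in> hom1 L A B; g \<in> hom1 L B C; \<alpha> \<in> iso2 L f f'; \<beta> \<in> iso2 L g g'\<rbrakk> \<Longrightarrow> \<beta> \<star> \<alpha> \<in> iso2 L (g \<odot> f) (g' \<odot> f')"
  using inverse2_hcomp hcomp_hom unfolding iso2_def by blast

lemma id2_hom1: "f \<in> hom1 L A B \<Longrightarrow> id2 L f \<in> hom2 L f f"
  using id2_hom by (auto simp: hom1_def)

lemma iso2_id1: "f \<in> hom1 L A B \<Longrightarrow> id2 L f \<in> iso2 L f f"
  by (auto simp: hom1_def)

lemma iso2D: "\<alpha> \<in> iso2 L f g \<Longrightarrow> \<alpha> \<in> hom2 L f g"
  by (simp add: iso2_def)

lemma squares_iff:
  "Sq f g s t \<phi> \<in> squares L S \<longleftrightarrow> f \<in> S \<inter> Mor L \<and> g \<in> S \<inter> Mor L \<and>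
     s \<in> hom1 L (src L f) (src L g) \<and> t \<in> hom1 L (tgt L f) (tgt L g) \<and> \<phi> \<in> iso2 L (g \<odot> s) (t \<odot> f)"
  by (auto simp: squares_def)

lemma square_cells_iff:
  "SqCell p q \<xi> \<mu> \<in> square_cells L S \<longleftrightarrow> p \<in> squares L S \<and> q \<in> squares L S \<and>
     sq_src q = sq_src p \<and> sq_tgt q = sq_tgt p \<and>
     \<xi> \<in> hom2 L (sq_top p) (sq_top q) \<and> \<mu> \<in> hom2 L (sq_bot p) (sq_bot q) \<and>
     sq_fill q \<bullet> (sq_tgt p \<rhd> \<xi>) = (\<mu> \<lhd> sq_src p) \<bullet> sq_fill p"
  by (cases p; cases q) (auto simp: square_cells_def)

lemma Mor_hom1: "f \<in> Mor L \<Longrightarrow> f \<in> hom1 L (src L f) (tgt L f)"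
  by (simp add: hom1_def)

lemma sq_id_squares: "f \<in> S \<Longrightarrow> f \<in> Mor L \<Longrightarrow> sq_id L f \<in> squares L S"
  using id1_hom src_Ob tgt_Ob comp1_id_left[OF Mor_hom1] comp1_id_right[OF Mor_hom1]
  by (simp add: sq_id_def squares_iff)

lemma sq_comp_squares:
  assumes "p \<in> squares L S" "q \<in> squares L S" "sq_tgt p = sq_src q"
  shows "sq_comp L q p \<in> squares L S"
proof -
  obtain f g s t \<phi> where p: "p = Sq f g s t \<phi>" by (cases p)
  obtain h s' t' \<phi>' where q: "q = Sq g h s' t' \<phi>'" using assms(3) p by (cases q) auto
  have P: "f \<in> S \<inter> Mor L" "g \<in> S \<inter> Mor L" "s \<in> hom1 L (src L f) (src L g)"
    "t \<in> hom1 L (tgt L f) (tgt L g)" "\<phi> \<in> iso2 L (g \<odot> s) (t \<odot> f)" using assms(1) p squares_iff by auto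
  have Q: "h \<in> S \<inter> Mor L" "s' \<in> hom1 L (src L g) (src L h)"
    "t' \<in> hom1 L (tgt L g) (tgt L h)" "\<phi>' \<in> iso2 L (h \<odot> s') (t' \<odot> g)" using assms(2) q squares_iff by auto
  have f: "f \<in> hom1 L (src L f) (tgt L f)" and g: "g \<in> hom1 L (src L g) (tgt L g)"
    and h: "h \<in> hom1 L (src L h) (tgt L h)" using P Q Mor_hom1 by auto
  have 1: "\<phi>' \<lhd> s \<in> iso2 L (h \<odot> (s' \<odot> s)) (t' \<odot> (g \<odot> s))"
    using iso2_hcomp[OF P(3) comp1_hom[OF Q(2) h] iso2_id1[OF P(3)] Q(4)]
      comp1_assoc[OF P(3) Q(2) h] comp1_assoc[OF P(3) g Q(3)] by simp
  have 2: "t' \<rhd> \<phi> \<in> iso2 L (t' \<odot> (g \<odot> s)) ((t' \<odot> t) \<odot> f)"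
    using iso2_hcomp[OF comp1_hom[OF P(3) g] Q(3) P(5) iso2_id1[OF Q(3)]] comp1_assoc[OF f P(4) Q(3)] by simp
  show ?thesis
    using iso2_vcomp[OF 1 2] P Q comp1_hom[OF P(3) Q(2)] comp1_hom[OF P(4) Q(3)]
    by (simp add: p q sq_comp_def squares_iff)
qed

lemma sq_comp_assoc:
  assumes "p \<in> squares L S" "q \<in> squares L S" "r \<in> squares L S" "sq_tgt p = sq_src q" "sq_tgt q = sq_src r"
  shows "sq_comp L (sq_comp L r q) p = sq_comp L r (sq_comp L q p)"
proof -
  obtain f g s t \<phi> where p: "p = Sq f g s t \<phi>" by (cases p)
  obtain h s' t' \<phi>' where q: "q = Sq g h s' t' \<phi>'" using assms(4) p by (cases q) auto
  obtain k s'' t'' \<phi>'' where r: "r = Sq h k s'' t'' \<phi>''" using assms(5) q by (cases r) auto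
  have P: "f \<in> Mor L" "g \<in> Mor L" "s \<in> hom1 L (src L f) (src L g)"
    "t \<in> hom1 L (tgt L f) (tgt L g)" "\<phi> \<in> hom2 L (g \<odot> s) (t \<odot> f)"
    using assms(1) p squares_iff iso2D by auto
  have Q: "h \<in> Mor L" "s' \<in> hom1 L (src L g) (src L h)"
    "t' \<in> hom1 L (tgt L g) (tgt L h)" "\<phi>' \<in> hom2 L (h \<odot> s') (t' \<odot> g)"
    using assms(2) q squares_iff iso2D by auto
  have R: "k \<in> Mor L" "s'' \<in> hom1 L (src L h) (src L k)"
    "t'' \<in> hom1 L (tgt L h) (tgt L k)" "\<phi>'' \<in> hom2 L (k \<odot> s'') (t'' \<odot> h)"
    using assms(3) r squares_iff iso2D by auto
  note m = Mor_hom1[OF P(1)] Mor_hom1[OF P(2)] Mor_hom1[OF Q(1)] Mor_hom1[OF R(1)]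
  note ids = id2_hom1[OF P(3)] and ids' = id2_hom1[OF Q(2)] and it' = id2_hom1[OF Q(3)] and it'' = id2_hom1[OF R(3)]
  have a: "\<phi>'' \<lhd> s' \<in> hom2 L (k \<odot> (s'' \<odot> s')) (t'' \<odot> (h \<odot> s'))"
    using hcomp_hom[OF Q(2) comp1_hom[OF R(2) m(4)] ids' R(4)]
      comp1_assoc[OF Q(2) R(2) m(4)] comp1_assoc[OF Q(2) m(3) R(3)] by simp
  have b: "t'' \<rhd> \<phi>' \<in> hom2 L (t'' \<odot> (h \<odot> s')) ((t'' \<odot> t') \<odot> g)"
    using hcomp_hom[OF comp1_hom[OF Q(2) m(3)] R(3) Q(4) it''] comp1_assoc[OF m(2) Q(3) R(3)] by simp
  have c: "\<phi>' \<lhd> s \<in> hom2 L (h \<odot> (s' \<odot> s)) (t' \<odot> (g \<odot> s))"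
    using hcomp_hom[OF P(3) comp1_hom[OF Q(2) m(3)] ids Q(4)]
      comp1_assoc[OF P(3) Q(2) m(3)] comp1_assoc[OF P(3) m(2) Q(3)] by simp
  have d: "t' \<rhd> \<phi> \<in> hom2 L (t' \<odot> (g \<odot> s)) ((t' \<odot> t) \<odot> f)"
    using hcomp_hom[OF comp1_hom[OF P(3) m(2)] Q(3) P(5) it'] comp1_assoc[OF m(1) P(4) Q(3)] by simp
  have s's: "s' \<odot> s \<in> hom1 L (src L f) (src L h)" and t't: "t' \<odot> t \<in> hom1 L (tgt L f) (tgt L h)"
    and t''t': "t'' \<odot> t' \<in> hom1 L (tgt L g) (tgt L k)" and s''s': "s'' \<odot> s' \<in> hom1 L (src L g) (src L k)"
    using comp1_hom P Q R by auto
  let ?x = "\<phi>'' \<lhd> (s' \<odot> s)" and ?y = "t'' \<rhd> \<phi>' \<lhd> s" and ?z = "(t'' \<odot> t') \<rhd> \<phi>"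
  have e1: "((t'' \<rhd> \<phi>') \<bullet> (\<phi>'' \<lhd> s')) \<lhd> s = ?y \<bullet> ?x"
    using interchange[OF P(3) comp1_hom[OF s''s' m(4)] ids ids a b] vcomp_id_left[OF ids]
      hcomp_assoc[OF P(3) Q(2) comp1_hom[OF R(2) m(4)] ids ids' R(4)] hcomp_id2[OF P(3) Q(2)]
      hcomp_assoc[OF P(3) comp1_hom[OF Q(2) m(3)] R(3) ids Q(4) it''] by simp
  have e2: "t'' \<rhd> ((t' \<rhd> \<phi>) \<bullet> (\<phi>' \<lhd> s)) = ?z \<bullet> ?y"
    using interchange[OF comp1_hom[OF s's m(3)] R(3) c d it'' it''] vcomp_id_left[OF it'']
      hcomp_assoc[OF comp1_hom[OF P(3) m(2)] Q(3) R(3) P(5) it' it''] hcomp_id2[OF Q(3) R(3)] by simp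
  have x: "?x \<in> hom2 L (k \<odot> (s'' \<odot> (s' \<odot> s))) (t'' \<odot> (h \<odot> (s' \<odot> s)))"
    using hcomp_hom[OF s's comp1_hom[OF R(2) m(4)] id2_hom1[OF s's] R(4)]
      comp1_assoc[OF s's R(2) m(4)] comp1_assoc[OF s's m(3) R(3)] by simp
  have y: "?y \<in> hom2 L (t'' \<odot> (h \<odot> (s' \<odot> s))) (t'' \<odot> (t' \<odot> (g \<odot> s)))"
    using hcomp_hom[OF comp1_hom[OF s's m(3)] R(3) c it''] .
  have z: "?z \<in> hom2 L (t'' \<odot> (t' \<odot> (g \<odot> s))) ((t'' \<odot> t') \<odot> (t \<odot> f))"
    using hcomp_hom[OF comp1_hom[OF P(3) m(2)] t''t' P(5) id2_hom1[OF t''t']]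
      comp1_assoc[OF comp1_hom[OF P(3) m(2)] Q(3) R(3)] by simp
  show ?thesis
    using e1 e2 vcomp_assoc[OF x y z] comp1_assoc[OF P(3) Q(2) R(2)] comp1_assoc[OF P(4) Q(3) R(3)]
    by (simp add: p q r sq_comp_def)
qed

lemma sq_comp_id:
  assumes "p \<in> squares L S"
  shows "sq_comp L p (sq_id L (sq_src p)) = p" and "sq_comp L (sq_id L (sq_tgt p)) p = p"
proof -
  obtain f g s t \<phi> where p: "p = Sq f g s t \<phi>" by (cases p)
  have P: "f \<in> Mor L" "g \<in> Mor L" "s \<in> hom1 L (src L f) (src L g)"
    "t \<in> hom1 L (tgt L f) (tgt L g)" "\<phi> \<in> hom2 L (g \<odot> s) (t \<odot> f)"
    using assms p squares_iff iso2D by auto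
  note f = Mor_hom1[OF P(1)] and g = Mor_hom1[OF P(2)]
  show "sq_comp L p (sq_id L (sq_src p)) = p"
    using P hcomp_id_right[OF comp1_hom[OF P(3) g] P(5)] hcomp_id2[OF f P(4)] vcomp_id_left[OF P(5)]
      comp1_id_right[OF P(3)] comp1_id_right[OF P(4)]
    by (simp add: p sq_comp_def sq_id_def)
  show "sq_comp L (sq_id L (sq_tgt p)) p = p"
    using P hcomp_id_left[OF comp1_hom[OF P(3) g] P(5)] hcomp_id2[OF P(3) g] vcomp_id_right[OF P(5)]
      comp1_id_left[OF P(3)] comp1_id_left[OF P(4)]
    by (simp add: p sq_comp_def sq_id_def)
qed

lemma square_cells_vcomp:
  assumes "SqCell p q \<xi> \<mu> \<in> square_cells L S" "SqCell q r \<xi>' \<mu>' \<in> square_cells L S"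
  shows "SqCell p r (\<xi>' \<bullet> \<xi>) (\<mu>' \<bullet> \<mu>) \<in> square_cells L S"
proof -
  obtain f g s t \<phi> where p: "p = Sq f g s t \<phi>" by (cases p)
  obtain s1 t1 \<phi>1 where q: "q = Sq f g s1 t1 \<phi>1" using assms p by (cases q) (auto simp: square_cells_iff)
  obtain s2 t2 \<phi>2 where r: "r = Sq f g s2 t2 \<phi>2" using assms q by (cases r) (auto simp: square_cells_iff)
  have A: "f \<in> Mor L" "g \<in> Mor L" "s \<in> hom1 L (src L f) (src L g)" "t \<in> hom1 L (tgt L f) (tgt L g)"
    "\<phi> \<in> hom2 L (g \<odot> s) (t \<odot> f)" "\<phi>1 \<in> hom2 L (g \<odot> s1) (t1 \<odot> f)" "\<phi>2 \<in> hom2 L (g \<odot> s2) (t2 \<odot> f)"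
    "\<xi> \<in> hom2 L s s1" "\<mu> \<in> hom2 L t t1" "\<xi>' \<in> hom2 L s1 s2" "\<mu>' \<in> hom2 L t1 t2"
    and C: "\<phi>1 \<bullet> (g \<rhd> \<xi>) = (\<mu> \<lhd> f) \<bullet> \<phi>" "\<phi>2 \<bullet> (g \<rhd> \<xi>') = (\<mu>' \<lhd> f) \<bullet> \<phi>1"
    using assms by (auto simp: square_cells_iff p q r squares_iff iso2D)
  note f = Mor_hom1[OF A(1)] and g = Mor_hom1[OF A(2)]
  have s1: "s1 \<in> hom1 L (src L f) (src L g)" and t1: "t1 \<in> hom1 L (tgt L f) (tgt L g)"
    using cell_hom1 A by auto
  have w: "g \<rhd> \<xi> \<in> hom2 L (g \<odot> s) (g \<odot> s1)" "g \<rhd> \<xi>' \<in> hom2 L (g \<odot> s1) (g \<odot> s2)"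
    "\<mu> \<lhd> f \<in> hom2 L (t \<odot> f) (t1 \<odot> f)" "\<mu>' \<lhd> f \<in> hom2 L (t1 \<odot> f) (t2 \<odot> f)"
    using hcomp_hom[OF A(3) g A(8) id2_hom1[OF g]] hcomp_hom[OF s1 g A(10) id2_hom1[OF g]]
      hcomp_hom[OF f A(4) id2_hom1[OF f] A(9)] hcomp_hom[OF f t1 id2_hom1[OF f] A(11)] by auto
  have "\<phi>2 \<bullet> (g \<rhd> (\<xi>' \<bullet> \<xi>)) = \<phi>2 \<bullet> (g \<rhd> \<xi>') \<bullet> (g \<rhd> \<xi>)"
    using interchange[OF A(3) g A(8,10) id2_hom1[OF g] id2_hom1[OF g]] vcomp_id_left[OF id2_hom1[OF g]] by simp
  also have "\<dots> = (\<mu>' \<lhd> f) \<bullet> \<phi>1 \<bullet> (g \<rhd> \<xi>)"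
    using vcomp_assoc[OF w(1,2) A(7)] vcomp_assoc[OF w(1) A(6) w(4)] C by simp
  also have "\<dots> = ((\<mu>' \<bullet> \<mu>) \<lhd> f) \<bullet> \<phi>"
    using vcomp_assoc[OF A(5) w(3,4)] C
      interchange[OF f A(4) id2_hom1[OF f] id2_hom1[OF f] A(9,11)] vcomp_id_left[OF id2_hom1[OF f]] by simp
  finally show ?thesis
    using assms vcomp_hom[OF A(8,10)] vcomp_hom[OF A(9,11)] by (auto simp: square_cells_iff p q r)
qed

lemma square_cells_hcomp:
  assumes "SqCell p p1 \<xi> \<mu> \<in> square_cells L S" "SqCell q q1 \<xi>' \<mu>' \<in> square_cells L S" "sq_tgt p = sq_src q"
  shows "SqCell (sq_comp L q p) (sq_comp L q1 p1) (\<xi>' \<star> \<xi>) (\<mu>' \<star> \<mu>) \<in> square_cells L S"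
proof -
  obtain f g s t \<phi> where p: "p = Sq f g s t \<phi>" by (cases p)
  obtain s1 t1 \<phi>1 where p1: "p1 = Sq f g s1 t1 \<phi>1" using assms p by (cases p1) (auto simp: square_cells_iff)
  obtain h s' t' \<phi>' where q: "q = Sq g h s' t' \<phi>'" using assms(3) p by (cases q) auto
  obtain s1' t1' \<phi>1' where q1: "q1 = Sq g h s1' t1' \<phi>1'"
    using assms q by (cases q1) (auto simp: square_cells_iff)
  have P: "f \<in> Mor L" "g \<in> Mor L" "s \<in> hom1 L (src L f) (src L g)" "t \<in> hom1 L (tgt L f) (tgt L g)"
    "\<phi> \<in> hom2 L (g \<odot> s) (t \<odot> f)" "\<phi>1 \<in> hom2 L (g \<odot> s1) (t1 \<odot> f)" "\<xi> \<in> hom2 L s s1" "\<mu> \<in> hom2 L t t1"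
    and C: "\<phi>1 \<bullet> (g \<rhd> \<xi>) = (\<mu> \<lhd> f) \<bullet> \<phi>"
    using assms by (auto simp: square_cells_iff p p1 squares_iff iso2D)
  have Q: "h \<in> Mor L" "s' \<in> hom1 L (src L g) (src L h)" "t' \<in> hom1 L (tgt L g) (tgt L h)"
    "\<phi>' \<in> hom2 L (h \<odot> s') (t' \<odot> g)" "\<phi>1' \<in> hom2 L (h \<odot> s1') (t1' \<odot> g)"
    "\<xi>' \<in> hom2 L s' s1'" "\<mu>' \<in> hom2 L t' t1'" and C': "\<phi>1' \<bullet> (h \<rhd> \<xi>') = (\<mu>' \<lhd> g) \<bullet> \<phi>'"
    using assms by (auto simp: square_cells_iff q q1 squares_iff iso2D)
  note f = Mor_hom1[OF P(1)] and g = Mor_hom1[OF P(2)] and h = Mor_hom1[OF Q(1)]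
  have s1: "s1 \<in> hom1 L (src L f) (src L g)" and t1: "t1 \<in> hom1 L (tgt L f) (tgt L g)"
    and s1': "s1' \<in> hom1 L (src L g) (src L h)" and t1': "t1' \<in> hom1 L (tgt L g) (tgt L h)"
    using cell_hom1 P Q by auto
  note I = id2_hom1
  have w: "g \<rhd> \<xi> \<in> hom2 L (g \<odot> s) (g \<odot> s1)" "\<mu> \<lhd> f \<in> hom2 L (t \<odot> f) (t1 \<odot> f)"
    "h \<rhd> \<xi>' \<in> hom2 L (h \<odot> s') (h \<odot> s1')" "\<mu>' \<lhd> g \<in> hom2 L (t' \<odot> g) (t1' \<odot> g)"
    using hcomp_hom[OF P(3) g P(7) I[OF g]] hcomp_hom[OF f P(4) I[OF f] P(8)]
      hcomp_hom[OF Q(2) h Q(6) I[OF h]] hcomp_hom[OF g Q(3) I[OF g] Q(7)] by auto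
  have a1: "(\<phi>1' \<lhd> s1) \<bullet> (h \<rhd> (\<xi>' \<star> \<xi>)) = (\<mu>' \<star> (g \<rhd> \<xi>)) \<bullet> (\<phi>' \<lhd> s)"
  proof -
    have "(\<phi>1' \<lhd> s1) \<bullet> (h \<rhd> (\<xi>' \<star> \<xi>)) = (\<phi>1' \<lhd> s1) \<bullet> ((h \<rhd> \<xi>') \<star> \<xi>)"
      using hcomp_assoc[OF P(3) Q(2) h P(7) Q(6) I[OF h]] by simp
    also have "\<dots> = (\<phi>1' \<bullet> (h \<rhd> \<xi>')) \<star> (id2 L s1 \<bullet> \<xi>)"
      using interchange[OF P(3) comp1_hom[OF Q(2) h] P(7) I[OF s1] w(3) Q(5)] by simp
    also have "\<dots> = ((\<mu>' \<lhd> g) \<bullet> \<phi>') \<star> (\<xi> \<bullet> id2 L s)"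
      using C' vcomp_id_left[OF P(7)] vcomp_id_right[OF P(7)] by simp
    also have "\<dots> = ((\<mu>' \<lhd> g) \<star> \<xi>) \<bullet> (\<phi>' \<lhd> s)"
      using interchange[OF P(3) comp1_hom[OF Q(2) h] I[OF P(3)] P(7) Q(4) w(4)] .
    also have "\<dots> = (\<mu>' \<star> (g \<rhd> \<xi>)) \<bullet> (\<phi>' \<lhd> s)"
      using hcomp_assoc[OF P(3) g Q(3) P(7) I[OF g] Q(7)] by simp
    finally show ?thesis .
  qed
  have a2: "(t1' \<rhd> \<phi>1) \<bullet> (\<mu>' \<star> (g \<rhd> \<xi>)) = ((\<mu>' \<star> \<mu>) \<lhd> f) \<bullet> (t' \<rhd> \<phi>)"
  proof -
    have "(t1' \<rhd> \<phi>1) \<bullet> (\<mu>' \<star> (g \<rhd> \<xi>)) = (id2 L t1' \<bullet> \<mu>') \<star> (\<phi>1 \<bullet> (g \<rhd> \<xi>))"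
      using interchange[OF comp1_hom[OF P(3) g] Q(3) w(1) P(6) Q(7) I[OF t1']] by simp
    also have "\<dots> = (\<mu>' \<bullet> id2 L t') \<star> ((\<mu> \<lhd> f) \<bullet> \<phi>)"
      using C vcomp_id_left[OF Q(7)] vcomp_id_right[OF Q(7)] by simp
    also have "\<dots> = (\<mu>' \<star> (\<mu> \<lhd> f)) \<bullet> (t' \<rhd> \<phi>)"
      using interchange[OF comp1_hom[OF P(3) g] Q(3) P(5) w(2) I[OF Q(3)] Q(7)] .
    also have "\<dots> = ((\<mu>' \<star> \<mu>) \<lhd> f) \<bullet> (t' \<rhd> \<phi>)"
      using hcomp_assoc[OF f P(4) Q(3) I[OF f] P(8) Q(7)] by simp
    finally show ?thesis .
  qed
  have v: "h \<rhd> (\<xi>' \<star> \<xi>) \<in> hom2 L (h \<odot> (s' \<odot> s)) (h \<odot> (s1' \<odot> s1))"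
    "\<phi>1' \<lhd> s1 \<in> hom2 L (h \<odot> (s1' \<odot> s1)) (t1' \<odot> (g \<odot> s1))"
    "t1' \<rhd> \<phi>1 \<in> hom2 L (t1' \<odot> (g \<odot> s1)) (t1' \<odot> (t1 \<odot> f))"
    "\<phi>' \<lhd> s \<in> hom2 L (h \<odot> (s' \<odot> s)) (t' \<odot> (g \<odot> s))"
    "\<mu>' \<star> (g \<rhd> \<xi>) \<in> hom2 L (t' \<odot> (g \<odot> s)) (t1' \<odot> (g \<odot> s1))"
    "t' \<rhd> \<phi> \<in> hom2 L (t' \<odot> (g \<odot> s)) (t' \<odot> (t \<odot> f))"
    "(\<mu>' \<star> \<mu>) \<lhd> f \<in> hom2 L (t' \<odot> (t \<odot> f)) (t1' \<odot> (t1 \<odot> f))"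
    using hcomp_hom[OF comp1_hom[OF P(3) Q(2)] h hcomp_hom[OF P(3) Q(2) P(7) Q(6)] I[OF h]]
      hcomp_hom[OF s1 comp1_hom[OF s1' h] I[OF s1] Q(5)] comp1_assoc[OF s1 s1' h] comp1_assoc[OF s1 g t1']
      hcomp_hom[OF comp1_hom[OF s1 g] t1' P(6) I[OF t1']]
      hcomp_hom[OF P(3) comp1_hom[OF Q(2) h] I[OF P(3)] Q(4)] comp1_assoc[OF P(3) Q(2) h]
      comp1_assoc[OF P(3) g Q(3)] hcomp_hom[OF comp1_hom[OF P(3) g] Q(3) w(1) Q(7)]
      hcomp_hom[OF comp1_hom[OF P(3) g] Q(3) P(5) I[OF Q(3)]]
      hcomp_hom[OF f comp1_hom[OF P(4) Q(3)] I[OF f] hcomp_hom[OF P(4) Q(3) P(8) Q(7)]]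
      comp1_assoc[OF f P(4) Q(3)] comp1_assoc[OF f t1 t1'] by auto
  have "((t1' \<rhd> \<phi>1) \<bullet> (\<phi>1' \<lhd> s1)) \<bullet> (h \<rhd> (\<xi>' \<star> \<xi>)) = (t1' \<rhd> \<phi>1) \<bullet> (\<mu>' \<star> (g \<rhd> \<xi>)) \<bullet> (\<phi>' \<lhd> s)"
    using vcomp_assoc[OF v(1,2,3)] a1 by simp
  also have "\<dots> = ((\<mu>' \<star> \<mu>) \<lhd> f) \<bullet> ((t' \<rhd> \<phi>) \<bullet> (\<phi>' \<lhd> s))"
    using vcomp_assoc[OF v(4,5,3)] vcomp_assoc[OF v(4,6,7)] a2 by simp
  finally have "((t1' \<rhd> \<phi>1) \<bullet> (\<phi>1' \<lhd> s1)) \<bullet> (h \<rhd> (\<xi>' \<star> \<xi>))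
    = ((\<mu>' \<star> \<mu>) \<lhd> f) \<bullet> ((t' \<rhd> \<phi>) \<bullet> (\<phi>' \<lhd> s))" .
  moreover have "sq_comp L q p \<in> squares L S" "sq_comp L q1 p1 \<in> squares L S"
    using assms by (auto intro!: sq_comp_squares simp: square_cells_iff p p1 q q1)
  ultimately show ?thesis
    using hcomp_hom[OF P(3) Q(2) P(7) Q(6)] hcomp_hom[OF P(4) Q(3) P(8) Q(7)]
    by (simp add: square_cells_iff p p1 q q1 sq_comp_def)
qed

lemma square_cells_id:
  assumes "p \<in> squares L S"
  shows "SqCell p p (id2 L (sq_top p)) (id2 L (sq_bot p)) \<in> square_cells L S"
proof -
  obtain f g s t \<phi> where p: "p = Sq f g s t \<phi>" by (cases p)
  have P: "f \<in> Mor L" "g \<in> Mor L" "s \<in> hom1 L (src L f) (src L g)"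
    "t \<in> hom1 L (tgt L f) (tgt L g)" "\<phi> \<in> hom2 L (g \<odot> s) (t \<odot> f)"
    using assms p squares_iff iso2D by auto
  show ?thesis
    using assms id2_hom1[OF P(3)] id2_hom1[OF P(4)] hcomp_id2[OF P(3) Mor_hom1[OF P(2)]]
      hcomp_id2[OF Mor_hom1[OF P(1)] P(4)] vcomp_id_left[OF P(5)] vcomp_id_right[OF P(5)]
    by (simp add: square_cells_iff p)
qed

theorem two_category_arrow2: "two_category (arrow2 L S)"
proof -
  let ?A = "arrow2 L S"
  have sel [simp]: "Ob ?A = S \<inter> Mor L" "Mor ?A = squares L S" "Cell ?A = square_cells L S"
    "src ?A = sq_src" "tgt ?A = sq_tgt" "dom2 ?A = sqc_dom" "cod2 ?A = sqc_cod" "id1 ?A = sq_id L"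
    "id2 ?A p = SqCell p p (id2 L (sq_top p)) (id2 L (sq_bot p))" "comp1 ?A = sq_comp L"
    "vcomp ?A y x = SqCell (sqc_dom x) (sqc_cod y) (sqc_top y \<bullet> sqc_top x) (sqc_bot y \<bullet> sqc_bot x)"
    "hcomp ?A y x = SqCell (sq_comp L (sqc_dom y) (sqc_dom x)) (sq_comp L (sqc_cod y) (sqc_cod x))
       (sqc_top y \<star> sqc_top x) (sqc_bot y \<star> sqc_bot x)" for p x y
    by (simp_all add: arrow2_def)
  have h1: "p \<in> hom1 ?A f g \<longleftrightarrow> p \<in> squares L S \<and> sq_src p = f \<and> sq_tgt p = g" for p f g
    by (simp add: hom1_def)
  have top: "sq_top p \<in> hom1 L (src L (sq_src p)) (src L (sq_tgt p))"
    and bot: "sq_bot p \<in> hom1 L (tgt L (sq_src p)) (tgt L (sq_tgt p))"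
    if "p \<in> squares L S" for p
    using that by (cases p; simp add: squares_iff)+
  have h2: "x \<in> hom2 ?A p q \<longleftrightarrow> (\<exists>\<xi> \<mu>. x = SqCell p q \<xi> \<mu> \<and> x \<in> square_cells L S)" for x p q
    by (cases x) (auto simp: hom2_def)
  have comp_sel [simp]: "sq_src (sq_comp L q p) = sq_src p" "sq_tgt (sq_comp L q p) = sq_tgt q"
    "sq_top (sq_comp L q p) = sq_top q \<odot> sq_top p" "sq_bot (sq_comp L q p) = sq_bot q \<odot> sq_bot p" for p q
    by (simp_all add: sq_comp_def)
  have id_sel [simp]: "sq_src (sq_id L f) = f" "sq_tgt (sq_id L f) = f"
    "sq_top (sq_id L f) = id1 L (src L f)" "sq_bot (sq_id L f) = id1 L (tgt L f)" for f
    by (simp_all add: sq_id_def)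
  have cellD: "p \<in> squares L S" "q \<in> squares L S" "sq_src q = sq_src p" "sq_tgt q = sq_tgt p"
    "\<xi> \<in> hom2 L (sq_top p) (sq_top q)" "\<mu> \<in> hom2 L (sq_bot p) (sq_bot q)"
    if "SqCell p q \<xi> \<mu> \<in> square_cells L S" for p q \<xi> \<mu>
    using that by (auto simp: square_cells_iff)
  show ?thesis
  proof (unfold_locales, goal_cases)
    case (1 f)
    then show ?case by (cases f) (simp add: squares_iff)
  next
    case (2 f)
    then show ?case by (cases f) (simp add: squares_iff)
  next
    case (3 A)
    then show ?case by (simp add: h1 sq_id_squares)
  next
    case (4 f A B g C)
    then show ?case by (simp add: h1 sq_comp_squares)
  next
    case (5 f A B g C h D)
    then show ?case using sq_comp_assoc[of f S g h] by (simp add: h1)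
  next
    case (6 f A B)
    then show ?case using sq_comp_id by (auto simp: h1)
  next
    case (7 f A B)
    then show ?case using sq_comp_id by (auto simp: h1)
  next
    case (8 \<alpha>)
    then show ?case by (cases \<alpha>) (simp add: square_cells_iff)
  next
    case (9 \<alpha>)
    then show ?case by (cases \<alpha>) (simp add: square_cells_iff)
  next
    case (10 \<alpha>)
    then show ?case by (cases \<alpha>) (simp add: square_cells_iff)
  next
    case (11 \<alpha>)
    then show ?case by (cases \<alpha>) (simp add: square_cells_iff)
  next
    case (12 f)
    then show ?case by (simp add: h2 square_cells_id)
  next
    case (13 \<alpha> f g \<beta> h)
    then show ?case by (auto simp: h2 square_cells_vcomp)
  next
    case (14 \<alpha> f g \<beta> h \<gamma> k)
    then show ?case by (auto simp: h2 square_cells_iff intro: vcomp_assoc)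
  next
    case (15 \<alpha> f g)
    then show ?case by (auto simp: h2 square_cells_iff intro: vcomp_id_right)
  next
    case (16 \<alpha> f g)
    then show ?case by (auto simp: h2 square_cells_iff intro: vcomp_id_left)
  next
    case (17 f A B g C \<alpha> f' \<beta> g')
    then show ?case by (auto simp: h2 h1 square_cells_hcomp)
  next
    case (18 f A B g C h D \<alpha> f' \<beta> g' \<gamma> h')
    then obtain a a' b b' c c' where x: "\<alpha> = SqCell f f' a a'" "\<beta> = SqCell g g' b b'" "\<gamma> = SqCell h h' c c'"
      "SqCell f f' a a' \<in> square_cells L S" "SqCell g g' b b' \<in> square_cells L S"
      "SqCell h h' c c' \<in> square_cells L S" by (auto simp: h2)
    have st: "sq_tgt f = sq_src g" "sq_tgt g = sq_src h" using 18 by (auto simp: h1)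
    note t = top[OF cellD(1)[OF x(4)]] top[OF cellD(1)[OF x(5)]] top[OF cellD(1)[OF x(6)]]
    note b = bot[OF cellD(1)[OF x(4)]] bot[OF cellD(1)[OF x(5)]] bot[OF cellD(1)[OF x(6)]]
    show ?case
      using x st t b cellD[OF x(4)] cellD[OF x(5)] cellD[OF x(6)]
        hcomp_assoc[OF t(1) _ _ cellD(5)[OF x(4)] cellD(5)[OF x(5)] cellD(5)[OF x(6)]]
        hcomp_assoc[OF b(1) _ _ cellD(6)[OF x(4)] cellD(6)[OF x(5)] cellD(6)[OF x(6)]]
        sq_comp_assoc[of f S g h] sq_comp_assoc[of f' S g' h'] by simp
  next
    case (19 f A B \<alpha> f')
    then obtain a a' where x: "\<alpha> = SqCell f f' a a'" "SqCell f f' a a' \<in> square_cells L S" by (auto simp: h2)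
    show ?case
      using 19 x cellD[OF x(2)] sq_comp_id(1)[OF cellD(1)[OF x(2)]] sq_comp_id(1)[OF cellD(2)[OF x(2)]]
        hcomp_id_right[OF top[OF cellD(1)[OF x(2)]] cellD(5)[OF x(2)]]
        hcomp_id_right[OF bot[OF cellD(1)[OF x(2)]] cellD(6)[OF x(2)]] by (auto simp: h1)
  next
    case (20 f A B \<alpha> f')
    then obtain a a' where x: "\<alpha> = SqCell f f' a a'" "SqCell f f' a a' \<in> square_cells L S" by (auto simp: h2)
    show ?case
      using 20 x cellD[OF x(2)] sq_comp_id(2)[OF cellD(1)[OF x(2)]] sq_comp_id(2)[OF cellD(2)[OF x(2)]]
        hcomp_id_left[OF top[OF cellD(1)[OF x(2)]] cellD(5)[OF x(2)]]
        hcomp_id_left[OF bot[OF cellD(1)[OF x(2)]] cellD(6)[OF x(2)]] by (auto simp: h1)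
  next
    case (21 f A B g C)
    then show ?case using top[of f] top[of g] bot[of f] bot[of g] by (auto simp: h1 intro: hcomp_id2)
  next
    case (22 f A B g C \<alpha> f' \<alpha>' f'' \<beta> g' \<beta>' g'')
    then obtain a b c d a' b' c' d' where x: "\<alpha> = SqCell f f' a a'" "\<alpha>' = SqCell f' f'' b b'"
      "\<beta> = SqCell g g' c c'" "\<beta>' = SqCell g' g'' d d'" "SqCell f f' a a' \<in> square_cells L S"
      "SqCell f' f'' b b' \<in> square_cells L S" "SqCell g g' c c' \<in> square_cells L S"
      "SqCell g' g'' d d' \<in> square_cells L S" by (auto simp: h2)
    have st: "sq_tgt f = sq_src g" using 22 by (auto simp: h1)
    show ?case
      using x(1-4) st interchange[OF top[OF cellD(1)[OF x(5)]] _ cellD(5)[OF x(5)] cellD(5)[OF x(6)]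
          cellD(5)[OF x(7)] cellD(5)[OF x(8)]] top[OF cellD(1)[OF x(7)]] bot[OF cellD(1)[OF x(7)]]
        interchange[OF bot[OF cellD(1)[OF x(5)]] _ cellD(6)[OF x(5)] cellD(6)[OF x(6)]
          cellD(6)[OF x(7)] cellD(6)[OF x(8)]] by simp
  qed
qed

end
end

theory Submission
  imports Defs
begin

text \<open>Both conditions force every invertible 2-cell between morphisms factoring through the bizero
  object to be unique (\<open>null_rigid\<close>). Under (i) this is the orthogonality of \<open>A \<rightarrow> Z\<close>, which is
  \<open>C(id)\<close>, and \<open>Z \<rightarrow> B\<close>, which is \<open>K(id)\<close>: a filling of an automorphism of the zero morphism consists
  of 2-cells into and out of \<open>Z\<close>, which are unique. Under (ii) the 2-kernel of an identity shows that
  null automorphisms are trivial, and since it reflects null morphisms every invertible 2-cell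
  between null morphisms is null.

  Given rigidity, nullity of the 2-cells in the definition of a 2-kernel of \<open>f\<close> just means
  invertibility of \<open>f \<rhd> \<xi>\<close>, and the ideal is automatically closed. From (ii) to (i), take for
  \<open>\<E>\<close> and \<open>\<M>\<close> the 2-cokernels and the 2-kernels; since these are cofaithful and faithful, a 2-cell of
  the arrow 2-categories is determined by its image in \<open>L\<close>, so any choice of 2-kernels and induced
  morphisms is coherent. From (i) to (ii), a morphism \<open>z : X \<rightarrow> A\<close> with \<open>c z\<close> null, where \<open>c = C(m)\<close>, is the
  same as a square from \<open>C(id\<^sub>X) : X \<rightarrow> Z\<close> to \<open>c\<close>, hence by the biequivalence a square from \<open>id\<^sub>X\<close>
  to \<open>m\<close>, that is a factorization of \<open>z\<close> through \<open>m\<close>.\<close>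

section \<open>Whiskering and invertible 2-cells\<close>

context
  fixes L :: "('o, 'a, 'c) twocat" (structure)
begin

text \<open>Comparison 2-cells between null morphisms are produced by mere existence and afterwards
  identified by rigidity, so no chosen coherence data has to be tracked. The biequivalence must also
  control 2-cells: for \<xi> between m u and m v with c \<xi> invertible, where c is C(m), \<xi>
  becomes a 2-cell of squares after C, its second component being the unique 2-cell out of
  \<open>Z\<close>, and local fullness of C, extracted from the unit, brings it back. A kernel of an
  arbitrary f comes from a factorization of f as e followed by n: since n is a kernel it reflects
  nullity, so e and f have the same kernels. Normality holds because, for a kernel m of f, the
  cokernel of m and the factor e of f factor through each other. Statements on 2-kernels are
  dualized through \<open>op\<close>; the pseudo arrow 2-category, however, has its filling 2-cells
  reversed under \<open>op\<close>, so the arguments with unit and counit are written out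
  separately.\<close>

definition invertible :: "'c \<Rightarrow> bool" where
  "invertible \<alpha> \<longleftrightarrow> (\<exists>\<beta>. inverse2 L \<alpha> \<beta>)"

definition isomorphic :: "'a \<Rightarrow> 'a \<Rightarrow> bool" where
  "isomorphic f g \<longleftrightarrow> iso2 L f g \<noteq> {}"

end

context two_category begin

text \<open>Here and in the following restatements, endpoints are recorded as equations on
  \<open>src\<close>, \<open>tgt\<close>, \<open>dom2\<close> and \<open>cod2\<close>, so that the
  simplifier can discharge typing conditions that the \<open>hom1\<close> and \<open>hom2\<close>
  forms leave to unification.\<close>

lemma Mor_comp1 [simp]:
  assumes "f \<in> Mor L" "g \<in> Mor L" "src L g = tgt L f"
  shows "g \<odot> f \<in> Mor L" "src L (g \<odot> f) = src L f" "tgt L (g \<odot> f) = tgt L g"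
  using comp1_hom[of f "src L f" "tgt L f" g "tgt L g"] assms by (auto simp: hom1_def)

lemma Mor_id1 [simp]:
  assumes "A \<in> Ob L"
  shows "id1 L A \<in> Mor L" "src L (id1 L A) = A" "tgt L (id1 L A) = A"
  using id1_hom[OF assms] by (auto simp: hom1_def)

lemma Cell_id2 [simp]:
  assumes "f \<in> Mor L"
  shows "id2 L f \<in> Cell L" "dom2 L (id2 L f) = f" "cod2 L (id2 L f) = f"
  using id2_hom[OF assms] by (auto simp: hom2_def)

lemma Cell_vcomp [simp]:
  assumes "\<alpha> \<in> Cell L" "\<beta> \<in> Cell L" "dom2 L \<beta> = cod2 L \<alpha>"
  shows "\<beta> \<bullet> \<alpha> \<in> Cell L" "dom2 L (\<beta> \<bullet> \<alpha>) = dom2 L \<alpha>" "cod2 L (\<beta> \<bullet> \<alpha>) = cod2 L \<beta>"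
  using vcomp_hom[of \<alpha> "dom2 L \<alpha>" "cod2 L \<alpha>" \<beta> "cod2 L \<beta>"] assms by (auto simp: hom2_def)

lemma Cell_hcomp [simp]:
  assumes "\<alpha> \<in> Cell L" "\<beta> \<in> Cell L" "src L (dom2 L \<beta>) = tgt L (dom2 L \<alpha>)"
  shows "\<beta> \<star> \<alpha> \<in> Cell L" "dom2 L (\<beta> \<star> \<alpha>) = dom2 L \<beta> \<odot> dom2 L \<alpha>"
    "cod2 L (\<beta> \<star> \<alpha>) = cod2 L \<beta> \<odot> cod2 L \<alpha>"
  using hcomp_hom[of "dom2 L \<alpha>" "src L (dom2 L \<alpha>)" "tgt L (dom2 L \<alpha>)" "dom2 L \<beta>" "tgt L (dom2 L \<beta>)" \<alpha>
      "cod2 L \<alpha>" \<beta> "cod2 L \<beta>"] assms dom2_Mor by (auto simp: hom1_def hom2_def)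

lemmas Cell_Mor [simp] = dom2_Mor cod2_Mor cell_src cell_tgt src_Ob tgt_Ob

lemma comp1_assoc_Mor:
  assumes "f \<in> Mor L" "g \<in> Mor L" "h \<in> Mor L" "src L g = tgt L f" "src L h = tgt L g"
  shows "(h \<odot> g) \<odot> f = h \<odot> g \<odot> f"
  using comp1_assoc[of f "src L f" "tgt L f" g "tgt L g" h "tgt L h"] assms by (auto simp: hom1_def)

lemma comp1_id_Mor:
  assumes "f \<in> Mor L"
  shows "src L f = A \<Longrightarrow> f \<odot> id1 L A = f" "tgt L f = A \<Longrightarrow> id1 L A \<odot> f = f"
  using comp1_id_right[of f] comp1_id_left[of f] assms by (auto simp: hom1_def)

lemma vcomp_assoc_Cell:
  assumes "\<alpha> \<in> Cell L" "\<beta> \<in> Cell L" "\<gamma> \<in> Cell L" "dom2 L \<beta> = cod2 L \<alpha>" "dom2 L \<gamma> = cod2 L \<beta>"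
  shows "(\<gamma> \<bullet> \<beta>) \<bullet> \<alpha> = \<gamma> \<bullet> \<beta> \<bullet> \<alpha>"
  using vcomp_assoc[of \<alpha> "dom2 L \<alpha>" "cod2 L \<alpha>" \<beta> "cod2 L \<beta>" \<gamma> "cod2 L \<gamma>"] assms by (auto simp: hom2_def)

lemma vcomp_id_Cell:
  assumes "\<alpha> \<in> Cell L"
  shows "dom2 L \<alpha> = f \<Longrightarrow> \<alpha> \<bullet> id2 L f = \<alpha>" "cod2 L \<alpha> = f \<Longrightarrow> id2 L f \<bullet> \<alpha> = \<alpha>"
  using vcomp_id_right[of \<alpha>] vcomp_id_left[of \<alpha>] assms by (auto simp: hom2_def)

lemma hcomp_assoc_Cell:
  assumes "\<alpha> \<in> Cell L" "\<beta> \<in> Cell L" "\<gamma> \<in> Cell L"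
    "src L (dom2 L \<beta>) = tgt L (dom2 L \<alpha>)" "src L (dom2 L \<gamma>) = tgt L (dom2 L \<beta>)"
  shows "(\<gamma> \<star> \<beta>) \<star> \<alpha> = \<gamma> \<star> \<beta> \<star> \<alpha>"
  using hcomp_assoc[of "dom2 L \<alpha>" "src L (dom2 L \<alpha>)" "tgt L (dom2 L \<alpha>)" "dom2 L \<beta>" "tgt L (dom2 L \<beta>)"
      "dom2 L \<gamma>" "tgt L (dom2 L \<gamma>)" \<alpha> "cod2 L \<alpha>" \<beta> "cod2 L \<beta>" \<gamma> "cod2 L \<gamma>"] assms dom2_Mor
  by (auto simp: hom1_def hom2_def)

lemma hcomp_id_Cell:
  assumes "\<alpha> \<in> Cell L"
  shows "src L (dom2 L \<alpha>) = A \<Longrightarrow> \<alpha> \<star> id2 L (id1 L A) = \<alpha>"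
    "tgt L (dom2 L \<alpha>) = A \<Longrightarrow> id2 L (id1 L A) \<star> \<alpha> = \<alpha>"
  using hcomp_id_right[of "dom2 L \<alpha>" _ _ \<alpha> "cod2 L \<alpha>"] hcomp_id_left[of "dom2 L \<alpha>" _ _ \<alpha> "cod2 L \<alpha>"] assms
  by (auto simp: hom1_def hom2_def)

lemma hcomp_id2_Mor:
  assumes "f \<in> Mor L" "g \<in> Mor L" "src L g = tgt L f"
  shows "id2 L g \<star> id2 L f = id2 L (g \<odot> f)"
  using hcomp_id2[of f "src L f" "tgt L f" g "tgt L g"] assms by (auto simp: hom1_def)

lemma interchange_Cell:
  assumes "\<alpha> \<in> Cell L" "\<alpha>' \<in> Cell L" "\<beta> \<in> Cell L" "\<beta>' \<in> Cell L" "dom2 L \<alpha>' = cod2 L \<alpha>"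
    "dom2 L \<beta>' = cod2 L \<beta>" "src L (dom2 L \<beta>) = tgt L (dom2 L \<alpha>)"
  shows "(\<beta>' \<bullet> \<beta>) \<star> (\<alpha>' \<bullet> \<alpha>) = (\<beta>' \<star> \<alpha>') \<bullet> (\<beta> \<star> \<alpha>)"
  using interchange[of "dom2 L \<alpha>" "src L (dom2 L \<alpha>)" "tgt L (dom2 L \<alpha>)" "dom2 L \<beta>" "tgt L (dom2 L \<beta>)" \<alpha>
      "cod2 L \<alpha>" \<alpha>' "cod2 L \<alpha>'" \<beta> "cod2 L \<beta>" \<beta>' "cod2 L \<beta>'"] assms dom2_Mor by (auto simp: hom1_def hom2_def)

lemma lwhisker_vcomp:
  assumes "\<alpha> \<in> Cell L" "\<beta> \<in> Cell L" "dom2 L \<beta> = cod2 L \<alpha>" "f \<in> Mor L" "src L f = tgt L (dom2 L \<alpha>)"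
  shows "f \<rhd> (\<beta> \<bullet> \<alpha>) = (f \<rhd> \<beta>) \<bullet> (f \<rhd> \<alpha>)"
  using interchange_Cell[of \<alpha> \<beta> "id2 L f" "id2 L f"] assms by (simp add: vcomp_id_Cell)

lemma rwhisker_vcomp:
  assumes "\<alpha> \<in> Cell L" "\<beta> \<in> Cell L" "dom2 L \<beta> = cod2 L \<alpha>" "f \<in> Mor L" "tgt L f = src L (dom2 L \<alpha>)"
  shows "(\<beta> \<bullet> \<alpha>) \<lhd> f = (\<beta> \<lhd> f) \<bullet> (\<alpha> \<lhd> f)"
  using interchange_Cell[of "id2 L f" "id2 L f" \<alpha> \<beta>] assms by (simp add: vcomp_id_Cell)

lemma lwhisker_lwhisker:
  assumes "\<alpha> \<in> Cell L" "f \<in> Mor L" "g \<in> Mor L" "src L f = tgt L (dom2 L \<alpha>)" "src L g = tgt L f"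
  shows "g \<rhd> f \<rhd> \<alpha> = (g \<odot> f) \<rhd> \<alpha>"
  using hcomp_assoc_Cell[of \<alpha> "id2 L f" "id2 L g"] assms by (simp add: hcomp_id2_Mor)

text \<open>Normal form for pasting equations: composites bracketed to the right, whiskerings
  distributed over vertical composites, successive whiskerings on one side merged into one.
  Interchange is applied by hand, through \<open>whisker_exchange\<close>.\<close>

lemmas cell_nf = comp1_assoc_Mor comp1_id_Mor vcomp_assoc_Cell vcomp_id_Cell hcomp_assoc_Cell hcomp_id_Cell
  hcomp_id2_Mor lwhisker_vcomp rwhisker_vcomp lwhisker_lwhisker

text \<open>Both sides equal \<beta> \<star> \<alpha>, by interchange with identity 2-cells.\<close>

lemma whisker_exchange:
  assumes "\<alpha> \<in> hom2 L f f'" "\<beta> \<in> hom2 L g g'" "f \<in> hom1 L A B" "g \<in> hom1 L B C"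
  shows "(\<beta> \<lhd> f') \<bullet> (g \<rhd> \<alpha>) = (g' \<rhd> \<alpha>) \<bullet> (\<beta> \<lhd> f)"
proof -
  have "f' \<in> hom1 L A B" "g' \<in> hom1 L B C" using assms cell_hom1 by blast+
  then show ?thesis
    using assms interchange_Cell[of \<alpha> "id2 L f'" "id2 L g" \<beta>] interchange_Cell[of "id2 L f" \<alpha> \<beta> "id2 L g'"]
    by (auto simp: hom1_def hom2_def vcomp_id_Cell)
qed

section \<open>Invertible 2-cells and isomorphism of 1-cells\<close>

lemma iso2_iff: "\<alpha> \<in> iso2 L f g \<longleftrightarrow> \<alpha> \<in> hom2 L f g \<and> invertible L \<alpha>"
  by (auto simp: iso2_def invertible_def)

lemma isomorphicI: "\<alpha> \<in> iso2 L f g \<Longrightarrow> isomorphic L f g"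
  by (auto simp: isomorphic_def)

lemma isomorphicE:
  assumes "isomorphic L f g"
  obtains \<alpha> where "\<alpha> \<in> iso2 L f g"
  using assms by (auto simp: isomorphic_def)

lemma iso2E:
  assumes "\<alpha> \<in> iso2 L f g"
  obtains \<beta> where "\<beta> \<in> iso2 L g f" "\<beta> \<bullet> \<alpha> = id2 L f" "\<alpha> \<bullet> \<beta> = id2 L g" "inv2 L \<alpha> = \<beta>"
proof -
  obtain \<beta> where b: "inverse2 L \<alpha> \<beta>" using assms by (auto simp: iso2_def)
  then have "inverse2 L \<beta> \<alpha>" using assms by (auto simp: inverse2_def iso2_def hom2_def)
  with b inv2_eq[OF b] assms show ?thesis by (intro that[of \<beta>]) (auto simp: inverse2_def iso2_def hom2_def)
qed

lemma iso2I:
  assumes "\<alpha> \<in> hom2 L f g" "\<beta> \<in> hom2 L g f" "\<beta> \<bullet> \<alpha> = id2 L f" "\<alpha> \<bullet> \<beta> = id2 L g"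
  shows "\<alpha> \<in> iso2 L f g"
  using assms by (auto simp: iso2_def inverse2_def hom2_def)

lemma inv2_iso2: "\<alpha> \<in> iso2 L f g \<Longrightarrow> inv2 L \<alpha> \<in> iso2 L g f"
  by (erule iso2E) simp

lemma inv2_vcomp:
  assumes "\<alpha> \<in> iso2 L f g"
  shows "inv2 L \<alpha> \<bullet> \<alpha> = id2 L f" "\<alpha> \<bullet> inv2 L \<alpha> = id2 L g"
  using assms by (auto elim: iso2E)

lemma hom2_Mor: "\<alpha> \<in> hom2 L f g \<Longrightarrow> f \<in> Mor L \<and> g \<in> Mor L \<and> src L g = src L f \<and> tgt L g = tgt L f"
  using cell_src cell_tgt by (auto simp: hom2_def)

lemma isomorphic_Mor: "isomorphic L f g \<Longrightarrow> f \<in> Mor L \<and> g \<in> Mor L \<and> src L g = src L f \<and> tgt L g = tgt L f"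
  using hom2_Mor iso2D isomorphicE by metis

lemma isomorphic_refl: "f \<in> Mor L \<Longrightarrow> isomorphic L f f"
  using iso2_id isomorphicI by blast

lemma isomorphic_sym: "isomorphic L f g \<Longrightarrow> isomorphic L g f"
  by (metis isomorphicE isomorphicI inv2_iso2)

lemma isomorphic_trans [trans]: "isomorphic L f g \<Longrightarrow> isomorphic L g h \<Longrightarrow> isomorphic L f h"
  by (metis isomorphicE isomorphicI iso2_vcomp)

lemma isomorphic_comp1:
  assumes "isomorphic L f f'" "isomorphic L g g'" "src L g = tgt L f"
  shows "isomorphic L (g \<odot> f) (g' \<odot> f')"
proof -
  obtain \<alpha> \<beta> where "\<alpha> \<in> iso2 L f f'" "\<beta> \<in> iso2 L g g'" using assms isomorphicE by metis
  moreover have "f \<in> hom1 L (src L f) (tgt L f)" "g \<in> hom1 L (tgt L f) (tgt L g)"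
    using assms isomorphic_Mor by (auto simp: hom1_def)
  ultimately show ?thesis using iso2_hcomp isomorphicI by blast
qed

lemma isomorphic_lwhisker:
  "\<lbrakk>isomorphic L f f'; g \<in> Mor L; src L g = tgt L f\<rbrakk> \<Longrightarrow> isomorphic L (g \<odot> f) (g \<odot> f')"
  by (intro isomorphic_comp1 isomorphic_refl)

lemma isomorphic_rwhisker:
  "\<lbrakk>isomorphic L g g'; f \<in> Mor L; src L g = tgt L f\<rbrakk> \<Longrightarrow> isomorphic L (g \<odot> f) (g' \<odot> f)"
  by (intro isomorphic_comp1 isomorphic_refl)

lemma iso2_lwhisker:
  "\<lbrakk>\<alpha> \<in> iso2 L f f'; f \<in> hom1 L A B; g \<in> hom1 L B C\<rbrakk> \<Longrightarrow> g \<rhd> \<alpha> \<in> iso2 L (g \<odot> f) (g \<odot> f')"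
  using iso2_hcomp iso2_id1 by blast

lemma iso2_rwhisker:
  "\<lbrakk>\<beta> \<in> iso2 L g g'; f \<in> hom1 L A B; g \<in> hom1 L B C\<rbrakk> \<Longrightarrow> \<beta> \<lhd> f \<in> iso2 L (g \<odot> f) (g' \<odot> f)"
  using iso2_hcomp iso2_id1 by blast

lemma hom2_lwhisker:
  "\<lbrakk>\<alpha> \<in> hom2 L f f'; f \<in> hom1 L A B; g \<in> hom1 L B C\<rbrakk> \<Longrightarrow> g \<rhd> \<alpha> \<in> hom2 L (g \<odot> f) (g \<odot> f')"
  using hcomp_hom id2_hom1 by blast

lemma hom2_rwhisker:
  "\<lbrakk>\<beta> \<in> hom2 L g g'; f \<in> hom1 L A B; g \<in> hom1 L B C\<rbrakk> \<Longrightarrow> \<beta> \<lhd> f \<in> hom2 L (g \<odot> f) (g' \<odot> f)"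
  using hcomp_hom id2_hom1 by blast

lemma iso2_cancel_left:
  assumes "\<beta> \<in> iso2 L g h" "\<alpha> \<in> hom2 L f g" "\<alpha>' \<in> hom2 L f g" "\<beta> \<bullet> \<alpha> = \<beta> \<bullet> \<alpha>'"
  shows "\<alpha> = \<alpha>'"
proof -
  obtain \<gamma> where g: "\<gamma> \<in> iso2 L h g" "\<gamma> \<bullet> \<beta> = id2 L g" using assms(1) by (rule iso2E)
  have "(\<gamma> \<bullet> \<beta>) \<bullet> \<alpha> = (\<gamma> \<bullet> \<beta>) \<bullet> \<alpha>'"
    using assms g vcomp_assoc[OF assms(2) iso2D[OF assms(1)] iso2D[OF g(1)]]
      vcomp_assoc[OF assms(3) iso2D[OF assms(1)] iso2D[OF g(1)]] by simp
  then show ?thesis using g assms vcomp_id_left by auto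
qed

lemma iso2_cancel_right:
  assumes "\<beta> \<in> iso2 L f g" "\<alpha> \<in> hom2 L g h" "\<alpha>' \<in> hom2 L g h" "\<alpha> \<bullet> \<beta> = \<alpha>' \<bullet> \<beta>"
  shows "\<alpha> = \<alpha>'"
proof -
  obtain \<gamma> where g: "\<gamma> \<in> iso2 L g f" "\<beta> \<bullet> \<gamma> = id2 L g" using assms(1) by (rule iso2E)
  have "\<alpha> \<bullet> (\<beta> \<bullet> \<gamma>) = \<alpha>' \<bullet> (\<beta> \<bullet> \<gamma>)"
    using assms g vcomp_assoc[OF iso2D[OF g(1)] iso2D[OF assms(1)] assms(2)]
      vcomp_assoc[OF iso2D[OF g(1)] iso2D[OF assms(1)] assms(3)] by simp
  then show ?thesis using g assms vcomp_id_right by auto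
qed

text \<open>Each of \<alpha> and \<beta> is the other one composed with invertible 2-cells. This
  carries invertibility across every change of structure 2-cells below.\<close>

lemma invertible_conj:
  assumes "\<phi> \<in> iso2 L f g" "\<psi> \<in> iso2 L f' g'" "\<alpha> \<in> hom2 L f f'" "\<beta> \<in> hom2 L g g'"
    and eq: "\<psi> \<bullet> \<alpha> = \<beta> \<bullet> \<phi>"
  shows "invertible L \<alpha> \<longleftrightarrow> invertible L \<beta>"
proof -
  obtain \<phi>' where p: "\<phi>' \<in> iso2 L g f" "\<phi>' \<bullet> \<phi> = id2 L f" "\<phi> \<bullet> \<phi>' = id2 L g" using assms(1) by (rule iso2E)
  obtain \<psi>' where q: "\<psi>' \<in> iso2 L g' f'" "\<psi>' \<bullet> \<psi> = id2 L f'" "\<psi> \<bullet> \<psi>' = id2 L g'" using assms(2) by (rule iso2E)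
  have "\<alpha> = (\<psi>' \<bullet> \<psi>) \<bullet> \<alpha>" using assms(3) q vcomp_id_left by simp
  then have a: "\<alpha> = \<psi>' \<bullet> \<beta> \<bullet> \<phi>" using assms vcomp_assoc q(1) iso2D by metis
  have "\<beta> = \<beta> \<bullet> (\<phi> \<bullet> \<phi>')" using assms(4) p vcomp_id_right by simp
  then have b: "\<beta> = (\<psi> \<bullet> \<alpha>) \<bullet> \<phi>'" using assms(1,4) p(1) eq vcomp_assoc iso2D by metis
  show ?thesis
  proof
    assume "invertible L \<alpha>"
    then have "\<alpha> \<in> iso2 L f f'" using assms by (simp add: iso2_iff)
    then show "invertible L \<beta>" using b iso2_vcomp[OF p(1) iso2_vcomp[OF _ assms(2)]] by (simp add: iso2_iff)
  next
    assume "invertible L \<beta>"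
    then have "\<beta> \<in> iso2 L g g'" using assms by (simp add: iso2_iff)
    then show "invertible L \<alpha>" using a iso2_vcomp[OF iso2_vcomp[OF assms(1)] q(1)] by (simp add: iso2_iff)
  qed
qed

text \<open>The conjugating square is the naturality of an isomorphism \<theta> from f to
  \<open>f'\<close>, taken at \<xi>.\<close>

lemma lwhisker_invertible_cong:
  assumes "isomorphic L f f'" "\<xi> \<in> hom2 L u v" "u \<in> hom1 L X (src L f)"
  shows "invertible L (f \<rhd> \<xi>) \<longleftrightarrow> invertible L (f' \<rhd> \<xi>)"
proof -
  obtain \<theta> where t: "\<theta> \<in> iso2 L f f'" using assms(1) by (rule isomorphicE)
  have f: "f \<in> hom1 L (src L f) (tgt L f)" "f' \<in> hom1 L (src L f) (tgt L f)"
    using isomorphic_Mor[OF assms(1)] by (auto simp: hom1_def)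
  have v: "v \<in> hom1 L X (src L f)" using cell_hom1 assms by blast
  show ?thesis
    by (rule invertible_conj[OF iso2_rwhisker[OF t assms(3) f(1)] iso2_rwhisker[OF t v f(1)]
          hom2_lwhisker[OF assms(2,3) f(1)] hom2_lwhisker[OF assms(2,3) f(2)]])
      (rule whisker_exchange[OF assms(2) iso2D[OF t] assms(3) f(1)])
qed

lemma invertible_lwhisker:
  "\<lbrakk>\<xi> \<in> hom2 L u v; u \<in> hom1 L A B; f \<in> hom1 L B C; invertible L \<xi>\<rbrakk> \<Longrightarrow> invertible L (f \<rhd> \<xi>)"
  by (meson iso2_iff iso2_lwhisker)

end

section \<open>Bizero objects and null 2-cells\<close>

lemma op_simps [simp]:
  "Ob (op L) = Ob L" "Mor (op L) = Mor L" "Cell (op L) = Cell L"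
  "src (op L) = tgt L" "tgt (op L) = src L" "dom2 (op L) = dom2 L" "cod2 (op L) = cod2 L"
  "id1 (op L) = id1 L" "id2 (op L) = id2 L" "comp1 (op L) g f = comp1 L f g"
  "vcomp (op L) = vcomp L" "hcomp (op L) \<beta> \<alpha> = hcomp L \<alpha> \<beta>"
  by (simp_all add: op_def)

lemma inverse2_op [simp]: "inverse2 (op L) = inverse2 L"
  by (simp add: fun_eq_iff inverse2_def)

lemma inv2_op [simp]: "inv2 (op L) = inv2 L"
  by (simp add: fun_eq_iff inv2_def)

lemma iso2_op [simp]: "iso2 (op L) = iso2 L"
  by (simp add: fun_eq_iff iso2_def)

lemma isomorphic_op [simp]: "isomorphic (op L) = isomorphic L"
  by (simp add: fun_eq_iff isomorphic_def)

lemma invertible_op [simp]: "invertible (op L) = invertible L"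
  by (simp add: fun_eq_iff invertible_def)

lemma hom_cat_op: "hom_cat (op L) A B = hom_cat L B A"
  by (simp add: hom_cat_def)

lemma op_op [simp]: "op (op L) = L"
  by (simp add: op_def)

lemma op_ideal_op_ideal [simp]: "op_ideal (op_ideal N) = N"
  by (simp add: op_ideal_def)

lemma bizero_op: "bizero L Z \<Longrightarrow> bizero (op L) Z"
  by (auto simp: bizero_def hom_cat_op)

text \<open>Up to invertible 2-cells, the null 2-cell conditions in the definition of a 2-kernel become
  invertibility of \<open>f \<rhd> \<xi>\<close>; this is faithful to the original notion as soon as the ideal is
  \<open>null_rigid\<close> (lemma \<open>kernel2_iff\<close>).\<close>

context
  fixes L :: "('o, 'a, 'c) twocat" (structure) and Z :: 'o
begin

definition nullish :: "'a \<Rightarrow> bool" where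
  "nullish f \<longleftrightarrow> (\<exists>A B t i. t \<in> hom1 L A Z \<and> i \<in> hom1 L Z B \<and> isomorphic L f (i \<odot> t))"

definition null_rigid :: bool where
  "null_rigid \<longleftrightarrow> (\<forall>A B t i \<phi>. t \<in> hom1 L A Z \<and> i \<in> hom1 L Z B \<and> \<phi> \<in> iso2 L (i \<odot> t) (i \<odot> t) \<longrightarrow>
     \<phi> = id2 L (i \<odot> t))"

definition zkernel :: "'a \<Rightarrow> 'a \<Rightarrow> bool" where
  "zkernel f k \<longleftrightarrow> f \<in> Mor L \<and> k \<in> Mor L \<and> tgt L k = src L f \<and> nullish (f \<odot> k) \<and>
     (\<forall>X z. z \<in> hom1 L X (src L f) \<and> nullish (f \<odot> z) \<longrightarrow>
        (\<exists>u \<in> hom1 L X (src L k). isomorphic L z (k \<odot> u))) \<and>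
     (\<forall>X u v \<xi>. u \<in> hom1 L X (src L k) \<and> v \<in> hom1 L X (src L k) \<and> \<xi> \<in> hom2 L (k \<odot> u) (k \<odot> v) \<and>
        invertible L (f \<rhd> \<xi>) \<longrightarrow> (\<exists>!\<mu>. \<mu> \<in> hom2 L u v \<and> k \<rhd> \<mu> = \<xi>))"

end

lemma nullish_op [simp]: "nullish (op L) Z = nullish L Z"
  by (auto simp: fun_eq_iff nullish_def)

lemma null_rigid_op [simp]: "null_rigid (op L) Z = null_rigid L Z"
  by (auto simp: null_rigid_def)

lemma null1_zero_ideal:
  "null1 (zero_ideal L Z) = {comp1 L i t | A B t i. t \<in> hom1 L A Z \<and> i \<in> hom1 L Z B}"
  by (simp add: zero_ideal_def)

text \<open>A pasting keeps its two factors in the dual, where the 1-cells into and out of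
  \<open>Z\<close> exchange roles; using the inclusion for \<open>op L\<close> as well gives
  equality.\<close>

lemma zero_null2_op_subset: "\<theta> \<in> zero_null2 L Z \<Longrightarrow> \<theta> \<in> zero_null2 (op L) Z"
proof (induction rule: zero_null2.induct)
  case (paste t A t' i B i' \<tau> \<iota>)
  then have "hcomp (op L) \<tau> \<iota> \<in> zero_null2 (op L) Z" by (intro zero_null2.paste) auto
  then show ?case by simp
next
  case (vcomp \<alpha> \<beta>)
  then have "vcomp (op L) \<beta> \<alpha> \<in> zero_null2 (op L) Z" by (intro zero_null2.vcomp) auto
  then show ?case by simp
qed

lemma zero_null2_op [simp]: "zero_null2 (op L) Z = zero_null2 L Z"
  using zero_null2_op_subset[of _ L Z] zero_null2_op_subset[of _ "op L" Z] by auto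

lemma null1_zero_ideal_op: "null1 (zero_ideal (op L) Z) = null1 (zero_ideal L Z)"
  by (auto simp: null1_zero_ideal)

section \<open>Morphisms into and out of the bizero object\<close>

locale pointed = two_category +
  fixes Z
  assumes bizero: "bizero L Z"
begin

lemma pointed_op: "pointed (op L) Z"
  using two_category_op[OF two_category_axioms] bizero_op[OF bizero]
  by (simp add: pointed_def pointed_axioms_def)

lemma zero_Ob: "Z \<in> Ob L"
  using bizero by (simp add: bizero_def)

lemma to_zero_hom: "A \<in> Ob L \<Longrightarrow> \<exists>t. t \<in> hom1 L A Z"
  using bizero terminal_hom(1) by (fastforce simp: bizero_def)

lemma from_zero_hom: "A \<in> Ob L \<Longrightarrow> \<exists>i. i \<in> hom1 L Z A"
  using bizero terminal_hom(1) by (fastforce simp: bizero_def)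

lemma hom1_Ob: "f \<in> hom1 L A B \<Longrightarrow> A \<in> Ob L \<and> B \<in> Ob L"
  by (auto simp: hom1_def)

lemma to_zero_ex1: "\<lbrakk>t \<in> hom1 L A Z; t' \<in> hom1 L A Z\<rbrakk> \<Longrightarrow> \<exists>!\<alpha>. \<alpha> \<in> hom2 L t t'"
  using bizero terminal_hom(2)[of A Z t t'] hom1_Ob by (auto simp: bizero_def)

lemma from_zero_ex1: "\<lbrakk>t \<in> hom1 L Z A; t' \<in> hom1 L Z A\<rbrakk> \<Longrightarrow> \<exists>!\<alpha>. \<alpha> \<in> hom2 L t t'"
  using bizero terminal_hom(2)[of Z A t t'] hom1_Ob by (auto simp: bizero_def)

lemma to_zero_eq: "\<lbrakk>\<alpha> \<in> hom2 L t t'; \<beta> \<in> hom2 L t t'; t \<in> hom1 L A Z\<rbrakk> \<Longrightarrow> \<alpha> = \<beta>"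
  using to_zero_ex1 cell_hom1 by metis

lemma from_zero_eq: "\<lbrakk>\<alpha> \<in> hom2 L t t'; \<beta> \<in> hom2 L t t'; t \<in> hom1 L Z A\<rbrakk> \<Longrightarrow> \<alpha> = \<beta>"
  using from_zero_ex1 cell_hom1 by metis

text \<open>A 2-cell back exists, and both composites are identities because a 1-cell into
  \<open>Z\<close> has only one endo-2-cell.\<close>

lemma to_zero_iso:
  assumes "t \<in> hom1 L A Z" "t' \<in> hom1 L A Z" "\<tau> \<in> hom2 L t t'"
  shows "\<tau> \<in> iso2 L t t'"
proof -
  obtain \<beta> where b: "\<beta> \<in> hom2 L t' t" using to_zero_ex1 assms by metis
  show ?thesis
    using to_zero_eq[OF vcomp_hom[OF assms(3) b] id2_hom1] to_zero_eq[OF vcomp_hom[OF b assms(3)] id2_hom1]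
      assms by (intro iso2I[OF assms(3) b]) auto
qed

lemma from_zero_iso:
  assumes "t \<in> hom1 L Z A" "t' \<in> hom1 L Z A" "\<tau> \<in> hom2 L t t'"
  shows "\<tau> \<in> iso2 L t t'"
proof -
  obtain \<beta> where b: "\<beta> \<in> hom2 L t' t" using from_zero_ex1 assms by metis
  show ?thesis
    using from_zero_eq[OF vcomp_hom[OF assms(3) b] id2_hom1] from_zero_eq[OF vcomp_hom[OF b assms(3)] id2_hom1]
      assms by (intro iso2I[OF assms(3) b]) auto
qed

lemma to_zero_isomorphic: "\<lbrakk>t \<in> hom1 L A Z; t' \<in> hom1 L A Z\<rbrakk> \<Longrightarrow> isomorphic L t t'"
  using to_zero_ex1 to_zero_iso isomorphicI by metis

lemma from_zero_isomorphic: "\<lbrakk>t \<in> hom1 L Z A; t' \<in> hom1 L Z A\<rbrakk> \<Longrightarrow> isomorphic L t t'"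
  using from_zero_ex1 from_zero_iso isomorphicI by metis

lemma null_isomorphic:
  assumes "t \<in> hom1 L A Z" "i \<in> hom1 L Z B" "t' \<in> hom1 L A Z" "i' \<in> hom1 L Z B"
  shows "isomorphic L (i \<odot> t) (i' \<odot> t')"
  using assms to_zero_isomorphic[OF assms(1,3)] from_zero_isomorphic[OF assms(2,4)]
  by (intro isomorphic_comp1) (auto simp: hom1_def)

lemma nullishE:
  assumes "nullish L Z f"
  obtains t i where "t \<in> hom1 L (src L f) Z" "i \<in> hom1 L Z (tgt L f)" "isomorphic L f (i \<odot> t)"
proof -
  obtain A B t i where "t \<in> hom1 L A Z" "i \<in> hom1 L Z B" "isomorphic L f (i \<odot> t)"
    using assms by (auto simp: nullish_def)
  moreover from this have "A = src L f" "B = tgt L f"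
    using isomorphic_Mor[of f "i \<odot> t"] comp1_hom[of t A Z i B] by (simp_all add: hom1_def)
  ultimately show ?thesis using that by blast
qed

lemma nullishI: "\<lbrakk>t \<in> hom1 L A Z; i \<in> hom1 L Z B; isomorphic L f (i \<odot> t)\<rbrakk> \<Longrightarrow> nullish L Z f"
  by (auto simp: nullish_def)

lemma nullish_Mor: "nullish L Z f \<Longrightarrow> f \<in> Mor L"
  using isomorphic_Mor by (auto simp: nullish_def)

lemma nullish_cong: "isomorphic L f g \<Longrightarrow> nullish L Z f \<longleftrightarrow> nullish L Z g"
  using isomorphic_trans isomorphic_sym unfolding nullish_def by metis

lemma nullish_any:
  assumes "nullish L Z f" "t \<in> hom1 L (src L f) Z" "i \<in> hom1 L Z (tgt L f)"
  shows "isomorphic L f (i \<odot> t)"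
proof -
  obtain t' i' where "t' \<in> hom1 L (src L f) Z" "i' \<in> hom1 L Z (tgt L f)" "isomorphic L f (i' \<odot> t')"
    using assms(1) by (rule nullishE)
  then show ?thesis using null_isomorphic[OF _ _ assms(2,3)] isomorphic_trans by blast
qed

lemma nullish_isomorphic:
  assumes "nullish L Z f" "nullish L Z g" "src L f = src L g" "tgt L f = tgt L g"
  shows "isomorphic L f g"
proof -
  obtain t i where "t \<in> hom1 L (src L f) Z" "i \<in> hom1 L Z (tgt L f)" "isomorphic L f (i \<odot> t)"
    using assms(1) by (rule nullishE)
  then show ?thesis using nullish_any[OF assms(2)] assms isomorphic_trans isomorphic_sym by metis
qed

lemma nullish_lwhisker:
  assumes "nullish L Z f" "g \<in> Mor L" "src L g = tgt L f"
  shows "nullish L Z (g \<odot> f)"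
proof -
  obtain t i where ti: "t \<in> hom1 L (src L f) Z" "i \<in> hom1 L Z (tgt L f)" "isomorphic L f (i \<odot> t)"
    using assms(1) by (rule nullishE)
  have "isomorphic L (g \<odot> f) ((g \<odot> i) \<odot> t)"
    using isomorphic_lwhisker[OF ti(3) assms(2,3)] ti assms comp1_assoc_Mor[of t i g] by (auto simp: hom1_def)
  moreover have "g \<odot> i \<in> hom1 L Z (tgt L g)" using ti assms by (auto simp: hom1_def)
  ultimately show ?thesis using ti nullishI by blast
qed

lemma nullish_factor: "\<lbrakk>t \<in> hom1 L A Z; i \<in> hom1 L Z B\<rbrakk> \<Longrightarrow> nullish L Z (i \<odot> t)"
  by (rule nullishI[OF _ _ isomorphic_refl]) (auto simp: hom1_def)

lemma null1_iff: "n \<in> null1 (zero_ideal L Z) \<longleftrightarrow>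
    n \<in> Mor L \<and> (\<exists>t i. t \<in> hom1 L (src L n) Z \<and> i \<in> hom1 L Z (tgt L n) \<and> n = i \<odot> t)"
proof
  assume "n \<in> null1 (zero_ideal L Z)"
  then obtain A B t i where ti: "t \<in> hom1 L A Z" "i \<in> hom1 L Z B" "n = i \<odot> t"
    by (auto simp: null1_zero_ideal)
  have n: "n \<in> hom1 L A B" using comp1_hom[OF ti(1,2)] ti(3) by simp
  then have "A = src L n" "B = tgt L n" "n \<in> Mor L" by (auto simp: hom1_def)
  then show "n \<in> Mor L \<and> (\<exists>t i. t \<in> hom1 L (src L n) Z \<and> i \<in> hom1 L Z (tgt L n) \<and> n = i \<odot> t)"
    using ti by blast
qed (auto simp: null1_zero_ideal)

lemma nullish_null1: "n \<in> null1 (zero_ideal L Z) \<Longrightarrow> nullish L Z n"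
  using null1_iff nullish_factor by metis

lemma nullishE_null1:
  assumes "nullish L Z f"
  obtains n where "n \<in> null1 (zero_ideal L Z)" "isomorphic L f n"
  using assms unfolding nullish_def null1_zero_ideal by blast

text \<open>The generators are horizontal composites of 2-cells into and out of \<open>Z\<close>,
  which are invertible with inverses of the same kind, and both properties pass to vertical
  composites. Hence nullity of a 2-cell already contains the nullity of the inverse that
  \<open>null_iso\<close> asks for.\<close>

lemma zero_null2_iso:
  assumes "\<theta> \<in> zero_null2 L Z"
  shows "\<theta> \<in> iso2 L (dom2 L \<theta>) (cod2 L \<theta>) \<and> inv2 L \<theta> \<in> zero_null2 L Z"
  using assms
proof induction
  case (paste t A t' i B i' \<tau> \<iota>)
  then have I: "\<tau> \<in> iso2 L t t'" "\<iota> \<in> iso2 L i i'" using to_zero_iso from_zero_iso by auto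
  obtain \<tau>' \<iota>' where inv: "inverse2 L \<tau> \<tau>'" "inverse2 L \<iota> \<iota>'" using I by (auto simp: iso2_def)
  have "\<iota> \<star> \<tau> \<in> iso2 L (i \<odot> t) (i' \<odot> t')" using iso2_hcomp[OF paste(1,3) I] .
  moreover have "inv2 L (\<iota> \<star> \<tau>) = \<iota>' \<star> \<tau>'" using inv2_eq[OF inverse2_hcomp[OF paste(1,3,5,6) inv]] .
  moreover have "\<iota>' \<star> \<tau>' \<in> zero_null2 L Z"
    using inv paste by (intro zero_null2.paste[of t' L A Z t i' B i]) (auto simp: inverse2_def hom2_def)
  ultimately show ?case by (auto simp: iso2_def hom2_def)
next
  case (vcomp \<alpha> \<beta>)
  then have I: "\<alpha> \<in> iso2 L (dom2 L \<alpha>) (cod2 L \<alpha>)" "\<beta> \<in> iso2 L (cod2 L \<alpha>) (cod2 L \<beta>)" by auto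
  obtain \<alpha>' \<beta>' where inv: "inverse2 L \<alpha> \<alpha>'" "inverse2 L \<beta> \<beta>'" using I by (auto simp: iso2_def)
  have "inv2 L (\<beta> \<bullet> \<alpha>) = \<alpha>' \<bullet> \<beta>'" using inv2_eq[OF inverse2_vcomp[OF iso2D[OF I(1)] iso2D[OF I(2)] inv]] .
  moreover have "\<alpha>' \<bullet> \<beta>' \<in> zero_null2 L Z"
    using inv vcomp inv2_eq by (intro zero_null2.vcomp) (auto simp: inverse2_def hom2_def)
  ultimately show ?case using iso2_vcomp[OF I] by (auto simp: iso2_def hom2_def)
qed

text \<open>The witness pastes the unique 2-cell between the factors into \<open>Z\<close> with the
  unique one between the factors out of \<open>Z\<close>.\<close>

lemma zero_null2_ex:
  assumes "p \<in> null1 (zero_ideal L Z)" "q \<in> null1 (zero_ideal L Z)" "src L p = src L q" "tgt L p = tgt L q"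
  obtains \<theta> where "\<theta> \<in> iso2 L p q" "\<theta> \<in> zero_null2 L Z"
proof -
  obtain t i where ti: "t \<in> hom1 L (src L p) Z" "i \<in> hom1 L Z (tgt L p)" "p = i \<odot> t"
    using assms unfolding null1_iff by metis
  obtain t' i' where ti': "t' \<in> hom1 L (src L p) Z" "i' \<in> hom1 L Z (tgt L p)" "q = i' \<odot> t'"
    using assms unfolding null1_iff by metis
  obtain \<tau> \<iota> where "\<tau> \<in> hom2 L t t'" "\<iota> \<in> hom2 L i i'" using to_zero_ex1 from_zero_ex1 ti ti' by metis
  then show ?thesis
    using that iso2_hcomp[OF ti(1,2)] to_zero_iso[OF ti(1) ti'(1)] from_zero_iso[OF ti(2) ti'(2)]
      zero_null2.paste[OF ti(1) ti'(1) ti(2) ti'(2)] ti(3) ti'(3) by blast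
qed

end

section \<open>Consequences of rigidity\<close>

locale rigid_pointed = pointed +
  assumes rigid: "null_rigid L Z"
begin

lemma rigid_pointed_op: "rigid_pointed (op L) Z"
  using pointed_op rigid by (simp add: rigid_pointed_def rigid_pointed_axioms_def)

text \<open>\<open>null_rigid\<close> speaks only of automorphisms of composites through
  \<open>Z\<close>. Composing \<phi> with the inverse of \<psi> gives an automorphism of f, and an
  isomorphism from f to such a composite carries it there.\<close>

lemma nullish_iso_unique:
  assumes "nullish L Z f" "\<phi> \<in> iso2 L f g" "\<psi> \<in> iso2 L f g"
  shows "\<phi> = \<psi>"
proof -
  obtain t i where ti: "t \<in> hom1 L (src L f) Z" "i \<in> hom1 L Z (tgt L f)" "isomorphic L f (i \<odot> t)"
    using assms(1) by (rule nullishE)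
  obtain \<theta> where th: "\<theta> \<in> iso2 L f (i \<odot> t)" using ti(3) by (rule isomorphicE)
  obtain \<theta>' where th': "\<theta>' \<in> iso2 L (i \<odot> t) f" "\<theta>' \<bullet> \<theta> = id2 L f" using th by (rule iso2E)
  obtain \<psi>' where ps: "\<psi>' \<in> iso2 L g f" "\<psi>' \<bullet> \<psi> = id2 L f" using assms(3) by (rule iso2E)
  have *: "\<theta> \<bullet> (\<psi>' \<bullet> \<chi>) \<bullet> \<theta>' = id2 L (i \<odot> t)" if "\<chi> \<in> iso2 L f g" for \<chi>
    using that rigid ti(1,2) iso2_vcomp[OF iso2_vcomp[OF th'(1) iso2_vcomp[OF that ps(1)]] th]
    unfolding null_rigid_def by blast
  have h: "\<psi>' \<bullet> \<chi> \<in> hom2 L f f" if "\<chi> \<in> iso2 L f g" for \<chi>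
    using iso2D[OF iso2_vcomp[OF that ps(1)]] .
  have c: "\<psi>' \<bullet> \<psi> \<in> iso2 L f f" "\<psi>' \<bullet> \<phi> \<in> iso2 L f f" using iso2_vcomp ps(1) assms by blast+
  have "(\<psi>' \<bullet> \<phi>) \<bullet> \<theta>' = (\<psi>' \<bullet> \<psi>) \<bullet> \<theta>'"
    by (rule iso2_cancel_left[OF th vcomp_hom[OF iso2D[OF th'(1)] iso2D[OF c(2)]]
          vcomp_hom[OF iso2D[OF th'(1)] iso2D[OF c(1)]]])
      (simp only: *[OF assms(2)] *[OF assms(3)])
  then have "\<psi>' \<bullet> \<phi> = \<psi>' \<bullet> \<psi>" using iso2_cancel_right[OF th'(1) h[OF assms(2)] h[OF assms(3)]] by blast
  then show ?thesis using iso2_cancel_left[OF ps(1)] assms iso2D by blast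
qed

text \<open>Some null invertible 2-cell from p to q exists, and rigidity forces \<phi> to equal
  it.\<close>

lemma iso2_null:
  assumes "p \<in> null1 (zero_ideal L Z)" "q \<in> null1 (zero_ideal L Z)" "\<phi> \<in> iso2 L p q"
  shows "\<phi> \<in> zero_null2 L Z"
proof -
  have "src L p = src L q" "tgt L p = tgt L q" using isomorphic_Mor[OF isomorphicI[OF assms(3)]] by auto
  then obtain \<theta> where "\<theta> \<in> iso2 L p q" "\<theta> \<in> zero_null2 L Z" using zero_null2_ex[OF assms(1,2)] by blast
  then show ?thesis using nullish_iso_unique[OF nullish_null1[OF assms(1)] assms(3)] by blast
qed

lemma null_iso_iff:
  assumes "null2 N = zero_null2 L Z" "p \<in> null1 (zero_ideal L Z)" "q \<in> null1 (zero_ideal L Z)"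
  shows "null_iso L N p q = iso2 L p q"
  using iso2_null[OF assms(2,3)] iso2_null[OF assms(3,2) inv2_iso2] assms(1) by (auto simp: null_iso_def)

end

section \<open>2-kernels up to invertible 2-cells\<close>

text \<open>The dual of the zero ideal brackets \<open>til\<close> the other way round, so it coincides with the zero ideal
  of the dual only on composable morphisms.\<close>

definition zero_like :: "('o, 'a, 'c) twocat \<Rightarrow> 'o \<Rightarrow> ('a, 'c) ideal \<Rightarrow> bool" where
  "zero_like L Z N \<longleftrightarrow> null1 N = null1 (zero_ideal L Z) \<and> null2 N = zero_null2 L Z \<and>
     (\<forall>A B C D a n b. a \<in> hom1 L A B \<and> n \<in> hom1 L B C \<and> b \<in> hom1 L C D \<longrightarrow>
        til N b n a = comp1 L b (comp1 L n a) \<and> nu N b n a = id2 L (comp1 L b (comp1 L n a)))"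

lemma zero_like_zero_ideal: "zero_like L Z (zero_ideal L Z)"
  by (simp add: zero_like_def zero_ideal_def)

text \<open>Condition (ii) freed of structure 2-cells and chosen null morphisms; rigidity supplies
  closedness in \<open>zkernel_reflects_null\<close>.\<close>

definition zero_exact :: "('o, 'a, 'c) twocat \<Rightarrow> 'o \<Rightarrow> bool" where
  "zero_exact L Z \<longleftrightarrow>
     (\<forall>f \<in> Mor L. \<exists>k. zkernel L Z f k) \<and> (\<forall>f \<in> Mor L. \<exists>c. zkernel (op L) Z f c) \<and>
     (\<forall>f m c. zkernel L Z f m \<and> zkernel (op L) Z m c \<longrightarrow> zkernel L Z c m) \<and>
     (\<forall>f c m. zkernel (op L) Z f c \<and> zkernel L Z c m \<longrightarrow> zkernel (op L) Z m c) \<and>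
     (\<forall>f \<in> Mor L. \<exists>c m. (\<exists>x. zkernel (op L) Z x c) \<and> (\<exists>y. zkernel L Z y m) \<and> tgt L c = src L m \<and>
        isomorphic L f (comp1 L m c))"

context pointed begin

lemma nullish_rwhisker:
  "\<lbrakk>nullish L Z f; g \<in> Mor L; src L f = tgt L g\<rbrakk> \<Longrightarrow> nullish L Z (f \<odot> g)"
  using pointed.nullish_lwhisker[OF pointed_op, of f g] by simp

lemma zero_like_op: "zero_like (op L) Z (op_ideal (zero_ideal L Z))"
  by (auto simp: zero_like_def op_ideal_def null1_zero_ideal_op zero_ideal_def comp1_assoc)

lemma zkernelD:
  assumes "zkernel L Z f k"
  shows "f \<in> Mor L" "k \<in> Mor L" "tgt L k = src L f" "nullish L Z (f \<odot> k)"
    "\<lbrakk>z \<in> hom1 L X (src L f); nullish L Z (f \<odot> z)\<rbrakk> \<Longrightarrow> \<exists>u \<in> hom1 L X (src L k). isomorphic L z (k \<odot> u)"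
    "\<lbrakk>u \<in> hom1 L X (src L k); v \<in> hom1 L X (src L k); \<xi> \<in> hom2 L (k \<odot> u) (k \<odot> v); invertible L (f \<rhd> \<xi>)\<rbrakk>
      \<Longrightarrow> \<exists>!\<mu>. \<mu> \<in> hom2 L u v \<and> k \<rhd> \<mu> = \<xi>"
  using assms unfolding zkernel_def by simp_all

text \<open>Up to isomorphism g passes through \<open>Z\<close>, and already the part of g into
  \<open>Z\<close> makes \<alpha> invertible, since all 2-cells between morphisms into
  \<open>Z\<close> are.\<close>

lemma nullish_lwhisker_invertible:
  assumes "nullish L Z g" "\<alpha> \<in> hom2 L u v" "u \<in> hom1 L X (src L g)"
  shows "invertible L (g \<rhd> \<alpha>)"
proof -
  obtain t i where ti: "t \<in> hom1 L (src L g) Z" "i \<in> hom1 L Z (tgt L g)" "isomorphic L g (i \<odot> t)"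
    using assms(1) by (rule nullishE)
  have v: "v \<in> hom1 L X (src L g)" using cell_hom1 assms by blast
  have "t \<rhd> \<alpha> \<in> iso2 L (t \<odot> u) (t \<odot> v)"
    using to_zero_iso[OF comp1_hom[OF assms(3) ti(1)] comp1_hom[OF v ti(1)]] hom2_lwhisker assms ti by blast
  then have "i \<rhd> (t \<rhd> \<alpha>) \<in> iso2 L (i \<odot> t \<odot> u) (i \<odot> t \<odot> v)"
    using iso2_lwhisker comp1_hom[OF assms(3) ti(1)] ti(2) by blast
  moreover have "i \<rhd> (t \<rhd> \<alpha>) = (i \<odot> t) \<rhd> \<alpha>"
    using assms ti lwhisker_lwhisker[of \<alpha> t i] by (simp add: hom1_def hom2_def)
  ultimately have "invertible L ((i \<odot> t) \<rhd> \<alpha>)" by (simp add: iso2_iff)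
  then show ?thesis using lwhisker_invertible_cong[OF ti(3) assms(2,3)] by blast
qed

text \<open>Whiskering \<open>k \<rhd> \<alpha>\<close> by f is whiskering \<alpha> by the nullish f
  k, which is invertible; so the unique lifting clause applies to \<xi> =
  \<open>k \<rhd> \<alpha>\<close>.\<close>

lemma zkernel_faithful:
  assumes "zkernel L Z f k"
  shows "faithful1 L k"
  unfolding faithful1_def
proof (intro conjI allI ballI impI)
  show "k \<in> Mor L" using zkernelD[OF assms] by blast
  fix D u v \<alpha> \<beta>
  assume u: "u \<in> hom1 L D (src L k)" "v \<in> hom1 L D (src L k)" and a: "\<alpha> \<in> hom2 L u v" "\<beta> \<in> hom2 L u v"
    and eq: "k \<rhd> \<alpha> = k \<rhd> \<beta>"
  note z = zkernelD[OF assms]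
  have "f \<rhd> (k \<rhd> \<alpha>) = (f \<odot> k) \<rhd> \<alpha>"
    using z(1-3) u a lwhisker_lwhisker[of \<alpha> k f] by (simp add: hom1_def hom2_def)
  then have "invertible L (f \<rhd> (k \<rhd> \<alpha>))"
    using nullish_lwhisker_invertible[OF z(4) a(1), of D] u z(1-3) by simp
  moreover have "k \<rhd> \<alpha> \<in> hom2 L (k \<odot> u) (k \<odot> v)" using hom2_lwhisker[OF a(1) u(1) Mor_hom1[OF z(2)]] .
  ultimately show "\<alpha> = \<beta>" using z(6)[OF u] a eq by metis
qed

text \<open>A kernel of f depends only on which morphisms f makes null and which 2-cells between
  these it makes invertible. For 2-cells the implication from \<open>f'\<close> to f is the relevant
  one, since invertibility of \<open>f' \<rhd> \<xi>\<close> is the premise of the lifting clause to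
  be proved.\<close>

lemma zkernel_transfer:
  assumes "zkernel L Z f k" "f' \<in> Mor L" "src L f' = src L f"
    and "\<And>X z. z \<in> hom1 L X (src L f) \<Longrightarrow> nullish L Z (f \<odot> z) \<longleftrightarrow> nullish L Z (f' \<odot> z)"
    and "\<And>X u v \<xi>. \<lbrakk>u \<in> hom1 L X (src L f); v \<in> hom1 L X (src L f); \<xi> \<in> hom2 L u v; nullish L Z (f \<odot> u);
      nullish L Z (f \<odot> v); invertible L (f' \<rhd> \<xi>)\<rbrakk> \<Longrightarrow> invertible L (f \<rhd> \<xi>)"
  shows "zkernel L Z f' k"
proof -
  note z = zkernelD[OF assms(1)]
  show ?thesis unfolding zkernel_def
  proof (intro conjI allI impI)
    show "f' \<in> Mor L" "k \<in> Mor L" "tgt L k = src L f'" using assms z(1-3) by auto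
    show "nullish L Z (f' \<odot> k)" using z(2-4) assms(4)[of k "src L k"] by (simp add: hom1_def)
  next
    fix X x assume "x \<in> hom1 L X (src L f') \<and> nullish L Z (f' \<odot> x)"
    then show "\<exists>u\<in>hom1 L X (src L k). isomorphic L x (k \<odot> u)" using z(5) assms(3,4) by metis
  next
    fix X u v \<xi>
    assume *: "u \<in> hom1 L X (src L k) \<and> v \<in> hom1 L X (src L k) \<and> \<xi> \<in> hom2 L (k \<odot> u) (k \<odot> v) \<and> invertible L (f' \<rhd> \<xi>)"
    have k: "k \<odot> w \<in> hom1 L X (src L f) \<and> nullish L Z (f \<odot> k \<odot> w)" if "w \<in> hom1 L X (src L k)" for w
      using that z(1-3) nullish_rwhisker[OF z(4), of w] by (auto simp: hom1_def comp1_assoc_Mor)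
    then have "invertible L (f \<rhd> \<xi>)" using assms(5)[of "k \<odot> u" X "k \<odot> v" \<xi>] k[of u] k[of v] * by blast
    then show "\<exists>!\<mu>. \<mu> \<in> hom2 L u v \<and> k \<rhd> \<mu> = \<xi>" using z(6)[of u X v \<xi>] * by blast
  qed
qed

text \<open>Composing with w on the left preserves nullity. Together with
  \<open>factor_invertible\<close> this feeds \<open>zkernel_transfer\<close> when two morphisms
  factor through each other.\<close>

lemma factor_nullish:
  assumes "isomorphic L f' (w \<odot> f)" "w \<in> hom1 L (tgt L f) B" "f \<in> Mor L" "z \<in> hom1 L X (src L f)"
    "nullish L Z (f \<odot> z)"
  shows "nullish L Z (f' \<odot> z)"
proof -
  have "isomorphic L (f' \<odot> z) ((w \<odot> f) \<odot> z)"
    using assms isomorphic_Mor[OF assms(1)] by (intro isomorphic_rwhisker) (auto simp: hom1_def)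
  moreover have "(w \<odot> f) \<odot> z = w \<odot> f \<odot> z" using assms by (intro comp1_assoc_Mor) (auto simp: hom1_def)
  moreover have "nullish L Z (w \<odot> f \<odot> z)" using assms nullish_lwhisker[of "f \<odot> z" w] by (auto simp: hom1_def)
  ultimately show ?thesis using nullish_cong by simp
qed

lemma factor_invertible:
  assumes "isomorphic L f' (w \<odot> f)" "w \<in> hom1 L (tgt L f) B" "f \<in> Mor L" "u \<in> hom1 L X (src L f)"
    "\<xi> \<in> hom2 L u v" "invertible L (f \<rhd> \<xi>)"
  shows "invertible L (f' \<rhd> \<xi>)"
proof -
  have s: "src L f' = src L f" using isomorphic_Mor[OF assms(1)] assms by (auto simp: hom1_def)
  have "invertible L (w \<rhd> (f \<rhd> \<xi>))"
    using invertible_lwhisker[OF hom2_lwhisker[OF assms(5,4) Mor_hom1[OF assms(3)]]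
        comp1_hom[OF assms(4) Mor_hom1[OF assms(3)]] assms(2,6)] .
  moreover have "w \<rhd> (f \<rhd> \<xi>) = (w \<odot> f) \<rhd> \<xi>"
    using assms lwhisker_lwhisker[of \<xi> f w] by (simp add: hom1_def hom2_def)
  ultimately show ?thesis using lwhisker_invertible_cong[OF assms(1,5), of X] assms(4) s by simp
qed

end

section \<open>2-kernels of the zero ideal in terms of \<open>zkernel\<close>\<close>

context rigid_pointed begin

text \<open>The null morphisms a and b are isomorphic by some \<theta>. Rigidity makes the
  whiskerings of \<zeta> and \<theta> by m equal, and faithfulness gives \<zeta> = \<theta>.\<close>

lemma faithful_reflects_invertible:
  assumes "faithful1 L m" "\<zeta> \<in> hom2 L a b" "a \<in> hom1 L X (src L m)" "nullish L Z a" "nullish L Z b"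
    "invertible L (m \<rhd> \<zeta>)"
  shows "invertible L \<zeta>"
proof -
  have m: "m \<in> hom1 L (src L m) (tgt L m)" using assms(1) by (simp add: faithful1_def hom1_def)
  have b: "b \<in> hom1 L X (src L m)" using cell_hom1 assms by blast
  obtain \<theta> where th: "\<theta> \<in> iso2 L a b"
    using nullish_isomorphic[OF assms(4,5)] assms(3) b isomorphicE by (auto simp: hom1_def)
  have "m \<rhd> \<zeta> \<in> iso2 L (m \<odot> a) (m \<odot> b)" using hom2_lwhisker[OF assms(2,3) m] assms(6) by (simp add: iso2_iff)
  moreover have "nullish L Z (m \<odot> a)" using assms m by (intro nullish_lwhisker) (auto simp: hom1_def)
  ultimately have "m \<rhd> \<zeta> = m \<rhd> \<theta>" using nullish_iso_unique iso2_lwhisker[OF th assms(3) m] by blast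
  then have "\<zeta> = \<theta>" using assms(1,2,3) b iso2D[OF th] unfolding faithful1_def by blast
  then show ?thesis using th by (simp add: iso2_iff)
qed

text \<open>s is compared with a composite i t through \<open>Z\<close>. Both become null after k,
  hence isomorphic; this isomorphism and its inverse lift along k, and faithfulness makes the lifts
  mutually inverse.\<close>

lemma zkernel_reflects_nullish:
  assumes "zkernel L Z f k" "s \<in> hom1 L D (src L k)" "nullish L Z (k \<odot> s)"
  shows "nullish L Z s"
proof -
  note z = zkernelD[OF assms(1)]
  have kh: "k \<in> hom1 L (src L k) (src L f)" and fh: "f \<in> hom1 L (src L f) (tgt L f)" using z by (auto simp: hom1_def)
  obtain t where t: "t \<in> hom1 L D Z" using to_zero_hom hom1_Ob assms(2) by blast
  obtain i where i: "i \<in> hom1 L Z (src L k)" using from_zero_hom hom1_Ob assms(2) by blast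
  have it: "i \<odot> t \<in> hom1 L D (src L k)" using comp1_hom[OF t i] .
  have ks: "k \<odot> s \<in> hom1 L D (src L f)" using comp1_hom[OF assms(2) kh] .
  have n: "nullish L Z (k \<odot> i \<odot> t)"
    using nullish_lwhisker[OF nullish_factor[OF t i], of k] it kh by (auto simp: hom1_def)
  obtain \<xi> where xi: "\<xi> \<in> iso2 L (k \<odot> s) (k \<odot> i \<odot> t)"
    using nullish_isomorphic[OF assms(3) n] ks comp1_hom[OF it kh] isomorphicE by (auto simp: hom1_def)
  have f\<xi>: "invertible L (f \<rhd> \<xi>)"
    using iso2_lwhisker[OF xi ks fh] by (simp add: iso2_iff)
  obtain \<mu> where mu: "\<mu> \<in> hom2 L s (i \<odot> t)" "k \<rhd> \<mu> = \<xi>" using z(6)[OF assms(2) it iso2D[OF xi] f\<xi>] by blast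
  obtain \<xi>' where xi': "\<xi>' \<in> iso2 L (k \<odot> i \<odot> t) (k \<odot> s)" "\<xi>' \<bullet> \<xi> = id2 L (k \<odot> s)" "\<xi> \<bullet> \<xi>' = id2 L (k \<odot> i \<odot> t)"
    using xi by (rule iso2E)
  have f\<xi>': "invertible L (f \<rhd> \<xi>')"
    using iso2_lwhisker[OF xi'(1) comp1_hom[OF it kh] fh] by (simp add: iso2_iff)
  obtain \<mu>' where mu': "\<mu>' \<in> hom2 L (i \<odot> t) s" "k \<rhd> \<mu>' = \<xi>'" using z(6)[OF it assms(2) iso2D[OF xi'(1)] f\<xi>'] by blast
  have fa: "\<alpha> = \<beta>" if "u \<in> hom1 L D (src L k)" "v \<in> hom1 L D (src L k)" "\<alpha> \<in> hom2 L u v" "\<beta> \<in> hom2 L u v"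
      "k \<rhd> \<alpha> = k \<rhd> \<beta>" for u v \<alpha> \<beta>
    using zkernel_faithful[OF assms(1)] that unfolding faithful1_def by blast
  have "k \<rhd> (\<mu>' \<bullet> \<mu>) = k \<rhd> id2 L s"
    using mu mu' xi' assms(2) kh hcomp_id2[OF assms(2) kh] lwhisker_vcomp[of \<mu> \<mu>' k]
    by (simp add: hom1_def hom2_def)
  then have a: "\<mu>' \<bullet> \<mu> = id2 L s"
    using fa[OF assms(2) assms(2) vcomp_hom[OF mu(1) mu'(1)] id2_hom1] assms(2) by blast
  have "k \<rhd> (\<mu> \<bullet> \<mu>') = k \<rhd> id2 L (i \<odot> t)"
    using mu mu' xi' it kh hcomp_id2[OF it kh] lwhisker_vcomp[of \<mu>' \<mu> k]
    by (simp add: hom1_def hom2_def)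
  then have b: "\<mu> \<bullet> \<mu>' = id2 L (i \<odot> t)"
    using fa[OF it it vcomp_hom[OF mu'(1) mu(1)] id2_hom1] it by blast
  show ?thesis using nullishI[OF t i isomorphicI[OF iso2I[OF mu(1) mu'(1) a b]]] .
qed

lemma null1_comp:
  assumes "n \<in> null1 (zero_ideal L Z)" "n \<in> hom1 L A B"
  shows "u \<in> hom1 L X A \<Longrightarrow> n \<odot> u \<in> null1 (zero_ideal L Z)"
    and "w \<in> hom1 L B Y \<Longrightarrow> w \<odot> n \<in> null1 (zero_ideal L Z)"
proof -
  obtain t i where ti: "t \<in> hom1 L A Z" "i \<in> hom1 L Z B" "n = i \<odot> t"
    using assms null1_iff by (auto simp: hom1_def)
  show "n \<odot> u \<in> null1 (zero_ideal L Z)" if "u \<in> hom1 L X A"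
    using comp1_assoc[OF that ti(1,2)] comp1_hom[OF that ti(1)] ti unfolding null1_zero_ideal by blast
  show "w \<odot> n \<in> null1 (zero_ideal L Z)" if "w \<in> hom1 L B Y"
    using comp1_assoc[OF ti(1,2) that, symmetric] comp1_hom[OF ti(2) that] ti unfolding null1_zero_ideal by blast
qed

text \<open>Under rigidity a 2-cell between null morphisms is null exactly when it is invertible. So
  the comparison 2-cell of the first clause is null automatically, and the nullity premise of the
  second clause becomes invertibility of \<open>f \<rhd> \<xi>\<close>.\<close>

lemma kernel2_iff:
  assumes N: "zero_like L Z N"
  shows "kernel2 L N f k n \<alpha> \<longleftrightarrow> n \<in> null1 (zero_ideal L Z) \<and> \<alpha> \<in> iso2 L (f \<odot> k) n \<and> zkernel L Z f k"
proof (cases "f \<in> Mor L \<and> k \<in> Mor L \<and> tgt L k = src L f \<and> n \<in> null1 (zero_ideal L Z) \<and> \<alpha> \<in> iso2 L (f \<odot> k) n")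
  case False
  then show ?thesis using N by (auto simp: kernel2_def zkernel_def zero_like_def)
next
  case True
  let ?N = "null1 (zero_ideal L Z)"
  have f: "f \<in> hom1 L (src L f) (tgt L f)" and k: "k \<in> hom1 L (src L k) (src L f)"
    and n: "n \<in> ?N" and \<alpha>: "\<alpha> \<in> iso2 L (f \<odot> k) n" using True by (auto simp: hom1_def)
  have fk: "f \<odot> k \<in> hom1 L (src L k) (tgt L f)" using comp1_hom[OF k f] .
  have nh: "n \<in> hom1 L (src L k) (tgt L f)" using cell_hom1[OF iso2D[OF \<alpha>] fk] .
  have N1: "null1 N = ?N" and N2: "null2 N = zero_null2 L Z" using N by (auto simp: zero_like_def)
  have nu: "nu N (id1 L (tgt L n)) n u = id2 L (n \<odot> u)" "til N (id1 L (tgt L n)) n u = n \<odot> u"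
    "n \<odot> u \<in> Mor L" if "u \<in> hom1 L X (src L k)" for u X
  proof -
    have i: "id1 L (tgt L n) \<in> hom1 L (tgt L f) (tgt L f)" using nh id1_hom[of "tgt L f"] hom1_Ob[OF nh] by (simp add: hom1_def)
    have e: "id1 L (tgt L n) \<odot> n \<odot> u = n \<odot> u" using comp1_id_left[OF comp1_hom[OF that nh]] nh by (simp add: hom1_def)
    have "til N (id1 L (tgt L n)) n u = id1 L (tgt L n) \<odot> n \<odot> u \<and>
      nu N (id1 L (tgt L n)) n u = id2 L (id1 L (tgt L n) \<odot> n \<odot> u)"
      using N that nh i unfolding zero_like_def by blast
    then show "nu N (id1 L (tgt L n)) n u = id2 L (n \<odot> u)" "til N (id1 L (tgt L n)) n u = n \<odot> u" using e by auto
    show "n \<odot> u \<in> Mor L" using comp1_hom[OF that nh] by (simp add: hom1_def)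
  qed
  have P1: "nu N (id1 L (tgt L n)) n u \<bullet> (\<alpha> \<lhd> u) \<bullet> (f \<rhd> \<gamma>) \<bullet> inv2 L \<beta> \<in> null_iso L N p (til N (id1 L (tgt L n)) n u)"
    if z: "z \<in> hom1 L X (src L f)" and p: "p \<in> ?N" and \<beta>: "\<beta> \<in> iso2 L (f \<odot> z) p"
      and u: "u \<in> hom1 L X (src L k)" and \<gamma>: "\<gamma> \<in> iso2 L z (k \<odot> u)" for X z p \<beta> u \<gamma>
  proof -
    have "f \<rhd> \<gamma> \<in> iso2 L (f \<odot> z) ((f \<odot> k) \<odot> u)" using iso2_lwhisker[OF \<gamma> z f] comp1_assoc[OF u k f] by simp
    then have "(\<alpha> \<lhd> u) \<bullet> (f \<rhd> \<gamma>) \<bullet> inv2 L \<beta> \<in> iso2 L p (n \<odot> u)"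
      using iso2_vcomp[OF iso2_vcomp[OF inv2_iso2[OF \<beta>]] iso2_rwhisker[OF \<alpha> u fk]] by blast
    then show ?thesis
      using nu[OF u] null_iso_iff[OF N2 p null1_comp(1)[OF n nh u]] vcomp_id_left iso2D by metis
  qed
  \<comment> \<open>The \<open>nu\<close> 2-cells are identities here, and the rest of the composite
    is \<open>f \<rhd> \<xi>\<close> conjugated by whiskerings of \<alpha>.\<close>
  have P2: "nu N (id1 L (tgt L n)) n v \<bullet> (\<alpha> \<lhd> v) \<bullet> (f \<rhd> \<xi>) \<bullet> (inv2 L \<alpha> \<lhd> u)
          \<bullet> inv2 L (nu N (id1 L (tgt L n)) n u) \<in> null2 N \<longleftrightarrow> invertible L (f \<rhd> \<xi>)"
    if u: "u \<in> hom1 L X (src L k)" and v: "v \<in> hom1 L X (src L k)" and \<xi>: "\<xi> \<in> hom2 L (k \<odot> u) (k \<odot> v)"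
    for X u v \<xi>
  proof -
    let ?c = "(\<alpha> \<lhd> v) \<bullet> (f \<rhd> \<xi>) \<bullet> (inv2 L \<alpha> \<lhd> u)"
    have fx: "f \<rhd> \<xi> \<in> hom2 L ((f \<odot> k) \<odot> u) ((f \<odot> k) \<odot> v)"
      using hom2_lwhisker[OF \<xi> comp1_hom[OF u k] f] comp1_assoc[OF u k f] comp1_assoc[OF v k f] by simp
    have au: "\<alpha> \<lhd> u \<in> iso2 L ((f \<odot> k) \<odot> u) (n \<odot> u)" and av: "\<alpha> \<lhd> v \<in> iso2 L ((f \<odot> k) \<odot> v) (n \<odot> v)"
      using iso2_rwhisker[OF \<alpha> u fk] iso2_rwhisker[OF \<alpha> v fk] by auto
    have iau: "inv2 L \<alpha> \<lhd> u \<in> iso2 L (n \<odot> u) ((f \<odot> k) \<odot> u)" using iso2_rwhisker[OF inv2_iso2[OF \<alpha>] u nh] .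
    have c: "?c \<in> hom2 L (n \<odot> u) (n \<odot> v)"
      using vcomp_hom[OF vcomp_hom[OF iso2D[OF iau] fx] iso2D[OF av]] .
    have "(inv2 L \<alpha> \<lhd> u) \<bullet> (\<alpha> \<lhd> u) = id2 L ((f \<odot> k) \<odot> u)"
      using inv2_vcomp(1)[OF \<alpha>] rwhisker_vcomp[of \<alpha> "inv2 L \<alpha>" u] u fk \<alpha> iso2D[OF inv2_iso2[OF \<alpha>]] iso2D[OF \<alpha>]
        hcomp_id2[OF u fk] by (auto simp: hom1_def hom2_def)
    then have "?c \<bullet> (\<alpha> \<lhd> u) = (\<alpha> \<lhd> v) \<bullet> (f \<rhd> \<xi>)"
      using vcomp_assoc[OF iso2D[OF au] iso2D[OF iau] fx] vcomp_id_right[OF fx]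
        vcomp_assoc[OF iso2D[OF au] vcomp_hom[OF iso2D[OF iau] fx] iso2D[OF av]] by simp
    then have "invertible L (f \<rhd> \<xi>) \<longleftrightarrow> invertible L ?c"
      using invertible_conj[OF au av fx c] by simp
    also have "\<dots> \<longleftrightarrow> ?c \<in> zero_null2 L Z"
    proof
      assume "invertible L ?c"
      then have "?c \<in> iso2 L (n \<odot> u) (n \<odot> v)" using c by (simp add: iso2_iff)
      then show "?c \<in> zero_null2 L Z" using iso2_null null1_comp(1)[OF n nh] u v by blast
    next
      assume "?c \<in> zero_null2 L Z"
      then show "invertible L ?c" using zero_null2_iso iso2_iff by blast
    qed
    also have "?c = nu N (id1 L (tgt L n)) n v \<bullet> (\<alpha> \<lhd> v) \<bullet> (f \<rhd> \<xi>) \<bullet> (inv2 L \<alpha> \<lhd> u)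
          \<bullet> inv2 L (nu N (id1 L (tgt L n)) n u)"
      using nu[OF u] nu[OF v] vcomp_id_left[OF c] vcomp_id_right[OF iso2D[OF iau]] by simp
    finally show ?thesis using N2 by simp
  qed
  have Q1: "(\<forall>X z p \<beta>. z \<in> hom1 L X (src L f) \<and> p \<in> null1 N \<and> \<beta> \<in> iso2 L (f \<odot> z) p \<longrightarrow>
        (\<exists>u \<in> hom1 L X (src L k). \<exists>\<gamma> \<in> iso2 L z (k \<odot> u).
           nu N (id1 L (tgt L n)) n u \<bullet> (\<alpha> \<lhd> u) \<bullet> (f \<rhd> \<gamma>) \<bullet> inv2 L \<beta>
           \<in> null_iso L N p (til N (id1 L (tgt L n)) n u)))
     \<longleftrightarrow> (\<forall>X z. z \<in> hom1 L X (src L f) \<and> nullish L Z (f \<odot> z) \<longrightarrow>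
        (\<exists>u \<in> hom1 L X (src L k). isomorphic L z (k \<odot> u)))" (is "?A \<longleftrightarrow> ?B")
  proof
    assume A: ?A
    show ?B
    proof (intro allI impI)
      fix X z assume z: "z \<in> hom1 L X (src L f) \<and> nullish L Z (f \<odot> z)"
      then obtain p where "p \<in> ?N" "isomorphic L (f \<odot> z) p" using nullishE_null1 by metis
      then show "\<exists>u \<in> hom1 L X (src L k). isomorphic L z (k \<odot> u)"
        using A z N1 isomorphicE isomorphicI by metis
    qed
  next
    assume B: ?B
    show ?A
    proof (intro allI impI)
      fix X z p \<beta> assume z: "z \<in> hom1 L X (src L f) \<and> p \<in> null1 N \<and> \<beta> \<in> iso2 L (f \<odot> z) p"
      then have "nullish L Z (f \<odot> z)" using nullish_cong[OF isomorphicI] nullish_null1 N1 by blast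
      then obtain u \<gamma> where "u \<in> hom1 L X (src L k)" "\<gamma> \<in> iso2 L z (k \<odot> u)"
        using B z isomorphicE by metis
      then show "\<exists>u \<in> hom1 L X (src L k). \<exists>\<gamma> \<in> iso2 L z (k \<odot> u).
           nu N (id1 L (tgt L n)) n u \<bullet> (\<alpha> \<lhd> u) \<bullet> (f \<rhd> \<gamma>) \<bullet> inv2 L \<beta>
           \<in> null_iso L N p (til N (id1 L (tgt L n)) n u)" using P1 z N1 by blast
    qed
  qed
  have nl: "nullish L Z (f \<odot> k)" using nullish_cong[OF isomorphicI[OF \<alpha>]] nullish_null1[OF n] by blast
  show ?thesis
    unfolding kernel2_def zkernel_def Q1 using True N1 P2 nl by (auto cong: conj_cong)
qed

lemma is_kernel2_iff:
  assumes N: "zero_like L Z N"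
  shows "is_kernel2 L N k \<longleftrightarrow> (\<exists>f. zkernel L Z f k)"
    and "has_kernels2 L N \<longleftrightarrow> (\<forall>f \<in> Mor L. \<exists>k. zkernel L Z f k)"
proof -
  have *: "\<exists>n \<alpha>. n \<in> null1 (zero_ideal L Z) \<and> \<alpha> \<in> iso2 L (f \<odot> k) n" if "zkernel L Z f k" for f k
    using zkernelD(4)[OF that] nullishE_null1 isomorphicE by metis
  show "is_kernel2 L N k \<longleftrightarrow> (\<exists>f. zkernel L Z f k)"
    unfolding is_kernel2_def kernel2_iff[OF N] using * by blast
  show "has_kernels2 L N \<longleftrightarrow> (\<forall>f \<in> Mor L. \<exists>k. zkernel L Z f k)"
    unfolding has_kernels2_def kernel2_iff[OF N] using * by blast
qed

text \<open>For morphisms, nullity up to isomorphism is reflected by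
  \<open>zkernel_reflects_nullish\<close>. For 2-cells, nullity is traded for invertibility,
  reflected along the faithful k, and traded back.\<close>

lemma zkernel_reflects_null:
  assumes N: "zero_like L Z N" and k: "zkernel L Z f k"
  shows "reflects_null_morphisms L N k" and "reflects_null_cells L N k"
proof -
  have kh: "k \<in> hom1 L (src L k) (tgt L k)" using zkernelD(2)[OF k] by (simp add: hom1_def)
  have N1: "null1 N = null1 (zero_ideal L Z)" and N2: "null2 N = zero_null2 L Z" using N by (auto simp: zero_like_def)
  have nu: "nu N k s (id1 L D) = id2 L (k \<odot> s)" "til N k s (id1 L D) = k \<odot> s" if "s \<in> hom1 L D (src L k)" for s D
    using N id1_hom[of D] hom1_Ob[OF that] that kh comp1_id_right[OF that] unfolding zero_like_def by metis+
  show "reflects_null_morphisms L N k"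
    unfolding reflects_null_morphisms_def
  proof (intro allI impI)
    fix D s n \<delta> assume *: "s \<in> hom1 L D (src L k) \<and> n \<in> null1 N \<and> \<delta> \<in> iso2 L (k \<odot> s) n"
    then have "nullish L Z (k \<odot> s)" using nullish_cong[OF isomorphicI] nullish_null1 N1 by blast
    then have "nullish L Z s" using zkernel_reflects_nullish[OF k] * by blast
    then obtain s' \<psi> where s': "s' \<in> null1 (zero_ideal L Z)" "\<psi> \<in> iso2 L s s'"
      using nullishE_null1 isomorphicE by metis
    have s'h: "s' \<in> hom1 L D (src L k)" using cell_hom1 iso2D s' * by blast
    have k\<psi>: "k \<rhd> \<psi> \<in> iso2 L (k \<odot> s) (k \<odot> s')" using iso2_lwhisker[OF s'(2) _ kh] * by blast
    have c: "(k \<rhd> \<psi>) \<bullet> inv2 L \<delta> \<in> iso2 L n (k \<odot> s')" using iso2_vcomp[OF inv2_iso2 k\<psi>] * by blast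
    have "nu N k s' (id1 L D) \<bullet> (k \<rhd> \<psi>) \<bullet> inv2 L \<delta> \<in> null_iso L N n (til N k s' (id1 L D))"
      using nu[OF s'h] vcomp_id_left[OF iso2D[OF c]] c null_iso_iff[OF N2] * N1 null1_comp(2)[OF s'(1) s'h kh] by simp
    then show "\<exists>s'\<in>null1 N. \<exists>\<psi>\<in>iso2 L s s'. nu N k s' (id1 L D) \<bullet> (k \<rhd> \<psi>) \<bullet> inv2 L \<delta>
        \<in> null_iso L N n (til N k s' (id1 L D))" using s' N1 by blast
  qed
  show "reflects_null_cells L N k"
    unfolding reflects_null_cells_def
  proof (intro allI impI, elim conjE)
    fix D s s' \<mu>
    assume s: "s \<in> hom1 L D (src L k)" "s \<in> null1 N" and s': "s' \<in> hom1 L D (src L k)" "s' \<in> null1 N"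
      and mu: "\<mu> \<in> hom2 L s s'"
      and n: "nu N k s' (id1 L D) \<bullet> (k \<rhd> \<mu>) \<bullet> inv2 L (nu N k s (id1 L D)) \<in> null2 N"
    have h: "k \<rhd> \<mu> \<in> hom2 L (k \<odot> s) (k \<odot> s')" using hom2_lwhisker[OF mu s(1) kh] .
    have "k \<odot> s \<in> Mor L" using comp1_hom[OF s(1) kh] by (simp add: hom1_def)
    then have "k \<rhd> \<mu> \<in> zero_null2 L Z"
      using n nu[OF s(1)] nu[OF s'(1)] N2 vcomp_id_left[OF h] vcomp_id_right[OF h] by simp
    then have "invertible L (k \<rhd> \<mu>)" using zero_null2_iso iso2_iff by blast
    then have "invertible L \<mu>"
      using faithful_reflects_invertible[OF zkernel_faithful[OF k] mu s(1)] s s' N1 nullish_null1 by blast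
    then show "\<mu> \<in> null2 N" using iso2_null[of s s' \<mu>] s s' N1 N2 mu by (simp add: iso2_iff)
  qed
qed

text \<open>The comparison \<theta> can be taken to be an identity: by \<open>kernel2_iff\<close>
  any invertible 2-cell to a null morphism serves as structure 2-cell of a kernel.\<close>

lemma kernels2_normal_iff:
  assumes N: "zero_like L Z N" and N': "zero_like (op L) Z (op_ideal N)"
  shows "kernels2_normal L N \<longleftrightarrow> (\<forall>f m c. zkernel L Z f m \<and> zkernel (op L) Z m c \<longrightarrow> zkernel L Z c m)"
proof -
  interpret op: rigid_pointed "op L" Z by (rule rigid_pointed_op)
  have N1: "null1 N = null1 (zero_ideal L Z)" and N2: "null2 N = zero_null2 L Z" using N by (auto simp: zero_like_def)
  have ck: "cokernel2 L N m c n \<gamma> \<longleftrightarrow> n \<in> null1 (zero_ideal L Z) \<and> \<gamma> \<in> iso2 L (c \<odot> m) n \<and> zkernel (op L) Z m c" for m c n \<gamma>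
    unfolding cokernel2_def op.kernel2_iff[OF N'] by (simp add: null1_zero_ideal_op)
  show ?thesis
  proof
    assume nrm: "kernels2_normal L N"
    show "\<forall>f m c. zkernel L Z f m \<and> zkernel (op L) Z m c \<longrightarrow> zkernel L Z c m"
    proof (intro allI impI)
      fix f m c assume *: "zkernel L Z f m \<and> zkernel (op L) Z m c"
      obtain n \<gamma> where "n \<in> null1 (zero_ideal L Z)" "\<gamma> \<in> iso2 L (c \<odot> m) n"
        using op.zkernelD(4)[of m c] * nullishE_null1 isomorphicE by (metis nullish_op op_simps(10))
      then have "cokernel2 L N m c n \<gamma>" using ck * by blast
      moreover have "is_kernel2 L N m" using is_kernel2_iff(1)[OF N] * by blast
      ultimately obtain n' \<theta> where "kernel2 L N c m n' (\<theta> \<bullet> \<gamma>)" using nrm unfolding kernels2_normal_def by blast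
      then show "zkernel L Z c m" using kernel2_iff[OF N] by blast
    qed
  next
    assume nrm: "\<forall>f m c. zkernel L Z f m \<and> zkernel (op L) Z m c \<longrightarrow> zkernel L Z c m"
    show "kernels2_normal L N"
      unfolding kernels2_normal_def ck is_kernel2_iff(1)[OF N]
    proof (intro allI impI, elim conjE exE)
      fix m c n \<gamma> f
      assume *: "n \<in> null1 (zero_ideal L Z)" "\<gamma> \<in> iso2 L (c \<odot> m) n" "zkernel (op L) Z m c" "zkernel L Z f m"
      have "n \<in> Mor L" using *(1) null1_iff by blast
      then have "id2 L n \<in> null_iso L N n n" using null_iso_iff[OF N2 *(1) *(1)] by simp
      moreover have "kernel2 L N c m n (id2 L n \<bullet> \<gamma>)"
        using kernel2_iff[OF N] * nrm vcomp_id_left[OF iso2D[OF *(2)]] by auto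
      ultimately show "\<exists>n'\<in>null1 N. \<exists>\<theta>\<in>null_iso L N n n'. kernel2 L N c m n' (\<theta> \<bullet> \<gamma>)" using *(1) N1 by blast
    qed
  qed
qed

lemma zero_exact_iff:
  assumes "N = zero_ideal L Z"
  shows "has_kernels2 L N \<and> has_cokernels2 L N \<and> closed_ideal L N \<and>
      kernels2_normal L N \<and> cokernels2_normal L N \<and> kernel_cokernel_factorizations L N
    \<longleftrightarrow> zero_exact L Z"
proof -
  interpret op: rigid_pointed "op L" Z by (rule rigid_pointed_op)
  have N: "zero_like L Z N" and N': "zero_like (op L) Z (op_ideal N)"
    using assms zero_like_zero_ideal zero_like_op by auto
  have N'': "zero_like (op (op L)) Z (op_ideal (op_ideal N))" using N by simp
  have cl: "closed_ideal L N"
    unfolding closed_ideal_def is_kernel2_iff(1)[OF N] is_cokernel2_def op.is_kernel2_iff(1)[OF N']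
      coreflects_null_morphisms_def coreflects_null_cells_def
    using zkernel_reflects_null[OF N] op.zkernel_reflects_null[OF N'] by blast
  show ?thesis
    unfolding zero_exact_def has_cokernels2_def is_kernel2_iff(2)[OF N] op.is_kernel2_iff(2)[OF N']
      kernels2_normal_iff[OF N N'] cokernels2_normal_def op.kernels2_normal_iff[OF N' N'']
      kernel_cokernel_factorizations_def is_kernel2_iff(1)[OF N] is_cokernel2_def op.is_kernel2_iff(1)[OF N']
    using cl by (simp add: isomorphic_def)
qed

end

section \<open>Rigidity from 2-kernels\<close>

lemma equivalence1_op [simp]: "equivalence1 (op L) i = equivalence1 L i"
  by (auto simp: equivalence1_def)

section \<open>Equivalences are faithful and full on 2-cells\<close>

context two_category begin

lemma equivalence1E:
  assumes "equivalence1 L i"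
  obtains g \<eta> \<epsilon> where "g \<in> hom1 L (tgt L i) (src L i)" "\<eta> \<in> iso2 L (g \<odot> i) (id1 L (src L i))"
    "\<epsilon> \<in> iso2 L (i \<odot> g) (id1 L (tgt L i))" "i \<in> hom1 L (src L i) (tgt L i)"
  using assms by (auto simp: equivalence1_def hom1_def)

lemma lwhisker_id1_conj:
  assumes "\<eta> \<in> iso2 L h (id1 L A)" "\<alpha> \<in> hom2 L u v" "u \<in> hom1 L X A"
  shows "(\<eta> \<lhd> v) \<bullet> (h \<rhd> \<alpha>) = \<alpha> \<bullet> (\<eta> \<lhd> u)"
proof -
  have A: "A \<in> Ob L" using assms(3) by (auto simp: hom1_def)
  have h: "h \<in> hom1 L A A" using hom2_Mor[OF iso2D[OF assms(1)]] A by (auto simp: hom1_def)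
  show ?thesis
    using whisker_exchange[OF assms(2) iso2D[OF assms(1)] assms(3) h] hcomp_id_left[OF assms(3,2)] by simp
qed

text \<open>Whiskering by g i is conjugate through \<eta> to doing nothing, so 2-cells with equal
  whiskerings by i are equal.\<close>

lemma faithful_of_retract:
  assumes "\<eta> \<in> iso2 L (g \<odot> i) (id1 L A)" "i \<in> hom1 L A B" "g \<in> hom1 L B A"
  shows "faithful1 L i"
  unfolding faithful1_def
proof (intro conjI allI ballI impI)
  show "i \<in> Mor L" using assms(2) by (simp add: hom1_def)
  fix D u v \<alpha> \<beta>
  assume u: "u \<in> hom1 L D (src L i)" "v \<in> hom1 L D (src L i)" and a: "\<alpha> \<in> hom2 L u v" "\<beta> \<in> hom2 L u v"
    and eq: "i \<rhd> \<alpha> = i \<rhd> \<beta>"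
  have s: "src L i = A" using assms(2) by (simp add: hom1_def)
  have "(g \<odot> i) \<rhd> \<gamma> = g \<rhd> (i \<rhd> \<gamma>)" if "\<gamma> \<in> hom2 L u v" for \<gamma>
    using that u assms(2,3) lwhisker_lwhisker[of \<gamma> i g] by (simp add: hom1_def hom2_def)
  then have "(g \<odot> i) \<rhd> \<alpha> = (g \<odot> i) \<rhd> \<beta>" using a eq by simp
  then have "\<alpha> \<bullet> (\<eta> \<lhd> u) = \<beta> \<bullet> (\<eta> \<lhd> u)"
    using lwhisker_id1_conj[OF assms(1) a(1)] lwhisker_id1_conj[OF assms(1) a(2)] u s by metis
  moreover have "\<eta> \<lhd> u \<in> iso2 L ((g \<odot> i) \<odot> u) u"
    using iso2_rwhisker[OF assms(1), of u D A A] comp1_hom[OF assms(2,3)] u(1) s comp1_id_left by auto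
  ultimately show "\<alpha> = \<beta>" using iso2_cancel_right a by blast
qed

text \<open>The candidate is \<open>g \<rhd> \<zeta>\<close> transported along \<eta>. Whiskered by
  i it agrees with \<zeta> after a further whiskering by g, and faithfulness of g, in place of a
  triangle identity, removes g.\<close>

lemma equivalence1_full:
  assumes "equivalence1 L i" "u \<in> hom1 L X (src L i)" "v \<in> hom1 L X (src L i)" "\<zeta> \<in> hom2 L (i \<odot> u) (i \<odot> v)"
  shows "\<exists>!\<mu>. \<mu> \<in> hom2 L u v \<and> i \<rhd> \<mu> = \<zeta>"
proof -
  obtain g \<eta> \<epsilon> where g: "g \<in> hom1 L (tgt L i) (src L i)" and \<eta>: "\<eta> \<in> iso2 L (g \<odot> i) (id1 L (src L i))"
    and \<epsilon>: "\<epsilon> \<in> iso2 L (i \<odot> g) (id1 L (tgt L i))" and i: "i \<in> hom1 L (src L i) (tgt L i)"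
    using assms(1) by (rule equivalence1E)
  have gi: "g \<odot> i \<in> hom1 L (src L i) (src L i)" using comp1_hom[OF i g] .
  have fi: "faithful1 L i" using faithful_of_retract[OF \<eta> i g] .
  have fg: "faithful1 L g" using faithful_of_retract[OF \<epsilon> g i] .
  have \<eta>u: "\<eta> \<lhd> u \<in> iso2 L (g \<odot> i \<odot> u) u" and \<eta>v: "\<eta> \<lhd> v \<in> iso2 L (g \<odot> i \<odot> v) v"
    using iso2_rwhisker[OF \<eta> assms(2) gi] iso2_rwhisker[OF \<eta> assms(3) gi] comp1_id_left assms(2,3)
      comp1_assoc[OF assms(2) i g] comp1_assoc[OF assms(3) i g] by auto
  have iu: "i \<odot> u \<in> hom1 L X (tgt L i)" "i \<odot> v \<in> hom1 L X (tgt L i)" using comp1_hom i assms(2,3) by auto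
  have g\<zeta>: "g \<rhd> \<zeta> \<in> hom2 L (g \<odot> i \<odot> u) (g \<odot> i \<odot> v)" using hom2_lwhisker[OF assms(4) iu(1) g] .
  obtain \<eta>' where \<eta>': "\<eta>' \<in> iso2 L u (g \<odot> i \<odot> u)" "\<eta>' \<bullet> (\<eta> \<lhd> u) = id2 L (g \<odot> i \<odot> u)"
    using \<eta>u by (rule iso2E)
  define \<mu> where "\<mu> = (\<eta> \<lhd> v) \<bullet> (g \<rhd> \<zeta>) \<bullet> \<eta>'"
  have \<mu>: "\<mu> \<in> hom2 L u v"
    unfolding \<mu>_def using vcomp_hom[OF vcomp_hom[OF iso2D[OF \<eta>'(1)] g\<zeta>] iso2D[OF \<eta>v]] .
  have "\<mu> \<bullet> (\<eta> \<lhd> u) = (\<eta> \<lhd> v) \<bullet> (g \<rhd> \<zeta>)"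
    unfolding \<mu>_def
    using vcomp_assoc[OF iso2D[OF \<eta>u] vcomp_hom[OF iso2D[OF \<eta>'(1)] g\<zeta>] iso2D[OF \<eta>v]]
      vcomp_assoc[OF iso2D[OF \<eta>u] iso2D[OF \<eta>'(1)] g\<zeta>] \<eta>'(2) vcomp_id_right[OF g\<zeta>] by simp
  then have "(\<eta> \<lhd> v) \<bullet> ((g \<odot> i) \<rhd> \<mu>) = (\<eta> \<lhd> v) \<bullet> (g \<rhd> \<zeta>)"
    using lwhisker_id1_conj[OF \<eta> \<mu> assms(2)] by simp
  moreover have "(g \<odot> i) \<rhd> \<mu> = g \<rhd> (i \<rhd> \<mu>)"
    using \<mu> assms(2) i g lwhisker_lwhisker[of \<mu> i g] by (simp add: hom1_def hom2_def)
  moreover have i\<mu>: "i \<rhd> \<mu> \<in> hom2 L (i \<odot> u) (i \<odot> v)" using hom2_lwhisker[OF \<mu> assms(2) i] .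
  ultimately have "g \<rhd> (i \<rhd> \<mu>) = g \<rhd> \<zeta>"
    using iso2_cancel_left[OF \<eta>v hom2_lwhisker[OF i\<mu> iu(1) g] g\<zeta>] by simp
  then have "i \<rhd> \<mu> = \<zeta>" using fg i\<mu> assms(4) iu g unfolding faithful1_def by (auto simp: hom1_def)
  then show ?thesis using \<mu> fi assms(2,3) unfolding faithful1_def by blast
qed

end

context pointed begin

text \<open>The kernel k of an identity is isomorphic by \<alpha> to a morphism through
  \<open>Z\<close>. First \<phi> is shown to be a null 2-cell, by reflecting nullity along k with a
  comparison 2-cell twisted by \<phi>. A null \<phi> is then conjugate to
  \<open>k \<rhd> \<mu>\<close> for an endo-2-cell \<mu> of u, and k sends every such \<mu> to an
  identity because it passes through \<open>Z\<close> up to \<alpha>.\<close>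

lemma null_rigid_of_kernels:
  assumes N: "N = zero_ideal L Z"
    and ker: "\<And>B. B \<in> Ob L \<Longrightarrow> \<exists>k n \<alpha>. kernel2 L N (id1 L B) k n \<alpha> \<and> reflects_null_morphisms L N k"
  shows "null_rigid L Z"
  unfolding null_rigid_def
proof (intro allI impI, elim conjE)
  fix X B t i \<phi>
  assume t: "t \<in> hom1 L X Z" and i: "i \<in> hom1 L Z B" and \<phi>: "\<phi> \<in> iso2 L (i \<odot> t) (i \<odot> t)"
  define n where "n = i \<odot> t"
  have n: "n \<in> hom1 L X B" using comp1_hom[OF t i] n_def by simp
  have B: "B \<in> Ob L" and X: "X \<in> Ob L" using hom1_Ob[OF n] by auto
  note b = id1_hom[OF B]
  have N1: "null1 N = null1 (zero_ideal L Z)" and N2: "null2 N = zero_null2 L Z"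
    and til: "til N = (\<lambda>b n a. b \<odot> n \<odot> a)" and nu: "nu N = (\<lambda>b n a. id2 L (b \<odot> n \<odot> a))"
    using N by (simp_all add: zero_ideal_def)
  have nN: "n \<in> null1 N" unfolding N1 null1_zero_ideal n_def using t i by blast
  obtain k n0 \<alpha> where K: "kernel2 L N (id1 L B) k n0 \<alpha>" and R: "reflects_null_morphisms L N k"
    using ker[OF B] by blast
  have k: "k \<in> hom1 L (src L k) B" and n0N: "n0 \<in> null1 N" and \<alpha>: "\<alpha> \<in> iso2 L k n0"
  proof -
    have "k \<in> Mor L" "tgt L k = src L (id1 L B)" "n0 \<in> null1 N" "\<alpha> \<in> iso2 L (id1 L B \<odot> k) n0"
      using K unfolding kernel2_def by blast+
    moreover from this have k: "k \<in> hom1 L (src L k) B" using B by (simp add: hom1_def)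
    ultimately show "k \<in> hom1 L (src L k) B" "n0 \<in> null1 N" "\<alpha> \<in> iso2 L k n0" using comp1_id_left[OF k] by auto
  qed
  have n0: "n0 \<in> hom1 L (src L k) B" using cell_hom1[OF iso2D[OF \<alpha>] k] .
  obtain r j where rj: "r \<in> hom1 L (src L k) Z" "j \<in> hom1 L Z B" "n0 = j \<odot> r"
    using n0N n0 N1 null1_iff by (auto simp: hom1_def)
  have nun0: "nu N (id1 L (tgt L n0)) n0 u = id2 L (n0 \<odot> u)" "til N (id1 L (tgt L n0)) n0 u = n0 \<odot> u"
    if "u \<in> hom1 L X (src L k)" for u
    using comp1_hom[OF that n0] comp1_id_left n0 nu til by (auto simp: hom1_def)
  have sb: "src L (id1 L B) = B" using B by simp
  have idn: "id2 L n \<in> iso2 L (id1 L B \<odot> n) n" using n comp1_id_left[OF n] by (simp add: hom1_def)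
  obtain u \<gamma> where u: "u \<in> hom1 L X (src L k)" and \<gamma>: "\<gamma> \<in> iso2 L n (k \<odot> u)"
    and c0: "nu N (id1 L (tgt L n0)) n0 u \<bullet> (\<alpha> \<lhd> u) \<bullet> (id1 L B \<rhd> \<gamma>) \<bullet> inv2 L (id2 L n)
       \<in> null_iso L N n (til N (id1 L (tgt L n0)) n0 u)"
    using K n nN idn sb unfolding kernel2_def by metis
  note ku = comp1_hom[OF u k]
  have \<alpha>u: "\<alpha> \<lhd> u \<in> iso2 L (k \<odot> u) (n0 \<odot> u)" using iso2_rwhisker[OF \<alpha> u k] .
  define c where "c = (\<alpha> \<lhd> u) \<bullet> \<gamma>"
  have ch: "c \<in> iso2 L n (n0 \<odot> u)" unfolding c_def using iso2_vcomp[OF \<gamma> \<alpha>u] .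
  have "c \<in> zero_null2 L Z"
    using c0 nun0[OF u] hcomp_id_left[OF n iso2D[OF \<gamma>]] vcomp_id_left[OF iso2D[OF ch]]
      vcomp_id_right[OF iso2D[OF \<gamma>]] n N2 by (simp add: null_iso_def c_def hom1_def)
  note cn = this
  note ph = \<phi>[folded n_def]
  obtain \<gamma>' where \<gamma>': "\<gamma>' \<in> iso2 L (k \<odot> u) n" "\<gamma>' \<bullet> \<gamma> = id2 L n" "\<gamma> \<bullet> \<gamma>' = id2 L (k \<odot> u)" using \<gamma> by (rule iso2E)
  \<comment> \<open>The twist: the 2-cell presenting k u as null is altered by the automorphism
    under study, and reflection must still answer with a null comparison e.\<close>
  define \<delta> where "\<delta> = \<phi> \<bullet> \<gamma>'"
  have \<delta>: "\<delta> \<in> iso2 L (k \<odot> u) n" unfolding \<delta>_def using iso2_vcomp[OF \<gamma>'(1) ph] .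
  obtain s' \<psi> where s'N: "s' \<in> null1 N" and \<psi>: "\<psi> \<in> iso2 L u s'"
    and e0: "nu N k s' (id1 L X) \<bullet> (k \<rhd> \<psi>) \<bullet> inv2 L \<delta> \<in> null_iso L N n (til N k s' (id1 L X))"
    using R u nN \<delta> unfolding reflects_null_morphisms_def by blast
  have s': "s' \<in> hom1 L X (src L k)" using cell_hom1[OF iso2D[OF \<psi>] u] .
  have k\<psi>: "k \<rhd> \<psi> \<in> iso2 L (k \<odot> u) (k \<odot> s')" using iso2_lwhisker[OF \<psi> u k] .
  define e where "e = (k \<rhd> \<psi>) \<bullet> inv2 L \<delta>"
  have eh: "e \<in> iso2 L n (k \<odot> s')" unfolding e_def using iso2_vcomp[OF inv2_iso2[OF \<delta>] k\<psi>] .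
  have en: "e \<in> zero_null2 L Z"
    using e0 nu til comp1_id_right[OF s'] vcomp_id_left[OF iso2D[OF eh]] N2 by (simp add: null_iso_def e_def)
  obtain t' i' where ti': "t' \<in> hom1 L X Z" "i' \<in> hom1 L Z (src L k)" "s' = i' \<odot> t'"
    using s'N s' N1 null1_iff by (auto simp: hom1_def)
  have \<alpha>s': "\<alpha> \<lhd> s' \<in> iso2 L (k \<odot> s') (n0 \<odot> s')" using iso2_rwhisker[OF \<alpha> s' k] .
  \<comment> \<open>Since \<open>s'\<close> is an actual composite through \<open>Z\<close>, this
    whiskering of \<alpha> is a pasting, although \<alpha> itself need not be null.\<close>
  have "\<alpha> \<lhd> s' = (\<alpha> \<lhd> i') \<lhd> t'"
    using ti' k n0 \<alpha> hcomp_assoc_Cell[of "id2 L t'" "id2 L i'" \<alpha>] hcomp_id2[OF ti'(1,2)]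
      iso2D[OF \<alpha>] by (simp add: hom1_def hom2_def)
  moreover have "\<dots> \<in> zero_null2 L Z"
    using hom2_rwhisker[OF iso2D[OF \<alpha>] ti'(2) k] comp1_hom[OF ti'(2) k] comp1_hom[OF ti'(2) n0] ti'(1) id2_hom1
    by (intro zero_null2.paste) blast+
  ultimately have \<alpha>s'n: "\<alpha> \<lhd> s' \<in> zero_null2 L Z" by simp
  \<comment> \<open>\<open>n0\<close> is \<open>j \<odot> r\<close> with r into \<open>Z\<close>, so
    whiskering by it turns any 2-cell out of u into a pasting.\<close>
  have paste: "n0 \<rhd> \<chi> \<in> zero_null2 L Z \<and> n0 \<rhd> \<chi> = j \<rhd> (r \<rhd> \<chi>)"
    if "\<chi> \<in> hom2 L u w" "w \<in> hom1 L X (src L k)" for \<chi> w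
  proof -
    have "n0 \<rhd> \<chi> = j \<rhd> (r \<rhd> \<chi>)"
      using rj that u lwhisker_lwhisker[of \<chi> r j] by (simp add: hom1_def hom2_def)
    moreover have "\<dots> \<in> zero_null2 L Z"
      using hom2_lwhisker[OF that(1) u rj(1)] comp1_hom[OF u rj(1)] comp1_hom[OF that(2) rj(1)] rj(2) id2_hom1
      by (intro zero_null2.paste) blast+
    ultimately show ?thesis by simp
  qed
  have n0\<psi>: "n0 \<rhd> \<psi> \<in> iso2 L (n0 \<odot> u) (n0 \<odot> s')" using iso2_lwhisker[OF \<psi> u n0] .
  \<comment> \<open>Apart from \<phi> every 2-cell grouped here is null, so solving for \<phi> makes
    \<phi> null.\<close>
  have key: "((\<alpha> \<lhd> s') \<bullet> e) \<bullet> \<phi> = (n0 \<rhd> \<psi>) \<bullet> c"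
  proof -
    have "e \<bullet> \<phi> = (k \<rhd> \<psi>) \<bullet> inv2 L \<delta> \<bullet> \<phi>"
      unfolding e_def using vcomp_assoc[OF iso2D[OF ph] iso2D[OF inv2_iso2[OF \<delta>]] iso2D[OF k\<psi>]] .
    also have "inv2 L \<delta> \<bullet> \<phi> = \<gamma>"
    proof (rule iso2_cancel_left[OF \<delta>])
      show "\<delta> \<bullet> inv2 L \<delta> \<bullet> \<phi> = \<delta> \<bullet> \<gamma>"
        using vcomp_assoc[OF iso2D[OF ph] iso2D[OF inv2_iso2[OF \<delta>]] iso2D[OF \<delta>]] inv2_vcomp[OF \<delta>]
          vcomp_id_left[OF iso2D[OF ph]] vcomp_id_right[OF iso2D[OF ph]] \<gamma>'(2)
          vcomp_assoc[OF iso2D[OF \<gamma>] iso2D[OF \<gamma>'(1)] iso2D[OF ph]] by (simp add: \<delta>_def)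
    qed (use vcomp_hom[OF iso2D[OF ph] iso2D[OF inv2_iso2[OF \<delta>]]] iso2D[OF \<gamma>] in auto)
    finally have "((\<alpha> \<lhd> s') \<bullet> e) \<bullet> \<phi> = (\<alpha> \<lhd> s') \<bullet> (k \<rhd> \<psi>) \<bullet> \<gamma>"
      using vcomp_assoc[OF iso2D[OF ph] iso2D[OF eh] iso2D[OF \<alpha>s']] by simp
    also have "\<dots> = ((\<alpha> \<lhd> s') \<bullet> (k \<rhd> \<psi>)) \<bullet> \<gamma>"
      using vcomp_assoc[OF iso2D[OF \<gamma>] iso2D[OF k\<psi>] iso2D[OF \<alpha>s']] by simp
    also have "\<dots> = ((n0 \<rhd> \<psi>) \<bullet> (\<alpha> \<lhd> u)) \<bullet> \<gamma>"
      using whisker_exchange[OF iso2D[OF \<psi>] iso2D[OF \<alpha>] u k] by simp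
    also have "\<dots> = (n0 \<rhd> \<psi>) \<bullet> c"
      using vcomp_assoc[OF iso2D[OF \<gamma>] iso2D[OF \<alpha>u] iso2D[OF n0\<psi>]] by (simp add: c_def)
    finally show ?thesis .
  qed
  have dc: "dom2 L \<theta> = p \<and> cod2 L \<theta> = q" if "\<theta> \<in> iso2 L p q" for \<theta> p q
    using iso2D[OF that] by (simp add: hom2_def)
  define x where "x = (\<alpha> \<lhd> s') \<bullet> e"
  define y where "y = (n0 \<rhd> \<psi>) \<bullet> c"
  have x: "x \<in> iso2 L n (n0 \<odot> s')" "x \<in> zero_null2 L Z"
    unfolding x_def using iso2_vcomp[OF eh \<alpha>s'] zero_null2.vcomp[OF en \<alpha>s'n] dc[OF eh] dc[OF \<alpha>s'] by auto
  have y: "y \<in> iso2 L n (n0 \<odot> s')" "y \<in> zero_null2 L Z"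
    unfolding y_def using iso2_vcomp[OF ch n0\<psi>] zero_null2.vcomp[OF cn] paste[OF iso2D[OF \<psi>] s'] dc[OF ch] dc[OF n0\<psi>] by auto
  have "\<phi> = inv2 L x \<bullet> y"
  proof (rule iso2_cancel_left[OF x(1) iso2D[OF ph] vcomp_hom[OF iso2D[OF y(1)] iso2D[OF inv2_iso2[OF x(1)]]]])
    show "x \<bullet> \<phi> = x \<bullet> inv2 L x \<bullet> y"
      using key vcomp_assoc[OF iso2D[OF y(1)] iso2D[OF inv2_iso2[OF x(1)]] iso2D[OF x(1)]] inv2_vcomp(2)[OF x(1)]
        vcomp_id_left[OF iso2D[OF y(1)]] by (simp add: x_def y_def)
  qed
  moreover have "inv2 L x \<bullet> y \<in> zero_null2 L Z"
    using zero_null2.vcomp[OF y(2), of "inv2 L x"] zero_null2_iso[OF x(2)] dc[OF inv2_iso2[OF x(1)]] dc[OF y(1)] by auto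
  ultimately have \<phi>n: "\<phi> \<in> zero_null2 L Z" by simp
  \<comment> \<open>Second stage: \<phi> moved to an automorphism of k u. The 2-cell d whose nullity
    lets \<xi> lift along k is \<phi> conjugated by the null c.\<close>
  define \<xi> where "\<xi> = \<gamma> \<bullet> \<phi> \<bullet> \<gamma>'"
  have \<xi>: "\<xi> \<in> hom2 L (k \<odot> u) (k \<odot> u)"
    unfolding \<xi>_def using iso2D[OF iso2_vcomp[OF iso2_vcomp[OF \<gamma>'(1) ph] \<gamma>]] .
  have "inv2 L \<alpha> \<lhd> u \<in> iso2 L (n0 \<odot> u) (k \<odot> u)" using iso2_rwhisker[OF inv2_iso2[OF \<alpha>] u n0] .
  note i\<alpha>u = this
  have "(inv2 L \<alpha> \<lhd> u) \<bullet> (\<alpha> \<lhd> u) = id2 L (k \<odot> u)"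
    using inv2_vcomp(1)[OF \<alpha>] rwhisker_vcomp[of \<alpha> "inv2 L \<alpha>" u] u k n0 iso2D[OF inv2_iso2[OF \<alpha>]] iso2D[OF \<alpha>]
      hcomp_id2[OF u k] by (auto simp: hom1_def hom2_def)
  note inv\<alpha> = this
  define d where "d = (\<alpha> \<lhd> u) \<bullet> \<xi> \<bullet> (inv2 L \<alpha> \<lhd> u)"
  have dh: "d \<in> hom2 L (n0 \<odot> u) (n0 \<odot> u)"
    unfolding d_def using vcomp_hom[OF vcomp_hom[OF iso2D[OF i\<alpha>u] \<xi>] iso2D[OF \<alpha>u]] .
  have "d \<bullet> c = c \<bullet> \<phi>"
  proof -
    have "d \<bullet> c = (\<alpha> \<lhd> u) \<bullet> \<xi> \<bullet> ((inv2 L \<alpha> \<lhd> u) \<bullet> (\<alpha> \<lhd> u)) \<bullet> \<gamma>"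
      unfolding d_def c_def
      using vcomp_assoc[OF vcomp_hom[OF iso2D[OF \<gamma>] iso2D[OF \<alpha>u]] vcomp_hom[OF iso2D[OF i\<alpha>u] \<xi>] iso2D[OF \<alpha>u]]
        vcomp_assoc[OF vcomp_hom[OF iso2D[OF \<gamma>] iso2D[OF \<alpha>u]] iso2D[OF i\<alpha>u] \<xi>]
        vcomp_assoc[OF iso2D[OF \<gamma>] iso2D[OF \<alpha>u] iso2D[OF i\<alpha>u]] by simp
    also have "\<dots> = (\<alpha> \<lhd> u) \<bullet> \<xi> \<bullet> \<gamma>" using inv\<alpha> vcomp_id_left[OF iso2D[OF \<gamma>]] by simp
    also have "\<xi> \<bullet> \<gamma> = \<gamma> \<bullet> \<phi>"
      unfolding \<xi>_def
      using vcomp_assoc[OF iso2D[OF \<gamma>] iso2D[OF iso2_vcomp[OF \<gamma>'(1) ph]] iso2D[OF \<gamma>]]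
        vcomp_assoc[OF iso2D[OF \<gamma>] iso2D[OF \<gamma>'(1)] iso2D[OF ph]] \<gamma>'(2) vcomp_id_right[OF iso2D[OF ph]] by simp
    also have "(\<alpha> \<lhd> u) \<bullet> \<gamma> \<bullet> \<phi> = c \<bullet> \<phi>"
      unfolding c_def using vcomp_assoc[OF iso2D[OF ph] iso2D[OF \<gamma>] iso2D[OF \<alpha>u]] by simp
    finally show ?thesis .
  qed
  then have "d = (c \<bullet> \<phi>) \<bullet> inv2 L c"
    using vcomp_assoc[OF iso2D[OF inv2_iso2[OF ch]] iso2D[OF ch] dh] inv2_vcomp(2)[OF ch] vcomp_id_right[OF dh] by simp
  moreover have "(c \<bullet> \<phi>) \<bullet> inv2 L c \<in> zero_null2 L Z"
    using zero_null2.vcomp[OF conjunct2[OF zero_null2_iso[OF cn]] zero_null2.vcomp[OF \<phi>n cn]]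
      dc[OF inv2_iso2[OF ch]] dc[OF ph] dc[OF ch] dc[OF iso2_vcomp[OF ph ch]] by auto
  ultimately have dn: "d \<in> zero_null2 L Z" by simp
  have "nu N (id1 L (tgt L n0)) n0 u \<bullet> (\<alpha> \<lhd> u) \<bullet> (id1 L B \<rhd> \<xi>) \<bullet> (inv2 L \<alpha> \<lhd> u)
          \<bullet> inv2 L (nu N (id1 L (tgt L n0)) n0 u) = d"
    using nun0[OF u] hcomp_id_left[OF ku \<xi>] vcomp_id_left[OF dh] vcomp_id_right[OF iso2D[OF i\<alpha>u]]
      comp1_hom[OF u n0] by (simp add: d_def hom1_def)
  then obtain \<mu> where mu: "\<mu> \<in> hom2 L u u" "k \<rhd> \<mu> = \<xi>"
    using K u \<xi> dn N2 unfolding kernel2_def by metis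
  \<comment> \<open>2-cells between morphisms into \<open>Z\<close> are unique, so r, hence
    \<open>n0\<close>, and by exchange with \<alpha> also k, cannot distinguish \<mu> from the
    identity.\<close>
  have "r \<rhd> \<mu> = r \<rhd> id2 L u"
    using to_zero_eq[OF hom2_lwhisker[OF mu(1) u rj(1)] hom2_lwhisker[OF id2_hom1[OF u] u rj(1)] comp1_hom[OF u rj(1)]] .
  then have "n0 \<rhd> \<mu> = n0 \<rhd> id2 L u" using paste[OF mu(1) u] paste[OF id2_hom1[OF u] u] by simp
  then have "(\<alpha> \<lhd> u) \<bullet> (k \<rhd> \<mu>) = (\<alpha> \<lhd> u) \<bullet> (k \<rhd> id2 L u)"
    using whisker_exchange[OF mu(1) iso2D[OF \<alpha>] u k] whisker_exchange[OF id2_hom1[OF u] iso2D[OF \<alpha>] u k] by simp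
  then have "k \<rhd> \<mu> = k \<rhd> id2 L u"
    by (rule iso2_cancel_left[OF \<alpha>u hom2_lwhisker[OF mu(1) u k] hom2_lwhisker[OF id2_hom1[OF u] u k]])
  then have "\<xi> = id2 L (k \<odot> u)" using mu(2) hcomp_id2[OF u k] by simp
  then have "\<gamma> \<bullet> \<phi> \<bullet> \<gamma>' = \<gamma> \<bullet> id2 L n \<bullet> \<gamma>'" using \<gamma>' vcomp_id_left[OF iso2D[OF \<gamma>'(1)]] by (simp add: \<xi>_def)
  then have "\<phi> \<bullet> \<gamma>' = id2 L n \<bullet> \<gamma>'"
    using iso2_cancel_left[OF \<gamma> iso2D[OF iso2_vcomp[OF \<gamma>'(1) ph]]] vcomp_id_left[OF iso2D[OF \<gamma>'(1)]] iso2D[OF \<gamma>'(1)] by simp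
  then have "\<phi> = id2 L n" using iso2_cancel_right[OF \<gamma>'(1) iso2D[OF ph] id2_hom1[OF n]] by simp
  then show "\<phi> = id2 L (i \<odot> t)" by (simp add: n_def)
qed

end

section \<open>Orthogonality of 2-cokernels and 2-kernels\<close>

context pointed begin

lemma nullish_rwhisker_invertible:
  assumes "nullish L Z g" "\<alpha> \<in> hom2 L u v" "u \<in> hom1 L (tgt L g) X"
  shows "invertible L (\<alpha> \<lhd> g)"
  using pointed.nullish_lwhisker_invertible[OF pointed_op, of g \<alpha> u v X] assms by simp

lemma zcokernelD:
  assumes "zkernel (op L) Z f c"
  shows "f \<in> Mor L" "c \<in> Mor L" "src L c = tgt L f" "nullish L Z (c \<odot> f)"
    "\<lbrakk>z \<in> hom1 L (tgt L f) X; nullish L Z (z \<odot> f)\<rbrakk> \<Longrightarrow> \<exists>u \<in> hom1 L (tgt L c) X. isomorphic L z (u \<odot> c)"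
    "\<lbrakk>u \<in> hom1 L (tgt L c) X; v \<in> hom1 L (tgt L c) X; \<xi> \<in> hom2 L (u \<odot> c) (v \<odot> c); invertible L (\<xi> \<lhd> f)\<rbrakk>
      \<Longrightarrow> \<exists>!\<mu>. \<mu> \<in> hom2 L u v \<and> \<mu> \<lhd> c = \<xi>"
  using pointed.zkernelD[OF pointed_op assms] by (simp_all)

lemma zcokernel_cofaithful: "zkernel (op L) Z f c \<Longrightarrow> cofaithful1 L c"
  unfolding cofaithful1_def by (rule pointed.zkernel_faithful[OF pointed_op])

lemma cofaithful1D:
  "\<lbrakk>cofaithful1 L e; u \<in> hom1 L (tgt L e) X; v \<in> hom1 L (tgt L e) X; \<alpha> \<in> hom2 L u v; \<beta> \<in> hom2 L u v;
    \<alpha> \<lhd> e = \<beta> \<lhd> e\<rbrakk> \<Longrightarrow> \<alpha> = \<beta>"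
  unfolding cofaithful1_def faithful1_def by simp

lemma faithful1D:
  "\<lbrakk>faithful1 L m; u \<in> hom1 L X (src L m); v \<in> hom1 L X (src L m); \<alpha> \<in> hom2 L u v; \<beta> \<in> hom2 L u v;
    m \<rhd> \<alpha> = m \<rhd> \<beta>\<rbrakk> \<Longrightarrow> \<alpha> = \<beta>"
  unfolding faithful1_def by blast

text \<open>The inverse of \<xi> satisfies the same invertibility premise as \<xi>, and faithfulness
  of k makes the two lifts mutually inverse.\<close>

lemma zkernel_iso2_lift:
  assumes "zkernel L Z f k" "u \<in> hom1 L X (src L k)" "v \<in> hom1 L X (src L k)" "\<xi> \<in> iso2 L (k \<odot> u) (k \<odot> v)"
  obtains \<mu> where "\<mu> \<in> iso2 L u v" "k \<rhd> \<mu> = \<xi>"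
proof -
  note z = zkernelD[OF assms(1)]
  have k: "k \<in> hom1 L (src L k) (src L f)" and f: "f \<in> hom1 L (src L f) (tgt L f)" using z by (auto simp: hom1_def)
  obtain \<xi>' where x: "\<xi>' \<in> iso2 L (k \<odot> v) (k \<odot> u)" "\<xi>' \<bullet> \<xi> = id2 L (k \<odot> u)" "\<xi> \<bullet> \<xi>' = id2 L (k \<odot> v)"
    using assms(4) by (rule iso2E)
  have "invertible L (f \<rhd> \<xi>)" "invertible L (f \<rhd> \<xi>')"
    using iso2_lwhisker[OF assms(4) comp1_hom[OF assms(2) k] f] iso2_lwhisker[OF x(1) comp1_hom[OF assms(3) k] f]
    by (auto simp: iso2_iff)
  then obtain \<mu> \<mu>' where mu: "\<mu> \<in> hom2 L u v" "k \<rhd> \<mu> = \<xi>" "\<mu>' \<in> hom2 L v u" "k \<rhd> \<mu>' = \<xi>'"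
    using z(6)[OF assms(2,3) iso2D[OF assms(4)]] z(6)[OF assms(3,2) iso2D[OF x(1)]] by blast
  have "k \<rhd> (\<mu>' \<bullet> \<mu>) = k \<rhd> id2 L u" "k \<rhd> (\<mu> \<bullet> \<mu>') = k \<rhd> id2 L v"
    using mu x assms(2,3) k hcomp_id2[OF assms(2) k] hcomp_id2[OF assms(3) k] lwhisker_vcomp[of \<mu> \<mu>' k]
      lwhisker_vcomp[of \<mu>' \<mu> k] by (simp_all add: hom1_def hom2_def)
  then have "\<mu>' \<bullet> \<mu> = id2 L u" "\<mu> \<bullet> \<mu>' = id2 L v"
    using faithful1D[OF zkernel_faithful[OF assms(1)]] assms(2,3) mu(1,3) vcomp_hom id2_hom1 by blast+
  then show ?thesis using that iso2I mu by blast
qed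

lemma zcokernel_iso2_lift:
  assumes "zkernel (op L) Z f c" "u \<in> hom1 L (tgt L c) X" "v \<in> hom1 L (tgt L c) X" "\<xi> \<in> iso2 L (u \<odot> c) (v \<odot> c)"
  obtains \<mu> where "\<mu> \<in> iso2 L u v" "\<mu> \<lhd> c = \<xi>"
  using pointed.zkernel_iso2_lift[OF pointed_op assms(1), of u X v \<xi>] assms(2-4) by auto

text \<open>One of the closure axioms of a factorization system: 1-cells are moved through i by its
  quasi-inverse g, 2-cells by \<open>equivalence1_full\<close>.\<close>

lemma zkernel_comp_equivalence:
  assumes "zkernel L Z f m" "equivalence1 L i" "tgt L i = src L m"
  shows "zkernel L Z f (m \<odot> i)"
proof -
  note z = zkernelD[OF assms(1)]
  obtain g \<eta> \<epsilon> where g: "g \<in> hom1 L (tgt L i) (src L i)" and \<epsilon>: "\<epsilon> \<in> iso2 L (i \<odot> g) (id1 L (tgt L i))"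
    and i: "i \<in> hom1 L (src L i) (tgt L i)"
    using assms(2) by (rule equivalence1E)
  note [simp] = comp1_assoc_Mor
  have mi: "m \<odot> i \<in> Mor L" "src L (m \<odot> i) = src L i" "tgt L (m \<odot> i) = src L f"
    using z i assms(3) by (auto simp: hom1_def)
  show ?thesis unfolding zkernel_def mi
  proof (intro conjI allI impI)
    show "f \<in> Mor L" "src L f = src L f" "m \<odot> i \<in> Mor L" using z mi by auto
    have "nullish L Z ((f \<odot> m) \<odot> i)" using nullish_rwhisker[OF z(4), of i] z i assms(3) by (simp add: hom1_def)
    then show "nullish L Z (f \<odot> m \<odot> i)" using z i assms(3) by (simp add: hom1_def)
  next
    fix X x assume x: "x \<in> hom1 L X (src L f) \<and> nullish L Z (f \<odot> x)"
    then obtain u where u: "u \<in> hom1 L X (src L m)" "isomorphic L x (m \<odot> u)" using z(5) by blast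
    have "isomorphic L u (i \<odot> g \<odot> u)"
    proof -
      have "isomorphic L (id1 L (tgt L i)) (i \<odot> g)" using isomorphic_sym[OF isomorphicI[OF \<epsilon>]] .
      then have "isomorphic L (id1 L (tgt L i) \<odot> u) ((i \<odot> g) \<odot> u)"
        using u i g assms(3) z(2) by (intro isomorphic_rwhisker) (auto simp: hom1_def)
      then show ?thesis using u i g assms(3) z(2) by (simp add: hom1_def comp1_id_Mor)
    qed
    then have "isomorphic L (m \<odot> u) (m \<odot> i \<odot> g \<odot> u)"
      using u z by (intro isomorphic_lwhisker) (auto simp: hom1_def)
    then have "isomorphic L x ((m \<odot> i) \<odot> (g \<odot> u))"
      using isomorphic_trans[OF u(2)] u i g z assms(3) by (simp add: hom1_def)
    moreover have "g \<odot> u \<in> hom1 L X (src L i)" using u g assms(3) by (auto simp: hom1_def)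
    ultimately show "\<exists>u\<in>hom1 L X (src L i). isomorphic L x ((m \<odot> i) \<odot> u)" by blast
  next
    fix X u v \<xi>
    assume *: "u \<in> hom1 L X (src L i) \<and> v \<in> hom1 L X (src L i) \<and> \<xi> \<in> hom2 L ((m \<odot> i) \<odot> u) ((m \<odot> i) \<odot> v)
      \<and> invertible L (f \<rhd> \<xi>)"
    have iu: "i \<odot> u \<in> hom1 L X (src L m)" "i \<odot> v \<in> hom1 L X (src L m)"
      and as: "(m \<odot> i) \<odot> u = m \<odot> i \<odot> u" "(m \<odot> i) \<odot> v = m \<odot> i \<odot> v"
      using * i z(2) assms(3) by (auto simp: hom1_def)
    then have ex: "\<exists>!\<nu>. \<nu> \<in> hom2 L (i \<odot> u) (i \<odot> v) \<and> m \<rhd> \<nu> = \<xi>" using z(6)[OF iu, of \<xi>] * by simp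
    have eq: "m \<rhd> (i \<rhd> \<mu>) = (m \<odot> i) \<rhd> \<mu>" if "\<mu> \<in> hom2 L u v" for \<mu>
      using that * i z(2) assms(3) lwhisker_lwhisker[of \<mu> i m] by (simp add: hom1_def hom2_def)
    obtain \<nu> where nu: "\<nu> \<in> hom2 L (i \<odot> u) (i \<odot> v)" "m \<rhd> \<nu> = \<xi>" using ex by blast
    obtain \<mu> where mu: "\<mu> \<in> hom2 L u v" "i \<rhd> \<mu> = \<nu>" using equivalence1_full[OF assms(2) _ _ nu(1)] * by blast
    show "\<exists>!\<mu>. \<mu> \<in> hom2 L u v \<and> (m \<odot> i) \<rhd> \<mu> = \<xi>"
    proof (rule ex1I[of _ \<mu>])
      show "\<mu> \<in> hom2 L u v \<and> (m \<odot> i) \<rhd> \<mu> = \<xi>" using mu nu eq[OF mu(1)] by simp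
      fix \<mu>' assume m': "\<mu>' \<in> hom2 L u v \<and> (m \<odot> i) \<rhd> \<mu>' = \<xi>"
      then have "i \<rhd> \<mu>' \<in> hom2 L (i \<odot> u) (i \<odot> v) \<and> m \<rhd> (i \<rhd> \<mu>') = \<xi>"
        using hom2_lwhisker[OF _ _ i] * eq by auto
      then have "i \<rhd> \<mu>' = \<nu>" using ex nu by blast
      then show "\<mu>' = \<mu>" using equivalence1_full[OF assms(2) _ _ nu(1)] * mu m' by blast
    qed
  qed
qed

text \<open>A 2-cell \<xi> over \<open>m'\<close> is carried by \<theta> to a 2-cell \<zeta> over m.
  The conjugation preserves invertibility after f and matches the lifts of \<zeta> with those of
  \<xi>.\<close>

lemma zkernel_isomorphic:
  assumes "zkernel L Z f m" "isomorphic L m m'"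
  shows "zkernel L Z f m'"
proof -
  note z = zkernelD[OF assms(1)]
  have m': "m' \<in> Mor L" "src L m' = src L m" "tgt L m' = src L f" using isomorphic_Mor[OF assms(2)] z by auto
  have mh: "m \<in> hom1 L (src L m) (src L f)" "m' \<in> hom1 L (src L m) (src L f)" "f \<in> hom1 L (src L f) (tgt L f)"
    using z m' by (auto simp: hom1_def)
  obtain \<theta> where th: "\<theta> \<in> iso2 L m m'" using assms(2) by (rule isomorphicE)
  show ?thesis unfolding zkernel_def m'
  proof (intro conjI allI impI)
    show "f \<in> Mor L" "m' \<in> Mor L" "src L f = src L f" using z m' by auto
    show "nullish L Z (f \<odot> m')" using nullish_cong[OF isomorphic_lwhisker[OF assms(2) z(1)]] z by simp
  next
    fix X x assume x: "x \<in> hom1 L X (src L f) \<and> nullish L Z (f \<odot> x)"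
    then obtain u where u: "u \<in> hom1 L X (src L m)" "isomorphic L x (m \<odot> u)" using z(5) by blast
    then have "isomorphic L (m \<odot> u) (m' \<odot> u)"
      using assms(2) by (intro isomorphic_rwhisker) (auto simp: hom1_def)
    then show "\<exists>u\<in>hom1 L X (src L m). isomorphic L x (m' \<odot> u)" using u isomorphic_trans by blast
  next
    fix X u v \<xi>
    assume *: "u \<in> hom1 L X (src L m) \<and> v \<in> hom1 L X (src L m) \<and> \<xi> \<in> hom2 L (m' \<odot> u) (m' \<odot> v) \<and> invertible L (f \<rhd> \<xi>)"
    then have u: "u \<in> hom1 L X (src L m)" and v: "v \<in> hom1 L X (src L m)" and xi: "\<xi> \<in> hom2 L (m' \<odot> u) (m' \<odot> v)" by auto
    have tu: "\<theta> \<lhd> u \<in> iso2 L (m \<odot> u) (m' \<odot> u)" and tv: "\<theta> \<lhd> v \<in> iso2 L (m \<odot> v) (m' \<odot> v)"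
      using iso2_rwhisker[OF th _ mh(1)] u v by auto
    obtain \<chi> where ch: "\<chi> \<in> iso2 L (m' \<odot> v) (m \<odot> v)" "\<chi> \<bullet> (\<theta> \<lhd> v) = id2 L (m \<odot> v)" "(\<theta> \<lhd> v) \<bullet> \<chi> = id2 L (m' \<odot> v)"
      using tv by (rule iso2E)
    define \<zeta> where "\<zeta> = \<chi> \<bullet> \<xi> \<bullet> (\<theta> \<lhd> u)"
    have ze: "\<zeta> \<in> hom2 L (m \<odot> u) (m \<odot> v)" unfolding \<zeta>_def using vcomp_hom[OF vcomp_hom[OF iso2D[OF tu] xi] iso2D[OF ch(1)]] .
    have zeq: "(\<theta> \<lhd> v) \<bullet> \<zeta> = \<xi> \<bullet> (\<theta> \<lhd> u)"
      unfolding \<zeta>_def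
      using vcomp_assoc[OF vcomp_hom[OF iso2D[OF tu] xi] iso2D[OF ch(1)] iso2D[OF tv]] ch(3)
        vcomp_id_left[OF vcomp_hom[OF iso2D[OF tu] xi]] by simp
    have mu: "m \<odot> u \<in> hom1 L X (src L f)" "m \<odot> v \<in> hom1 L X (src L f)" "m' \<odot> u \<in> hom1 L X (src L f)"
      "m' \<odot> v \<in> hom1 L X (src L f)" using comp1_hom u v mh by auto
    have "invertible L (f \<rhd> \<zeta>) \<longleftrightarrow> invertible L (f \<rhd> \<xi>)"
    proof (rule invertible_conj)
      show "f \<rhd> (\<theta> \<lhd> u) \<in> iso2 L (f \<odot> m \<odot> u) (f \<odot> m' \<odot> u)" "f \<rhd> (\<theta> \<lhd> v) \<in> iso2 L (f \<odot> m \<odot> v) (f \<odot> m' \<odot> v)"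
        using iso2_lwhisker[OF tu mu(1) mh(3)] iso2_lwhisker[OF tv mu(2) mh(3)] by auto
      show "f \<rhd> \<zeta> \<in> hom2 L (f \<odot> m \<odot> u) (f \<odot> m \<odot> v)" "f \<rhd> \<xi> \<in> hom2 L (f \<odot> m' \<odot> u) (f \<odot> m' \<odot> v)"
        using hom2_lwhisker[OF ze mu(1) mh(3)] hom2_lwhisker[OF xi mu(3) mh(3)] by auto
      show "(f \<rhd> (\<theta> \<lhd> v)) \<bullet> (f \<rhd> \<zeta>) = (f \<rhd> \<xi>) \<bullet> (f \<rhd> (\<theta> \<lhd> u))"
        using lwhisker_vcomp[of \<zeta> "\<theta> \<lhd> v" f] lwhisker_vcomp[of "\<theta> \<lhd> u" \<xi> f] zeq ze xi iso2D[OF tu] iso2D[OF tv] mu mh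
        by (simp add: hom1_def hom2_def)
    qed
    then have ex: "\<exists>!\<mu>. \<mu> \<in> hom2 L u v \<and> m \<rhd> \<mu> = \<zeta>" using z(6)[OF u v ze] * by blast
    moreover have "m \<rhd> \<mu> = \<zeta> \<longleftrightarrow> m' \<rhd> \<mu> = \<xi>" if "\<mu> \<in> hom2 L u v" for \<mu>
    proof -
      have e: "(\<theta> \<lhd> v) \<bullet> (m \<rhd> \<mu>) = (m' \<rhd> \<mu>) \<bullet> (\<theta> \<lhd> u)"
        using whisker_exchange[OF that iso2D[OF th] u mh(1)] .
      show ?thesis
        using e zeq iso2_cancel_left[OF tv hom2_lwhisker[OF that u mh(1)] ze]
          iso2_cancel_right[OF tu hom2_lwhisker[OF that u mh(2)] xi] by auto
    qed
    ultimately show "\<exists>!\<mu>. \<mu> \<in> hom2 L u v \<and> m' \<rhd> \<mu> = \<xi>" by blast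
  qed
qed

end

context rigid_pointed begin

text \<open>m reflects nullity, so s x is null together with t e x, and s extends along e, the
  cokernel of x; the other triangle is then lifted along e. For 2-cells, the 2-cell \<kappa> forced
  between the composites with e descends along e once it is invertible after whiskering with x, and
  this is tested after applying the faithful m.\<close>

lemma zkernel_orthogonal:
  assumes e: "zkernel (op L) Z x e" and m: "zkernel L Z y m"
  shows "orthogonal L e m"
  unfolding orthogonal_def
proof (intro conjI ballI allI impI)
  note ze = zcokernelD[OF e] and zm = zkernelD[OF m]
  have eh: "e \<in> hom1 L (src L e) (tgt L e)" and mh: "m \<in> hom1 L (src L m) (tgt L m)"
    and xh: "x \<in> hom1 L (src L x) (src L e)"
    using ze zm by (auto simp: hom1_def)
  fix s t \<phi>
  assume s: "s \<in> hom1 L (src L e) (src L m)" and t: "t \<in> hom1 L (tgt L e) (tgt L m)"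
    and \<phi>: "\<phi> \<in> iso2 L (m \<odot> s) (t \<odot> e)"
  have "nullish L Z (t \<odot> e \<odot> x)"
    using nullish_lwhisker[OF ze(4), of t] t ze by (auto simp: hom1_def)
  moreover have "isomorphic L ((m \<odot> s) \<odot> x) ((t \<odot> e) \<odot> x)"
    using isomorphicI[OF \<phi>] s mh ze by (intro isomorphic_rwhisker) (auto simp: hom1_def)
  moreover have "(m \<odot> s) \<odot> x = m \<odot> s \<odot> x" "(t \<odot> e) \<odot> x = t \<odot> e \<odot> x"
    using comp1_assoc[OF xh s mh] comp1_assoc[OF xh eh t] by auto
  ultimately have "nullish L Z (m \<odot> s \<odot> x)" using nullish_cong by simp
  then have "nullish L Z (s \<odot> x)" using zkernel_reflects_nullish[OF m comp1_hom[OF xh s]] by blast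
  moreover have "s \<in> hom1 L (tgt L x) (src L m)" using s ze(3) by simp
  ultimately obtain d \<sigma> where d: "d \<in> hom1 L (tgt L e) (src L m)" and \<sigma>: "\<sigma> \<in> iso2 L s (d \<odot> e)"
    using ze(5) isomorphicE by metis
  have m\<sigma>: "m \<rhd> \<sigma> \<in> iso2 L (m \<odot> s) (m \<odot> d \<odot> e)" using iso2_lwhisker[OF \<sigma> s mh] .
  obtain \<sigma>' where \<sigma>': "\<sigma>' \<in> iso2 L (m \<odot> d \<odot> e) (m \<odot> s)" "\<sigma>' \<bullet> (m \<rhd> \<sigma>) = id2 L (m \<odot> s)" using m\<sigma> by (rule iso2E)
  have "\<phi> \<bullet> \<sigma>' \<in> iso2 L ((m \<odot> d) \<odot> e) (t \<odot> e)"
    using iso2_vcomp[OF \<sigma>'(1) \<phi>] comp1_assoc[OF eh d mh] by simp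
  then obtain \<rho> where \<rho>: "\<rho> \<in> iso2 L (m \<odot> d) t" "\<rho> \<lhd> e = \<phi> \<bullet> \<sigma>'"
    by (rule zcokernel_iso2_lift[OF e comp1_hom[OF d mh] t])
  have "(\<rho> \<lhd> e) \<bullet> (m \<rhd> \<sigma>) = \<phi>"
    using \<rho>(2) \<sigma>'(2) vcomp_assoc[OF iso2D[OF m\<sigma>] iso2D[OF \<sigma>'(1)] iso2D[OF \<phi>]] vcomp_id_right[OF iso2D[OF \<phi>]] by simp
  then show "\<exists>d \<sigma> \<rho>. filling L e m s t \<phi> d \<sigma> \<rho>" using s t \<phi> d \<sigma> \<rho> unfolding filling_def by metis
next
  note ze = zcokernelD[OF e] and zm = zkernelD[OF m]
  have eh: "e \<in> hom1 L (src L e) (tgt L e)" and mh: "m \<in> hom1 L (src L m) (tgt L m)"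
    and xh: "x \<in> hom1 L (src L x) (src L e)"
    using ze zm by (auto simp: hom1_def)
  fix s t \<phi> d \<sigma> \<rho> s' t' \<phi>' d' \<sigma>' \<rho>' \<xi> \<mu>
  assume A: "filling L e m s t \<phi> d \<sigma> \<rho> \<and> filling L e m s' t' \<phi>' d' \<sigma>' \<rho>' \<and>
        \<xi> \<in> hom2 L s s' \<and> \<mu> \<in> hom2 L t t' \<and> \<phi>' \<bullet> (m \<rhd> \<xi>) = (\<mu> \<lhd> e) \<bullet> \<phi>"
  then have s: "s \<in> hom1 L (src L e) (src L m)" and t: "t \<in> hom1 L (tgt L e) (tgt L m)"
    and d: "d \<in> hom1 L (tgt L e) (src L m)" and \<sigma>: "\<sigma> \<in> iso2 L s (d \<odot> e)" and \<rho>: "\<rho> \<in> iso2 L (m \<odot> d) t"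
    and \<phi>: "\<phi> = (\<rho> \<lhd> e) \<bullet> (m \<rhd> \<sigma>)"
    and s': "s' \<in> hom1 L (src L e) (src L m)" and t': "t' \<in> hom1 L (tgt L e) (tgt L m)"
    and d': "d' \<in> hom1 L (tgt L e) (src L m)" and \<sigma>': "\<sigma>' \<in> iso2 L s' (d' \<odot> e)" and \<rho>': "\<rho>' \<in> iso2 L (m \<odot> d') t'"
    and \<phi>': "\<phi>' = (\<rho>' \<lhd> e) \<bullet> (m \<rhd> \<sigma>')"
    and \<xi>: "\<xi> \<in> hom2 L s s'" and \<mu>: "\<mu> \<in> hom2 L t t'" and eq: "\<phi>' \<bullet> (m \<rhd> \<xi>) = (\<mu> \<lhd> e) \<bullet> \<phi>"
    by (auto simp: filling_def)
  note T = s t d iso2D[OF \<sigma>] iso2D[OF \<rho>] s' t' d' iso2D[OF \<sigma>'] iso2D[OF \<rho>'] \<xi> \<mu> eh mh xh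
  have T': "\<sigma> \<in> Cell L" "dom2 L \<sigma> = s" "cod2 L \<sigma> = d \<odot> e" "\<sigma>' \<in> Cell L" "dom2 L \<sigma>' = s'" "cod2 L \<sigma>' = d' \<odot> e"
    "\<rho> \<in> Cell L" "dom2 L \<rho> = m \<odot> d" "cod2 L \<rho> = t" "\<rho>' \<in> Cell L" "dom2 L \<rho>' = m \<odot> d'" "cod2 L \<rho>' = t'"
    "\<xi> \<in> Cell L" "dom2 L \<xi> = s" "cod2 L \<xi> = s'" "\<mu> \<in> Cell L" "dom2 L \<mu> = t" "cod2 L \<mu> = t'"
    "s \<in> Mor L" "t \<in> Mor L" "d \<in> Mor L" "s' \<in> Mor L" "t' \<in> Mor L" "d' \<in> Mor L" "e \<in> Mor L" "m \<in> Mor L" "x \<in> Mor L"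
    "src L s = src L e" "tgt L s = src L m" "src L s' = src L e" "tgt L s' = src L m"
    "src L t = tgt L e" "tgt L t = tgt L m" "src L t' = tgt L e" "tgt L t' = tgt L m"
    "src L d = tgt L e" "tgt L d = src L m" "src L d' = tgt L e" "tgt L d' = src L m" "tgt L x = src L e"
    using T by (auto simp: hom1_def hom2_def)
  \<comment> \<open>Compatibility with \<sigma> and \<open>\<sigma>'\<close> forces the filler,
    whiskered with e, to be this 2-cell.\<close>
  define \<kappa> where "\<kappa> = \<sigma>' \<bullet> \<xi> \<bullet> inv2 L \<sigma>"
  have \<kappa>: "\<kappa> \<in> hom2 L (d \<odot> e) (d' \<odot> e)"
    unfolding \<kappa>_def using vcomp_hom[OF vcomp_hom[OF iso2D[OF inv2_iso2[OF \<sigma>]] \<xi>] iso2D[OF \<sigma>']] .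
  have \<kappa>\<sigma>: "\<kappa> \<bullet> \<sigma> = \<sigma>' \<bullet> \<xi>"
    unfolding \<kappa>_def
    using vcomp_assoc[OF iso2D[OF \<sigma>] vcomp_hom[OF iso2D[OF inv2_iso2[OF \<sigma>]] \<xi>] iso2D[OF \<sigma>']]
      vcomp_assoc[OF iso2D[OF \<sigma>] iso2D[OF inv2_iso2[OF \<sigma>]] \<xi>] inv2_vcomp[OF \<sigma>] vcomp_id_right[OF \<xi>] by simp
  have K: "\<kappa> \<in> Cell L" "dom2 L \<kappa> = d \<odot> e" "cod2 L \<kappa> = d' \<odot> e" using \<kappa> by (auto simp: hom2_def)
  have de: "d \<odot> e \<in> hom1 L (src L e) (src L m)" "d' \<odot> e \<in> hom1 L (src L e) (src L m)"
    using comp1_hom[OF eh d] comp1_hom[OF eh d'] by auto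
  have m\<sigma>: "m \<rhd> \<sigma> \<in> iso2 L (m \<odot> s) (m \<odot> d \<odot> e)" using iso2_lwhisker[OF \<sigma> s mh] .
  have m\<kappa>: "(\<rho>' \<lhd> e) \<bullet> (m \<rhd> \<kappa>) = (\<mu> \<bullet> \<rho>) \<lhd> e"
  proof (rule iso2_cancel_right[OF m\<sigma>])
    show "(\<rho>' \<lhd> e) \<bullet> (m \<rhd> \<kappa>) \<in> hom2 L (m \<odot> d \<odot> e) (t' \<odot> e)" "(\<mu> \<bullet> \<rho>) \<lhd> e \<in> hom2 L (m \<odot> d \<odot> e) (t' \<odot> e)"
      using T' K by (simp_all add: hom2_def comp1_assoc_Mor)
    have "((\<rho>' \<lhd> e) \<bullet> (m \<rhd> \<kappa>)) \<bullet> (m \<rhd> \<sigma>) = (\<rho>' \<lhd> e) \<bullet> (m \<rhd> (\<kappa> \<bullet> \<sigma>))"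
      using T' K by (simp add: cell_nf)
    also have "\<dots> = \<phi>' \<bullet> (m \<rhd> \<xi>)" unfolding \<kappa>\<sigma> \<phi>' using T' by (simp add: cell_nf)
    also have "\<dots> = ((\<mu> \<bullet> \<rho>) \<lhd> e) \<bullet> (m \<rhd> \<sigma>)" unfolding eq \<phi> using T' by (simp add: cell_nf)
    finally show "((\<rho>' \<lhd> e) \<bullet> (m \<rhd> \<kappa>)) \<bullet> (m \<rhd> \<sigma>) = ((\<mu> \<bullet> \<rho>) \<lhd> e) \<bullet> (m \<rhd> \<sigma>)" .
  qed
  have nx: "nullish L Z (e \<odot> x)" using ze(4) .
  have dn: "nullish L Z (h \<odot> e \<odot> x)" if "h \<in> hom1 L (tgt L e) B" for h B
    using nullish_lwhisker[OF nx, of h] that T' by (auto simp: hom1_def)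
  \<comment> \<open>After m, this 2-cell is conjugate to a whiskering by the nullish e x, and such
    whiskerings are always invertible.\<close>
  have "invertible L (m \<rhd> (\<kappa> \<lhd> x))"
  proof -
    have "invertible L (m \<rhd> (\<kappa> \<lhd> x)) \<longleftrightarrow> invertible L ((\<mu> \<bullet> \<rho>) \<lhd> (e \<odot> x))"
    proof (rule invertible_conj)
      show "id2 L (m \<odot> d \<odot> e \<odot> x) \<in> iso2 L (m \<odot> d \<odot> e \<odot> x) (m \<odot> d \<odot> e \<odot> x)" using T' by (intro iso2_id) simp
      show "\<rho>' \<lhd> (e \<odot> x) \<in> iso2 L (m \<odot> d' \<odot> e \<odot> x) (t' \<odot> e \<odot> x)"
        using iso2_rwhisker[OF \<rho>' comp1_hom[OF xh eh] comp1_hom[OF d' mh]] T' by (simp add: comp1_assoc_Mor)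
      show "m \<rhd> (\<kappa> \<lhd> x) \<in> hom2 L (m \<odot> d \<odot> e \<odot> x) (m \<odot> d' \<odot> e \<odot> x)"
        "(\<mu> \<bullet> \<rho>) \<lhd> (e \<odot> x) \<in> hom2 L (m \<odot> d \<odot> e \<odot> x) (t' \<odot> e \<odot> x)"
        using T' K by (simp_all add: hom2_def comp1_assoc_Mor)
      have "(\<rho>' \<lhd> (e \<odot> x)) \<bullet> (m \<rhd> (\<kappa> \<lhd> x)) = ((\<rho>' \<lhd> e) \<bullet> (m \<rhd> \<kappa>)) \<lhd> x"
        using T' K by (simp add: cell_nf)
      also have "\<dots> = (\<mu> \<bullet> \<rho>) \<lhd> (e \<odot> x)" unfolding m\<kappa> using T' by (simp add: cell_nf)
      finally show "(\<rho>' \<lhd> (e \<odot> x)) \<bullet> (m \<rhd> (\<kappa> \<lhd> x)) = ((\<mu> \<bullet> \<rho>) \<lhd> (e \<odot> x)) \<bullet> id2 L (m \<odot> d \<odot> e \<odot> x)"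
        using T' by (simp add: cell_nf)
    qed
    moreover have "invertible L ((\<mu> \<bullet> \<rho>) \<lhd> (e \<odot> x))"
      using nullish_rwhisker_invertible[OF nx, of "\<mu> \<bullet> \<rho>" "m \<odot> d" t'] T' by (simp add: hom1_def hom2_def)
    ultimately show ?thesis by blast
  qed
  moreover have "\<kappa> \<lhd> x \<in> hom2 L (d \<odot> e \<odot> x) (d' \<odot> e \<odot> x)" using T' K by (simp add: hom2_def comp1_assoc_Mor)
  moreover have "d \<odot> e \<odot> x \<in> hom1 L (src L x) (src L m)" using T' by (simp add: hom1_def)
  ultimately have "invertible L (\<kappa> \<lhd> x)"
    using faithful_reflects_invertible[OF zkernel_faithful[OF m]] dn[OF d] dn[OF d'] by blast
  then obtain \<iota> where \<iota>: "\<iota> \<in> hom2 L d d'" "\<iota> \<lhd> e = \<kappa>" using ze(6)[OF d d' \<kappa>] by blast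
  have I: "\<iota> \<in> Cell L" "dom2 L \<iota> = d" "cod2 L \<iota> = d'" using \<iota> by (auto simp: hom2_def)
  show "\<exists>!\<iota>. \<iota> \<in> hom2 L d d' \<and> \<rho>' \<bullet> (m \<rhd> \<iota>) = \<mu> \<bullet> \<rho> \<and> (\<iota> \<lhd> e) \<bullet> \<sigma> = \<sigma>' \<bullet> \<xi>"
  proof (rule ex1I[of _ \<iota>], intro conjI)
    show "\<iota> \<in> hom2 L d d'" "(\<iota> \<lhd> e) \<bullet> \<sigma> = \<sigma>' \<bullet> \<xi>" using \<iota> \<kappa>\<sigma> by auto
    \<comment> \<open>The condition over t is known after whiskering with e, and e is
      cofaithful.\<close>
    show "\<rho>' \<bullet> (m \<rhd> \<iota>) = \<mu> \<bullet> \<rho>"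
    proof (rule cofaithful1D[OF zcokernel_cofaithful[OF e]])
      show "m \<odot> d \<in> hom1 L (tgt L e) (tgt L m)" "t' \<in> hom1 L (tgt L e) (tgt L m)" using T' by (auto simp: hom1_def)
      show "\<rho>' \<bullet> (m \<rhd> \<iota>) \<in> hom2 L (m \<odot> d) t'" "\<mu> \<bullet> \<rho> \<in> hom2 L (m \<odot> d) t'" using T' I by (auto simp: hom2_def)
      have "(\<rho>' \<bullet> (m \<rhd> \<iota>)) \<lhd> e = (\<rho>' \<lhd> e) \<bullet> (m \<rhd> (\<iota> \<lhd> e))" using T' I by (simp add: cell_nf)
      then show "(\<rho>' \<bullet> (m \<rhd> \<iota>)) \<lhd> e = (\<mu> \<bullet> \<rho>) \<lhd> e" using m\<kappa> \<iota>(2) by simp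
    qed
  next
    fix \<iota>' assume *: "\<iota>' \<in> hom2 L d d' \<and> \<rho>' \<bullet> (m \<rhd> \<iota>') = \<mu> \<bullet> \<rho> \<and> (\<iota>' \<lhd> e) \<bullet> \<sigma> = \<sigma>' \<bullet> \<xi>"
    then have "\<iota>' \<lhd> e = \<iota> \<lhd> e"
      using iso2_cancel_right[OF \<sigma> hom2_rwhisker[OF _ eh d] \<kappa>] \<kappa>\<sigma> \<iota>(2) by metis
    then show "\<iota>' = \<iota>" using cofaithful1D[OF zcokernel_cofaithful[OF e] d d'] * \<iota>(1) by blast
  qed
qed

end

section \<open>Biequivalences from locally faithful correspondences\<close>

lemma pseudofunctorD:
  assumes "pseudofunctor X Y F"
  shows "A \<in> Ob X \<Longrightarrow> F0 F A \<in> Ob Y" "f \<in> hom1 X A B \<Longrightarrow> F1 F f \<in> hom1 Y (F0 F A) (F0 F B)"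
    "\<alpha> \<in> hom2 X f g \<Longrightarrow> F2 F \<alpha> \<in> hom2 Y (F1 F f) (F1 F g)"
    "A \<in> Ob X \<Longrightarrow> Funit F A \<in> iso2 Y (id1 Y (F0 F A)) (F1 F (id1 X A))"
    "\<lbrakk>f \<in> hom1 X A B; g \<in> hom1 X B C\<rbrakk> \<Longrightarrow> Fcomp F g f \<in> iso2 Y (F1 F g \<odot>\<^bsub>Y\<^esub> F1 F f) (F1 F (g \<odot>\<^bsub>X\<^esub> f))"
    "f \<in> Mor X \<Longrightarrow> F2 F (id2 X f) = id2 Y (F1 F f)"
    "\<lbrakk>\<alpha> \<in> hom2 X f g; \<beta> \<in> hom2 X g h\<rbrakk> \<Longrightarrow> F2 F (\<beta> \<bullet>\<^bsub>X\<^esub> \<alpha>) = F2 F \<beta> \<bullet>\<^bsub>Y\<^esub> F2 F \<alpha>"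
  using assms unfolding pseudofunctor_def by simp_all

text \<open>P is a strict 2-functor, stored as a \<open>psfun\<close> with identity coherence
  2-cells so that \<open>comp_psfun\<close> and \<open>eq_psfun\<close> apply to it. It stands for
  dom and cod.\<close>

locale over_base = base: two_category L + two_category X
  for L :: "('o, 'a, 'c) twocat" and X :: "('o1, 'a1, 'c1) twocat" (structure) +
  fixes P :: "('o1, 'a1, 'c1, 'o, 'a, 'c) psfun"
  assumes P0: "A \<in> Ob X \<Longrightarrow> F0 P A \<in> Ob L"
    and P1: "f \<in> hom1 X A B \<Longrightarrow> F1 P f \<in> hom1 L (F0 P A) (F0 P B)"
    and P2: "\<alpha> \<in> hom2 X f g \<Longrightarrow> F2 P \<alpha> \<in> hom2 L (F1 P f) (F1 P g)"
    and P_id1: "A \<in> Ob X \<Longrightarrow> F1 P (id1 X A) = id1 L (F0 P A)"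
    and P_comp1: "\<lbrakk>f \<in> hom1 X A B; g \<in> hom1 X B C\<rbrakk> \<Longrightarrow> F1 P (g \<odot> f) = F1 P g \<odot>\<^bsub>L\<^esub> F1 P f"
    and P_id2: "f \<in> Mor X \<Longrightarrow> F2 P (id2 X f) = id2 L (F1 P f)"
    and P_vcomp: "\<lbrakk>\<alpha> \<in> hom2 X f g; \<beta> \<in> hom2 X g h\<rbrakk> \<Longrightarrow> F2 P (\<beta> \<bullet> \<alpha>) = F2 P \<beta> \<bullet>\<^bsub>L\<^esub> F2 P \<alpha>"
    and P_hcomp: "\<lbrakk>f \<in> hom1 X A B; g \<in> hom1 X B C; \<alpha> \<in> hom2 X f f'; \<beta> \<in> hom2 X g g'\<rbrakk>
      \<Longrightarrow> F2 P (\<beta> \<star> \<alpha>) = F2 P \<beta> \<star>\<^bsub>L\<^esub> F2 P \<alpha>"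
    and P_Fcomp: "\<lbrakk>f \<in> hom1 X A B; g \<in> hom1 X B C\<rbrakk> \<Longrightarrow> Fcomp P g f = id2 L (F1 P g \<odot>\<^bsub>L\<^esub> F1 P f)"
    and P_Funit: "A \<in> Ob X \<Longrightarrow> Funit P A = id2 L (id1 L (F0 P A))"

definition locally_faithful ::
  "('o1, 'a1, 'c1) twocat \<Rightarrow> ('o1, 'a1, 'c1, 'o, 'a, 'c) psfun \<Rightarrow> bool" where
  "locally_faithful X P \<longleftrightarrow> (\<forall>f g \<alpha> \<beta>. \<alpha> \<in> hom2 X f g \<and> \<beta> \<in> hom2 X f g \<and> F2 P \<alpha> = F2 P \<beta> \<longrightarrow> \<alpha> = \<beta>)"

text \<open>The data of a pseudofunctor lying strictly over L, without coherence equations: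
  \<open>over_psfun_pseudofunctor\<close> recovers these when the target is locally
  faithful.\<close>

definition over_psfun ::
  "('o, 'a, 'c) twocat \<Rightarrow> ('o1, 'a1, 'c1) twocat \<Rightarrow> ('o1, 'a1, 'c1, 'o, 'a, 'c) psfun \<Rightarrow>
   ('o2, 'a2, 'c2) twocat \<Rightarrow> ('o2, 'a2, 'c2, 'o, 'a, 'c) psfun \<Rightarrow>
   ('o1, 'a1, 'c1, 'o2, 'a2, 'c2) psfun \<Rightarrow> bool" where
  "over_psfun L X P Y Q F \<longleftrightarrow>
     (\<forall>A \<in> Ob X. F0 F A \<in> Ob Y \<and> F0 Q (F0 F A) = F0 P A \<and>
        Funit F A \<in> iso2 Y (id1 Y (F0 F A)) (F1 F (id1 X A)) \<and> F2 Q (Funit F A) = id2 L (id1 L (F0 P A))) \<and>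
     (\<forall>A B. \<forall>f \<in> hom1 X A B. F1 F f \<in> hom1 Y (F0 F A) (F0 F B) \<and> F1 Q (F1 F f) = F1 P f) \<and>
     (\<forall>f g. \<forall>\<alpha> \<in> hom2 X f g. F2 F \<alpha> \<in> hom2 Y (F1 F f) (F1 F g) \<and> F2 Q (F2 F \<alpha>) = F2 P \<alpha>) \<and>
     (\<forall>A B C. \<forall>f \<in> hom1 X A B. \<forall>g \<in> hom1 X B C.
        Fcomp F g f \<in> iso2 Y (F1 F g \<odot>\<^bsub>Y\<^esub> F1 F f) (F1 F (g \<odot>\<^bsub>X\<^esub> f)) \<and>
        F2 Q (Fcomp F g f) = id2 L (F1 P (g \<odot>\<^bsub>X\<^esub> f)))"

lemma over_psfunD:
  assumes "over_psfun L X P Y Q F"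
  shows "A \<in> Ob X \<Longrightarrow> F0 F A \<in> Ob Y" "A \<in> Ob X \<Longrightarrow> F0 Q (F0 F A) = F0 P A"
    "A \<in> Ob X \<Longrightarrow> Funit F A \<in> iso2 Y (id1 Y (F0 F A)) (F1 F (id1 X A))"
    "A \<in> Ob X \<Longrightarrow> F2 Q (Funit F A) = id2 L (id1 L (F0 P A))"
    "f \<in> hom1 X A B \<Longrightarrow> F1 F f \<in> hom1 Y (F0 F A) (F0 F B)" "f \<in> hom1 X A B \<Longrightarrow> F1 Q (F1 F f) = F1 P f"
    "\<alpha> \<in> hom2 X f g \<Longrightarrow> F2 F \<alpha> \<in> hom2 Y (F1 F f) (F1 F g)" "\<alpha> \<in> hom2 X f g \<Longrightarrow> F2 Q (F2 F \<alpha>) = F2 P \<alpha>"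
    "f \<in> hom1 X A B \<Longrightarrow> g \<in> hom1 X B C \<Longrightarrow> Fcomp F g f \<in> iso2 Y (F1 F g \<odot>\<^bsub>Y\<^esub> F1 F f) (F1 F (g \<odot>\<^bsub>X\<^esub> f))"
    "f \<in> hom1 X A B \<Longrightarrow> g \<in> hom1 X B C \<Longrightarrow> F2 Q (Fcomp F g f) = id2 L (F1 P (g \<odot>\<^bsub>X\<^esub> f))"
  using assms unfolding over_psfun_def by blast+

locale over_pair = X: over_base L X P + Y: over_base L Y Q
  for L :: "('o, 'a, 'c) twocat" and X :: "('o1, 'a1, 'c1) twocat" and P :: "('o1, 'a1, 'c1, 'o, 'a, 'c) psfun"
    and Y :: "('o2, 'a2, 'c2) twocat" and Q :: "('o2, 'a2, 'c2, 'o, 'a, 'c) psfun"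
begin

lemma over_psfun_eq_psfun:
  assumes "over_psfun L X P Y Q F"
  shows "eq_psfun X (comp_psfun L Q F) P"
proof -
  note F = over_psfunD[OF assms]
  have idid: "id2 L h \<bullet>\<^bsub>L\<^esub> id2 L h = id2 L h" if "h \<in> hom1 L A B" for h A B
    using X.base.vcomp_id_left[OF X.base.id2_hom1[OF that]] .
  show ?thesis unfolding eq_psfun_def comp_psfun_def
  proof (intro conjI ballI impI, goal_cases)
    case (1 A)
    then show ?case using F by simp
  next
    case (2 A)
    then show ?case using F(1,2,4)[OF 2] Y.P_Funit[OF F(1)[OF 2]] X.P_Funit[OF 2] idid[OF X.base.id1_hom[OF X.P0[OF 2]]] by simp
  next
    case (3 f)
    then show ?case using F(6)[OF X.Mor_hom1[OF 3]] by simp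
  next
    case (4 \<alpha>)
    then show ?case using F(8)[of \<alpha>] by (simp add: hom2_def)
  next
    case (5 f g)
    then have f: "f \<in> hom1 X (src X f) (tgt X f)" and g: "g \<in> hom1 X (tgt X f) (tgt X g)" by (auto simp: hom1_def)
    show ?case
      using F(10)[OF f g] Y.P_Fcomp[OF F(5)[OF f] F(5)[OF g]] F(6)[OF f] F(6)[OF g] X.P_Fcomp[OF f g] X.P_comp1[OF f g]
        idid[OF X.base.comp1_hom[OF X.P1[OF f] X.P1[OF g]]] by simp
  qed
qed

text \<open>\<open>eq_psfun\<close> constrains only the coherence 2-cells of the composite with Q;
  as those of Q are identities, the coherence 2-cells of F must themselves lie over
  identities.\<close>

lemma over_psfunI:
  assumes F: "pseudofunctor X Y F" and eq: "eq_psfun X (comp_psfun L Q F) P"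
  shows "over_psfun L X P Y Q F"
proof -
  note T = pseudofunctorD(1-5)[OF F]
  have E: "\<And>A. A \<in> Ob X \<Longrightarrow> F0 Q (F0 F A) = F0 P A"
    "\<And>A. A \<in> Ob X \<Longrightarrow> F2 Q (Funit F A) \<bullet>\<^bsub>L\<^esub> Funit Q (F0 F A) = Funit P A"
    "\<And>f. f \<in> Mor X \<Longrightarrow> F1 Q (F1 F f) = F1 P f" "\<And>\<alpha>. \<alpha> \<in> Cell X \<Longrightarrow> F2 Q (F2 F \<alpha>) = F2 P \<alpha>"
    "\<And>f g. \<lbrakk>f \<in> Mor X; g \<in> Mor X; tgt X f = src X g\<rbrakk> \<Longrightarrow>
       F2 Q (Fcomp F g f) \<bullet>\<^bsub>L\<^esub> Fcomp Q (F1 F g) (F1 F f) = Fcomp P g f"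
    using eq unfolding eq_psfun_def comp_psfun_def by auto
  show ?thesis unfolding over_psfun_def
  proof (intro conjI ballI allI, goal_cases)
    case (4 A)
    have fu: "Funit F A \<in> hom2 Y (id1 Y (F0 F A)) (F1 F (id1 X A))" using T(4)[OF 4] by (simp add: iso2_def)
    have "F2 Q (Funit F A) \<in> hom2 L (id1 L (F0 P A)) (F1 Q (F1 F (id1 X A)))"
      using Y.P2[OF fu] Y.P_id1[OF T(1)[OF 4]] E(1)[OF 4] by simp
    then show ?case
      using E(2)[OF 4] Y.P_Funit[OF T(1)[OF 4]] E(1)[OF 4] X.P_Funit[OF 4] X.base.vcomp_id_right by metis
  next
    case (10 A B C f g)
    have fg: "f \<in> Mor X" "g \<in> Mor X" "tgt X f = src X g" using 10 by (auto simp: hom1_def)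
    have fc: "Fcomp F g f \<in> hom2 Y (F1 F g \<odot>\<^bsub>Y\<^esub> F1 F f) (F1 F (g \<odot>\<^bsub>X\<^esub> f))" using T(5)[OF 10] by (simp add: iso2_def)
    have "F2 Q (Fcomp F g f) \<in> hom2 L (F1 P g \<odot>\<^bsub>L\<^esub> F1 P f) (F1 Q (F1 F (g \<odot>\<^bsub>X\<^esub> f)))"
      using Y.P2[OF fc] Y.P_comp1[OF T(2)[OF 10(1)] T(2)[OF 10(2)]] E(3)[OF fg(1)] E(3)[OF fg(2)] by simp
    then have "F2 Q (Fcomp F g f) = Fcomp P g f"
      using E(5)[OF fg] Y.P_Fcomp[OF T(2)[OF 10(1)] T(2)[OF 10(2)]] E(3)[OF fg(1)] E(3)[OF fg(2)]
        X.base.vcomp_id_right by metis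
    then show ?case using X.P_Fcomp[OF 10] X.P_comp1[OF 10] by simp
  qed (use T E in \<open>auto simp: hom1_def hom2_def\<close>)
qed

text \<open>Every remaining law compares two parallel 2-cells of Y, and their images in L agree
  because all coherence 2-cells of F lie over identities.\<close>

lemma over_psfun_pseudofunctor:
  assumes "over_psfun L X P Y Q F" "locally_faithful Y Q"
  shows "pseudofunctor X Y F"
proof -
  note F = over_psfunD[OF assms(1)]
  have eqI: "\<alpha> = \<beta>" if "\<alpha> \<in> hom2 Y f g" "\<beta> \<in> hom2 Y f g" "F2 Q \<alpha> = F2 Q \<beta>" for \<alpha> \<beta> f g
    using assms(2) that unfolding locally_faithful_def by blast
  have FC: "Fcomp F g f \<in> hom2 Y (F1 F g \<odot>\<^bsub>Y\<^esub> F1 F f) (F1 F (g \<odot>\<^bsub>X\<^esub> f))"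
    if "f \<in> hom1 X A B" "g \<in> hom1 X B C" for f g A B C
    using F(9)[OF that] by (simp add: iso2_def)
  have FU: "Funit F A \<in> hom2 Y (id1 Y (F0 F A)) (F1 F (id1 X A))" if "A \<in> Ob X" for A
    using F(3)[OF that] by (simp add: iso2_def)
  have cell1: "g \<in> hom1 X A B" if "\<alpha> \<in> hom2 X f g" "f \<in> hom1 X A B" for f g \<alpha> A B
    using X.cell_hom1[OF that] .
  show ?thesis unfolding pseudofunctor_def
  proof (intro conjI allI ballI impI, goal_cases)
    case (4 f)
    then show ?case
      using F(7)[OF X.id2_hom[OF 4]] F(8)[OF X.id2_hom[OF 4]] F(5,6)[OF X.Mor_hom1[OF 4]] X.P_id2[OF 4]
        Y.P_id2[of "F1 F f"] Y.id2_hom1[of "F1 F f"] by (intro eqI[of _ "F1 F f" "F1 F f"]) (auto simp: hom1_def)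
  next
    case (5 f g h \<alpha> \<beta>)
    show ?case
      using F(7)[OF X.vcomp_hom[OF 5]] Y.vcomp_hom[OF F(7)[OF 5(1)] F(7)[OF 5(2)]] F(8)[OF X.vcomp_hom[OF 5]]
        Y.P_vcomp[OF F(7)[OF 5(1)] F(7)[OF 5(2)]] F(8)[OF 5(1)] F(8)[OF 5(2)] X.P_vcomp[OF 5] by (intro eqI) auto
  next
    case (8 A B C f f' g g' \<alpha> \<beta>)
    then have f: "f \<in> hom1 X A B" and g: "g \<in> hom1 X B C" and a: "\<alpha> \<in> hom2 X f f'" and b: "\<beta> \<in> hom2 X g g'" by auto
    have f': "f' \<in> hom1 X A B" and g': "g' \<in> hom1 X B C" using cell1 f g a b by auto
    note ba = X.hcomp_hom[OF f g a b]
    note fba = Y.hcomp_hom[OF F(5)[OF f] F(5)[OF g] F(7)[OF a] F(7)[OF b]]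
    have l: "F2 Q (F2 F \<beta> \<star>\<^bsub>Y\<^esub> F2 F \<alpha>) = F2 P (\<beta> \<star>\<^bsub>X\<^esub> \<alpha>)"
      using Y.P_hcomp[OF F(5)[OF f] F(5)[OF g] F(7)[OF a] F(7)[OF b]] F(8)[OF a] F(8)[OF b] X.P_hcomp[OF f g a b] by simp
    show ?case
    proof (rule eqI)
      show "Fcomp F g' f' \<bullet>\<^bsub>Y\<^esub> (F2 F \<beta> \<star>\<^bsub>Y\<^esub> F2 F \<alpha>) \<in> hom2 Y (F1 F g \<odot>\<^bsub>Y\<^esub> F1 F f) (F1 F (g' \<odot>\<^bsub>X\<^esub> f'))"
        "F2 F (\<beta> \<star>\<^bsub>X\<^esub> \<alpha>) \<bullet>\<^bsub>Y\<^esub> Fcomp F g f \<in> hom2 Y (F1 F g \<odot>\<^bsub>Y\<^esub> F1 F f) (F1 F (g' \<odot>\<^bsub>X\<^esub> f'))"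
        using Y.vcomp_hom[OF fba FC[OF f' g']] Y.vcomp_hom[OF FC[OF f g] F(7)[OF ba]] by auto
      show "F2 Q (Fcomp F g' f' \<bullet>\<^bsub>Y\<^esub> (F2 F \<beta> \<star>\<^bsub>Y\<^esub> F2 F \<alpha>)) = F2 Q (F2 F (\<beta> \<star>\<^bsub>X\<^esub> \<alpha>) \<bullet>\<^bsub>Y\<^esub> Fcomp F g f)"
        using Y.P_vcomp[OF fba FC[OF f' g']] Y.P_vcomp[OF FC[OF f g] F(7)[OF ba]] F(10)[OF f g] F(10)[OF f' g']
          F(8)[OF ba] l X.base.vcomp_id_left[OF X.P2[OF ba]] X.base.vcomp_id_right[OF X.P2[OF ba]] by simp
    qed
  next
    case (9 A B C D f g h)
    note fg = X.comp1_hom[OF 9(1,2)] and gh = X.comp1_hom[OF 9(2,3)] and as = X.comp1_assoc[OF 9]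
    note f = F(5)[OF 9(1)] and g = F(5)[OF 9(2)] and h = F(5)[OF 9(3)]
    let ?x = "Fcomp F h g \<lhd>\<^bsub>Y\<^esub> F1 F f" and ?y = "F1 F h \<rhd>\<^bsub>Y\<^esub> Fcomp F g f"
    have x: "?x \<in> hom2 Y (F1 F h \<odot>\<^bsub>Y\<^esub> F1 F g \<odot>\<^bsub>Y\<^esub> F1 F f) (F1 F (h \<odot>\<^bsub>X\<^esub> g) \<odot>\<^bsub>Y\<^esub> F1 F f)"
      using Y.hom2_rwhisker[OF FC[OF 9(2,3)] f Y.comp1_hom[OF g h]] Y.comp1_assoc[OF f g h] by simp
    have y: "?y \<in> hom2 Y (F1 F h \<odot>\<^bsub>Y\<^esub> F1 F g \<odot>\<^bsub>Y\<^esub> F1 F f) (F1 F h \<odot>\<^bsub>Y\<^esub> F1 F (g \<odot>\<^bsub>X\<^esub> f))"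
      using Y.hom2_lwhisker[OF FC[OF 9(1,2)] Y.comp1_hom[OF f g] h] .
    note F1s = X.P1[OF 9(1)] X.P1[OF 9(2)] X.P1[OF 9(3)]
    have lx: "F2 Q ?x = id2 L (F1 P (h \<odot>\<^bsub>X\<^esub> g \<odot>\<^bsub>X\<^esub> f))"
      using Y.P_hcomp[OF f Y.comp1_hom[OF g h] Y.id2_hom1[OF f] FC[OF 9(2,3)]] F(10)[OF 9(2,3)] Y.P_id2[of "F1 F f"] f
        F(6)[OF 9(1)] X.base.hcomp_id2[OF F1s(1) X.P1[OF gh]] X.P_comp1[OF 9(1) gh] as by (simp add: hom1_def)
    have ly: "F2 Q ?y = id2 L (F1 P (h \<odot>\<^bsub>X\<^esub> g \<odot>\<^bsub>X\<^esub> f))"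
      using Y.P_hcomp[OF Y.comp1_hom[OF f g] h FC[OF 9(1,2)] Y.id2_hom1[OF h]] F(10)[OF 9(1,2)] Y.P_id2[of "F1 F h"] h
        F(6)[OF 9(3)] X.base.hcomp_id2[OF X.P1[OF fg] F1s(3)] X.P_comp1[OF fg 9(3)] as by (simp add: hom1_def)
    have x': "Fcomp F (h \<odot>\<^bsub>X\<^esub> g) f \<in> hom2 Y (F1 F (h \<odot>\<^bsub>X\<^esub> g) \<odot>\<^bsub>Y\<^esub> F1 F f) (F1 F (h \<odot>\<^bsub>X\<^esub> g \<odot>\<^bsub>X\<^esub> f))"
      using FC[OF 9(1) gh] as by simp
    have y': "Fcomp F h (g \<odot>\<^bsub>X\<^esub> f) \<in> hom2 Y (F1 F h \<odot>\<^bsub>Y\<^esub> F1 F (g \<odot>\<^bsub>X\<^esub> f)) (F1 F (h \<odot>\<^bsub>X\<^esub> g \<odot>\<^bsub>X\<^esub> f))"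
      using FC[OF fg 9(3)] .
    show ?case
      using Y.vcomp_hom[OF x x'] Y.vcomp_hom[OF y y'] Y.P_vcomp[OF x x'] Y.P_vcomp[OF y y'] lx ly
        F(10)[OF 9(1) gh] F(10)[OF fg 9(3)] as by (intro eqI) auto
  next
    case (10 A B f)
    have A: "A \<in> Ob X" using 10 X.src_Ob by (auto simp: hom1_def)
    note i = X.id1_hom[OF A]
    note f = F(5)[OF 10] and j = Y.id1_hom[OF F(1)[OF A]]
    let ?x = "F1 F f \<rhd>\<^bsub>Y\<^esub> Funit F A"
    have x: "?x \<in> hom2 Y (F1 F f) (F1 F f \<odot>\<^bsub>Y\<^esub> F1 F (id1 X A))"
      using Y.hom2_lwhisker[OF FU[OF A] j f] Y.comp1_id_right[OF f] by simp
    have y: "Fcomp F f (id1 X A) \<in> hom2 Y (F1 F f \<odot>\<^bsub>Y\<^esub> F1 F (id1 X A)) (F1 F f)"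
      using FC[OF i 10] X.comp1_id_right[OF 10] by simp
    have l: "F2 Q ?x = id2 L (F1 P f)"
      using Y.P_hcomp[OF j f FU[OF A] Y.id2_hom1[OF f]] F(4)[OF A] Y.P_id2[of "F1 F f"] f F(6)[OF 10]
        X.base.hcomp_id2[OF X.base.id1_hom[OF X.P0[OF A]] X.P1[OF 10]] X.base.comp1_id_right[OF X.P1[OF 10]]
      by (simp add: hom1_def)
    show ?case
      using Y.vcomp_hom[OF x y] Y.id2_hom1[OF f] Y.P_vcomp[OF x y] l F(10)[OF i 10] X.comp1_id_right[OF 10]
        Y.P_id2[of "F1 F f"] f F(6)[OF 10] X.base.vcomp_id_left[OF X.base.id2_hom1[OF X.P1[OF 10]]]
      by (intro eqI[of _ "F1 F f" "F1 F f"]) (auto simp: hom1_def)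
  next
    case (11 A B f)
    have B: "B \<in> Ob X" using 11 X.tgt_Ob by (auto simp: hom1_def)
    note i = X.id1_hom[OF B]
    note f = F(5)[OF 11] and j = Y.id1_hom[OF F(1)[OF B]]
    let ?x = "Funit F B \<lhd>\<^bsub>Y\<^esub> F1 F f"
    have x: "?x \<in> hom2 Y (F1 F f) (F1 F (id1 X B) \<odot>\<^bsub>Y\<^esub> F1 F f)"
      using Y.hom2_rwhisker[OF FU[OF B] f j] Y.comp1_id_left[OF f] by simp
    have y: "Fcomp F (id1 X B) f \<in> hom2 Y (F1 F (id1 X B) \<odot>\<^bsub>Y\<^esub> F1 F f) (F1 F f)"
      using FC[OF 11 i] X.comp1_id_left[OF 11] by simp
    have l: "F2 Q ?x = id2 L (F1 P f)"
      using Y.P_hcomp[OF f j Y.id2_hom1[OF f] FU[OF B]] F(4)[OF B] Y.P_id2[of "F1 F f"] f F(6)[OF 11]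
        X.base.hcomp_id2[OF X.P1[OF 11] X.base.id1_hom[OF X.P0[OF B]]] X.base.comp1_id_left[OF X.P1[OF 11]]
      by (simp add: hom1_def)
    show ?case
      using Y.vcomp_hom[OF x y] Y.id2_hom1[OF f] Y.P_vcomp[OF x y] l F(10)[OF 11 i] X.comp1_id_left[OF 11]
        Y.P_id2[of "F1 F f"] f F(6)[OF 11] X.base.vcomp_id_left[OF X.base.id2_hom1[OF X.P1[OF 11]]]
      by (intro eqI[of _ "F1 F f" "F1 F f"]) (auto simp: hom1_def)
  qed (use F in auto)
qed

end

lemma pseudofunctor_iso2:
  fixes X :: "('o1, 'a1, 'c1) twocat" and Y :: "('o2, 'a2, 'c2) twocat"
  assumes "pseudofunctor X Y F" "two_category X" "two_category Y" "\<alpha> \<in> iso2 X f g"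
  shows "F2 F \<alpha> \<in> iso2 Y (F1 F f) (F1 F g)"
proof -
  interpret X: two_category X by fact
  interpret Y: two_category Y by fact
  note T = pseudofunctorD(3,6,7)[OF assms(1)]
  obtain \<beta> where b: "\<beta> \<in> iso2 X g f" "\<beta> \<bullet>\<^bsub>X\<^esub> \<alpha> = id2 X f" "\<alpha> \<bullet>\<^bsub>X\<^esub> \<beta> = id2 X g" using assms(4) by (rule X.iso2E)
  note h = X.iso2D[OF assms(4)] X.iso2D[OF b(1)]
  show ?thesis
    using T(1)[OF h(1)] T(1)[OF h(2)] T(3)[OF h] T(3)[OF h(2,1)] T(2) b X.hom2_Mor[OF h(1)] by (intro Y.iso2I) auto
qed

lemma over_psfun_id:
  assumes "over_base L X P"
  shows "over_psfun L X P X P (id_psfun X)"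
proof -
  interpret over_base L X P by fact
  have i: "F2 P (id2 X f) = id2 L (F1 P f) \<and> id2 X f \<in> iso2 X f f" if "f \<in> hom1 X A B" for f A B
    using that P_id2[of f] iso2_id1[OF that] by (simp add: hom1_def)
  show ?thesis
    unfolding over_psfun_def id_psfun_def using i[OF id1_hom] P_id1 i[OF comp1_hom] by simp
qed

lemma over_psfun_comp:
  assumes "over_pair L X P Y Q" "over_pair L Y Q W R" "over_psfun L X P Y Q F" "over_psfun L Y Q W R G"
    "pseudofunctor Y W G"
  shows "over_psfun L X P W R (comp_psfun W G F)"
proof -
  interpret XY: over_pair L X P Y Q by fact
  interpret YW: over_pair L Y Q W R by fact
  note F = over_psfunD[OF assms(3)] and G = over_psfunD[OF assms(4)]
  note GI = pseudofunctor_iso2[OF assms(5) XY.Y.two_category_axioms YW.Y.two_category_axioms]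
  have idid: "id2 L h \<bullet>\<^bsub>L\<^esub> id2 L h = id2 L h" if "h \<in> hom1 L A B" for h A B
    using XY.X.base.vcomp_id_left[OF XY.X.base.id2_hom1[OF that]] .
  show ?thesis unfolding over_psfun_def comp_psfun_def
  proof (intro conjI ballI allI, goal_cases)
    case (3 A)
    show ?case using YW.Y.iso2_vcomp[OF G(3)[OF F(1)[OF 3]] GI[OF F(3)[OF 3]]] by simp
  next
    case (4 A)
    have "F2 R (F2 G (Funit F A) \<bullet>\<^bsub>W\<^esub> Funit G (F0 F A)) = F2 R (F2 G (Funit F A)) \<bullet>\<^bsub>L\<^esub> F2 R (Funit G (F0 F A))"
      using YW.Y.P_vcomp[OF YW.Y.iso2D[OF G(3)[OF F(1)[OF 4]]] YW.Y.iso2D[OF GI[OF F(3)[OF 4]]]] .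
    then show ?case
      using G(4)[OF F(1)[OF 4]] G(8)[OF XY.Y.iso2D[OF F(3)[OF 4]]] F(4)[OF 4] F(2)[OF 4]
        idid[OF XY.X.base.id1_hom[OF XY.X.P0[OF 4]]] by simp
  next
    case (9 A B C f g)
    show ?case
      using YW.Y.iso2_vcomp[OF G(9)[OF F(5)[OF 9(1)] F(5)[OF 9(2)]] GI[OF F(9)[OF 9]]] by simp
  next
    case (10 A B C f g)
    have "F2 R (F2 G (Fcomp F g f) \<bullet>\<^bsub>W\<^esub> Fcomp G (F1 F g) (F1 F f))
        = F2 R (F2 G (Fcomp F g f)) \<bullet>\<^bsub>L\<^esub> F2 R (Fcomp G (F1 F g) (F1 F f))"
      using YW.Y.P_vcomp[OF YW.Y.iso2D[OF G(9)[OF F(5)[OF 10(1)] F(5)[OF 10(2)]]] YW.Y.iso2D[OF GI[OF F(9)[OF 10]]]] .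
    moreover have "F1 Q (F1 F g \<odot>\<^bsub>Y\<^esub> F1 F f) = F1 P (g \<odot>\<^bsub>X\<^esub> f)"
      using XY.Y.P_comp1[OF F(5)[OF 10(1)] F(5)[OF 10(2)]] F(6)[OF 10(1)] F(6)[OF 10(2)] XY.X.P_comp1[OF 10] by simp
    ultimately show ?case
      using G(10)[OF F(5)[OF 10(1)] F(5)[OF 10(2)]] G(8)[OF XY.Y.iso2D[OF F(9)[OF 10]]] F(10)[OF 10]
        idid[OF XY.X.P1[OF XY.X.comp1_hom[OF 10]]] by simp
  next
    case (2 A)
    then show ?case using F(1,2) G(2) by simp
  next
    case (6 A B f)
    show ?case using F(6)[OF 6] G(6)[OF F(5)[OF 6]] by simp
  next
    case (8 f g \<alpha>)
    show ?case using F(8)[OF 8] G(8)[OF F(7)[OF 8]] by simp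
  qed (use F(1,5,7) G(1,5,7) in auto)
qed

text \<open>A correspondence between two locally faithful 2-categories over \<open>L\<close> which lifts 1-cells and
  2-cells in both directions. As 2-cells are determined by their images in \<open>L\<close>, every choice
  of lifts is automatically coherent.\<close>

locale correspondence = over_pair L X P Y Q
  for L :: "('o, 'a, 'c) twocat" and X :: "('o1, 'a1, 'c1) twocat" and P :: "('o1, 'a1, 'c1, 'o, 'a, 'c) psfun"
    and Y :: "('o2, 'a2, 'c2) twocat" and Q :: "('o2, 'a2, 'c2, 'o, 'a, 'c) psfun" +
  fixes Rel :: "'o1 \<Rightarrow> 'o2 \<Rightarrow> bool"
  assumes Rel_Ob: "Rel x y \<Longrightarrow> x \<in> Ob X \<and> y \<in> Ob Y \<and> F0 P x = F0 Q y"
    and faithful_X: "locally_faithful X P" and faithful_Y: "locally_faithful Y Q"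
    and lift1: "\<lbrakk>Rel x y; Rel x' y'; f \<in> hom1 X x x'\<rbrakk> \<Longrightarrow> \<exists>g \<in> hom1 Y y y'. F1 Q g = F1 P f"
    and lift1': "\<lbrakk>Rel x y; Rel x' y'; g \<in> hom1 Y y y'\<rbrakk> \<Longrightarrow> \<exists>f \<in> hom1 X x x'. F1 P f = F1 Q g"
    and lift2: "\<lbrakk>Rel x y; Rel x' y'; f \<in> hom1 X x x'; f' \<in> hom1 X x x'; g \<in> hom1 Y y y'; g' \<in> hom1 Y y y';
        F1 Q g = F1 P f; F1 Q g' = F1 P f'; \<alpha> \<in> hom2 X f f'\<rbrakk> \<Longrightarrow> \<exists>\<beta> \<in> hom2 Y g g'. F2 Q \<beta> = F2 P \<alpha>"
    and lift2': "\<lbrakk>Rel x y; Rel x' y'; f \<in> hom1 X x x'; f' \<in> hom1 X x x'; g \<in> hom1 Y y y'; g' \<in> hom1 Y y y';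
        F1 Q g = F1 P f; F1 Q g' = F1 P f'; \<beta> \<in> hom2 Y g g'\<rbrakk> \<Longrightarrow> \<exists>\<alpha> \<in> hom2 X f f'. F2 P \<alpha> = F2 Q \<beta>"
begin

lemma correspondence_sym: "correspondence L Y Q X P (\<lambda>y x. Rel x y)"
proof (unfold_locales, goal_cases)
  case (1 x y) then show ?case using Rel_Ob by metis
next
  case 2 show ?case by (rule faithful_Y)
next
  case 3 show ?case by (rule faithful_X)
next
  case 4 then show ?case using lift1' by metis
next
  case 5 then show ?case using lift1 by metis
next
  case (6 x y x' y' f f' g g' \<alpha>) show ?case
    by (rule lift2'[OF 6(1,2,5,6,3,4) 6(7)[symmetric] 6(8)[symmetric] 6(9)])
next
  case (7 x y x' y' f f' g g' \<alpha>) show ?case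
    by (rule lift2[OF 7(1,2,5,6,3,4) 7(7)[symmetric] 7(8)[symmetric] 7(9)])
qed

lemma cell_eqI: "\<lbrakk>\<alpha> \<in> hom2 Y f g; \<beta> \<in> hom2 Y f g; F2 Q \<alpha> = F2 Q \<beta>\<rbrakk> \<Longrightarrow> \<alpha> = \<beta>"
  using faithful_Y unfolding locally_faithful_def by blast

text \<open>The identity 2-cell of f lifts in both directions. The composites of the two lifts lie
  over an identity, hence are identities by local faithfulness.\<close>

lemma lift_iso:
  assumes "Rel x y" "Rel x' y'" "f \<in> hom1 X x x'" "g \<in> hom1 Y y y'" "g' \<in> hom1 Y y y'"
    "F1 Q g = F1 P f" "F1 Q g' = F1 P f"
  shows "\<exists>\<beta> \<in> iso2 Y g g'. F2 Q \<beta> = id2 L (F1 P f)"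
proof -
  have f: "f \<in> Mor X" "F1 P f \<in> hom1 L (F0 P x) (F0 P x')" using assms(3) X.P1 by (auto simp: hom1_def)
  note i = X.id2_hom1[OF assms(3)] and li = X.P_id2[OF f(1)]
  obtain \<beta> where b: "\<beta> \<in> hom2 Y g g'" "F2 Q \<beta> = id2 L (F1 P f)"
    using lift2[OF assms(1-3) assms(3) assms(4-7) i] li by auto
  obtain \<gamma> where c: "\<gamma> \<in> hom2 Y g' g" "F2 Q \<gamma> = id2 L (F1 P f)"
    using lift2[OF assms(1-3) assms(3) assms(5,4,7,6) i] li by auto
  have ii: "id2 L (F1 P f) \<bullet>\<^bsub>L\<^esub> id2 L (F1 P f) = id2 L (F1 P f)"
    using X.base.vcomp_id_left[OF X.base.id2_hom1[OF f(2)]] .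
  have "\<gamma> \<bullet>\<^bsub>Y\<^esub> \<beta> = id2 Y g"
    using Y.vcomp_hom[OF b(1) c(1)] Y.id2_hom1[OF assms(4)] Y.P_vcomp[OF b(1) c(1)] b c ii Y.P_id2[of g] assms
    by (intro cell_eqI) (auto simp: hom1_def)
  moreover have "\<beta> \<bullet>\<^bsub>Y\<^esub> \<gamma> = id2 Y g'"
    using Y.vcomp_hom[OF c(1) b(1)] Y.id2_hom1[OF assms(5)] Y.P_vcomp[OF c(1) b(1)] b c ii Y.P_id2[of g'] assms
    by (intro cell_eqI) (auto simp: hom1_def)
  ultimately show ?thesis using b c Y.iso2I by blast
qed

text \<open>Arbitrary choices of lifts suffice, as \<open>over_psfun\<close> constrains only
  boundaries and images in L.\<close>

lemma lift_psfun:
  assumes K0: "\<And>x. x \<in> Ob X \<Longrightarrow> Rel x (K0 x)"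
  obtains K where "F0 K = K0" "over_psfun L X P Y Q K" "normal_psfun X Y K"
proof -
  \<comment> \<open>Identities are sent to identities by decree, which makes K normal; only the
    other 1-cells are lifted by choice.\<close>
  define k1 where "k1 f = (if f = id1 X (src X f) then id1 Y (K0 (src X f))
    else SOME g. g \<in> hom1 Y (K0 (src X f)) (K0 (tgt X f)) \<and> F1 Q g = F1 P f)" for f
  define k2 where "k2 \<alpha> = (SOME \<beta>. \<beta> \<in> hom2 Y (k1 (dom2 X \<alpha>)) (k1 (cod2 X \<alpha>)) \<and> F2 Q \<beta> = F2 P \<alpha>)" for \<alpha>
  define kc where "kc g f = (SOME \<beta>. \<beta> \<in> iso2 Y (k1 g \<odot>\<^bsub>Y\<^esub> k1 f) (k1 (g \<odot>\<^bsub>X\<^esub> f)) \<and> F2 Q \<beta> = id2 L (F1 P (g \<odot>\<^bsub>X\<^esub> f)))" for g f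
  define K where "K = \<lparr>F0 = K0, F1 = k1, F2 = k2, Fcomp = kc, Funit = \<lambda>A. id2 Y (id1 Y (K0 A))\<rparr>"
  have O: "K0 x \<in> Ob Y" "F0 Q (K0 x) = F0 P x" if "x \<in> Ob X" for x using Rel_Ob[OF K0[OF that]] by auto
  have k1id: "k1 (id1 X A) = id1 Y (K0 A)" if "A \<in> Ob X" for A using that by (simp add: k1_def)
  have k1: "k1 f \<in> hom1 Y (K0 A) (K0 B) \<and> F1 Q (k1 f) = F1 P f" if f: "f \<in> hom1 X A B" for f A B
  proof -
    have A: "src X f = A" "tgt X f = B" "A \<in> Ob X" "B \<in> Ob X" using f X.src_Ob X.tgt_Ob by (auto simp: hom1_def)
    show ?thesis
    proof (cases "f = id1 X A")
      case True
      then have "B = A" using f X.id1_hom[OF A(3)] by (auto simp: hom1_def)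
      then show ?thesis using True k1id[OF A(3)] Y.id1_hom[OF O(1)[OF A(3)]] Y.P_id1[OF O(1)[OF A(3)]] X.P_id1[OF A(3)] O(2)[OF A(3)] by simp
    next
      case False
      then have k: "k1 f = (SOME g. g \<in> hom1 Y (K0 A) (K0 B) \<and> F1 Q g = F1 P f)" using A by (simp add: k1_def)
      have ex: "\<exists>g. g \<in> hom1 Y (K0 A) (K0 B) \<and> F1 Q g = F1 P f" using lift1[OF K0[OF A(3)] K0[OF A(4)] f] by blast
      show ?thesis unfolding k by (rule someI_ex[OF ex])
    qed
  qed
  have k2: "k2 \<alpha> \<in> hom2 Y (k1 f) (k1 g) \<and> F2 Q (k2 \<alpha>) = F2 P \<alpha>" if a: "\<alpha> \<in> hom2 X f g" for f g \<alpha>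
  proof -
    have d: "dom2 X \<alpha> = f" "cod2 X \<alpha> = g" using a by (auto simp: hom2_def)
    have f: "f \<in> hom1 X (src X f) (tgt X f)" using X.hom2_Mor[OF a] by (simp add: hom1_def)
    have g: "g \<in> hom1 X (src X f) (tgt X f)" using X.cell_hom1[OF a f] .
    have s: "src X f \<in> Ob X" "tgt X f \<in> Ob X" using f X.src_Ob X.tgt_Ob by (auto simp: hom1_def)
    have "\<exists>\<beta>. \<beta> \<in> hom2 Y (k1 f) (k1 g) \<and> F2 Q \<beta> = F2 P \<alpha>"
      using lift2[OF K0[OF s(1)] K0[OF s(2)] f g _ _ _ _ a] k1[OF f] k1[OF g] by blast
    then show ?thesis unfolding k2_def d by (rule someI_ex)
  qed
  have kc: "kc g f \<in> iso2 Y (k1 g \<odot>\<^bsub>Y\<^esub> k1 f) (k1 (g \<odot>\<^bsub>X\<^esub> f)) \<and> F2 Q (kc g f) = id2 L (F1 P (g \<odot>\<^bsub>X\<^esub> f))"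
    if f: "f \<in> hom1 X A B" and g: "g \<in> hom1 X B C" for f g A B C
  proof -
    have s: "A \<in> Ob X" "C \<in> Ob X" using f g X.src_Ob X.tgt_Ob by (auto simp: hom1_def)
    note gf = X.comp1_hom[OF f g]
    have "k1 g \<odot>\<^bsub>Y\<^esub> k1 f \<in> hom1 Y (K0 A) (K0 C)" "F1 Q (k1 g \<odot>\<^bsub>Y\<^esub> k1 f) = F1 P (g \<odot>\<^bsub>X\<^esub> f)"
      using Y.comp1_hom[of "k1 f" "K0 A" "K0 B" "k1 g" "K0 C"] Y.P_comp1[of "k1 f" "K0 A" "K0 B" "k1 g" "K0 C"]
        k1[OF f] k1[OF g] X.P_comp1[OF f g] by auto
    then have "\<exists>\<beta>. \<beta> \<in> iso2 Y (k1 g \<odot>\<^bsub>Y\<^esub> k1 f) (k1 (g \<odot>\<^bsub>X\<^esub> f)) \<and> F2 Q \<beta> = id2 L (F1 P (g \<odot>\<^bsub>X\<^esub> f))"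
      using lift_iso[OF K0[OF s(1)] K0[OF s(2)] gf] k1[OF gf] by blast
    then show ?thesis unfolding kc_def by (rule someI_ex)
  qed
  have "over_psfun L X P Y Q K"
    unfolding over_psfun_def K_def using O k1 k2 kc k1id Y.iso2_id1[OF Y.id1_hom] Y.P_id2 Y.P_id1
    by auto
  moreover have "normal_psfun X Y K" unfolding normal_psfun_def K_def using k1id by simp
  moreover have "F0 K = K0" by (simp add: K_def)
  ultimately show ?thesis using that by blast
qed

text \<open>The values of F and G at y correspond to one object \<open>c y\<close>, so a component
  is a lift of its identity, and a lift in the opposite direction is a quasi-inverse. The 1-cells
  \<open>h f\<close> provide the X-side morphism that \<open>lift_iso\<close> needs for the
  structure 2-cells.\<close>

lemma lift_transformation:
  assumes F: "over_psfun L Y Q Y Q F" and G: "over_psfun L Y Q Y Q G"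
    and rel: "\<And>y. y \<in> Ob Y \<Longrightarrow> Rel (c y) (F0 F y) \<and> Rel (c y) (F0 G y)"
    and h: "\<And>y y' f. f \<in> hom1 Y y y' \<Longrightarrow> h f \<in> hom1 X (c y) (c y') \<and> F1 P (h f) = F1 Q f"
  shows "\<exists>\<eta> \<eta>1. pseudonat_equivalence Y Y F G \<eta> \<eta>1 \<and> lies_over Y L Q \<eta> \<eta>1"
proof -
  note F = over_psfunD[OF F] and G = over_psfunD[OF G]
  have lab: "F0 P (c y) = F0 Q y" "c y \<in> Ob X" if "y \<in> Ob Y" for y
    using Rel_Ob[OF conjunct1[OF rel[OF that]]] F(2)[OF that] by auto
  have ex: "\<exists>h. h \<in> hom1 Y (F0 F y) (F0 G y) \<and> F1 Q h = id1 L (F0 Q y) \<and> equivalence1 Y h" if y: "y \<in> Ob Y" for y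
  proof -
    note r = rel[OF y] and i = X.id1_hom[OF lab(2)[OF y]]
    have Pi: "F1 P (id1 X (c y)) = id1 L (F0 Q y)" using X.P_id1[OF lab(2)[OF y]] lab[OF y] by simp
    have ii: "id1 L (F0 Q y) \<odot>\<^bsub>L\<^esub> id1 L (F0 Q y) = id1 L (F0 Q y)"
      using X.base.comp1_id_left[OF X.base.id1_hom[OF Y.P0[OF y]]] .
    obtain a where a: "a \<in> hom1 Y (F0 F y) (F0 G y)" "F1 Q a = id1 L (F0 Q y)" using lift1[OF _ _ i] r Pi by metis
    obtain b where b: "b \<in> hom1 Y (F0 G y) (F0 F y)" "F1 Q b = id1 L (F0 Q y)" using lift1[OF _ _ i] r Pi by metis
    have j: "id1 Y (F0 F y) \<in> hom1 Y (F0 F y) (F0 F y)" "F1 Q (id1 Y (F0 F y)) = id1 L (F0 Q y)"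
      "id1 Y (F0 G y) \<in> hom1 Y (F0 G y) (F0 G y)" "F1 Q (id1 Y (F0 G y)) = id1 L (F0 Q y)"
      using Y.id1_hom Y.P_id1 F(1,2)[OF y] G(1,2)[OF y] by auto
    have "iso2 Y (b \<odot>\<^bsub>Y\<^esub> a) (id1 Y (F0 F y)) \<noteq> {}"
      using lift_iso[OF conjunct1[OF r] conjunct1[OF r] i Y.comp1_hom[OF a(1) b(1)] j(1)]
        Y.P_comp1[OF a(1) b(1)] a b Pi ii j by auto
    moreover have "iso2 Y (a \<odot>\<^bsub>Y\<^esub> b) (id1 Y (F0 G y)) \<noteq> {}"
      using lift_iso[OF conjunct2[OF r] conjunct2[OF r] i Y.comp1_hom[OF b(1) a(1)] j(3)]
        Y.P_comp1[OF b(1) a(1)] a b Pi ii j by auto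
    ultimately have "equivalence1 Y a" unfolding equivalence1_def using a b by (auto simp: hom1_def)
    then show ?thesis using a by blast
  qed
  define \<eta> where "\<eta> y = (SOME h. h \<in> hom1 Y (F0 F y) (F0 G y) \<and> F1 Q h = id1 L (F0 Q y) \<and> equivalence1 Y h)" for y
  have \<eta>: "\<eta> y \<in> hom1 Y (F0 F y) (F0 G y)" "F1 Q (\<eta> y) = id1 L (F0 Q y)" "equivalence1 Y (\<eta> y)" if "y \<in> Ob Y" for y
    using someI_ex[OF ex[OF that]] unfolding \<eta>_def by auto
  have ex1: "\<exists>\<theta>. \<theta> \<in> iso2 Y (F1 G f \<odot>\<^bsub>Y\<^esub> \<eta> A) (\<eta> B \<odot>\<^bsub>Y\<^esub> F1 F f) \<and> F2 Q \<theta> = id2 L (F1 Q f)"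
    if f: "f \<in> hom1 Y A B" for f A B
  proof -
    have s: "A \<in> Ob Y" "B \<in> Ob Y" using f Y.src_Ob Y.tgt_Ob by (auto simp: hom1_def)
    show ?thesis
      using lift_iso[OF conjunct1[OF rel[OF s(1)]] conjunct2[OF rel[OF s(2)]] conjunct1[OF h[OF f]]
          Y.comp1_hom[OF \<eta>(1)[OF s(1)] G(5)[OF f]] Y.comp1_hom[OF F(5)[OF f] \<eta>(1)[OF s(2)]]]
        Y.P_comp1[OF \<eta>(1)[OF s(1)] G(5)[OF f]] Y.P_comp1[OF F(5)[OF f] \<eta>(1)[OF s(2)]]
        \<eta>(2)[OF s(1)] \<eta>(2)[OF s(2)] F(6)[OF f] G(6)[OF f] h[OF f]
        X.base.comp1_id_left[OF Y.P1[OF f]] X.base.comp1_id_right[OF Y.P1[OF f]] by auto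
  qed
  define \<eta>1 where "\<eta>1 f = (SOME \<theta>. \<theta> \<in> iso2 Y (F1 G f \<odot>\<^bsub>Y\<^esub> \<eta> (src Y f)) (\<eta> (tgt Y f) \<odot>\<^bsub>Y\<^esub> F1 F f) \<and> F2 Q \<theta> = id2 L (F1 Q f))" for f
  have \<eta>1: "\<eta>1 f \<in> iso2 Y (F1 G f \<odot>\<^bsub>Y\<^esub> \<eta> A) (\<eta> B \<odot>\<^bsub>Y\<^esub> F1 F f)" "F2 Q (\<eta>1 f) = id2 L (F1 Q f)"
    if "f \<in> hom1 Y A B" for f A B
    using someI_ex[OF ex1[OF that]] that unfolding \<eta>1_def by (auto simp: hom1_def)
  note \<eta>1h = Y.iso2D[OF \<eta>1(1)]
  have lw: "F2 Q (g \<rhd>\<^bsub>Y\<^esub> \<alpha>) = F1 Q g \<rhd>\<^bsub>L\<^esub> F2 Q \<alpha>" if "\<alpha> \<in> hom2 Y u v" "u \<in> hom1 Y A B" "g \<in> hom1 Y B C" for g \<alpha> u v A B C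
    using Y.P_hcomp[OF that(2,3,1) Y.id2_hom1[OF that(3)]] Y.P_id2[of g] that(3) by (simp add: hom1_def)
  have rw: "F2 Q (\<alpha> \<lhd>\<^bsub>Y\<^esub> g) = F2 Q \<alpha> \<lhd>\<^bsub>L\<^esub> F1 Q g" if "\<alpha> \<in> hom2 Y u v" "u \<in> hom1 Y B C" "g \<in> hom1 Y A B" for g \<alpha> u v A B C
    using Y.P_hcomp[OF that(3,2) Y.id2_hom1[OF that(3)] that(1)] Y.P_id2[of g] that(3) by (simp add: hom1_def)
  \<comment> \<open>Both sides of each equation have the same boundary and the same image in L, so
    \<open>cell_eqI\<close> identifies them.\<close>
  have "pseudonat Y Y F G \<eta> \<eta>1"
    unfolding pseudonat_def
  proof (intro conjI allI ballI, goal_cases)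
    case (1 A) then show ?case using \<eta> by blast
  next
    case (2 A B f) then show ?case using \<eta>1 by blast
  next
    case (3 A B f g \<alpha>)
    have s: "A \<in> Ob Y" "B \<in> Ob Y" using 3 Y.src_Ob Y.tgt_Ob by (auto simp: hom1_def)
    note a = \<eta>(1)[OF s(1)] and b = \<eta>(1)[OF s(2)] and al = Y.P2[OF 3(3)]
    note x = Y.hom2_rwhisker[OF G(7)[OF 3(3)] a G(5)[OF 3(1)]] and y = Y.hom2_lwhisker[OF F(7)[OF 3(3)] F(5)[OF 3(1)] b]
    show ?case
      using Y.vcomp_hom[OF x \<eta>1h[OF 3(2)]] Y.vcomp_hom[OF \<eta>1h[OF 3(1)] y] Y.P_vcomp[OF x \<eta>1h[OF 3(2)]]
        Y.P_vcomp[OF \<eta>1h[OF 3(1)] y] rw[OF G(7)[OF 3(3)] G(5)[OF 3(1)] a] lw[OF F(7)[OF 3(3)] F(5)[OF 3(1)] b]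
        F(8)[OF 3(3)] G(8)[OF 3(3)] \<eta>1(2)[OF 3(1)] \<eta>1(2)[OF 3(2)] \<eta>(2)[OF s(1)] \<eta>(2)[OF s(2)]
        X.base.hcomp_id_right[OF Y.P1[OF 3(1)] al] X.base.hcomp_id_left[OF Y.P1[OF 3(1)] al]
        X.base.vcomp_id_left[OF al] X.base.vcomp_id_right[OF al]
      by (intro cell_eqI) auto
  next
    case (4 A B C f g)
    have s: "A \<in> Ob Y" "B \<in> Ob Y" "C \<in> Ob Y" using 4 Y.src_Ob Y.tgt_Ob by (auto simp: hom1_def)
    note a = \<eta>(1)[OF s(1)] and b = \<eta>(1)[OF s(2)] and c = \<eta>(1)[OF s(3)] and gf = Y.comp1_hom[OF 4]
    note Ff = F(5)[OF 4(1)] and Fg = F(5)[OF 4(2)] and Gf = G(5)[OF 4(1)] and Gg = G(5)[OF 4(2)]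
    note FC = Y.iso2D[OF F(9)[OF 4]] and GC = Y.iso2D[OF G(9)[OF 4]]
    note Qf = Y.P1[OF 4(1)] and Qg = Y.P1[OF 4(2)] and Qgf = Y.P1[OF gf]
    have x: "Fcomp G g f \<lhd>\<^bsub>Y\<^esub> \<eta> A \<in> hom2 Y (F1 G g \<odot>\<^bsub>Y\<^esub> F1 G f \<odot>\<^bsub>Y\<^esub> \<eta> A) (F1 G (g \<odot>\<^bsub>Y\<^esub> f) \<odot>\<^bsub>Y\<^esub> \<eta> A)"
      using Y.hom2_rwhisker[OF GC a Y.comp1_hom[OF Gf Gg]] Y.comp1_assoc[OF a Gf Gg] by simp
    have y1: "F1 G g \<rhd>\<^bsub>Y\<^esub> \<eta>1 f \<in> hom2 Y (F1 G g \<odot>\<^bsub>Y\<^esub> F1 G f \<odot>\<^bsub>Y\<^esub> \<eta> A) (F1 G g \<odot>\<^bsub>Y\<^esub> \<eta> B \<odot>\<^bsub>Y\<^esub> F1 F f)"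
      using Y.hom2_lwhisker[OF \<eta>1h[OF 4(1)] Y.comp1_hom[OF a Gf] Gg] .
    have y2: "\<eta>1 g \<lhd>\<^bsub>Y\<^esub> F1 F f \<in> hom2 Y (F1 G g \<odot>\<^bsub>Y\<^esub> \<eta> B \<odot>\<^bsub>Y\<^esub> F1 F f) (\<eta> C \<odot>\<^bsub>Y\<^esub> F1 F g \<odot>\<^bsub>Y\<^esub> F1 F f)"
      using Y.hom2_rwhisker[OF \<eta>1h[OF 4(2)] Ff Y.comp1_hom[OF b Gg]] Y.comp1_assoc[OF Ff b Gg] Y.comp1_assoc[OF Ff Fg c] by simp
    have y3: "\<eta> C \<rhd>\<^bsub>Y\<^esub> Fcomp F g f \<in> hom2 Y (\<eta> C \<odot>\<^bsub>Y\<^esub> F1 F g \<odot>\<^bsub>Y\<^esub> F1 F f) (\<eta> C \<odot>\<^bsub>Y\<^esub> F1 F (g \<odot>\<^bsub>Y\<^esub> f))"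
      using Y.hom2_lwhisker[OF FC Y.comp1_hom[OF Ff Fg] c] .
    note y12 = Y.vcomp_hom[OF y1 y2]
    have lx: "F2 Q (Fcomp G g f \<lhd>\<^bsub>Y\<^esub> \<eta> A) = id2 L (F1 Q (g \<odot>\<^bsub>Y\<^esub> f))"
      using rw[OF GC Y.comp1_hom[OF Gf Gg] a] G(10)[OF 4] \<eta>(2)[OF s(1)]
        X.base.hcomp_id_right[OF Qgf X.base.id2_hom1[OF Qgf]] by simp
    have l1: "F2 Q (F1 G g \<rhd>\<^bsub>Y\<^esub> \<eta>1 f) = id2 L (F1 Q (g \<odot>\<^bsub>Y\<^esub> f))"
      using lw[OF \<eta>1h[OF 4(1)] Y.comp1_hom[OF a Gf] Gg] \<eta>1(2)[OF 4(1)] G(6)[OF 4(2)]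
        X.base.hcomp_id2[OF Qf Qg] Y.P_comp1[OF 4] by simp
    have l2: "F2 Q (\<eta>1 g \<lhd>\<^bsub>Y\<^esub> F1 F f) = id2 L (F1 Q (g \<odot>\<^bsub>Y\<^esub> f))"
      using rw[OF \<eta>1h[OF 4(2)] Y.comp1_hom[OF b Gg] Ff] \<eta>1(2)[OF 4(2)] F(6)[OF 4(1)]
        X.base.hcomp_id2[OF Qf Qg] Y.P_comp1[OF 4] by simp
    have l3: "F2 Q (\<eta> C \<rhd>\<^bsub>Y\<^esub> Fcomp F g f) = id2 L (F1 Q (g \<odot>\<^bsub>Y\<^esub> f))"
      using lw[OF FC Y.comp1_hom[OF Ff Fg] c] F(10)[OF 4] \<eta>(2)[OF s(3)]
        X.base.hcomp_id_left[OF Qgf X.base.id2_hom1[OF Qgf]] by simp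
    show ?case
      using Y.vcomp_hom[OF x \<eta>1h[OF gf]] Y.vcomp_hom[OF y12 y3] Y.P_vcomp[OF x \<eta>1h[OF gf]] Y.P_vcomp[OF y12 y3]
        Y.P_vcomp[OF y1 y2] lx l1 l2 l3 \<eta>1(2)[OF gf] X.base.vcomp_id_left[OF X.base.id2_hom1[OF Qgf]]
      by (intro cell_eqI) auto
  next
    case (5 A)
    note i = Y.id1_hom[OF 5] and a = \<eta>(1)[OF 5]
    note Gi = Y.id1_hom[OF G(1)[OF 5]] and Fi = Y.id1_hom[OF F(1)[OF 5]]
    note FU = Y.iso2D[OF F(3)[OF 5]] and GU = Y.iso2D[OF G(3)[OF 5]]
    note Li = X.base.id1_hom[OF Y.P0[OF 5]]
    have x: "Funit G A \<lhd>\<^bsub>Y\<^esub> \<eta> A \<in> hom2 Y (\<eta> A) (F1 G (id1 Y A) \<odot>\<^bsub>Y\<^esub> \<eta> A)"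
      using Y.hom2_rwhisker[OF GU a Gi] Y.comp1_id_left[OF a] by simp
    have y: "\<eta> A \<rhd>\<^bsub>Y\<^esub> Funit F A \<in> hom2 Y (\<eta> A) (\<eta> A \<odot>\<^bsub>Y\<^esub> F1 F (id1 Y A))"
      using Y.hom2_lwhisker[OF FU Fi a] Y.comp1_id_right[OF a] by simp
    show ?case
      using Y.vcomp_hom[OF x \<eta>1h[OF i]] y Y.P_vcomp[OF x \<eta>1h[OF i]] rw[OF GU Gi a] lw[OF FU Fi a]
        F(4)[OF 5] G(4)[OF 5] \<eta>(2)[OF 5] \<eta>1(2)[OF i] Y.P_id1[OF 5] X.base.hcomp_id2[OF Li Li] X.base.comp1_id_left[OF Li]
        X.base.vcomp_id_left[OF X.base.id2_hom1[OF Li]] by (intro cell_eqI) auto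
  qed
  moreover have "lies_over Y L Q \<eta> \<eta>1"
    unfolding lies_over_def using \<eta>(2) \<eta>1(2)[OF Y.Mor_hom1] by simp
  ultimately show ?thesis unfolding pseudonat_equivalence_def using \<eta>(3) by blast
qed

text \<open>For the unit, y and K C y both correspond to C y, and C itself supplies the 1-cells on
  the other side; the counit is the same argument with the correspondence reversed.\<close>

theorem biequivalence:
  assumes K0: "\<And>x. x \<in> Ob X \<Longrightarrow> Rel x (K0 x)" and C0: "\<And>y. y \<in> Ob Y \<Longrightarrow> Rel (C0 y) y"
  obtains K C where "F0 K = K0" "F0 C = C0" "biequivalence_over L X P Y Q K C"
    "normal_psfun X Y K" "normal_psfun Y X C"
proof -
  interpret s: correspondence L Y Q X P "\<lambda>y x. Rel x y" by (rule correspondence_sym)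
  obtain K where K: "F0 K = K0" "over_psfun L X P Y Q K" "normal_psfun X Y K" using lift_psfun[OF K0] by blast
  obtain C where C: "F0 C = C0" "over_psfun L Y Q X P C" "normal_psfun Y X C" using s.lift_psfun[OF C0] by blast
  have pK: "pseudofunctor X Y K" using over_psfun_pseudofunctor[OF K(2) faithful_Y] .
  have pC: "pseudofunctor Y X C" using s.over_psfun_pseudofunctor[OF C(2) faithful_X] .
  note DK = over_psfunD[OF K(2), unfolded K(1)] and DC = over_psfunD[OF C(2), unfolded C(1)]
  have KC: "over_psfun L Y Q Y Q (comp_psfun Y K C)"
    using over_psfun_comp[OF s.over_pair_axioms over_pair_axioms C(2) K(2) pK] .
  have CK: "over_psfun L X P X P (comp_psfun X C K)"
    using over_psfun_comp[OF over_pair_axioms s.over_pair_axioms K(2) C(2) pC] .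
  have "\<exists>\<eta> \<eta>1. pseudonat_equivalence Y Y (id_psfun Y) (comp_psfun Y K C) \<eta> \<eta>1 \<and> lies_over Y L Q \<eta> \<eta>1"
    by (rule lift_transformation[OF over_psfun_id[OF Y.over_base_axioms] KC, of C0 "F1 C"])
      (use DC K0 C0 K(1) C(1) in \<open>auto simp: id_psfun_def comp_psfun_def\<close>)
  moreover have "\<exists>\<epsilon> \<epsilon>1. pseudonat_equivalence X X (comp_psfun X C K) (id_psfun X) \<epsilon> \<epsilon>1 \<and> lies_over X L P \<epsilon> \<epsilon>1"
    by (rule s.lift_transformation[OF CK over_psfun_id[OF X.over_base_axioms], of K0 "F1 K"])
      (use DK K0 C0 K(1) C(1) in \<open>auto simp: id_psfun_def comp_psfun_def\<close>)
  ultimately have "biequivalence_over L X P Y Q K C"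
    unfolding biequivalence_over_def
    using pK pC over_psfun_eq_psfun[OF K(2)] s.over_psfun_eq_psfun[OF C(2)] by blast
  then show ?thesis using that K C by blast
qed

end

section \<open>The biequivalence given by 2-kernels and 2-cokernels\<close>

context two_category begin

lemma arrow2_simps [simp]:
  "Ob (arrow2 L S) = S \<inter> Mor L" "Mor (arrow2 L S) = squares L S" "Cell (arrow2 L S) = square_cells L S"
  "src (arrow2 L S) = sq_src" "tgt (arrow2 L S) = sq_tgt" "dom2 (arrow2 L S) = sqc_dom" "cod2 (arrow2 L S) = sqc_cod"
  "id1 (arrow2 L S) = sq_id L" "id2 (arrow2 L S) p = SqCell p p (id2 L (sq_top p)) (id2 L (sq_bot p))"
  "comp1 (arrow2 L S) = sq_comp L"
  "vcomp (arrow2 L S) y x = SqCell (sqc_dom x) (sqc_cod y) (sqc_top y \<bullet> sqc_top x) (sqc_bot y \<bullet> sqc_bot x)"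
  "hcomp (arrow2 L S) y x = SqCell (sq_comp L (sqc_dom y) (sqc_dom x)) (sq_comp L (sqc_cod y) (sqc_cod x))
     (sqc_top y \<star> sqc_top x) (sqc_bot y \<star> sqc_bot x)"
  by (simp_all add: arrow2_def)

lemma sq_simps [simp]:
  "sq_src (sq_comp L q p) = sq_src p" "sq_tgt (sq_comp L q p) = sq_tgt q"
  "sq_top (sq_comp L q p) = sq_top q \<odot> sq_top p" "sq_bot (sq_comp L q p) = sq_bot q \<odot> sq_bot p"
  "sq_src (sq_id L f) = f" "sq_tgt (sq_id L f) = f"
  "sq_top (sq_id L f) = id1 L (src L f)" "sq_bot (sq_id L f) = id1 L (tgt L f)"
  by (simp_all add: sq_comp_def sq_id_def)

lemma arrow2_hom1_iff:
  "p \<in> hom1 (arrow2 L S) f g \<longleftrightarrow> (\<exists>s t \<phi>. p = Sq f g s t \<phi> \<and> Sq f g s t \<phi> \<in> squares L S)"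
  by (cases p) (auto simp: hom1_def)

lemma arrow2_hom1D:
  assumes "p \<in> hom1 (arrow2 L S) f g"
  shows "p = Sq f g (sq_top p) (sq_bot p) (sq_fill p)" "f \<in> S" "g \<in> S" "f \<in> Mor L" "g \<in> Mor L"
    "sq_top p \<in> hom1 L (src L f) (src L g)" "sq_bot p \<in> hom1 L (tgt L f) (tgt L g)"
    "sq_fill p \<in> iso2 L (g \<odot> sq_top p) (sq_bot p \<odot> f)"
  using assms by (auto simp: arrow2_hom1_iff squares_iff)

lemma arrow2_hom1I:
  "\<lbrakk>f \<in> S; g \<in> S; f \<in> Mor L; g \<in> Mor L; s \<in> hom1 L (src L f) (src L g); t \<in> hom1 L (tgt L f) (tgt L g);
    \<phi> \<in> iso2 L (g \<odot> s) (t \<odot> f)\<rbrakk> \<Longrightarrow> Sq f g s t \<phi> \<in> hom1 (arrow2 L S) f g"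
  by (simp add: arrow2_hom1_iff squares_iff)

lemma arrow2_hom2_iff:
  assumes "p \<in> hom1 (arrow2 L S) f g" "q \<in> hom1 (arrow2 L S) f g"
  shows "x \<in> hom2 (arrow2 L S) p q \<longleftrightarrow> x = SqCell p q (sqc_top x) (sqc_bot x) \<and>
     sqc_top x \<in> hom2 L (sq_top p) (sq_top q) \<and> sqc_bot x \<in> hom2 L (sq_bot p) (sq_bot q) \<and>
     sq_fill q \<bullet> (g \<rhd> sqc_top x) = (sqc_bot x \<lhd> f) \<bullet> sq_fill p"
proof (cases x)
  case (SqCell p' q' \<xi> \<mu>)
  show ?thesis using assms by (auto simp: SqCell hom2_def square_cells_iff hom1_def)
qed

lemma arrow2_hom2D:
  assumes "x \<in> hom2 (arrow2 L S) p q"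
  shows "\<exists>f g. p \<in> hom1 (arrow2 L S) f g \<and> q \<in> hom1 (arrow2 L S) f g"
  using assms by (cases x) (auto simp: hom2_def square_cells_iff hom1_def)

lemma over_base_arrow2:
  shows "over_base L (arrow2 L S) (dom_psfun L)" and "over_base L (arrow2 L S) (cod_psfun L)"
proof -
  interpret A: two_category "arrow2 L S" by (rule two_category_arrow2)
  have c: "sqc_top x \<in> hom2 L (sq_top p) (sq_top q) \<and> sqc_bot x \<in> hom2 L (sq_bot p) (sq_bot q)"
    if "x \<in> hom2 (arrow2 L S) p q" for x p q
    using arrow2_hom2D[OF that] arrow2_hom2_iff[of p S _ _ q x] that by blast
  show "over_base L (arrow2 L S) (dom_psfun L)"
    by unfold_locales (auto simp: dom_psfun_def src_Ob dest: arrow2_hom1D(6) c)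
  show "over_base L (arrow2 L S) (cod_psfun L)"
    by unfold_locales (auto simp: cod_psfun_def tgt_Ob dest: arrow2_hom1D(7) c)
qed

text \<open>The invertible filling determines the bottom component, whiskered with f, from the top
  one, and f is cofaithful.\<close>

lemma locally_faithful_dom:
  assumes "\<And>e. e \<in> E \<Longrightarrow> cofaithful1 L e"
  shows "locally_faithful (arrow2 L E) (dom_psfun L)"
  unfolding locally_faithful_def
proof (intro allI impI, elim conjE)
  fix p q x y
  assume x: "x \<in> hom2 (arrow2 L E) p q" and y: "y \<in> hom2 (arrow2 L E) p q"
    and "F2 (dom_psfun L) x = F2 (dom_psfun L) y"
  then have eq: "sqc_top x = sqc_top y" by (simp add: dom_psfun_def)
  obtain f g where pq: "p \<in> hom1 (arrow2 L E) f g" "q \<in> hom1 (arrow2 L E) f g" using arrow2_hom2D[OF x] by blast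
  note X = x[unfolded arrow2_hom2_iff[OF pq]] and Y = y[unfolded arrow2_hom2_iff[OF pq]]
  note p = arrow2_hom1D[OF pq(1)] and q = arrow2_hom1D[OF pq(2)]
  have f: "f \<in> hom1 L (src L f) (tgt L f)" using p by (simp add: hom1_def)
  have w: "sqc_bot x \<lhd> f \<in> hom2 L (sq_bot p \<odot> f) (sq_bot q \<odot> f)" "sqc_bot y \<lhd> f \<in> hom2 L (sq_bot p \<odot> f) (sq_bot q \<odot> f)"
    using hom2_rwhisker[OF _ f p(7)] X Y by auto
  have "(sqc_bot x \<lhd> f) \<bullet> sq_fill p = (sqc_bot y \<lhd> f) \<bullet> sq_fill p" using X Y eq by metis
  then have "sqc_bot x \<lhd> f = sqc_bot y \<lhd> f" by (rule iso2_cancel_right[OF p(8) w])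
  then have "sqc_bot x = sqc_bot y"
    using assms[OF p(2)] p(7) q(7) X Y unfolding cofaithful1_def faithful1_def by simp
  then show "x = y" using X Y eq by metis
qed

text \<open>The filling determines the top component, whiskered by g, from the bottom one, and g is
  faithful.\<close>

lemma locally_faithful_cod:
  assumes "\<And>m. m \<in> M \<Longrightarrow> faithful1 L m"
  shows "locally_faithful (arrow2 L M) (cod_psfun L)"
  unfolding locally_faithful_def
proof (intro allI impI, elim conjE)
  fix p q x y
  assume x: "x \<in> hom2 (arrow2 L M) p q" and y: "y \<in> hom2 (arrow2 L M) p q"
    and "F2 (cod_psfun L) x = F2 (cod_psfun L) y"
  then have eq: "sqc_bot x = sqc_bot y" by (simp add: cod_psfun_def)
  obtain f g where pq: "p \<in> hom1 (arrow2 L M) f g" "q \<in> hom1 (arrow2 L M) f g" using arrow2_hom2D[OF x] by blast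
  note X = x[unfolded arrow2_hom2_iff[OF pq]] and Y = y[unfolded arrow2_hom2_iff[OF pq]]
  note p = arrow2_hom1D[OF pq(1)] and q = arrow2_hom1D[OF pq(2)]
  have g: "g \<in> hom1 L (src L g) (tgt L g)" using p by (simp add: hom1_def)
  have w: "g \<rhd> sqc_top x \<in> hom2 L (g \<odot> sq_top p) (g \<odot> sq_top q)" "g \<rhd> sqc_top y \<in> hom2 L (g \<odot> sq_top p) (g \<odot> sq_top q)"
    using hom2_lwhisker[OF _ p(6) g] X Y by auto
  have "sq_fill q \<bullet> (g \<rhd> sqc_top x) = sq_fill q \<bullet> (g \<rhd> sqc_top y)" using X Y eq by metis
  then have "g \<rhd> sqc_top x = g \<rhd> sqc_top y" by (rule iso2_cancel_left[OF q(8) w])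
  then have "sqc_top x = sqc_top y"
    using assms[OF p(3)] p(6) q(6) X Y unfolding faithful1_def by blast
  then show "x = y" using X Y eq by metis
qed

end

context pointed begin

text \<open>All 1-cells factor through an identity and all 2-cells lift to themselves. Applied to
  maps into \<open>Z\<close>, and dually to maps out of it, this puts identities among the kernels
  and the cokernels.\<close>

lemma zkernel_nullish:
  assumes "nullish L Z f"
  shows "zkernel L Z f (id1 L (src L f))"
proof -
  have f: "f \<in> Mor L" using nullish_Mor[OF assms] .
  have i: "id1 L (src L f) \<in> Mor L" "src L (id1 L (src L f)) = src L f" "tgt L (id1 L (src L f)) = src L f" using f by auto
  have l: "id1 L (src L f) \<odot> u = u" if "u \<in> hom1 L X (src L f)" for u X using comp1_id_left[OF that] .
  have lc: "id1 L (src L f) \<rhd> \<mu> = \<mu>" if "u \<in> hom1 L X (src L f)" "\<mu> \<in> hom2 L u v" for u v X \<mu>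
    using hcomp_id_left[OF that] .
  show ?thesis unfolding zkernel_def i
  proof (intro conjI allI impI)
    show "nullish L Z (f \<odot> id1 L (src L f))" using assms f by (simp add: comp1_id_Mor)
  next
    fix X z assume "z \<in> hom1 L X (src L f) \<and> nullish L Z (f \<odot> z)"
    then have "z \<in> hom1 L X (src L f)" "isomorphic L z (id1 L (src L f) \<odot> z)"
      using l isomorphic_refl[of z] by (auto simp: hom1_def)
    then show "\<exists>u\<in>hom1 L X (src L f). isomorphic L z (id1 L (src L f) \<odot> u)" by blast
  next
    fix X u v \<xi>
    assume *: "u \<in> hom1 L X (src L f) \<and> v \<in> hom1 L X (src L f) \<and>
      \<xi> \<in> hom2 L (id1 L (src L f) \<odot> u) (id1 L (src L f) \<odot> v) \<and> invertible L (f \<rhd> \<xi>)"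
    then have "\<xi> \<in> hom2 L u v" using l[of u X] l[of v X] by simp
    then show "\<exists>!\<mu>. \<mu> \<in> hom2 L u v \<and> id1 L (src L f) \<rhd> \<mu> = \<xi>" using lc[of u X _ v] * by metis
  qed (use f i in auto)
qed

end

context rigid_pointed begin

text \<open>An identity makes null exactly the morphisms through \<open>Z\<close>. For 2-cells, the
  unique 2-cell from u to v is the lift, since rigidity allows just one invertible 2-cell between
  the null composites. This is where K(id) acquires the domain \<open>Z\<close>.\<close>

lemma zkernel_id:
  assumes j: "j \<in> hom1 L Z A"
  shows "zkernel L Z (id1 L A) j"
proof -
  have A: "A \<in> Ob L" using hom1_Ob[OF j] by blast
  have i: "src L (id1 L A) = A" using A by simp
  have jM: "j \<in> Mor L" "tgt L j = A" "src L j = Z" using j by (auto simp: hom1_def)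
  have jn: "nullish L Z j" using nullish_factor[OF id1_hom[OF zero_Ob] j] comp1_id_right[OF j] by simp
  show ?thesis unfolding zkernel_def i jM
  proof (intro conjI allI impI)
    show "nullish L Z (id1 L A \<odot> j)" using jn comp1_id_left[OF j] by simp
  next
    fix X z assume z: "z \<in> hom1 L X A \<and> nullish L Z (id1 L A \<odot> z)"
    then have n: "nullish L Z z" using comp1_id_left[of z X A] by simp
    obtain t where t: "t \<in> hom1 L X Z" using to_zero_hom[of X] hom1_Ob z by blast
    have s: "src L z = X" "tgt L z = A" using z by (auto simp: hom1_def)
    show "\<exists>u\<in>hom1 L X Z. isomorphic L z (j \<odot> u)"
      using t nullish_any[OF n, unfolded s, OF t j] by blast
  next
    fix X u v \<xi>
    assume *: "u \<in> hom1 L X Z \<and> v \<in> hom1 L X Z \<and> \<xi> \<in> hom2 L (j \<odot> u) (j \<odot> v) \<and> invertible L (id1 L A \<rhd> \<xi>)"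
    then have u: "u \<in> hom1 L X Z" and v: "v \<in> hom1 L X Z" and xi: "\<xi> \<in> hom2 L (j \<odot> u) (j \<odot> v)" by auto
    have "id1 L A \<rhd> \<xi> = \<xi>" using hcomp_id_left[OF comp1_hom[OF u j] xi] .
    then have x: "\<xi> \<in> iso2 L (j \<odot> u) (j \<odot> v)" using xi * by (simp add: iso2_iff)
    obtain \<mu> where mu: "\<mu> \<in> hom2 L u v" using to_zero_ex1[OF u v] by blast
    have "j \<rhd> \<mu> = \<xi>"
      using nullish_iso_unique[OF nullish_factor[OF u j] iso2_lwhisker[OF to_zero_iso[OF u v mu] u j] x] .
    then show "\<exists>!\<mu>. \<mu> \<in> hom2 L u v \<and> j \<rhd> \<mu> = \<xi>" using mu to_zero_ex1[OF u v] by blast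
  qed (use A jM in auto)
qed

section \<open>Short exact sequences and the correspondence they define\<close>

definition kernels :: "'b set" where
  "kernels = {m. \<exists>f. zkernel L Z f m}"

definition cokernels :: "'b set" where
  "cokernels = {c. \<exists>f. zkernel (op L) Z f c}"

text \<open>A short exact sequence, with its second map written first to match the passage from
  cokernels to kernels.\<close>

definition ses :: "'b \<Rightarrow> 'b \<Rightarrow> bool" where
  "ses e m \<longleftrightarrow> zkernel L Z e m \<and> zkernel (op L) Z m e"

lemma ses_op: "rigid_pointed.ses (op L) Z e m = ses m e"
  by (simp add: rigid_pointed.ses_def[OF rigid_pointed_op] ses_def conj_commute)

text \<open>The composite of m, s and \<open>e'\<close> is isomorphic to t e m, which is null, so s
  m factors through the kernel \<open>m'\<close>.\<close>

lemma ses_square_lift: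
  assumes "ses e m" "ses e' m'" "s \<in> hom1 L (src L e) (src L e')" "t \<in> hom1 L (tgt L e) (tgt L e')"
    "\<phi> \<in> iso2 L (e' \<odot> s) (t \<odot> e)"
  shows "\<exists>u \<psi>. u \<in> hom1 L (src L m) (src L m') \<and> \<psi> \<in> iso2 L (m' \<odot> u) (s \<odot> m)"
proof -
  note z = zkernelD[of e m] and z' = zkernelD[of e' m']
  have k: "zkernel L Z e m" "zkernel L Z e' m'" using assms by (auto simp: ses_def)
  have h: "m \<in> hom1 L (src L m) (src L e)" "e \<in> hom1 L (src L e) (tgt L e)" "e' \<in> hom1 L (src L e') (tgt L e')"
    using z[OF k(1)] z'[OF k(2)] by (auto simp: hom1_def)
  note sm = comp1_hom[OF h(1) assms(3)]
  have "isomorphic L ((e' \<odot> s) \<odot> m) ((t \<odot> e) \<odot> m)"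
    using isomorphicI[OF assms(5)] h assms(3) by (intro isomorphic_rwhisker) (auto simp: hom1_def)
  moreover have "nullish L Z (t \<odot> e \<odot> m)"
    using nullish_lwhisker[OF z(4)[OF k(1)], of t] assms(4) h by (simp add: hom1_def)
  ultimately have "nullish L Z (e' \<odot> s \<odot> m)"
    using nullish_cong comp1_assoc[OF h(1) assms(3) h(3)] comp1_assoc[OF h(1,2) assms(4)] by simp
  then obtain u where u: "u \<in> hom1 L (src L m) (src L m')" "isomorphic L (s \<odot> m) (m' \<odot> u)"
    using z'(5)[OF k(2) sm] by blast
  then show ?thesis using isomorphic_sym isomorphicE by metis
qed

text \<open>Conjugating \<open>\<xi> \<lhd> m\<close> by the fillings gives \<zeta>, the only
  candidate for \<open>m' \<rhd> \<nu>\<close>. It lifts along \<open>m'\<close> because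
  \<open>e' \<rhd> \<zeta>\<close> is conjugate to \<mu> whiskered with the nullish e m.\<close>

lemma ses_cell_lift:
  assumes ses: "ses e m" "ses e' m'" and s: "s \<in> hom1 L (src L e) (src L e')" and t: "t \<in> hom1 L (tgt L e) (tgt L e')"
    and \<phi>: "\<phi> \<in> iso2 L (e' \<odot> s) (t \<odot> e)" and \<phi>': "\<phi>' \<in> iso2 L (e' \<odot> s') (t' \<odot> e)"
    and u: "u \<in> hom1 L (src L m) (src L m')" and u': "u' \<in> hom1 L (src L m) (src L m')"
    and \<psi>: "\<psi> \<in> iso2 L (m' \<odot> u) (s \<odot> m)" and \<psi>': "\<psi>' \<in> iso2 L (m' \<odot> u') (s' \<odot> m)"
    and \<xi>: "\<xi> \<in> hom2 L s s'" and \<mu>: "\<mu> \<in> hom2 L t t'" and eq: "\<phi>' \<bullet> (e' \<rhd> \<xi>) = (\<mu> \<lhd> e) \<bullet> \<phi>"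
  shows "\<exists>\<nu> \<in> hom2 L u u'. \<psi>' \<bullet> (m' \<rhd> \<nu>) = (\<xi> \<lhd> m) \<bullet> \<psi>"
proof -
  have k: "zkernel L Z e m" "zkernel L Z e' m'" using ses by (auto simp: ses_def)
  note z = zkernelD[OF k(1)] and z' = zkernelD[OF k(2)]
  have h: "m \<in> hom1 L (src L m) (src L e)" "m' \<in> hom1 L (src L m') (src L e')" "e \<in> hom1 L (src L e) (tgt L e)"
    "e' \<in> hom1 L (src L e') (tgt L e')"
    using z z' by (auto simp: hom1_def)
  have s': "s' \<in> hom1 L (src L e) (src L e')" and t': "t' \<in> hom1 L (tgt L e) (tgt L e')"
    using cell_hom1 s t \<xi> \<mu> by blast+
  obtain \<chi> where \<chi>: "\<chi> \<in> iso2 L (s' \<odot> m) (m' \<odot> u')" "\<psi>' \<bullet> \<chi> = id2 L (s' \<odot> m)" using \<psi>' by (rule iso2E)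
  have T: "\<phi> \<in> Cell L" "dom2 L \<phi> = e' \<odot> s" "cod2 L \<phi> = t \<odot> e" "\<phi>' \<in> Cell L" "dom2 L \<phi>' = e' \<odot> s'" "cod2 L \<phi>' = t' \<odot> e"
    "\<psi> \<in> Cell L" "dom2 L \<psi> = m' \<odot> u" "cod2 L \<psi> = s \<odot> m" "\<psi>' \<in> Cell L" "dom2 L \<psi>' = m' \<odot> u'" "cod2 L \<psi>' = s' \<odot> m"
    "\<xi> \<in> Cell L" "dom2 L \<xi> = s" "cod2 L \<xi> = s'" "\<mu> \<in> Cell L" "dom2 L \<mu> = t" "cod2 L \<mu> = t'"
    "\<chi> \<in> Cell L" "dom2 L \<chi> = s' \<odot> m" "cod2 L \<chi> = m' \<odot> u'"
    "s \<in> Mor L" "t \<in> Mor L" "u \<in> Mor L" "s' \<in> Mor L" "t' \<in> Mor L" "u' \<in> Mor L" "e \<in> Mor L" "m \<in> Mor L" "e' \<in> Mor L" "m' \<in> Mor L"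
    "src L s = src L e" "tgt L s = src L e'" "src L s' = src L e" "tgt L s' = src L e'"
    "src L t = tgt L e" "tgt L t = tgt L e'" "src L t' = tgt L e" "tgt L t' = tgt L e'"
    "src L u = src L m" "tgt L u = src L m'" "src L u' = src L m" "tgt L u' = src L m'" "tgt L m = src L e" "tgt L m' = src L e'"
    using s t s' t' u u' h iso2D[OF \<phi>] iso2D[OF \<phi>'] iso2D[OF \<psi>] iso2D[OF \<psi>'] iso2D[OF \<chi>(1)] \<xi> \<mu>
    by (auto simp: hom1_def hom2_def)
  define \<zeta> where "\<zeta> = \<chi> \<bullet> (\<xi> \<lhd> m) \<bullet> \<psi>"
  have \<zeta>: "\<zeta> \<in> hom2 L (m' \<odot> u) (m' \<odot> u')" unfolding \<zeta>_def using T by (simp add: hom2_def)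
  have \<zeta>T: "\<zeta> \<in> Cell L" "dom2 L \<zeta> = m' \<odot> u" "cod2 L \<zeta> = m' \<odot> u'" using \<zeta> by (auto simp: hom2_def)
  have "\<psi>' \<bullet> \<zeta> = (\<psi>' \<bullet> \<chi>) \<bullet> (\<xi> \<lhd> m) \<bullet> \<psi>" unfolding \<zeta>_def using T by (simp add: vcomp_assoc_Cell)
  then have \<psi>\<zeta>: "\<psi>' \<bullet> \<zeta> = (\<xi> \<lhd> m) \<bullet> \<psi>" using T \<chi>(2) by (simp add: vcomp_id_Cell)
  have "invertible L (e' \<rhd> \<zeta>) \<longleftrightarrow> invertible L (e' \<rhd> (\<xi> \<lhd> m))"
  proof (rule invertible_conj)
    show "e' \<rhd> \<psi> \<in> iso2 L (e' \<odot> m' \<odot> u) (e' \<odot> s \<odot> m)" "e' \<rhd> \<psi>' \<in> iso2 L (e' \<odot> m' \<odot> u') (e' \<odot> s' \<odot> m)"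
      using iso2_lwhisker[OF \<psi> comp1_hom[OF u h(2)] h(4)] iso2_lwhisker[OF \<psi>' comp1_hom[OF u' h(2)] h(4)] by auto
    show "e' \<rhd> \<zeta> \<in> hom2 L (e' \<odot> m' \<odot> u) (e' \<odot> m' \<odot> u')" "e' \<rhd> (\<xi> \<lhd> m) \<in> hom2 L (e' \<odot> s \<odot> m) (e' \<odot> s' \<odot> m)"
      using T \<zeta>T by (simp_all add: hom2_def)
    have "(e' \<rhd> \<psi>') \<bullet> (e' \<rhd> \<zeta>) = e' \<rhd> (\<psi>' \<bullet> \<zeta>)" using T \<zeta>T by (simp add: lwhisker_vcomp)
    then show "(e' \<rhd> \<psi>') \<bullet> (e' \<rhd> \<zeta>) = (e' \<rhd> (\<xi> \<lhd> m)) \<bullet> (e' \<rhd> \<psi>)" unfolding \<psi>\<zeta> using T by (simp add: lwhisker_vcomp)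
  qed
  also have "\<dots> \<longleftrightarrow> invertible L (\<mu> \<lhd> (e \<odot> m))"
  proof (rule invertible_conj)
    show "\<phi> \<lhd> m \<in> iso2 L (e' \<odot> s \<odot> m) (t \<odot> e \<odot> m)" "\<phi>' \<lhd> m \<in> iso2 L (e' \<odot> s' \<odot> m) (t' \<odot> e \<odot> m)"
      using iso2_rwhisker[OF \<phi> h(1) comp1_hom[OF s h(4)]] iso2_rwhisker[OF \<phi>' h(1) comp1_hom[OF s' h(4)]] T
      by (auto simp: comp1_assoc_Mor)
    show "e' \<rhd> (\<xi> \<lhd> m) \<in> hom2 L (e' \<odot> s \<odot> m) (e' \<odot> s' \<odot> m)" "\<mu> \<lhd> (e \<odot> m) \<in> hom2 L (t \<odot> e \<odot> m) (t' \<odot> e \<odot> m)"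
      using T by (simp_all add: hom2_def)
    have "(\<phi>' \<lhd> m) \<bullet> (e' \<rhd> (\<xi> \<lhd> m)) = (\<phi>' \<bullet> (e' \<rhd> \<xi>)) \<lhd> m" using T by (simp add: cell_nf)
    then show "(\<phi>' \<lhd> m) \<bullet> (e' \<rhd> (\<xi> \<lhd> m)) = (\<mu> \<lhd> (e \<odot> m)) \<bullet> (\<phi> \<lhd> m)" unfolding eq using T by (simp add: cell_nf)
  qed
  also have "\<dots>" using nullish_rwhisker_invertible[OF z(4) \<mu>] T t by simp
  finally obtain \<nu> where "\<nu> \<in> hom2 L u u'" "m' \<rhd> \<nu> = \<zeta>" using z'(6)[OF u u' \<zeta>] by blast
  then show ?thesis using \<psi>\<zeta> by blast
qed

text \<open>Dual of \<open>ses_square_lift\<close>; the filling 2-cells run backwards in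
  \<open>op L\<close> and are inverted on the way in and out.\<close>

lemma ses_square_lift':
  assumes "ses e m" "ses e' m'" "u \<in> hom1 L (src L m) (src L m')" "s \<in> hom1 L (tgt L m) (tgt L m')"
    "\<psi> \<in> iso2 L (m' \<odot> u) (s \<odot> m)"
  shows "\<exists>t \<phi>. t \<in> hom1 L (tgt L e) (tgt L e') \<and> \<phi> \<in> iso2 L (e' \<odot> s) (t \<odot> e)"
proof -
  interpret op: rigid_pointed "op L" Z by (rule rigid_pointed_op)
  have o: "op.ses m' e'" "op.ses m e" using assms(1,2) ses_op by auto
  have "\<exists>t \<phi>. t \<in> hom1 L (tgt L e) (tgt L e') \<and> \<phi> \<in> iso2 L (t \<odot> e) (e' \<odot> s)"
    using op.ses_square_lift[OF o, of s u "inv2 L \<psi>"] assms(3,4) inv2_iso2[OF assms(5)] by simp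
  then show ?thesis using inv2_iso2 by blast
qed

text \<open>Dual of \<open>ses_cell_lift\<close>: the compatibility equation is rewritten for the
  inverted fillings, and the equation obtained is rewritten back.\<close>

lemma ses_cell_lift':
  assumes ses: "ses e m" "ses e' m'" and u: "u \<in> hom1 L (src L m) (src L m')" and s: "s \<in> hom1 L (tgt L m) (tgt L m')"
    and \<psi>: "\<psi> \<in> iso2 L (m' \<odot> u) (s \<odot> m)" and \<psi>': "\<psi>' \<in> iso2 L (m' \<odot> u') (s' \<odot> m)"
    and t: "t \<in> hom1 L (tgt L e) (tgt L e')" and t': "t' \<in> hom1 L (tgt L e) (tgt L e')"
    and \<phi>: "\<phi> \<in> iso2 L (e' \<odot> s) (t \<odot> e)" and \<phi>': "\<phi>' \<in> iso2 L (e' \<odot> s') (t' \<odot> e)"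
    and \<nu>: "\<nu> \<in> hom2 L u u'" and \<xi>: "\<xi> \<in> hom2 L s s'" and eq: "\<psi>' \<bullet> (m' \<rhd> \<nu>) = (\<xi> \<lhd> m) \<bullet> \<psi>"
  shows "\<exists>\<mu> \<in> hom2 L t t'. \<phi>' \<bullet> (e' \<rhd> \<xi>) = (\<mu> \<lhd> e) \<bullet> \<phi>"
proof -
  interpret op: rigid_pointed "op L" Z by (rule rigid_pointed_op)
  have o: "op.ses m' e'" "op.ses m e" using ses ses_op by auto
  \<comment> \<open>A commuting square of 2-cells still commutes with its two invertible sides
    reversed.\<close>
  have swap: "\<beta> \<bullet> inv2 L \<alpha> = inv2 L \<alpha>' \<bullet> \<gamma>"
    if "\<alpha> \<in> iso2 L a b" "\<alpha>' \<in> iso2 L a' b'" "\<beta> \<in> hom2 L a a'" "\<gamma> \<in> hom2 L b b'" "\<alpha>' \<bullet> \<beta> = \<gamma> \<bullet> \<alpha>"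
    for \<alpha> \<alpha>' \<beta> \<gamma> a b a' b'
  proof (rule iso2_cancel_left[OF that(2) vcomp_hom[OF iso2D[OF inv2_iso2[OF that(1)]] that(3)]
        vcomp_hom[OF that(4) iso2D[OF inv2_iso2[OF that(2)]]]])
    show "\<alpha>' \<bullet> \<beta> \<bullet> inv2 L \<alpha> = \<alpha>' \<bullet> inv2 L \<alpha>' \<bullet> \<gamma>"
      using vcomp_assoc[OF iso2D[OF inv2_iso2[OF that(1)]] that(3) iso2D[OF that(2)]]
        vcomp_assoc[OF that(4) iso2D[OF inv2_iso2[OF that(2)]] iso2D[OF that(2)]]
        vcomp_assoc[OF iso2D[OF inv2_iso2[OF that(1)]] iso2D[OF that(1)] that(4)]
        that(5) inv2_vcomp(2)[OF that(1)] inv2_vcomp(2)[OF that(2)] vcomp_id_left[OF that(4)] vcomp_id_right[OF that(4)]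
      by simp
  qed
  have k: "zkernel L Z e m" "zkernel L Z e' m'" using ses by (auto simp: ses_def)
  note z = zkernelD[OF k(1)] and z' = zkernelD[OF k(2)]
  have h: "m \<in> hom1 L (src L m) (src L e)" "m' \<in> hom1 L (src L m') (src L e')" "e \<in> hom1 L (src L e) (tgt L e)"
    "e' \<in> hom1 L (src L e') (tgt L e')"
    using z z' by (auto simp: hom1_def)
  have s2: "s \<in> hom1 L (src L e) (src L e')" using s z(3) z'(3) by simp
  have e1: "(m' \<rhd> \<nu>) \<bullet> inv2 L \<psi> = inv2 L \<psi>' \<bullet> (\<xi> \<lhd> m)"
    using swap[OF \<psi> \<psi>' hom2_lwhisker[OF \<nu> u h(2)] hom2_rwhisker[OF \<xi> h(1) s2] eq] .
  have "\<exists>\<mu>\<in>hom2 L t t'. inv2 L \<phi>' \<bullet> (\<mu> \<lhd> e) = (e' \<rhd> \<xi>) \<bullet> inv2 L \<phi>"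
    using op.ses_cell_lift[OF o, of s u "inv2 L \<psi>" "inv2 L \<psi>'" s' u' t t' "inv2 L \<phi>" "inv2 L \<phi>'" \<xi> \<nu>]
      s u t t' inv2_iso2[OF \<psi>] inv2_iso2[OF \<psi>'] inv2_iso2[OF \<phi>] inv2_iso2[OF \<phi>'] \<nu> \<xi> e1 z(3) z'(3) by simp
  then obtain \<mu> where \<mu>: "\<mu> \<in> hom2 L t t'" "inv2 L \<phi>' \<bullet> (\<mu> \<lhd> e) = (e' \<rhd> \<xi>) \<bullet> inv2 L \<phi>" by blast
  have inv: "inv2 L (inv2 L \<alpha>) = \<alpha>" if \<alpha>: "\<alpha> \<in> iso2 L a b" for \<alpha> a b
  proof -
    obtain \<beta> where b: "\<beta> \<in> iso2 L b a" "\<beta> \<bullet> \<alpha> = id2 L a" "\<alpha> \<bullet> \<beta> = id2 L b" "inv2 L \<alpha> = \<beta>" using \<alpha> by (rule iso2E)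
    obtain \<gamma> where c: "\<gamma> \<in> iso2 L a b" "\<gamma> \<bullet> \<beta> = id2 L b" "\<beta> \<bullet> \<gamma> = id2 L a" "inv2 L \<beta> = \<gamma>" using b(1) by (rule iso2E)
    have "\<gamma> = \<alpha>" using iso2_cancel_left[OF b(1) iso2D[OF c(1)] iso2D[OF \<alpha>]] b c by simp
    then show ?thesis using b c by simp
  qed
  have "(\<mu> \<lhd> e) \<bullet> inv2 L (inv2 L \<phi>) = inv2 L (inv2 L \<phi>') \<bullet> (e' \<rhd> \<xi>)"
    using swap[OF inv2_iso2[OF \<phi>] inv2_iso2[OF \<phi>'] hom2_rwhisker[OF \<mu>(1) h(3) t] hom2_lwhisker[OF \<xi> s2 h(4)] \<mu>(2)] .
  then show ?thesis using \<mu>(1) inv[OF \<phi>] inv[OF \<phi>'] by metis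
qed

text \<open>Both projections give the middle object of a short exact sequence, dom on the cokernel
  side and cod on the kernel side. A square on either side thus lies over its edge between middle
  objects, and the lifts are those of \<open>ses_square_lift\<close> and
  \<open>ses_cell_lift\<close> with their duals.\<close>

lemma ses_correspondence:
  assumes E: "\<And>e. e \<in> E \<Longrightarrow> cofaithful1 L e" and M: "\<And>m. m \<in> M \<Longrightarrow> faithful1 L m"
  shows "correspondence L (arrow2 L E) (dom_psfun L) (arrow2 L M) (cod_psfun L) (\<lambda>e m. e \<in> E \<and> m \<in> M \<and> ses e m)"
proof -
  interpret A: over_base L "arrow2 L E" "dom_psfun L" by (rule over_base_arrow2)
  interpret B: over_base L "arrow2 L M" "cod_psfun L" by (rule over_base_arrow2)
  note [simp] = dom_psfun_def cod_psfun_def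
  have st: "e \<in> Mor L" "m \<in> Mor L" "tgt L m = src L e" if "ses e m" for e m
    using that zkernelD unfolding ses_def by blast+
  show ?thesis
  proof (unfold_locales, goal_cases)
    case (1 e m) then show ?case using st[of e m] by simp
  next
    case 2 show ?case by (rule locally_faithful_dom[OF E])
  next
    case 3 show ?case by (rule locally_faithful_cod[OF M])
  next
    case (4 e m e' m' p)
    note p = arrow2_hom1D[OF 4(3)]
    obtain u \<psi> where u: "u \<in> hom1 L (src L m) (src L m')" "\<psi> \<in> iso2 L (m' \<odot> u) (sq_top p \<odot> m)"
      using ses_square_lift[of e m e' m'] 4 p by blast
    have "Sq m m' u (sq_top p) \<psi> \<in> hom1 (arrow2 L M) m m'" using u 4 p st[of e m] st[of e' m'] by (intro arrow2_hom1I) auto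
    then show ?case by (intro bexI[of _ "Sq m m' u (sq_top p) \<psi>"]) auto
  next
    case (5 e m e' m' p)
    note p = arrow2_hom1D[OF 5(3)]
    obtain t \<phi> where t: "t \<in> hom1 L (tgt L e) (tgt L e')" "\<phi> \<in> iso2 L (e' \<odot> sq_bot p) (t \<odot> e)"
      using ses_square_lift'[of e m e' m'] 5 p by blast
    have "Sq e e' (sq_bot p) t \<phi> \<in> hom1 (arrow2 L E) e e'" using t 5 p st[of e m] st[of e' m'] by (intro arrow2_hom1I) auto
    then show ?case by (intro bexI[of _ "Sq e e' (sq_bot p) t \<phi>"]) auto
  next
    case (6 e m e' m' p p' q q' x)
    note p = arrow2_hom1D[OF 6(3)] and p' = arrow2_hom1D[OF 6(4)] and q = arrow2_hom1D[OF 6(5)] and q' = arrow2_hom1D[OF 6(6)]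
    note x = 6(9)[unfolded arrow2_hom2_iff[OF 6(3,4)]]
    have s: "ses e m" "ses e' m'" "sq_bot q = sq_top p" "sq_bot q' = sq_top p'" using 6 by auto
    obtain \<nu> where "\<nu> \<in> hom2 L (sq_top q) (sq_top q')" "sq_fill q' \<bullet> (m' \<rhd> \<nu>) = (sqc_top x \<lhd> m) \<bullet> sq_fill q"
      using ses_cell_lift[OF s(1,2) p(6,7,8) p'(8) q(6) q'(6) q(8)[unfolded s(3)] q'(8)[unfolded s(4)]] x by blast
    then have "SqCell q q' \<nu> (sqc_top x) \<in> hom2 (arrow2 L M) q q'"
      unfolding arrow2_hom2_iff[OF 6(5,6)] using x s by simp
    then show ?case by (intro bexI[of _ "SqCell q q' \<nu> (sqc_top x)"]) auto
  next
    case (7 e m e' m' p p' q q' x)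
    note p = arrow2_hom1D[OF 7(3)] and p' = arrow2_hom1D[OF 7(4)] and q = arrow2_hom1D[OF 7(5)] and q' = arrow2_hom1D[OF 7(6)]
    note x = 7(9)[unfolded arrow2_hom2_iff[OF 7(5,6)]]
    have s: "ses e m" "ses e' m'" "sq_top p = sq_bot q" "sq_top p' = sq_bot q'" using 7 by auto
    obtain \<mu> where "\<mu> \<in> hom2 L (sq_bot p) (sq_bot p')" "sq_fill p' \<bullet> (e' \<rhd> sqc_bot x) = (\<mu> \<lhd> e) \<bullet> sq_fill p"
      using ses_cell_lift'[OF s(1,2) q(6,7,8) q'(8) p(7) p'(7) p(8)[unfolded s(3)] p'(8)[unfolded s(4)]] x by blast
    then have "SqCell p p' (sqc_bot x) \<mu> \<in> hom2 (arrow2 L E) p p'"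
      unfolding arrow2_hom2_iff[OF 7(3,4)] using x s by simp
    then show ?case by (intro bexI[of _ "SqCell p p' (sqc_bot x) \<mu>"]) auto
  qed
qed

lemma zero_exact_factorization_system:
  assumes "zero_exact L Z"
  shows "factorization_system L cokernels kernels" and "proper11 L cokernels kernels"
proof -
  interpret op: rigid_pointed "op L" Z by (rule rigid_pointed_op)
  have "i \<odot> e \<in> cokernels" if "e \<in> cokernels" "equivalence1 L i" "src L i = tgt L e" for e i
    using op.zkernel_comp_equivalence[of _ e i] that unfolding cokernels_def by auto
  moreover have "m \<odot> i \<in> kernels" if "m \<in> kernels" "equivalence1 L i" "tgt L i = src L m" for m i
    using zkernel_comp_equivalence[of _ m i] that unfolding kernels_def by auto
  moreover have "g \<in> cokernels" if "f \<in> cokernels" "iso2 L f g \<noteq> {}" for f g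
    using op.zkernel_isomorphic[of _ f g] that unfolding cokernels_def isomorphic_def by auto
  moreover have "g \<in> kernels" if "f \<in> kernels" "iso2 L f g \<noteq> {}" for f g
    using zkernel_isomorphic[of _ f g] that unfolding kernels_def isomorphic_def by auto
  moreover have "cokernels \<subseteq> Mor L" "kernels \<subseteq> Mor L"
    using zcokernelD(2) zkernelD(2) unfolding cokernels_def kernels_def by auto
  moreover have "\<exists>e\<in>cokernels. \<exists>m\<in>kernels. tgt L e = src L m \<and> iso2 L f (m \<odot> e) \<noteq> {}" if "f \<in> Mor L" for f
    using assms that unfolding zero_exact_def cokernels_def kernels_def isomorphic_def by blast
  moreover have "orthogonal L e m" if "e \<in> cokernels" "m \<in> kernels" for e m
    using that zkernel_orthogonal unfolding cokernels_def kernels_def by blast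
  ultimately show "factorization_system L cokernels kernels" unfolding factorization_system_def by blast
  show "proper11 L cokernels kernels"
    unfolding proper11_def cokernels_def kernels_def using zkernel_faithful zcokernel_cofaithful by blast
qed

text \<open>The choices of kernels and cokernels are free except at identities, where the condition
  asks for \<open>Z\<close> itself and not only for an equivalent object.\<close>

theorem zero_exact_biequivalence:
  assumes ex: "zero_exact L Z"
  shows "\<exists>E M K C. factorization_system L E M \<and> proper11 L E M \<and>
        biequivalence_over L (arrow2 L E) (dom_psfun L) (arrow2 L M) (cod_psfun L) K C \<and>
        normal_psfun (arrow2 L E) (arrow2 L M) K \<and> normal_psfun (arrow2 L M) (arrow2 L E) C \<and>
        (\<forall>A \<in> Ob L. src L (F0 K (id1 L A)) = Z \<and> tgt L (F0 C (id1 L A)) = Z)"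
proof -
  interpret op: rigid_pointed "op L" Z by (rule rigid_pointed_op)
  note fs = zero_exact_factorization_system[OF ex]
  have cf: "cofaithful1 L e" if "e \<in> cokernels" for e using fs(2) that unfolding proper11_def by blast
  have ff: "faithful1 L m" if "m \<in> kernels" for m using fs(2) that unfolding proper11_def by blast
  interpret c: correspondence L "arrow2 L cokernels" "dom_psfun L" "arrow2 L kernels" "cod_psfun L"
    "\<lambda>e m. e \<in> cokernels \<and> m \<in> kernels \<and> ses e m"
    by (rule ses_correspondence) (fact cf ff)+
  \<comment> \<open>An identity is a cokernel of the map from \<open>Z\<close>, which in turn is a
    kernel of the identity; this sequence is the prescribed value of K at the identity.\<close>
  have idk: "\<exists>j. j \<in> hom1 L Z A \<and> ses (id1 L A) j \<and> id1 L A \<in> cokernels" if A: "A \<in> Ob L" for A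
  proof -
    obtain j where j: "j \<in> hom1 L Z A" using from_zero_hom[OF A] by blast
    have "nullish L Z j" using nullish_factor[OF id1_hom[OF zero_Ob] j] comp1_id_right[OF j] by simp
    then have "zkernel (op L) Z j (id1 L A)" using op.zkernel_nullish[of j] j by (simp add: hom1_def)
    then show ?thesis using j zkernel_id[OF j] unfolding ses_def cokernels_def by blast
  qed
  have idc: "\<exists>t. t \<in> hom1 L A Z \<and> ses t (id1 L A) \<and> id1 L A \<in> kernels" if A: "A \<in> Ob L" for A
  proof -
    obtain t where t: "t \<in> hom1 L A Z" using to_zero_hom[OF A] by blast
    have "nullish L Z t" using nullish_factor[OF t id1_hom[OF zero_Ob]] comp1_id_left[OF t] by simp
    then have "zkernel L Z t (id1 L A)" using zkernel_nullish[of t] t by (simp add: hom1_def)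
    moreover have "zkernel (op L) Z (id1 L A) t" using op.zkernel_id[of t A] t by simp
    ultimately show ?thesis using t unfolding ses_def kernels_def by blast
  qed
  have K0: "\<exists>m. ses e m \<and> (\<forall>A\<in>Ob L. e = id1 L A \<longrightarrow> src L m = Z)" if e: "e \<in> cokernels" for e
  proof (cases "\<exists>A\<in>Ob L. e = id1 L A")
    case True
    then show ?thesis using idk by (auto simp: hom1_def)
  next
    case False
    obtain f where f: "zkernel (op L) Z f e" using e unfolding cokernels_def by blast
    then obtain m where m: "zkernel L Z e m" using ex zcokernelD(2) unfolding zero_exact_def by blast
    then have "ses e m" using ex f unfolding zero_exact_def ses_def by blast
    then show ?thesis using False by blast
  qed
  have C0: "\<exists>c. ses c m \<and> (\<forall>A\<in>Ob L. m = id1 L A \<longrightarrow> tgt L c = Z)" if m: "m \<in> kernels" for m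
  proof (cases "\<exists>A\<in>Ob L. m = id1 L A")
    case True
    then show ?thesis using idc by (auto simp: hom1_def)
  next
    case False
    obtain f where f: "zkernel L Z f m" using m unfolding kernels_def by blast
    then obtain c where c: "zkernel (op L) Z m c" using ex zkernelD(2) unfolding zero_exact_def by blast
    then have "ses c m" using ex f unfolding zero_exact_def ses_def by blast
    then show ?thesis using False by blast
  qed
  define k0 where "k0 e = (SOME m. ses e m \<and> (\<forall>A\<in>Ob L. e = id1 L A \<longrightarrow> src L m = Z))" for e
  define c0 where "c0 m = (SOME c. ses c m \<and> (\<forall>A\<in>Ob L. m = id1 L A \<longrightarrow> tgt L c = Z))" for m
  have k0: "ses e (k0 e) \<and> (\<forall>A\<in>Ob L. e = id1 L A \<longrightarrow> src L (k0 e) = Z)" if "e \<in> cokernels" for e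
    unfolding k0_def by (rule someI_ex[OF K0[OF that]])
  have c0: "ses (c0 m) m \<and> (\<forall>A\<in>Ob L. m = id1 L A \<longrightarrow> tgt L (c0 m) = Z)" if "m \<in> kernels" for m
    unfolding c0_def by (rule someI_ex[OF C0[OF that]])
  have k0r: "e \<in> cokernels \<and> k0 e \<in> kernels \<and> ses e (k0 e)" if "e \<in> Ob (arrow2 L cokernels)" for e
    using k0[of e] that unfolding kernels_def ses_def by auto
  have c0r: "c0 m \<in> cokernels \<and> m \<in> kernels \<and> ses (c0 m) m" if "m \<in> Ob (arrow2 L kernels)" for m
    using c0[of m] that unfolding cokernels_def ses_def by auto
  obtain K C where KC: "F0 K = k0" "F0 C = c0"
    "biequivalence_over L (arrow2 L cokernels) (dom_psfun L) (arrow2 L kernels) (cod_psfun L) K C"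
    "normal_psfun (arrow2 L cokernels) (arrow2 L kernels) K" "normal_psfun (arrow2 L kernels) (arrow2 L cokernels) C"
    by (rule c.biequivalence[of k0 c0, OF k0r c0r])
  have "\<forall>A \<in> Ob L. src L (F0 K (id1 L A)) = Z \<and> tgt L (F0 C (id1 L A)) = Z"
    using idk idc k0 c0 KC(1,2) by metis
  then show ?thesis using fs KC(3-5) by blast
qed

end

section \<open>Exactness from factorizations\<close>

context rigid_pointed begin

text \<open>If f is isomorphic to n e with e in E and n in M, then n, being a kernel, reflects
  nullity and, between null morphisms, invertibility; so e and f have the same kernels. For
  normality, a cokernel c of a kernel m of f and the factor e factor through each other, so m is a
  kernel of c because it is one of e. The statements on cokernels are these for \<open>op L\<close>
  with E and M exchanged.\<close>

lemma zero_exact_half: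
  assumes M: "\<And>m. m \<in> M \<Longrightarrow> \<exists>c \<in> E. ses c m" and E: "\<And>e. e \<in> E \<Longrightarrow> \<exists>k \<in> M. ses e k"
    and fact: "\<And>f. f \<in> Mor L \<Longrightarrow> \<exists>e \<in> E. \<exists>m \<in> M. tgt L e = src L m \<and> isomorphic L f (m \<odot> e)"
  shows "f \<in> Mor L \<Longrightarrow> \<exists>k. zkernel L Z f k"
    and "\<lbrakk>zkernel L Z f m; zkernel (op L) Z m c\<rbrakk> \<Longrightarrow> zkernel L Z c m"
proof -
  have *: "\<exists>e k. ses e k \<and> src L f = src L e \<and> zkernel L Z f k \<and> (zkernel L Z f m \<longrightarrow> zkernel L Z e m)"
    if f: "f \<in> Mor L" for f m
  proof -
    obtain e n where en: "e \<in> E" "n \<in> M" "tgt L e = src L n" "isomorphic L f (n \<odot> e)" using fact[OF f] by blast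
    obtain k where k: "k \<in> M" "ses e k" using E[OF en(1)] by blast
    obtain c where c: "zkernel L Z c n" using M[OF en(2)] unfolding ses_def by blast
    have ek: "zkernel L Z e k" using k by (simp add: ses_def)
    have e: "e \<in> Mor L" and n: "n \<in> hom1 L (tgt L e) (tgt L n)" using zkernelD[OF ek] zkernelD[OF c] en by (auto simp: hom1_def)
    have sf: "src L f = src L e" using isomorphic_Mor[OF en(4)] e n by (auto simp: hom1_def)
    have nl: "nullish L Z (e \<odot> z) \<longleftrightarrow> nullish L Z (f \<odot> z)" if z: "z \<in> hom1 L X (src L e)" for X z
    proof
      show "nullish L Z (e \<odot> z) \<Longrightarrow> nullish L Z (f \<odot> z)" using factor_nullish[OF en(4) n e z] .
      assume "nullish L Z (f \<odot> z)"
      moreover have "isomorphic L (f \<odot> z) ((n \<odot> e) \<odot> z)"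
        using en(4) z f sf by (intro isomorphic_rwhisker) (auto simp: hom1_def)
      moreover have "(n \<odot> e) \<odot> z = n \<odot> e \<odot> z" using z e n by (intro comp1_assoc_Mor) (auto simp: hom1_def)
      ultimately have "nullish L Z (n \<odot> e \<odot> z)" using nullish_cong by simp
      then show "nullish L Z (e \<odot> z)"
        using zkernel_reflects_nullish[OF c, of "e \<odot> z" X] comp1_hom[OF z, of e] e en(3) by (simp add: hom1_def)
    qed
    have inv: "invertible L (e \<rhd> \<xi>) \<longleftrightarrow> invertible L (f \<rhd> \<xi>)"
      if u: "u \<in> hom1 L X (src L e)" and v: "v \<in> hom1 L X (src L e)" and x: "\<xi> \<in> hom2 L u v"
        and nu: "nullish L Z (e \<odot> u)" "nullish L Z (e \<odot> v)" for X u v \<xi>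
    proof
      show "invertible L (e \<rhd> \<xi>) \<Longrightarrow> invertible L (f \<rhd> \<xi>)" using factor_invertible[OF en(4) n e u x] .
      assume "invertible L (f \<rhd> \<xi>)"
      then have "invertible L ((n \<odot> e) \<rhd> \<xi>)" using lwhisker_invertible_cong[OF en(4) x] u sf by simp
      moreover have "(n \<odot> e) \<rhd> \<xi> = n \<rhd> (e \<rhd> \<xi>)"
        using u x e n lwhisker_lwhisker[of \<xi> e n] by (simp add: hom1_def hom2_def)
      ultimately show "invertible L (e \<rhd> \<xi>)"
        using faithful_reflects_invertible[OF zkernel_faithful[OF c] hom2_lwhisker[OF x u Mor_hom1[OF e]], of X] nu
          comp1_hom[OF u Mor_hom1[OF e]] en(3) by simp
    qed
    have "zkernel L Z f k"
      by (rule zkernel_transfer[OF ek f sf]) (use nl inv in blast)+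
    moreover have "zkernel L Z e m" if fm: "zkernel L Z f m"
      by (rule zkernel_transfer[OF fm e sf[symmetric]]) (use nl inv sf in auto)
    ultimately show ?thesis using k sf by blast
  qed
  show "\<exists>k. zkernel L Z f k" if "f \<in> Mor L" using *[OF that] by blast
  show "zkernel L Z c m" if fm: "zkernel L Z f m" and mc: "zkernel (op L) Z m c"
  proof -
    note zf = zkernelD[OF fm] and zc = zcokernelD[OF mc]
    obtain e k where ek: "ses e k" "src L f = src L e" "zkernel L Z f k" "zkernel L Z e m" using *[OF zf(1), of m] fm by blast
    have ke: "zkernel (op L) Z k e" using ek by (simp add: ses_def)
    note ze = zcokernelD[OF ke] and zm = zkernelD[OF ek(4)] and zk = zkernelD[OF ek(3)]
    have ce: "src L c = src L e" using zc zm by simp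
    have eh: "e \<in> hom1 L (tgt L m) (tgt L e)" using zm by (simp add: hom1_def)
    \<comment> \<open>e makes m null, so e extends along the cokernel c of m.\<close>
    obtain b where b: "b \<in> hom1 L (tgt L c) (tgt L e)" "isomorphic L e (b \<odot> c)" using zc(5)[OF eh zm(4)] by blast
    have ch: "c \<in> hom1 L (tgt L k) (tgt L c)" using zc ze ce by (simp add: hom1_def)
    have kh: "k \<in> hom1 L (src L k) (src L f)" using zk by (simp add: hom1_def)
    \<comment> \<open>k factors through m, so c makes k null and hence extends along e, a cokernel
      of k.\<close>
    obtain w where w: "w \<in> hom1 L (src L k) (src L m)" "isomorphic L k (m \<odot> w)" using zf(5)[OF kh zk(4)] by blast
    have "nullish L Z ((c \<odot> m) \<odot> w)" using nullish_rwhisker[OF zc(4), of w] w zc by (simp add: hom1_def)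
    moreover have "(c \<odot> m) \<odot> w = c \<odot> m \<odot> w" using w zc by (intro comp1_assoc_Mor) (auto simp: hom1_def)
    moreover have "isomorphic L (c \<odot> k) (c \<odot> m \<odot> w)" using w(2) zc(2) ch by (intro isomorphic_lwhisker) (auto simp: hom1_def)
    ultimately have "nullish L Z (c \<odot> k)" using nullish_cong by simp
    then obtain a where a: "a \<in> hom1 L (tgt L e) (tgt L c)" "isomorphic L c (a \<odot> e)" using ze(5)[OF ch] by blast
    show ?thesis
    proof (rule zkernel_transfer[OF ek(4) zc(2) ce])
      fix X z assume z: "z \<in> hom1 L X (src L e)"
      show "nullish L Z (e \<odot> z) \<longleftrightarrow> nullish L Z (c \<odot> z)"
        using factor_nullish[OF a(2,1) zm(1) z] factor_nullish[OF b(2,1) zc(2)] z ce by auto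
    next
      fix X u v \<xi> assume "u \<in> hom1 L X (src L e)" "\<xi> \<in> hom2 L u v" "invertible L (c \<rhd> \<xi>)"
      then show "invertible L (e \<rhd> \<xi>)" using factor_invertible[OF b(2,1) zc(2)] ce by auto
    qed
  qed
qed

lemma zero_exactI:
  assumes M: "\<And>m. m \<in> M \<Longrightarrow> \<exists>c \<in> E. ses c m" and E: "\<And>e. e \<in> E \<Longrightarrow> \<exists>k \<in> M. ses e k"
    and fact: "\<And>f. f \<in> Mor L \<Longrightarrow> \<exists>e \<in> E. \<exists>m \<in> M. tgt L e = src L m \<and> isomorphic L f (m \<odot> e)"
  shows "zero_exact L Z"
proof -
  interpret op: rigid_pointed "op L" Z by (rule rigid_pointed_op)
  have oM: "\<exists>c \<in> M. op.ses c m" if "m \<in> E" for m using E[OF that] ses_op by blast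
  have oE: "\<exists>k \<in> E. op.ses e k" if "e \<in> M" for e using M[OF that] ses_op by blast
  have ofact: "\<exists>e \<in> M. \<exists>m \<in> E. tgt (op L) e = src (op L) m \<and> isomorphic (op L) f (m \<odot>\<^bsub>op L\<^esub> e)" if f: "f \<in> Mor (op L)" for f
  proof -
    obtain e m where "e \<in> E" "m \<in> M" "tgt L e = src L m" "isomorphic L f (m \<odot> e)" using fact[of f] f by auto
    then show ?thesis by (intro bexI[of _ m] bexI[of _ e]) auto
  qed
  show ?thesis unfolding zero_exact_def
  proof (intro conjI ballI allI impI)
    show "\<exists>k. zkernel L Z f k" if "f \<in> Mor L" for f 
      by (rule zero_exact_half(1)[of M E]) (fact M E fact that)+
    show "\<exists>c. zkernel (op L) Z f c" if "f \<in> Mor L" for f 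
      by (rule op.zero_exact_half(1)[of E M]) (fact oM oE ofact that | use that in simp)+
    show "zkernel L Z c m" if "zkernel L Z f m \<and> zkernel (op L) Z m c" for f m c
      by (rule zero_exact_half(2)[of M E f]) (fact M E fact | use that in simp)+
    show "zkernel (op L) Z m c" if "zkernel (op L) Z f c \<and> zkernel L Z c m" for f c m
      by (rule op.zero_exact_half(2)[of E M f]) (fact oM oE ofact | use that in simp)+
    show "\<exists>c m. (\<exists>x. zkernel (op L) Z x c) \<and> (\<exists>y. zkernel L Z y m) \<and> tgt L c = src L m \<and> isomorphic L f (m \<odot> c)"
      if "f \<in> Mor L" for f
      using fact[OF that] M E unfolding ses_def by blast
  qed
qed

end

section \<open>Fillings and identities in a factorization system\<close>

context two_category begin

text \<open>The 2-dimensional half of orthogonality, at identity 2-cells of s and t, gives 2-cells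
  both ways between the fillings, and its uniqueness makes them inverse.\<close>

lemma fillings_isomorphic:
  assumes o: "orthogonal L e m" and e: "e \<in> Mor L" and m: "m \<in> Mor L"
    and f: "filling L e m s t \<phi> d \<sigma> \<rho>" and f': "filling L e m s t \<phi> d' \<sigma>' \<rho>'"
  shows "isomorphic L d d'"
proof -
  have eh: "e \<in> hom1 L (src L e) (tgt L e)" and mh: "m \<in> hom1 L (src L m) (tgt L m)" using e m by (auto simp: hom1_def)
  have st: "s \<in> hom1 L (src L e) (src L m)" "t \<in> hom1 L (tgt L e) (tgt L m)" "\<phi> \<in> hom2 L (m \<odot> s) (t \<odot> e)"
    using f iso2D by (auto simp: filling_def)
  have q: "\<phi> \<bullet> (m \<rhd> id2 L s) = (id2 L t \<lhd> e) \<bullet> \<phi>"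
    using hcomp_id2[OF st(1) mh] hcomp_id2[OF eh st(2)] vcomp_id_left[OF st(3)] vcomp_id_right[OF st(3)] by simp
  have U: "\<exists>!\<iota>. \<iota> \<in> hom2 L d1 d2 \<and> \<rho>2 \<bullet> (m \<rhd> \<iota>) = \<rho>1 \<and> (\<iota> \<lhd> e) \<bullet> \<sigma>1 = \<sigma>2"
    if "filling L e m s t \<phi> d1 \<sigma>1 \<rho>1" "filling L e m s t \<phi> d2 \<sigma>2 \<rho>2" for d1 \<sigma>1 \<rho>1 d2 \<sigma>2 \<rho>2
  proof -
    have r: "\<rho>1 \<in> hom2 L (m \<odot> d1) t" "\<sigma>2 \<in> hom2 L s (d2 \<odot> e)" using that iso2D by (auto simp: filling_def)
    have c: "filling L e m s t \<phi> d1 \<sigma>1 \<rho>1 \<and> filling L e m s t \<phi> d2 \<sigma>2 \<rho>2 \<and> id2 L s \<in> hom2 L s s \<and>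
        id2 L t \<in> hom2 L t t \<and> \<phi> \<bullet> (m \<rhd> id2 L s) = (id2 L t \<lhd> e) \<bullet> \<phi>"
      using that id2_hom1[OF st(1)] id2_hom1[OF st(2)] q by blast
    note o2 = conjunct2[OF o[unfolded orthogonal_def]]
    have "\<exists>!\<iota>. \<iota> \<in> hom2 L d1 d2 \<and> \<rho>2 \<bullet> (m \<rhd> \<iota>) = id2 L t \<bullet> \<rho>1 \<and> (\<iota> \<lhd> e) \<bullet> \<sigma>1 = \<sigma>2 \<bullet> id2 L s"
      by (rule o2[THEN spec, THEN spec, THEN spec, THEN spec, THEN spec, THEN spec, THEN spec, THEN spec, THEN spec,
            THEN spec, THEN spec, THEN spec, THEN spec, THEN spec, THEN mp, OF c])
    then show ?thesis using vcomp_id_left[OF r(1)] vcomp_id_right[OF r(2)] by simp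
  qed
  have D: "d1 \<in> hom1 L (tgt L e) (src L m)" "\<sigma>1 \<in> hom2 L s (d1 \<odot> e)" "\<rho>1 \<in> hom2 L (m \<odot> d1) t"
    if "filling L e m s t \<phi> d1 \<sigma>1 \<rho>1" for d1 \<sigma>1 \<rho>1 using that iso2D by (auto simp: filling_def)
  obtain a where a: "a \<in> hom2 L d d'" "\<rho>' \<bullet> (m \<rhd> a) = \<rho>" "(a \<lhd> e) \<bullet> \<sigma> = \<sigma>'" using U[OF f f'] by blast
  obtain b where b: "b \<in> hom2 L d' d" "\<rho> \<bullet> (m \<rhd> b) = \<rho>'" "(b \<lhd> e) \<bullet> \<sigma>' = \<sigma>" using U[OF f' f] by blast
  have comp: "h2 \<bullet> h1 = id2 L d1"
    if F1: "filling L e m s t \<phi> d1 \<sigma>1 \<rho>1" and F2: "filling L e m s t \<phi> d2 \<sigma>2 \<rho>2"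
      and h1: "h1 \<in> hom2 L d1 d2" "\<rho>2 \<bullet> (m \<rhd> h1) = \<rho>1" "(h1 \<lhd> e) \<bullet> \<sigma>1 = \<sigma>2"
      and h2: "h2 \<in> hom2 L d2 d1" "\<rho>1 \<bullet> (m \<rhd> h2) = \<rho>2" "(h2 \<lhd> e) \<bullet> \<sigma>2 = \<sigma>1"
    for d1 \<sigma>1 \<rho>1 d2 \<sigma>2 \<rho>2 h1 h2
  proof -
    note d1 = D[OF F1] and d2 = D[OF F2]
    have x: "m \<rhd> (h2 \<bullet> h1) = (m \<rhd> h2) \<bullet> (m \<rhd> h1)" "(h2 \<bullet> h1) \<lhd> e = (h2 \<lhd> e) \<bullet> (h1 \<lhd> e)"
      using h1 h2 d1 d2 mh eh lwhisker_vcomp[of h1 h2 m] rwhisker_vcomp[of h1 h2 e] by (auto simp: hom1_def hom2_def)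
    have "\<rho>1 \<bullet> (m \<rhd> (h2 \<bullet> h1)) = \<rho>1"
      using x(1) vcomp_assoc[OF hom2_lwhisker[OF h1(1) d1(1) mh] hom2_lwhisker[OF h2(1) d2(1) mh] d1(3)] h1(2) h2(2) by simp
    moreover have "((h2 \<bullet> h1) \<lhd> e) \<bullet> \<sigma>1 = \<sigma>1"
      using x(2) vcomp_assoc[OF d1(2) hom2_rwhisker[OF h1(1) eh d1(1)] hom2_rwhisker[OF h2(1) eh d2(1)]] h1(3) h2(3) by simp
    moreover have "\<rho>1 \<bullet> (m \<rhd> id2 L d1) = \<rho>1" "(id2 L d1 \<lhd> e) \<bullet> \<sigma>1 = \<sigma>1"
      using hcomp_id2[OF d1(1) mh] hcomp_id2[OF eh d1(1)] vcomp_id_right[OF d1(3)] vcomp_id_left[OF d1(2)] by auto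
    ultimately show ?thesis using U[OF F1 F1] vcomp_hom[OF h1(1) h2(1)] id2_hom1[OF d1(1)] by blast
  qed
  show ?thesis using isomorphicI[OF iso2I[OF a(1) b(1) comp[OF f f' a b] comp[OF f' f b a]]] .
qed

lemma factorization_systemD:
  assumes "factorization_system L E M"
  shows "e \<in> E \<Longrightarrow> e \<in> Mor L" "m \<in> M \<Longrightarrow> m \<in> Mor L"
    "\<lbrakk>m \<in> M; equivalence1 L i; tgt L i = src L m\<rbrakk> \<Longrightarrow> m \<odot> i \<in> M"
    "\<lbrakk>e \<in> E; equivalence1 L i; src L i = tgt L e\<rbrakk> \<Longrightarrow> i \<odot> e \<in> E"
    "\<lbrakk>f \<in> E; isomorphic L f g\<rbrakk> \<Longrightarrow> g \<in> E" "\<lbrakk>f \<in> M; isomorphic L f g\<rbrakk> \<Longrightarrow> g \<in> M"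
    "f \<in> Mor L \<Longrightarrow> \<exists>e \<in> E. \<exists>m \<in> M. tgt L e = src L m \<and> isomorphic L f (m \<odot> e)"
    "\<lbrakk>e \<in> E; m \<in> M\<rbrakk> \<Longrightarrow> orthogonal L e m"
proof -
  note fs = assms[unfolded factorization_system_def]
  show "e \<in> E \<Longrightarrow> e \<in> Mor L" using conjunct1[OF fs] by blast
  note fs = conjunct2[OF fs]
  show "m \<in> M \<Longrightarrow> m \<in> Mor L" using conjunct1[OF fs] by blast
  note fs = conjunct2[OF fs]
  show "\<lbrakk>m \<in> M; equivalence1 L i; tgt L i = src L m\<rbrakk> \<Longrightarrow> m \<odot> i \<in> M" using conjunct1[OF fs] by blast
  note fs = conjunct2[OF fs]
  show "\<lbrakk>e \<in> E; equivalence1 L i; src L i = tgt L e\<rbrakk> \<Longrightarrow> i \<odot> e \<in> E" using conjunct1[OF fs] by blast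
  note fs = conjunct2[OF fs, folded isomorphic_def]
  show "\<lbrakk>f \<in> E; isomorphic L f g\<rbrakk> \<Longrightarrow> g \<in> E" using conjunct1[OF fs] by blast
  note fs = conjunct2[OF fs]
  show "\<lbrakk>f \<in> M; isomorphic L f g\<rbrakk> \<Longrightarrow> g \<in> M" using conjunct1[OF fs] by blast
  note fs = conjunct2[OF fs]
  show "f \<in> Mor L \<Longrightarrow> \<exists>e \<in> E. \<exists>m \<in> M. tgt L e = src L m \<and> isomorphic L f (m \<odot> e)" using conjunct1[OF fs] by blast
  show "\<lbrakk>e \<in> E; m \<in> M\<rbrakk> \<Longrightarrow> orthogonal L e m" using conjunct2[OF fs] by blast
qed

text \<open>The axioms do not mention identities, so one is factored as m e. The square with sides e
  and m is filled both by an identity and by e m; hence e m is isomorphic to an identity and both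
  factors are equivalences. The closure axioms then put m e, and so the identity, in both
  classes.\<close>

lemma factorization_system_id:
  assumes fs: "factorization_system L E M" and A: "A \<in> Ob L"
  shows "id1 L A \<in> E" and "id1 L A \<in> M"
proof -
  have "id1 L A \<in> Mor L" using A by simp
  then obtain e m where em: "e \<in> E" "m \<in> M" "tgt L e = src L m" "isomorphic L (id1 L A) (m \<odot> e)"
    using factorization_systemD(7)[OF fs] by blast
  have eM: "e \<in> Mor L" "m \<in> Mor L" and o: "orthogonal L e m" using factorization_systemD(1,2,8)[OF fs] em by blast+
  have eh: "e \<in> hom1 L A (src L m)" and mh: "m \<in> hom1 L (src L m) A" and s: "src L e = A" "tgt L m = A"
    using isomorphic_Mor[OF em(4)] eM em(3) A by (auto simp: hom1_def)
  obtain \<theta> where th: "\<theta> \<in> iso2 L (id1 L A) (m \<odot> e)" using em(4) by (rule isomorphicE)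
  obtain \<theta>' where th': "\<theta>' \<in> iso2 L (m \<odot> e) (id1 L A)" "\<theta>' \<bullet> \<theta> = id2 L (id1 L A)" using th by (rule iso2E)
  note T = comp1_hom[OF eh mh] and i = id1_hom[OF A]
  have qO: "src L m \<in> Ob L" using eM by simp
  note iq = id1_hom[OF qO]
  \<comment> \<open>The two whiskerings of \<theta> agree after the invertible \<theta> by exchange;
    this makes the filling by e m compose to the identity 2-cell.\<close>
  have sw: "\<theta> \<lhd> (m \<odot> e) = (m \<odot> e) \<rhd> \<theta>"
  proof (rule iso2_cancel_right[OF th])
    show "\<theta> \<lhd> (m \<odot> e) \<in> hom2 L (m \<odot> e) ((m \<odot> e) \<odot> m \<odot> e)" "(m \<odot> e) \<rhd> \<theta> \<in> hom2 L (m \<odot> e) ((m \<odot> e) \<odot> m \<odot> e)"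
      using hom2_rwhisker[OF iso2D[OF th] T i] hom2_lwhisker[OF iso2D[OF th] i T] comp1_id_left[OF T] comp1_id_right[OF T] by auto
    show "(\<theta> \<lhd> (m \<odot> e)) \<bullet> \<theta> = ((m \<odot> e) \<rhd> \<theta>) \<bullet> \<theta>"
      using whisker_exchange[OF iso2D[OF th] iso2D[OF th] i i] hcomp_id_left[OF i iso2D[OF th]] hcomp_id_right[OF i iso2D[OF th]] by simp
  qed
  have C: "\<theta> \<in> Cell L" "dom2 L \<theta> = id1 L A" "cod2 L \<theta> = m \<odot> e" "\<theta>' \<in> Cell L" "dom2 L \<theta>' = m \<odot> e" "cod2 L \<theta>' = id1 L A"
    using iso2D[OF th] iso2D[OF th'(1)] by (auto simp: hom2_def)
  have st: "e \<in> hom1 L (src L e) (src L m)" "m \<in> hom1 L (tgt L e) (tgt L m)" "id1 L (src L m) \<in> hom1 L (tgt L e) (src L m)"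
    "e \<odot> m \<in> hom1 L (tgt L e) (src L m)"
    using eh mh s em(3) iq comp1_hom[OF mh eh] by auto
  have meI: "id2 L (m \<odot> e) \<in> iso2 L (m \<odot> e) (m \<odot> e)" using iso2_id1[OF T] .
  have f1: "filling L e m e m (id2 L (m \<odot> e)) (id1 L (src L m)) (id2 L e) (id2 L m)"
    unfolding filling_def using st meI iso2_id1[OF eh] iso2_id1[OF mh] comp1_id_left[OF eh] comp1_id_right[OF mh]
      hcomp_id2[OF eh mh] vcomp_id_left[OF iso2D[OF meI]] by simp
  have f2: "filling L e m e m (id2 L (m \<odot> e)) (e \<odot> m) (e \<rhd> \<theta>) (\<theta>' \<lhd> m)"
    unfolding filling_def
  proof (intro conjI)
    show "e \<rhd> \<theta> \<in> iso2 L e ((e \<odot> m) \<odot> e)"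
      using iso2_lwhisker[OF th i eh] comp1_id_right[OF eh] comp1_assoc[OF eh mh eh] by simp
    show "\<theta>' \<lhd> m \<in> iso2 L (m \<odot> e \<odot> m) m"
      using iso2_rwhisker[OF th'(1) mh T] comp1_id_left[OF mh] comp1_assoc[OF mh eh mh] by simp
    have "((\<theta>' \<lhd> m) \<lhd> e) \<bullet> (m \<rhd> e \<rhd> \<theta>) = (\<theta>' \<lhd> (m \<odot> e)) \<bullet> ((m \<odot> e) \<rhd> \<theta>)"
      using C eM s em(3) A by (simp add: cell_nf)
    also have "\<dots> = (\<theta>' \<bullet> \<theta>) \<lhd> (m \<odot> e)" unfolding sw[symmetric] using C eM s em(3) A by (simp add: cell_nf)
    also have "\<dots> = id2 L (m \<odot> e)" using th'(2) hcomp_id2[OF T i] comp1_id_left[OF T] by simp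
    finally show "id2 L (m \<odot> e) = ((\<theta>' \<lhd> m) \<lhd> e) \<bullet> (m \<rhd> e \<rhd> \<theta>)" by simp
  qed (use st meI in auto)
  have iq2: "isomorphic L (e \<odot> m) (id1 L (src L m))" using isomorphic_sym[OF fillings_isomorphic[OF o eM f1 f2]] .
  have "equivalence1 L m" "equivalence1 L e"
    unfolding equivalence1_def using eM s em(3) eh mh iq2 isomorphic_sym[OF em(4)] by (auto simp: isomorphic_def)
  then have "m \<odot> e \<in> E" "m \<odot> e \<in> M" using factorization_systemD(3,4)[OF fs] em by auto
  then show "id1 L A \<in> E" "id1 L A \<in> M"
    using factorization_systemD(5,6)[OF fs] isomorphic_sym[OF em(4)] by blast+
qed

end

context pointed begin

lemma null_rigid_of_orthogonal:
  assumes o: "\<And>A B. A \<in> Ob L \<Longrightarrow> B \<in> Ob L \<Longrightarrow> \<exists>c j. c \<in> hom1 L A Z \<and> j \<in> hom1 L Z B \<and> orthogonal L c j"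
  shows "null_rigid L Z"
  unfolding null_rigid_def
proof (intro allI impI, elim conjE)
  fix A B t i \<phi>
  assume t: "t \<in> hom1 L A Z" and i: "i \<in> hom1 L Z B" and \<phi>: "\<phi> \<in> iso2 L (i \<odot> t) (i \<odot> t)"
  obtain c j where c: "c \<in> hom1 L A Z" and j: "j \<in> hom1 L Z B" and orth: "orthogonal L c j"
    using o[of A B] hom1_Ob[OF t] hom1_Ob[OF i] by blast
  have cj: "src L c = A" "tgt L c = Z" "src L j = Z" "tgt L j = B" "c \<in> Mor L" "j \<in> Mor L" using c j by (auto simp: hom1_def)
  note jc = comp1_hom[OF c j]
  have triv: "\<chi> = id2 L (j \<odot> c)" if \<chi>: "\<chi> \<in> iso2 L (j \<odot> c) (j \<odot> c)" for \<chi>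
  proof -
    obtain d \<sigma> \<rho> where F: "filling L c j c j \<chi> d \<sigma> \<rho>"
      using conjunct1[OF orth[unfolded orthogonal_def]] \<chi> c j cj by metis
    have d: "d \<in> hom1 L Z Z" and \<sigma>: "\<sigma> \<in> hom2 L c (d \<odot> c)" and \<rho>: "\<rho> \<in> hom2 L (j \<odot> d) j"
      and eq: "\<chi> = (\<rho> \<lhd> c) \<bullet> (j \<rhd> \<sigma>)" using F cj iso2D by (auto simp: filling_def)
    note iz = id1_hom[OF zero_Ob]
    \<comment> \<open>d is an endomorphism of \<open>Z\<close>, so a 2-cell \<delta> from the
      identity exists. Uniqueness into \<open>Z\<close> expresses \<sigma> through \<delta>, and
      uniqueness out of \<open>Z\<close> cancels \<rho> against it.\<close>
    obtain \<delta> where de: "\<delta> \<in> hom2 L (id1 L Z) d" using to_zero_ex1[OF iz d] by blast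
    have "\<sigma> = \<delta> \<lhd> c"
      using to_zero_eq[OF \<sigma> _ c] hom2_rwhisker[OF de c iz] comp1_id_left[OF c] by simp
    moreover have jd: "j \<rhd> \<delta> \<in> hom2 L j (j \<odot> d)" using hom2_lwhisker[OF de iz j] comp1_id_right[OF j] by simp
    moreover have "\<rho> \<bullet> (j \<rhd> \<delta>) = id2 L j" using from_zero_eq[OF vcomp_hom[OF jd \<rho>] id2_hom1[OF j] j] .
    moreover have "(\<rho> \<lhd> c) \<bullet> (j \<rhd> \<delta> \<lhd> c) = (\<rho> \<bullet> (j \<rhd> \<delta>)) \<lhd> c"
      using \<rho> de d j c zero_Ob by (simp add: hom1_def hom2_def cell_nf)
    ultimately show ?thesis using eq hcomp_id2[OF c j] by simp
  qed
  \<comment> \<open>Every composite through \<open>Z\<close> is isomorphic to j c, so its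
    automorphisms are conjugate to trivial ones.\<close>
  obtain \<theta> where th: "\<theta> \<in> iso2 L (i \<odot> t) (j \<odot> c)" using null_isomorphic[OF t i c j] by (rule isomorphicE)
  obtain \<theta>' where th': "\<theta>' \<in> iso2 L (j \<odot> c) (i \<odot> t)" "\<theta>' \<bullet> \<theta> = id2 L (i \<odot> t)" "\<theta> \<bullet> \<theta>' = id2 L (j \<odot> c)" using th by (rule iso2E)
  note it = comp1_hom[OF t i]
  have "\<theta> \<bullet> \<phi> \<bullet> \<theta>' = id2 L (j \<odot> c)" using triv[OF iso2_vcomp[OF iso2_vcomp[OF th'(1) \<phi>] th]] .
  then have "\<theta> \<bullet> \<phi> \<bullet> \<theta>' = \<theta> \<bullet> \<theta>'" using th' by simp
  then have "\<phi> \<bullet> \<theta>' = \<theta>'"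
    using iso2_cancel_left[OF th iso2D[OF iso2_vcomp[OF th'(1) \<phi>]] iso2D[OF th'(1)]] by simp
  then have "\<phi> \<bullet> \<theta>' = id2 L (i \<odot> t) \<bullet> \<theta>'" using vcomp_id_left[OF iso2D[OF th'(1)]] by simp
  then show "\<phi> = id2 L (i \<odot> t)" by (rule iso2_cancel_right[OF th'(1) iso2D[OF \<phi>] id2_hom1[OF it]])
qed

end

section \<open>Local fullness of biequivalences over a base\<close>

lemma (in two_category) rwhisker_id1_conj:
  assumes "\<eta> \<in> iso2 L h (id1 L A)" "\<alpha> \<in> hom2 L u v" "u \<in> hom1 L A X"
  shows "(v \<rhd> \<eta>) \<bullet> (\<alpha> \<lhd> h) = \<alpha> \<bullet> (u \<rhd> \<eta>)"
  using two_category.lwhisker_id1_conj[OF two_category_op[OF two_category_axioms], of \<eta> h A \<alpha> u v X] assms by simp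

context over_base begin

lemma P_iso2:
  assumes "\<alpha> \<in> iso2 X f g"
  shows "F2 P \<alpha> \<in> iso2 L (F1 P f) (F1 P g)"
proof -
  obtain \<beta> where b: "\<beta> \<in> iso2 X g f" "\<beta> \<bullet> \<alpha> = id2 X f" "\<alpha> \<bullet> \<beta> = id2 X g" using assms by (rule iso2E)
  note h = iso2D[OF assms] iso2D[OF b(1)]
  show ?thesis
    using P2[OF h(1)] P2[OF h(2)] P_vcomp[OF h] P_vcomp[OF h(2,1)] b P_id2 hom2_Mor[OF h(1)]
    by (intro base.iso2I) auto
qed

lemma P_lwhisker:
  "\<lbrakk>\<alpha> \<in> hom2 X u v; u \<in> hom1 X A B; g \<in> hom1 X B C\<rbrakk> \<Longrightarrow> F2 P (g \<rhd> \<alpha>) = F1 P g \<rhd>\<^bsub>L\<^esub> F2 P \<alpha>"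
  using P_hcomp[of u A B g C \<alpha> v "id2 X g" g] id2_hom1[of g] P_id2[of g] by (simp add: hom1_def)

lemma P_rwhisker:
  "\<lbrakk>\<alpha> \<in> hom2 X u v; u \<in> hom1 X B C; g \<in> hom1 X A B\<rbrakk> \<Longrightarrow> F2 P (\<alpha> \<lhd> g) = F2 P \<alpha> \<lhd>\<^bsub>L\<^esub> F1 P g"
  using P_hcomp[of g A B u C "id2 X g" g \<alpha> v] id2_hom1[of g] P_id2[of g] by (simp add: hom1_def)

lemma over_id_inverse:
  assumes "\<beta> \<in> iso2 X f g" "F2 P \<beta> = id2 L h" "F1 P f = h" "F1 P g = h"
  obtains \<gamma> where "\<gamma> \<in> iso2 X g f" "\<beta> \<bullet> \<gamma> = id2 X g" "\<gamma> \<bullet> \<beta> = id2 X f" "F2 P \<gamma> = id2 L h"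
proof -
  obtain \<gamma> where g: "\<gamma> \<in> iso2 X g f" "\<gamma> \<bullet> \<beta> = id2 X f" "\<beta> \<bullet> \<gamma> = id2 X g" using assms(1) by (rule iso2E)
  have "f \<in> Mor X" using hom2_Mor[OF iso2D[OF assms(1)]] by blast
  then have "F2 P \<gamma> \<bullet>\<^bsub>L\<^esub> F2 P \<beta> = id2 L h" using P_vcomp[OF iso2D[OF assms(1)] iso2D[OF g(1)]] g(2) P_id2 assms(3) by simp
  moreover have "F2 P \<gamma> \<in> hom2 L h h" using P2[OF iso2D[OF g(1)]] assms by simp
  ultimately have "F2 P \<gamma> = id2 L h" using assms(2) base.vcomp_id_right by simp
  then show ?thesis using that g by blast
qed

end

context over_pair begin

text \<open>Local fullness of C. Applying K to \<Xi> and conjugating by the structure 2-cells of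
  \<eta> gives a 2-cell from \<open>\<eta> y' \<odot> R\<close> to
  \<open>\<eta> y' \<odot> R'\<close> over the image of \<Xi>; a quasi-inverse g of
  \<open>\<eta> y'\<close> then removes \<eta>.\<close>

lemma full_of_unit:
  assumes K: "over_psfun L X P Y Q K" and C: "over_psfun L Y Q X P C"
    and eq: "pseudonat_equivalence Y Y (id_psfun Y) (comp_psfun Y K C) \<eta> \<eta>1" and over: "lies_over Y L Q \<eta> \<eta>1"
    and R: "R \<in> hom1 Y y y'" and R': "R' \<in> hom1 Y y y'" and X: "\<Xi> \<in> hom2 X (F1 C R) (F1 C R')"
  shows "\<exists>\<zeta> \<in> hom2 Y R R'. F2 Q \<zeta> = F2 P \<Xi>"
proof -
  note K = over_psfunD[OF K] and C = over_psfunD[OF C]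
  have y: "y \<in> Ob Y" "y' \<in> Ob Y" using R Y.src_Ob Y.tgt_Ob by (auto simp: hom1_def)
  have ps: "pseudonat Y Y (id_psfun Y) (comp_psfun Y K C) \<eta> \<eta>1" "equivalence1 Y (\<eta> y')"
    using eq y unfolding pseudonat_equivalence_def by blast+
  have e: "\<eta> A \<in> hom1 Y A (F0 K (F0 C A))" if "A \<in> Ob Y" for A
    using ps(1) that unfolding pseudonat_def by (simp add: id_psfun_def comp_psfun_def)
  have e1: "\<eta>1 f \<in> iso2 Y (F1 K (F1 C f) \<odot>\<^bsub>Y\<^esub> \<eta> A) (\<eta> B \<odot>\<^bsub>Y\<^esub> f)" if "f \<in> hom1 Y A B" for f A B
    using ps(1) that unfolding pseudonat_def by (simp add: id_psfun_def comp_psfun_def)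
  have le: "F1 Q (\<eta> A) = id1 L (F0 Q A)" if "A \<in> Ob Y" for A using over that unfolding lies_over_def by blast
  have le1: "F2 Q (\<eta>1 f) = id2 L (F1 Q f)" if "f \<in> Mor Y" for f using over that unfolding lies_over_def by blast
  have RM: "R \<in> Mor Y" "R' \<in> Mor Y" using R R' by (auto simp: hom1_def)
  note CR = C(5)[OF R] and CR' = C(5)[OF R'] and KCR = K(5)[OF C(5)[OF R]] and KCR' = K(5)[OF C(5)[OF R']]
  note QR = Y.P1[OF R] and QR' = Y.P1[OF R']
  have l: "F1 Q (F1 K (F1 C R) \<odot>\<^bsub>Y\<^esub> \<eta> y) = F1 Q R" "F1 Q (\<eta> y' \<odot>\<^bsub>Y\<^esub> R) = F1 Q R"
    using Y.P_comp1[OF e[OF y(1)] KCR] Y.P_comp1[OF R e[OF y(2)]] le[OF y(1)] le[OF y(2)] K(6)[OF CR] C(6)[OF R]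
      X.base.comp1_id_right[OF QR] X.base.comp1_id_left[OF QR] by auto
  obtain h where h: "h \<in> iso2 Y (\<eta> y' \<odot>\<^bsub>Y\<^esub> R) (F1 K (F1 C R) \<odot>\<^bsub>Y\<^esub> \<eta> y)" "F2 Q h = id2 L (F1 Q R)"
    using Y.over_id_inverse[OF e1[OF R] le1[OF RM(1)] l] by blast
  note KX = K(7)[OF X]
  have xi: "F2 P \<Xi> \<in> hom2 L (F1 Q R) (F1 Q R')" using X.P2[OF X] C(6)[OF R] C(6)[OF R'] by simp
  define z0 where "z0 = \<eta>1 R' \<bullet>\<^bsub>Y\<^esub> (F2 K \<Xi> \<lhd>\<^bsub>Y\<^esub> \<eta> y) \<bullet>\<^bsub>Y\<^esub> h"
  have w: "F2 K \<Xi> \<lhd>\<^bsub>Y\<^esub> \<eta> y \<in> hom2 Y (F1 K (F1 C R) \<odot>\<^bsub>Y\<^esub> \<eta> y) (F1 K (F1 C R') \<odot>\<^bsub>Y\<^esub> \<eta> y)"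
    using Y.hom2_rwhisker[OF KX e[OF y(1)] KCR] .
  have wl: "F2 Q (F2 K \<Xi> \<lhd>\<^bsub>Y\<^esub> \<eta> y) = F2 P \<Xi>"
    using Y.P_rwhisker[OF KX KCR e[OF y(1)]] le[OF y(1)] K(8)[OF X] X.base.hcomp_id_right[OF QR xi] by simp
  note v1 = Y.vcomp_hom[OF Y.iso2D[OF h(1)] w]
  have z0: "z0 \<in> hom2 Y (\<eta> y' \<odot>\<^bsub>Y\<^esub> R) (\<eta> y' \<odot>\<^bsub>Y\<^esub> R')" unfolding z0_def using Y.vcomp_hom[OF v1 Y.iso2D[OF e1[OF R']]] .
  have z0l: "F2 Q z0 = F2 P \<Xi>"
    unfolding z0_def
    using Y.P_vcomp[OF v1 Y.iso2D[OF e1[OF R']]] Y.P_vcomp[OF Y.iso2D[OF h(1)] w] h(2) wl le1[OF RM(2)]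
      X.base.vcomp_id_right[OF xi] X.base.vcomp_id_left[OF xi] by simp
  have sy: "src Y (\<eta> y') = y'" "tgt Y (\<eta> y') = F0 K (F0 C y')" using e[OF y(2)] by (auto simp: hom1_def)
  obtain g \<theta> where g: "g \<in> hom1 Y (F0 K (F0 C y')) y'" and th: "\<theta> \<in> iso2 Y (g \<odot>\<^bsub>Y\<^esub> \<eta> y') (id1 Y y')"
    using ps(2) Y.equivalence1E[of "\<eta> y'"] sy by metis
  obtain \<theta>' where th': "\<theta>' \<in> iso2 Y (id1 Y y') (g \<odot>\<^bsub>Y\<^esub> \<eta> y')" "\<theta> \<bullet>\<^bsub>Y\<^esub> \<theta>' = id2 Y (id1 Y y')" using th by (rule Y.iso2E)
  note ey = e[OF y(2)] and iy = Y.id1_hom[OF y(2)]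
  note ge = Y.comp1_hom[OF ey g]
  have a1: "\<theta>' \<lhd>\<^bsub>Y\<^esub> R \<in> hom2 Y R (g \<odot>\<^bsub>Y\<^esub> \<eta> y' \<odot>\<^bsub>Y\<^esub> R)"
    using Y.hom2_rwhisker[OF Y.iso2D[OF th'(1)] R iy] Y.comp1_id_left[OF R] Y.comp1_assoc[OF R ey g] by simp
  have a2: "g \<rhd>\<^bsub>Y\<^esub> z0 \<in> hom2 Y (g \<odot>\<^bsub>Y\<^esub> \<eta> y' \<odot>\<^bsub>Y\<^esub> R) (g \<odot>\<^bsub>Y\<^esub> \<eta> y' \<odot>\<^bsub>Y\<^esub> R')"
    using Y.hom2_lwhisker[OF z0 Y.comp1_hom[OF R ey] g] .
  have a3: "\<theta> \<lhd>\<^bsub>Y\<^esub> R' \<in> hom2 Y (g \<odot>\<^bsub>Y\<^esub> \<eta> y' \<odot>\<^bsub>Y\<^esub> R') R'"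
    using Y.hom2_rwhisker[OF Y.iso2D[OF th] R' ge] Y.comp1_id_left[OF R'] Y.comp1_assoc[OF R' ey g] by simp
  define \<zeta> where "\<zeta> = (\<theta> \<lhd>\<^bsub>Y\<^esub> R') \<bullet>\<^bsub>Y\<^esub> (g \<rhd>\<^bsub>Y\<^esub> z0) \<bullet>\<^bsub>Y\<^esub> (\<theta>' \<lhd>\<^bsub>Y\<^esub> R)"
  note a12 = Y.vcomp_hom[OF a1 a2]
  have ze: "\<zeta> \<in> hom2 Y R R'" unfolding \<zeta>_def using Y.vcomp_hom[OF a12 a3] .
  have Qge: "F1 Q (g \<odot>\<^bsub>Y\<^esub> \<eta> y') = F1 Q g" and Qg: "F1 Q g \<in> hom1 L (F0 Q y') (F0 Q y')"
    using Y.P_comp1[OF ey g] le[OF y(2)] Y.P1[OF g] X.base.comp1_id_right Y.P1[OF ey] X.base.id1_hom[OF Y.P0[OF y(2)]]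
    by (auto simp: hom1_def X.base.comp1_id_Mor)
  have Qth: "F2 Q \<theta> \<in> iso2 L (F1 Q g) (id1 L (F0 Q y'))" using Y.P_iso2[OF th] Qge Y.P_id1[OF y(2)] by simp
  have lab: "F2 Q \<zeta> = (F2 Q \<theta> \<lhd>\<^bsub>L\<^esub> F1 Q R') \<bullet>\<^bsub>L\<^esub> (F1 Q g \<rhd>\<^bsub>L\<^esub> F2 P \<Xi>) \<bullet>\<^bsub>L\<^esub> (F2 Q \<theta>' \<lhd>\<^bsub>L\<^esub> F1 Q R)"
    unfolding \<zeta>_def
    using Y.P_vcomp[OF a12 a3] Y.P_vcomp[OF a1 a2] Y.P_rwhisker[OF Y.iso2D[OF th] ge R'] Y.P_lwhisker[OF z0 Y.comp1_hom[OF R ey] g]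
      Y.P_rwhisker[OF Y.iso2D[OF th'(1)] iy R] z0l by simp
  have Qth': "F2 Q \<theta>' \<in> hom2 L (id1 L (F0 Q y')) (F1 Q g)" using Y.P2[OF Y.iso2D[OF th'(1)]] Qge Y.P_id1[OF y(2)] by simp
  have inv: "F2 Q \<theta> \<bullet>\<^bsub>L\<^esub> F2 Q \<theta>' = id2 L (id1 L (F0 Q y'))"
    using Y.P_vcomp[OF Y.iso2D[OF th'(1)] Y.iso2D[OF th]] th'(2) Y.P_id2[of "id1 Y y'"] y Y.P_id1[OF y(2)] by simp
  note iL = X.base.id1_hom[OF Y.P0[OF y(2)]]
  have b1: "F2 Q \<theta>' \<lhd>\<^bsub>L\<^esub> F1 Q R \<in> hom2 L (F1 Q R) (F1 Q g \<odot>\<^bsub>L\<^esub> F1 Q R)"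
    using X.base.hom2_rwhisker[OF Qth' QR iL] X.base.comp1_id_left[OF QR] by simp
  have b2: "F1 Q g \<rhd>\<^bsub>L\<^esub> F2 P \<Xi> \<in> hom2 L (F1 Q g \<odot>\<^bsub>L\<^esub> F1 Q R) (F1 Q g \<odot>\<^bsub>L\<^esub> F1 Q R')"
    using X.base.hom2_lwhisker[OF xi QR Qg] .
  have b3: "F2 Q \<theta> \<lhd>\<^bsub>L\<^esub> F1 Q R' \<in> hom2 L (F1 Q g \<odot>\<^bsub>L\<^esub> F1 Q R') (F1 Q R')"
    using X.base.hom2_rwhisker[OF X.base.iso2D[OF Qth] QR' Qg] X.base.comp1_id_left[OF QR'] by simp
  have b4: "F2 Q \<theta> \<lhd>\<^bsub>L\<^esub> F1 Q R \<in> hom2 L (F1 Q g \<odot>\<^bsub>L\<^esub> F1 Q R) (F1 Q R)"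
    using X.base.hom2_rwhisker[OF X.base.iso2D[OF Qth] QR Qg] X.base.comp1_id_left[OF QR] by simp
  \<comment> \<open>Neither g nor \<theta> has to lie over an identity of L. Naturality moves the
    image of \<theta> past that of \<Xi>, where it cancels against the image of
    \<open>\<theta>'\<close>.\<close>
  have "F2 Q \<zeta> = ((F2 Q \<theta> \<lhd>\<^bsub>L\<^esub> F1 Q R') \<bullet>\<^bsub>L\<^esub> (F1 Q g \<rhd>\<^bsub>L\<^esub> F2 P \<Xi>)) \<bullet>\<^bsub>L\<^esub> (F2 Q \<theta>' \<lhd>\<^bsub>L\<^esub> F1 Q R)"
    using lab X.base.vcomp_assoc[OF b1 b2 b3] by simp
  also have "\<dots> = (F2 P \<Xi> \<bullet>\<^bsub>L\<^esub> (F2 Q \<theta> \<lhd>\<^bsub>L\<^esub> F1 Q R)) \<bullet>\<^bsub>L\<^esub> (F2 Q \<theta>' \<lhd>\<^bsub>L\<^esub> F1 Q R)"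
    using X.base.lwhisker_id1_conj[OF Qth xi QR] by simp
  also have "\<dots> = F2 P \<Xi> \<bullet>\<^bsub>L\<^esub> ((F2 Q \<theta> \<bullet>\<^bsub>L\<^esub> F2 Q \<theta>') \<lhd>\<^bsub>L\<^esub> F1 Q R)"
    using X.base.vcomp_assoc[OF b1 b4 xi] Qth' X.base.iso2D[OF Qth] QR iL
      X.base.rwhisker_vcomp[of "F2 Q \<theta>'" "F2 Q \<theta>" "F1 Q R"] by (auto simp: hom1_def hom2_def)
  also have "\<dots> = F2 P \<Xi>"
    using inv X.base.hcomp_id2[OF QR iL] X.base.comp1_id_left[OF QR] X.base.vcomp_id_right[OF xi] by simp
  finally show ?thesis using ze by blast
qed

text \<open>Local fullness of K, read off the counit. Here \<epsilon> sits on the source side of R,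
  so it is removed by whiskering with g on the right.\<close>

lemma full_of_counit:
  assumes K: "over_psfun L X P Y Q K" and C: "over_psfun L Y Q X P C"
    and eq: "pseudonat_equivalence X X (comp_psfun X C K) (id_psfun X) \<epsilon> \<epsilon>1" and over: "lies_over X L P \<epsilon> \<epsilon>1"
    and R: "R \<in> hom1 X y y'" and R': "R' \<in> hom1 X y y'" and X: "\<Xi> \<in> hom2 Y (F1 K R) (F1 K R')"
  shows "\<exists>\<zeta> \<in> hom2 X R R'. F2 P \<zeta> = F2 Q \<Xi>"
proof -
  note K = over_psfunD[OF K] and C = over_psfunD[OF C]
  have y: "y \<in> Ob X" "y' \<in> Ob X" using R X.src_Ob X.tgt_Ob by (auto simp: hom1_def)
  have ps: "pseudonat X X (comp_psfun X C K) (id_psfun X) \<epsilon> \<epsilon>1" "equivalence1 X (\<epsilon> y)"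
    using eq y unfolding pseudonat_equivalence_def by blast+
  have e: "\<epsilon> A \<in> hom1 X (F0 C (F0 K A)) A" if "A \<in> Ob X" for A
    using ps(1) that unfolding pseudonat_def by (simp add: id_psfun_def comp_psfun_def)
  have e1: "\<epsilon>1 f \<in> iso2 X (f \<odot>\<^bsub>X\<^esub> \<epsilon> A) (\<epsilon> B \<odot>\<^bsub>X\<^esub> F1 C (F1 K f))" if "f \<in> hom1 X A B" for f A B
    using ps(1) that unfolding pseudonat_def by (simp add: id_psfun_def comp_psfun_def)
  have le: "F1 P (\<epsilon> A) = id1 L (F0 P A)" if "A \<in> Ob X" for A using over that unfolding lies_over_def by blast
  have le1: "F2 P (\<epsilon>1 f) = id2 L (F1 P f)" if "f \<in> Mor X" for f using over that unfolding lies_over_def by blast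
  have RM: "R \<in> Mor X" "R' \<in> Mor X" using R R' by (auto simp: hom1_def)
  note CR = K(5)[OF R] and CR' = K(5)[OF R'] and KCR = C(5)[OF K(5)[OF R]] and KCR' = C(5)[OF K(5)[OF R']]
  note QR = X.P1[OF R] and QR' = X.P1[OF R']
  have l: "F1 P (R' \<odot>\<^bsub>X\<^esub> \<epsilon> y) = F1 P R'" "F1 P (\<epsilon> y' \<odot>\<^bsub>X\<^esub> F1 C (F1 K R')) = F1 P R'"
    using X.P_comp1[OF KCR' e[OF y(2)]] X.P_comp1[OF e[OF y(1)] R'] le[OF y(1)] le[OF y(2)] C(6)[OF CR'] K(6)[OF R']
      X.base.comp1_id_right[OF QR'] X.base.comp1_id_left[OF QR'] by auto
  obtain h where h: "h \<in> iso2 X (\<epsilon> y' \<odot>\<^bsub>X\<^esub> F1 C (F1 K R')) (R' \<odot>\<^bsub>X\<^esub> \<epsilon> y)" "F2 P h = id2 L (F1 P R')"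
    using X.over_id_inverse[OF e1[OF R'] le1[OF RM(2)] l] by blast
  note KX = C(7)[OF X]
  have xi: "F2 Q \<Xi> \<in> hom2 L (F1 P R) (F1 P R')" using Y.P2[OF X] K(6)[OF R] K(6)[OF R'] by simp
  define z0 where "z0 = h \<bullet>\<^bsub>X\<^esub> (\<epsilon> y' \<rhd>\<^bsub>X\<^esub> F2 C \<Xi>) \<bullet>\<^bsub>X\<^esub> \<epsilon>1 R"
  have w: "\<epsilon> y' \<rhd>\<^bsub>X\<^esub> F2 C \<Xi> \<in> hom2 X (\<epsilon> y' \<odot>\<^bsub>X\<^esub> F1 C (F1 K R)) (\<epsilon> y' \<odot>\<^bsub>X\<^esub> F1 C (F1 K R'))"
    using X.hom2_lwhisker[OF KX KCR e[OF y(2)]] .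
  have wl: "F2 P (\<epsilon> y' \<rhd>\<^bsub>X\<^esub> F2 C \<Xi>) = F2 Q \<Xi>"
    using X.P_lwhisker[OF KX KCR e[OF y(2)]] le[OF y(2)] C(8)[OF X] X.base.hcomp_id_left[OF QR xi] by simp
  note v1 = X.vcomp_hom[OF X.iso2D[OF e1[OF R]] w]
  have z0: "z0 \<in> hom2 X (R \<odot>\<^bsub>X\<^esub> \<epsilon> y) (R' \<odot>\<^bsub>X\<^esub> \<epsilon> y)" unfolding z0_def using X.vcomp_hom[OF v1 X.iso2D[OF h(1)]] .
  have z0l: "F2 P z0 = F2 Q \<Xi>"
    unfolding z0_def
    using X.P_vcomp[OF v1 X.iso2D[OF h(1)]] X.P_vcomp[OF X.iso2D[OF e1[OF R]] w] h(2) wl le1[OF RM(1)]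
      X.base.vcomp_id_right[OF xi] X.base.vcomp_id_left[OF xi] by simp
  have sy: "tgt X (\<epsilon> y) = y" "src X (\<epsilon> y) = F0 C (F0 K y)" using e[OF y(1)] by (auto simp: hom1_def)
  obtain g \<theta> where g: "g \<in> hom1 X y (F0 C (F0 K y))" and th: "\<theta> \<in> iso2 X (\<epsilon> y \<odot>\<^bsub>X\<^esub> g) (id1 X y)"
    using ps(2) X.equivalence1E[of "\<epsilon> y"] sy by metis
  obtain \<theta>' where th': "\<theta>' \<in> iso2 X (id1 X y) (\<epsilon> y \<odot>\<^bsub>X\<^esub> g)" "\<theta> \<bullet>\<^bsub>X\<^esub> \<theta>' = id2 X (id1 X y)" using th by (rule X.iso2E)
  note ey = e[OF y(1)] and iy = X.id1_hom[OF y(1)]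
  note ge = X.comp1_hom[OF g ey]
  have a1: "R \<rhd>\<^bsub>X\<^esub> \<theta>' \<in> hom2 X R ((R \<odot>\<^bsub>X\<^esub> \<epsilon> y) \<odot>\<^bsub>X\<^esub> g)"
    using X.hom2_lwhisker[OF X.iso2D[OF th'(1)] iy R] X.comp1_id_right[OF R] X.comp1_assoc[OF g ey R] by simp
  have a2: "z0 \<lhd>\<^bsub>X\<^esub> g \<in> hom2 X ((R \<odot>\<^bsub>X\<^esub> \<epsilon> y) \<odot>\<^bsub>X\<^esub> g) ((R' \<odot>\<^bsub>X\<^esub> \<epsilon> y) \<odot>\<^bsub>X\<^esub> g)"
    using X.hom2_rwhisker[OF z0 g X.comp1_hom[OF ey R]] .
  have a3: "R' \<rhd>\<^bsub>X\<^esub> \<theta> \<in> hom2 X ((R' \<odot>\<^bsub>X\<^esub> \<epsilon> y) \<odot>\<^bsub>X\<^esub> g) R'"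
    using X.hom2_lwhisker[OF X.iso2D[OF th] ge R'] X.comp1_id_right[OF R'] X.comp1_assoc[OF g ey R'] by simp
  define \<zeta> where "\<zeta> = (R' \<rhd>\<^bsub>X\<^esub> \<theta>) \<bullet>\<^bsub>X\<^esub> (z0 \<lhd>\<^bsub>X\<^esub> g) \<bullet>\<^bsub>X\<^esub> (R \<rhd>\<^bsub>X\<^esub> \<theta>')"
  note a12 = X.vcomp_hom[OF a1 a2]
  have ze: "\<zeta> \<in> hom2 X R R'" unfolding \<zeta>_def using X.vcomp_hom[OF a12 a3] .
  have Qge: "F1 P (\<epsilon> y \<odot>\<^bsub>X\<^esub> g) = F1 P g" and Qg: "F1 P g \<in> hom1 L (F0 P y) (F0 P y)"
    using X.P_comp1[OF g ey] le[OF y(1)] X.P1[OF g] X.P1[OF ey] X.base.id1_hom[OF X.P0[OF y(1)]]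
    by (auto simp: hom1_def X.base.comp1_id_Mor)
  have Qth: "F2 P \<theta> \<in> iso2 L (F1 P g) (id1 L (F0 P y))" using X.P_iso2[OF th] Qge X.P_id1[OF y(1)] by simp
  have lab: "F2 P \<zeta> = (F1 P R' \<rhd>\<^bsub>L\<^esub> F2 P \<theta>) \<bullet>\<^bsub>L\<^esub> (F2 Q \<Xi> \<lhd>\<^bsub>L\<^esub> F1 P g) \<bullet>\<^bsub>L\<^esub> (F1 P R \<rhd>\<^bsub>L\<^esub> F2 P \<theta>')"
    unfolding \<zeta>_def
    using X.P_vcomp[OF a12 a3] X.P_vcomp[OF a1 a2] X.P_lwhisker[OF X.iso2D[OF th] ge R'] X.P_rwhisker[OF z0 X.comp1_hom[OF ey R] g]
      X.P_lwhisker[OF X.iso2D[OF th'(1)] iy R] z0l by simp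
  have Qth': "F2 P \<theta>' \<in> hom2 L (id1 L (F0 P y)) (F1 P g)" using X.P2[OF X.iso2D[OF th'(1)]] Qge X.P_id1[OF y(1)] by simp
  have inv: "F2 P \<theta> \<bullet>\<^bsub>L\<^esub> F2 P \<theta>' = id2 L (id1 L (F0 P y))"
    using X.P_vcomp[OF X.iso2D[OF th'(1)] X.iso2D[OF th]] th'(2) X.P_id2[of "id1 X y"] y X.P_id1[OF y(1)] by simp
  note iL = X.base.id1_hom[OF X.P0[OF y(1)]]
  have b1: "F1 P R \<rhd>\<^bsub>L\<^esub> F2 P \<theta>' \<in> hom2 L (F1 P R) (F1 P R \<odot>\<^bsub>L\<^esub> F1 P g)"
    using X.base.hom2_lwhisker[OF Qth' iL QR] X.base.comp1_id_right[OF QR] by simp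
  have b2: "F2 Q \<Xi> \<lhd>\<^bsub>L\<^esub> F1 P g \<in> hom2 L (F1 P R \<odot>\<^bsub>L\<^esub> F1 P g) (F1 P R' \<odot>\<^bsub>L\<^esub> F1 P g)"
    using X.base.hom2_rwhisker[OF xi Qg QR] .
  have b3: "F1 P R' \<rhd>\<^bsub>L\<^esub> F2 P \<theta> \<in> hom2 L (F1 P R' \<odot>\<^bsub>L\<^esub> F1 P g) (F1 P R')"
    using X.base.hom2_lwhisker[OF X.base.iso2D[OF Qth] Qg QR'] X.base.comp1_id_right[OF QR'] by simp
  have b4: "F1 P R \<rhd>\<^bsub>L\<^esub> F2 P \<theta> \<in> hom2 L (F1 P R \<odot>\<^bsub>L\<^esub> F1 P g) (F1 P R)"
    using X.base.hom2_lwhisker[OF X.base.iso2D[OF Qth] Qg QR] X.base.comp1_id_right[OF QR] by simp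
  have "F2 P \<zeta> = ((F1 P R' \<rhd>\<^bsub>L\<^esub> F2 P \<theta>) \<bullet>\<^bsub>L\<^esub> (F2 Q \<Xi> \<lhd>\<^bsub>L\<^esub> F1 P g)) \<bullet>\<^bsub>L\<^esub> (F1 P R \<rhd>\<^bsub>L\<^esub> F2 P \<theta>')"
    using lab X.base.vcomp_assoc[OF b1 b2 b3] by simp
  also have "\<dots> = (F2 Q \<Xi> \<bullet>\<^bsub>L\<^esub> (F1 P R \<rhd>\<^bsub>L\<^esub> F2 P \<theta>)) \<bullet>\<^bsub>L\<^esub> (F1 P R \<rhd>\<^bsub>L\<^esub> F2 P \<theta>')"
    using X.base.rwhisker_id1_conj[OF Qth xi QR] by simp
  also have "\<dots> = F2 Q \<Xi> \<bullet>\<^bsub>L\<^esub> (F1 P R \<rhd>\<^bsub>L\<^esub> (F2 P \<theta> \<bullet>\<^bsub>L\<^esub> F2 P \<theta>'))"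
    using X.base.vcomp_assoc[OF b1 b4 xi] Qth' X.base.iso2D[OF Qth] QR iL
      X.base.lwhisker_vcomp[of "F2 P \<theta>'" "F2 P \<theta>" "F1 P R"] by (auto simp: hom1_def hom2_def)
  also have "\<dots> = F2 Q \<Xi>"
    using inv X.base.hcomp_id2[OF iL QR] X.base.comp1_id_right[OF QR] X.base.vcomp_id_right[OF xi] by simp
  finally show ?thesis using ze by blast
qed

end

section \<open>From biequivalences to 2-kernels\<close>

locale zero_biequivalence = pointed +
  fixes E M :: "'b set" and K C \<eta> \<eta>1 \<epsilon> \<epsilon>1
  assumes fs: "factorization_system L E M" and proper: "proper11 L E M"
    and K: "over_psfun L (arrow2 L E) (dom_psfun L) (arrow2 L M) (cod_psfun L) K"
    and C: "over_psfun L (arrow2 L M) (cod_psfun L) (arrow2 L E) (dom_psfun L) C"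
    and unit: "pseudonat_equivalence (arrow2 L M) (arrow2 L M) (id_psfun (arrow2 L M)) (comp_psfun (arrow2 L M) K C) \<eta> \<eta>1"
      "lies_over (arrow2 L M) L (cod_psfun L) \<eta> \<eta>1"
    and counit: "pseudonat_equivalence (arrow2 L E) (arrow2 L E) (comp_psfun (arrow2 L E) C K) (id_psfun (arrow2 L E)) \<epsilon> \<epsilon>1"
      "lies_over (arrow2 L E) L (dom_psfun L) \<epsilon> \<epsilon>1"
    and zero: "A \<in> Ob L \<Longrightarrow> src L (F0 K (id1 L A)) = Z \<and> tgt L (F0 C (id1 L A)) = Z"
begin

abbreviation k :: "'b \<Rightarrow> 'b" where "k \<equiv> F0 K"
abbreviation c :: "'b \<Rightarrow> 'b" where "c \<equiv> F0 C"

lemma over_pair_arrow2: "over_pair L (arrow2 L E) (dom_psfun L) (arrow2 L M) (cod_psfun L)"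
  unfolding over_pair_def using over_base_arrow2 by blast

lemma EM_Mor: "e \<in> E \<Longrightarrow> e \<in> Mor L" "m \<in> M \<Longrightarrow> m \<in> Mor L"
  using factorization_systemD(1,2)[OF fs] by auto

lemma id_EM: "A \<in> Ob L \<Longrightarrow> id1 L A \<in> E" "A \<in> Ob L \<Longrightarrow> id1 L A \<in> M"
  using factorization_system_id[OF fs] by auto

lemma k_M: "e \<in> E \<Longrightarrow> k e \<in> M" "e \<in> E \<Longrightarrow> k e \<in> Mor L" "e \<in> E \<Longrightarrow> tgt L (k e) = src L e"
  using over_psfunD(1,2)[OF K, of e] EM_Mor(1)[of e] by (auto simp: dom_psfun_def cod_psfun_def)

lemma c_E: "m \<in> M \<Longrightarrow> c m \<in> E" "m \<in> M \<Longrightarrow> c m \<in> Mor L" "m \<in> M \<Longrightarrow> src L (c m) = tgt L m"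
  using over_psfunD(1,2)[OF C, of m] EM_Mor(2)[of m] by (auto simp: dom_psfun_def cod_psfun_def)

lemma K_square:
  assumes "p \<in> hom1 (arrow2 L E) e e'"
  shows "F1 K p \<in> hom1 (arrow2 L M) (k e) (k e')" "sq_bot (F1 K p) = sq_top p"
  using over_psfunD(5,6)[OF K assms] by (auto simp: dom_psfun_def cod_psfun_def)

lemma C_square:
  assumes "p \<in> hom1 (arrow2 L M) m m'"
  shows "F1 C p \<in> hom1 (arrow2 L E) (c m) (c m')" "sq_top (F1 C p) = sq_bot p"
  using over_psfunD(5,6)[OF C assms] by (auto simp: dom_psfun_def cod_psfun_def)

lemma k_id: "A \<in> Ob L \<Longrightarrow> k (id1 L A) \<in> hom1 L Z A"
  using zero[of A] k_M[OF id_EM(1)[of A]] by (simp add: hom1_def)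

lemma c_id: "A \<in> Ob L \<Longrightarrow> c (id1 L A) \<in> hom1 L A Z"
  using zero[of A] c_E[OF id_EM(2)[of A]] by (simp add: hom1_def)

lemma null_rigid: "null_rigid L Z"
proof (rule null_rigid_of_orthogonal)
  fix A B assume "A \<in> Ob L" "B \<in> Ob L"
  then show "\<exists>c j. c \<in> hom1 L A Z \<and> j \<in> hom1 L Z B \<and> orthogonal L c j"
    using k_id[of B] c_id[of A] factorization_systemD(8)[OF fs c_E(1)[OF id_EM(2)[of A]] k_M(1)[OF id_EM(1)[of B]]] by blast
qed

sublocale rigid_pointed
  by (unfold_locales) (rule null_rigid)

lemma faithful: "m \<in> M \<Longrightarrow> faithful1 L m" and cofaithful: "e \<in> E \<Longrightarrow> cofaithful1 L e"
  using proper unfolding proper11_def by auto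

text \<open>Lying over L is imposed on \<eta> and not on its quasi-inverse, so the square backwards
  lies over a 1-cell that is only isomorphic to an identity. Factorizations up to isomorphism ask
  for no more.\<close>

lemma unit_square:
  assumes m: "m \<in> M"
  shows "\<eta> m \<in> hom1 (arrow2 L M) m (k (c m))" "sq_bot (\<eta> m) = id1 L (tgt L m)"
    "\<exists>g \<in> hom1 (arrow2 L M) (k (c m)) m. isomorphic L (sq_bot g) (id1 L (tgt L m))"
proof -
  interpret B: over_base L "arrow2 L M" "cod_psfun L" by (rule over_base_arrow2)
  have mO: "m \<in> Ob (arrow2 L M)" using m EM_Mor by simp
  show e: "\<eta> m \<in> hom1 (arrow2 L M) m (k (c m))"
    using unit(1) mO unfolding pseudonat_equivalence_def pseudonat_def by (simp add: id_psfun_def comp_psfun_def)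
  show l: "sq_bot (\<eta> m) = id1 L (tgt L m)"
    using unit(2) mO unfolding lies_over_def by (simp add: cod_psfun_def)
  have eq: "equivalence1 (arrow2 L M) (\<eta> m)" using unit(1) mO unfolding pseudonat_equivalence_def by blast
  obtain g \<theta> where g: "g \<in> hom1 (arrow2 L M) (k (c m)) m" "\<theta> \<in> iso2 (arrow2 L M) (sq_comp L g (\<eta> m)) (sq_id L m)"
    by (rule B.equivalence1E[OF eq]) (use e in \<open>auto simp: hom1_def\<close>)
  have "sqc_bot \<theta> \<in> iso2 L (sq_bot g \<odot> id1 L (tgt L m)) (id1 L (tgt L m))"
    using B.P_iso2[OF g(2)] l by (simp add: cod_psfun_def)
  moreover have "sq_bot g \<in> hom1 L (tgt L m) (tgt L m)" using arrow2_hom1D(7)[OF g(1)] k_M c_E m by simp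
  ultimately have "isomorphic L (sq_bot g) (id1 L (tgt L m))" using isomorphicI comp1_id_right by metis
  then show "\<exists>g \<in> hom1 (arrow2 L M) (k (c m)) m. isomorphic L (sq_bot g) (id1 L (tgt L m))" using g(1) by blast
qed

lemma counit_square:
  assumes e: "e \<in> E"
  shows "\<epsilon> e \<in> hom1 (arrow2 L E) (c (k e)) e" "sq_top (\<epsilon> e) = id1 L (src L e)"
    "\<exists>g \<in> hom1 (arrow2 L E) e (c (k e)). isomorphic L (sq_top g) (id1 L (src L e))"
proof -
  interpret B: over_base L "arrow2 L E" "dom_psfun L" by (rule over_base_arrow2)
  have eO: "e \<in> Ob (arrow2 L E)" using e EM_Mor by simp
  show h: "\<epsilon> e \<in> hom1 (arrow2 L E) (c (k e)) e"
    using counit(1) eO unfolding pseudonat_equivalence_def pseudonat_def by (simp add: id_psfun_def comp_psfun_def)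
  show l: "sq_top (\<epsilon> e) = id1 L (src L e)"
    using counit(2) eO unfolding lies_over_def by (simp add: dom_psfun_def)
  have eq: "equivalence1 (arrow2 L E) (\<epsilon> e)" using counit(1) eO unfolding pseudonat_equivalence_def by blast
  obtain g \<theta> where g: "g \<in> hom1 (arrow2 L E) e (c (k e))" "\<theta> \<in> iso2 (arrow2 L E) (sq_comp L (\<epsilon> e) g) (sq_id L e)"
    by (rule B.equivalence1E[OF eq]) (use h in \<open>auto simp: hom1_def\<close>)
  have "sqc_top \<theta> \<in> iso2 L (id1 L (src L e) \<odot> sq_top g) (id1 L (src L e))"
    using B.P_iso2[OF g(2)] l by (simp add: dom_psfun_def)
  moreover have "sq_top g \<in> hom1 L (src L e) (src L e)" using arrow2_hom1D(6)[OF g(1)] k_M c_E e by simp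
  ultimately have "isomorphic L (sq_top g) (id1 L (src L e))" using isomorphicI comp1_id_left by metis
  then show "\<exists>g \<in> hom1 (arrow2 L E) e (c (k e)). isomorphic L (sq_top g) (id1 L (src L e))" using g(1) by blast
qed

lemma square_isomorphic:
  assumes "p \<in> hom1 (arrow2 L S) f g"
  shows "isomorphic L (g \<odot> sq_top p) (sq_bot p \<odot> f)"
  using arrow2_hom1D(8)[OF assms] by (rule isomorphicI)

text \<open>m is the bottom of a square from the identity of its domain to m. C turns it into a
  square with top m out of C(id), whose codomain is \<open>Z\<close>, and its filling exhibits the
  composite as a morphism through \<open>Z\<close>.\<close>

lemma c_comp_nullish:
  assumes m: "m \<in> M"
  shows "nullish L Z (c m \<odot> m)"
proof -
  have mh: "m \<in> hom1 L (src L m) (tgt L m)" using EM_Mor m by (simp add: hom1_def)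
  have O: "src L m \<in> Ob L" using EM_Mor m by simp
  let ?p = "Sq (id1 L (src L m)) m (id1 L (src L m)) m (id2 L m)"
  have p: "?p \<in> hom1 (arrow2 L M) (id1 L (src L m)) m"
    using O m EM_Mor id_EM mh iso2_id1[OF mh] id1_hom[OF O] by (intro arrow2_hom1I) (auto simp: comp1_id_Mor)
  note q = arrow2_hom1D[OF C_square(1)[OF p]]
  have iso: "isomorphic L (c m \<odot> m) (sq_bot (F1 C ?p) \<odot> c (id1 L (src L m)))"
    using square_isomorphic[OF C_square(1)[OF p]] C_square(2)[OF p] by simp
  have "sq_bot (F1 C ?p) \<in> hom1 L Z (tgt L (c m))" using q(7) c_id[OF O] by (simp add: hom1_def)
  then show ?thesis using nullishI[OF c_id[OF O] _ iso] by blast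
qed

text \<open>K is applied to the square with top e from e to the identity of its codomain; the
  resulting square ends in K(id), whose domain is \<open>Z\<close>.\<close>

lemma k_comp_nullish:
  assumes e: "e \<in> E"
  shows "nullish L Z (e \<odot> k e)"
proof -
  have eh: "e \<in> hom1 L (src L e) (tgt L e)" using EM_Mor e by (simp add: hom1_def)
  have O: "tgt L e \<in> Ob L" using EM_Mor e by simp
  let ?p = "Sq e (id1 L (tgt L e)) e (id1 L (tgt L e)) (id2 L e)"
  have p: "?p \<in> hom1 (arrow2 L E) e (id1 L (tgt L e))"
    using O e EM_Mor id_EM eh iso2_id1[OF eh] id1_hom[OF O] by (intro arrow2_hom1I) (auto simp: comp1_id_Mor)
  note q = arrow2_hom1D[OF K_square(1)[OF p]]
  have iso: "isomorphic L (e \<odot> k e) (k (id1 L (tgt L e)) \<odot> sq_top (F1 K ?p))"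
    using isomorphic_sym[OF square_isomorphic[OF K_square(1)[OF p]]] K_square(2)[OF p] by simp
  have "sq_top (F1 K ?p) \<in> hom1 L (src L (k e)) Z" using q(6) k_id[OF O] by (simp add: hom1_def)
  then show ?thesis using nullishI[OF _ k_id[OF O] iso] by blast
qed

text \<open>For the 2-dimensional clause, u and v are turned into squares from the identity of X to
  m, and \<xi> into a 2-cell between their images under C; \<open>full_of_unit\<close> brings it
  back to a 2-cell between u and v.\<close>

lemma zkernel_c:
  assumes m: "m \<in> M"
  shows "zkernel L Z (c m) m"
proof -
  interpret op: over_pair L "arrow2 L E" "dom_psfun L" "arrow2 L M" "cod_psfun L" by (rule over_pair_arrow2)
  have mh: "m \<in> hom1 L (src L m) (tgt L m)" using EM_Mor m by (simp add: hom1_def)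
  have ch: "c m \<in> hom1 L (tgt L m) (tgt L (c m))" using c_E m by (simp add: hom1_def)
  show ?thesis unfolding zkernel_def c_E(3)[OF m]
  proof (intro conjI allI impI)
    show "c m \<in> Mor L" "m \<in> Mor L" "nullish L Z (c m \<odot> m)" using c_E m EM_Mor c_comp_nullish by auto
  next
    fix X z assume *: "z \<in> hom1 L X (tgt L m) \<and> nullish L Z (c m \<odot> z)"
    then have z: "z \<in> hom1 L X (tgt L m)" and O: "X \<in> Ob L" using hom1_Ob by blast+
    obtain i where i: "i \<in> hom1 L Z (tgt L (c m))" using from_zero_hom hom1_Ob[OF ch] by blast
    have "isomorphic L (c m \<odot> z) (i \<odot> c (id1 L X))"
      using nullish_any[of "c m \<odot> z" "c (id1 L X)" i] * c_id[OF O] i comp1_hom[OF z ch] by (simp add: hom1_def)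
    then obtain \<phi> where \<phi>: "\<phi> \<in> iso2 L (c m \<odot> z) (i \<odot> c (id1 L X))" by (rule isomorphicE)
    have cX: "src L (c (id1 L X)) = X" "tgt L (c (id1 L X)) = Z" using c_id[OF O] by (auto simp: hom1_def)
    have p: "Sq (c (id1 L X)) (c m) z i \<phi> \<in> hom1 (arrow2 L E) (c (id1 L X)) (c m)"
      using m O z i \<phi> cX c_E id_EM by (intro arrow2_hom1I) auto
    let ?p = "F1 K (Sq (c (id1 L X)) (c m) z i \<phi>)"
    note Kp = K_square[OF p]
    note ui = unit_square(1,2)[OF id_EM(2)[OF O]]
    obtain g where g: "g \<in> hom1 (arrow2 L M) (k (c m)) m" "isomorphic L (sq_bot g) (id1 L (tgt L m))"
      using unit_square(3)[OF m] by blast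
    \<comment> \<open>The unit at the identity, then K of the square on z, then the square inverting
      the unit at m: its top is the factor of z through m.\<close>
    let ?q = "sq_comp L g (sq_comp L ?p (\<eta> (id1 L X)))"
    have q: "?q \<in> hom1 (arrow2 L M) (id1 L X) m"
      using op.Y.comp1_hom[OF op.Y.comp1_hom[OF ui(1) Kp(1)] g(1)] by simp
    have top: "sq_top ?q \<in> hom1 L X (src L m)" using arrow2_hom1D(6)[OF q] O by simp
    have tX: "tgt L (id1 L X) = X" using O by simp
    have zi: "z \<odot> id1 L X = z" using comp1_id_right[OF z] .
    have "sq_bot ?q = sq_bot g \<odot> z" using Kp(2) ui(2) tX zi by simp
    then have 1: "isomorphic L (m \<odot> sq_top ?q) ((sq_bot g \<odot> z) \<odot> id1 L X)" using square_isomorphic[OF q] by simp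
    have gh: "sq_bot g \<in> hom1 L (tgt L m) (tgt L m)" using arrow2_hom1D(7)[OF g(1)] k_M c_E m by simp
    have "isomorphic L (sq_bot g \<odot> z) (id1 L (tgt L m) \<odot> z)"
      using g(2) z gh by (intro isomorphic_rwhisker) (auto simp: hom1_def)
    then have "isomorphic L (m \<odot> sq_top ?q) z"
      using isomorphic_trans[OF 1] comp1_id_right[OF comp1_hom[OF z gh]] comp1_id_left[OF z] by simp
    then show "\<exists>u\<in>hom1 L X (src L m). isomorphic L z (m \<odot> u)" using top isomorphic_sym by blast
  next
    fix X u v \<xi>
    assume "u \<in> hom1 L X (src L m) \<and> v \<in> hom1 L X (src L m) \<and> \<xi> \<in> hom2 L (m \<odot> u) (m \<odot> v) \<and> invertible L (c m \<rhd> \<xi>)"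
    then have u: "u \<in> hom1 L X (src L m)" and v: "v \<in> hom1 L X (src L m)" and xi: "\<xi> \<in> hom2 L (m \<odot> u) (m \<odot> v)"
      and inv: "invertible L (c m \<rhd> \<xi>)" by auto
    have O: "X \<in> Ob L" using hom1_Ob[OF u] by blast
    note mu = comp1_hom[OF u mh] and mv = comp1_hom[OF v mh]
    have sq: "Sq (id1 L X) m w (m \<odot> w) (id2 L (m \<odot> w)) \<in> hom1 (arrow2 L M) (id1 L X) m" if w: "w \<in> hom1 L X (src L m)" for w
      using m O w mh EM_Mor id_EM comp1_hom[OF w mh] iso2_id1[OF comp1_hom[OF w mh]] comp1_id_right[OF comp1_hom[OF w mh]]
      by (intro arrow2_hom1I) auto
    let ?U = "Sq (id1 L X) m u (m \<odot> u) (id2 L (m \<odot> u))" and ?V = "Sq (id1 L X) m v (m \<odot> v) (id2 L (m \<odot> v))"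
    note CU = C_square[OF sq[OF u]] and CV = C_square[OF sq[OF v]]
    note dU = arrow2_hom1D[OF CU(1)] and dV = arrow2_hom1D[OF CV(1)]
    note cX = c_id[OF O]
    have tops: "sq_top (F1 C ?U) = m \<odot> u" "sq_top (F1 C ?V) = m \<odot> v" using CU(2) CV(2) by auto
    have b: "sq_bot (F1 C ?U) \<in> hom1 L Z (tgt L (c m))" "sq_bot (F1 C ?V) \<in> hom1 L Z (tgt L (c m))"
      using dU(7) dV(7) cX by (auto simp: hom1_def)
    \<comment> \<open>Both bottoms start at \<open>Z\<close>, so there is exactly one candidate for
      the second component.\<close>
    obtain \<iota> where \<iota>: "\<iota> \<in> hom2 L (sq_bot (F1 C ?U)) (sq_bot (F1 C ?V))" using from_zero_ex1[OF b] by blast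
    note \<iota>i = from_zero_iso[OF b \<iota>]
    have cx: "c m \<rhd> \<xi> \<in> iso2 L (c m \<odot> m \<odot> u) (c m \<odot> m \<odot> v)" using hom2_lwhisker[OF xi mu ch] inv by (simp add: iso2_iff)
    have fU: "sq_fill (F1 C ?U) \<in> iso2 L (c m \<odot> m \<odot> u) (sq_bot (F1 C ?U) \<odot> c (id1 L X))" using dU(8) tops by simp
    have fV: "sq_fill (F1 C ?V) \<in> iso2 L (c m \<odot> m \<odot> v) (sq_bot (F1 C ?V) \<odot> c (id1 L X))" using dV(8) tops by simp
    have n: "nullish L Z (c m \<odot> m \<odot> u)"
      using nullish_rwhisker[OF c_comp_nullish[OF m], of u] comp1_assoc[OF u mh ch] u mh ch by (simp add: hom1_def)
    \<comment> \<open>Both sides are invertible 2-cells out of a null morphism, so rigidity gives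
      the compatibility.\<close>
    have eq: "sq_fill (F1 C ?V) \<bullet> (c m \<rhd> \<xi>) = (\<iota> \<lhd> c (id1 L X)) \<bullet> sq_fill (F1 C ?U)"
      using nullish_iso_unique[OF n iso2_vcomp[OF cx fV] iso2_vcomp[OF fU iso2_rwhisker[OF \<iota>i cX b(1)]]] .
    have cell: "SqCell (F1 C ?U) (F1 C ?V) \<xi> \<iota> \<in> hom2 (arrow2 L E) (F1 C ?U) (F1 C ?V)"
      unfolding arrow2_hom2_iff[OF CU(1) CV(1)] using xi \<iota> eq tops by simp
    obtain x where x: "x \<in> hom2 (arrow2 L M) ?U ?V" "F2 (cod_psfun L) x = F2 (dom_psfun L) (SqCell (F1 C ?U) (F1 C ?V) \<xi> \<iota>)"
      using op.full_of_unit[OF K C unit sq[OF u] sq[OF v] cell] by blast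
    have "sqc_bot x = \<xi>" using x(2) by (simp add: dom_psfun_def cod_psfun_def)
    then have t: "sqc_top x \<in> hom2 L u v" "id2 L (m \<odot> v) \<bullet> (m \<rhd> sqc_top x) = (\<xi> \<lhd> id1 L X) \<bullet> id2 L (m \<odot> u)"
      using x(1) unfolding arrow2_hom2_iff[OF sq[OF u] sq[OF v]] by auto
    then have "m \<rhd> sqc_top x = \<xi>"
      using vcomp_id_left[OF hom2_lwhisker[OF t(1) u mh]] hcomp_id_right[OF mu xi] vcomp_id_right[OF xi] by simp
    then show "\<exists>!\<mu>. \<mu> \<in> hom2 L u v \<and> m \<rhd> \<mu> = \<xi>" using t(1) faithful1D[OF faithful[OF m] u v] by blast
  qed (simp)
qed

text \<open>Mirror image of \<open>zkernel_c\<close>, with the counit and with 2-cells into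
  \<open>Z\<close>. It is carried out in L because the pseudo arrow 2-category of
  \<open>op L\<close> has the reversed fillings.\<close>

lemma zcokernel_k:
  assumes e: "e \<in> E"
  shows "zkernel (op L) Z (k e) e"
proof -
  interpret op: over_pair L "arrow2 L E" "dom_psfun L" "arrow2 L M" "cod_psfun L" by (rule over_pair_arrow2)
  have eh: "e \<in> hom1 L (src L e) (tgt L e)" using EM_Mor e by (simp add: hom1_def)
  have kh: "k e \<in> hom1 L (src L (k e)) (src L e)" using k_M e by (simp add: hom1_def)
  show ?thesis unfolding zkernel_def op_simps nullish_op isomorphic_op invertible_op hom1_op hom2_op k_M(3)[OF e]
  proof (intro conjI allI impI)
    show "k e \<in> Mor L" "e \<in> Mor L" "nullish L Z (e \<odot> k e)" using k_M e EM_Mor k_comp_nullish by auto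
  next
    fix X z assume *: "z \<in> hom1 L (src L e) X \<and> nullish L Z (z \<odot> k e)"
    then have z: "z \<in> hom1 L (src L e) X" and O: "X \<in> Ob L" using hom1_Ob by blast+
    obtain t where t: "t \<in> hom1 L (src L (k e)) Z" using to_zero_hom hom1_Ob[OF kh] by blast
    have "isomorphic L (z \<odot> k e) (k (id1 L X) \<odot> t)"
      using nullish_any[of "z \<odot> k e" t "k (id1 L X)"] * k_id[OF O] t comp1_hom[OF kh z] by (simp add: hom1_def)
    then obtain \<phi> where \<phi>: "\<phi> \<in> iso2 L (k (id1 L X) \<odot> t) (z \<odot> k e)" using isomorphic_sym isomorphicE by metis
    have kX: "tgt L (k (id1 L X)) = X" "src L (k (id1 L X)) = Z" using k_id[OF O] by (auto simp: hom1_def)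
    have p: "Sq (k e) (k (id1 L X)) t z \<phi> \<in> hom1 (arrow2 L M) (k e) (k (id1 L X))"
      using e O z t \<phi> kX k_M id_EM by (intro arrow2_hom1I) auto
    let ?p = "F1 C (Sq (k e) (k (id1 L X)) t z \<phi>)"
    note Cp = C_square[OF p]
    note ui = counit_square(1,2)[OF id_EM(1)[OF O]]
    obtain g where g: "g \<in> hom1 (arrow2 L E) e (c (k e))" "isomorphic L (sq_top g) (id1 L (src L e))"
      using counit_square(3)[OF e] by blast
    let ?q = "sq_comp L (\<epsilon> (id1 L X)) (sq_comp L ?p g)"
    have q: "?q \<in> hom1 (arrow2 L E) e (id1 L X)"
      using op.X.comp1_hom[OF op.X.comp1_hom[OF g(1) Cp(1)] ui(1)] by simp
    have bot: "sq_bot ?q \<in> hom1 L (tgt L e) X" using arrow2_hom1D(7)[OF q] O by simp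
    have sX: "src L (id1 L X) = X" using O by simp
    have gh: "sq_top g \<in> hom1 L (src L e) (src L e)" using arrow2_hom1D(6)[OF g(1)] k_M c_E e by simp
    note zg = comp1_hom[OF gh z]
    have "sq_top ?q = z \<odot> sq_top g" using Cp(2) ui(2) sX comp1_id_left[OF zg] by simp
    then have 1: "isomorphic L (z \<odot> sq_top g) (sq_bot ?q \<odot> e)" using square_isomorphic[OF q] comp1_id_left[OF zg] by simp
    have "isomorphic L (z \<odot> sq_top g) (z \<odot> id1 L (src L e))"
      using g(2) z gh by (intro isomorphic_lwhisker) (auto simp: hom1_def)
    then have "isomorphic L z (sq_bot ?q \<odot> e)"
      using isomorphic_trans[OF isomorphic_sym 1] comp1_id_right[OF z] by simp
    then show "\<exists>u\<in>hom1 L (tgt L e) X. isomorphic L z (u \<odot> e)" using bot by blast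
  next
    fix X u v \<xi>
    assume "u \<in> hom1 L (tgt L e) X \<and> v \<in> hom1 L (tgt L e) X \<and> \<xi> \<in> hom2 L (u \<odot> e) (v \<odot> e) \<and> invertible L (\<xi> \<lhd> k e)"
    then have u: "u \<in> hom1 L (tgt L e) X" and v: "v \<in> hom1 L (tgt L e) X" and xi: "\<xi> \<in> hom2 L (u \<odot> e) (v \<odot> e)"
      and inv: "invertible L (\<xi> \<lhd> k e)" by auto
    have O: "X \<in> Ob L" using hom1_Ob[OF u] by blast
    note ue = comp1_hom[OF eh u] and ve = comp1_hom[OF eh v]
    have sq: "Sq e (id1 L X) (w \<odot> e) w (id2 L (w \<odot> e)) \<in> hom1 (arrow2 L E) e (id1 L X)" if w: "w \<in> hom1 L (tgt L e) X" for w
      using e O w eh EM_Mor id_EM comp1_hom[OF eh w] iso2_id1[OF comp1_hom[OF eh w]] comp1_id_left[OF comp1_hom[OF eh w]]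
      by (intro arrow2_hom1I) auto
    let ?U = "Sq e (id1 L X) (u \<odot> e) u (id2 L (u \<odot> e))" and ?V = "Sq e (id1 L X) (v \<odot> e) v (id2 L (v \<odot> e))"
    note KU = K_square[OF sq[OF u]] and KV = K_square[OF sq[OF v]]
    note dU = arrow2_hom1D[OF KU(1)] and dV = arrow2_hom1D[OF KV(1)]
    note kX = k_id[OF O]
    have bots: "sq_bot (F1 K ?U) = u \<odot> e" "sq_bot (F1 K ?V) = v \<odot> e" using KU(2) KV(2) by auto
    have b: "sq_top (F1 K ?U) \<in> hom1 L (src L (k e)) Z" "sq_top (F1 K ?V) \<in> hom1 L (src L (k e)) Z"
      using dU(6) dV(6) kX by (auto simp: hom1_def)
    obtain \<tau> where \<tau>: "\<tau> \<in> hom2 L (sq_top (F1 K ?U)) (sq_top (F1 K ?V))" using to_zero_ex1[OF b] by blast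
    note \<tau>i = to_zero_iso[OF b \<tau>]
    have xk: "\<xi> \<lhd> k e \<in> iso2 L ((u \<odot> e) \<odot> k e) ((v \<odot> e) \<odot> k e)" using hom2_rwhisker[OF xi kh ue] inv by (simp add: iso2_iff)
    have fU: "sq_fill (F1 K ?U) \<in> iso2 L (k (id1 L X) \<odot> sq_top (F1 K ?U)) ((u \<odot> e) \<odot> k e)" using dU(8) bots by simp
    have fV: "sq_fill (F1 K ?V) \<in> iso2 L (k (id1 L X) \<odot> sq_top (F1 K ?V)) ((v \<odot> e) \<odot> k e)" using dV(8) bots by simp
    have eq: "sq_fill (F1 K ?V) \<bullet> (k (id1 L X) \<rhd> \<tau>) = (\<xi> \<lhd> k e) \<bullet> sq_fill (F1 K ?U)"
      using nullish_iso_unique[OF nullish_factor[OF b(1) kX] iso2_vcomp[OF iso2_lwhisker[OF \<tau>i b(1) kX] fV] iso2_vcomp[OF fU xk]] .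
    have cell: "SqCell (F1 K ?U) (F1 K ?V) \<tau> \<xi> \<in> hom2 (arrow2 L M) (F1 K ?U) (F1 K ?V)"
      unfolding arrow2_hom2_iff[OF KU(1) KV(1)] using xi \<tau> eq bots by simp
    obtain x where x: "x \<in> hom2 (arrow2 L E) ?U ?V" "F2 (dom_psfun L) x = F2 (cod_psfun L) (SqCell (F1 K ?U) (F1 K ?V) \<tau> \<xi>)"
      using op.full_of_counit[OF K C counit sq[OF u] sq[OF v] cell] by blast
    have "sqc_top x = \<xi>" using x(2) by (simp add: dom_psfun_def cod_psfun_def)
    then have t: "sqc_bot x \<in> hom2 L u v" "id2 L (v \<odot> e) \<bullet> (id1 L X \<rhd> \<xi>) = (sqc_bot x \<lhd> e) \<bullet> id2 L (u \<odot> e)"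
      using x(1) unfolding arrow2_hom2_iff[OF sq[OF u] sq[OF v]] by auto
    then have "sqc_bot x \<lhd> e = \<xi>"
      using vcomp_id_right[OF hom2_rwhisker[OF t(1) eh u]] hcomp_id_left[OF ue xi] vcomp_id_left[OF xi] by simp
    then show "\<exists>!\<mu>. \<mu> \<in> hom2 L u v \<and> \<mu> \<lhd> e = \<xi>" using t(1) cofaithful1D[OF cofaithful[OF e] u v] by blast
  qed simp
qed

text \<open>By \<open>zkernel_c\<close>, \<open>k e\<close> is a kernel of \<open>c (k e)\<close>.
  The counit square and its quasi-inverse make e and \<open>c (k e)\<close> factor through each
  other, so the kernel property transfers to e.\<close>

lemma ses_k:
  assumes e: "e \<in> E"
  shows "ses e (k e)"
proof -
  have eh: "e \<in> hom1 L (src L e) (tgt L e)" using EM_Mor e by (simp add: hom1_def)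
  have kM: "k e \<in> M" and s: "src L (c (k e)) = src L e" using k_M c_E e by auto
  note cE = c_E(1)[OF kM] and cM = c_E(2)[OF kM]
  have ch: "c (k e) \<in> hom1 L (src L e) (tgt L (c (k e)))" using cM s by (simp add: hom1_def)
  note u = counit_square(1,2)[OF e]
  obtain g where g: "g \<in> hom1 (arrow2 L E) e (c (k e))" "isomorphic L (sq_top g) (id1 L (src L e))"
    using counit_square(3)[OF e] by blast
  note du = arrow2_hom1D[OF u(1)] and dg = arrow2_hom1D[OF g(1)]
  have 1: "isomorphic L e (sq_bot (\<epsilon> e) \<odot> c (k e))" using square_isomorphic[OF u(1)] u(2) comp1_id_right[OF eh] by simp
  have "isomorphic L (c (k e) \<odot> sq_top g) (c (k e) \<odot> id1 L (src L e))"
    using g(2) dg(6) s cM by (intro isomorphic_lwhisker) (auto simp: hom1_def)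
  then have 2: "isomorphic L (c (k e)) (sq_bot g \<odot> e)"
    using isomorphic_trans[OF isomorphic_sym square_isomorphic[OF g(1)]] comp1_id_right[OF ch] by simp
  have "zkernel L Z e (k e)"
  proof (rule zkernel_transfer[OF zkernel_c[OF kM] EM_Mor(1)[OF e] s[symmetric]])
    fix X z assume z: "z \<in> hom1 L X (src L (c (k e)))"
    show "nullish L Z (c (k e) \<odot> z) \<longleftrightarrow> nullish L Z (e \<odot> z)"
      using factor_nullish[OF 1 du(7) cM z] factor_nullish[OF 2 dg(7) EM_Mor(1)[OF e]] z s by auto
  next
    fix X u v \<xi> assume "u \<in> hom1 L X (src L (c (k e)))" "\<xi> \<in> hom2 L u v" "invertible L (e \<rhd> \<xi>)"
    then show "invertible L (c (k e) \<rhd> \<xi>)" using factor_invertible[OF 2 dg(7) EM_Mor(1)[OF e]] s by auto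
  qed
  then show ?thesis using zcokernel_k[OF e] by (simp add: ses_def)
qed

text \<open>Dual transfer: m and \<open>k (c m)\<close> factor through each other by the unit
  squares, and \<open>c m\<close> is a cokernel of the latter.\<close>

lemma ses_c:
  assumes m: "m \<in> M"
  shows "ses (c m) m"
proof -
  interpret op: rigid_pointed "op L" Z by (rule rigid_pointed_op)
  have mh: "m \<in> hom1 L (src L m) (tgt L m)" using EM_Mor m by (simp add: hom1_def)
  have cE: "c m \<in> E" and s: "tgt L (k (c m)) = tgt L m" using k_M c_E m by auto
  note kM = k_M(1)[OF cE] and kMor = k_M(2)[OF cE]
  have kh: "k (c m) \<in> hom1 L (src L (k (c m))) (tgt L m)" using kMor s by (simp add: hom1_def)
  note u = unit_square(1,2)[OF m]
  obtain g where g: "g \<in> hom1 (arrow2 L M) (k (c m)) m" "isomorphic L (sq_bot g) (id1 L (tgt L m))"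
    using unit_square(3)[OF m] by blast
  note du = arrow2_hom1D[OF u(1)] and dg = arrow2_hom1D[OF g(1)]
  have 1: "isomorphic L m (k (c m) \<odot> sq_top (\<eta> m))"
    using isomorphic_sym[OF square_isomorphic[OF u(1)]] u(2) comp1_id_left[OF mh] by simp
  have "isomorphic L (sq_bot g \<odot> k (c m)) (id1 L (tgt L m) \<odot> k (c m))"
    using g(2) dg(7) s kMor by (intro isomorphic_rwhisker) (auto simp: hom1_def)
  then have 2: "isomorphic L (k (c m)) (m \<odot> sq_top g)"
    using isomorphic_sym[OF isomorphic_trans[OF square_isomorphic[OF g(1)]]] comp1_id_left[OF kh] by simp
  have "zkernel (op L) Z m (c m)"
  proof (rule op.zkernel_transfer[OF zcokernel_k[OF cE]])
    show "m \<in> Mor (op L)" "src (op L) m = src (op L) (k (c m))" using EM_Mor m s by auto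
    fix X z assume z: "z \<in> hom1 (op L) X (src (op L) (k (c m)))"
    show "nullish (op L) Z (k (c m) \<odot>\<^bsub>op L\<^esub> z) \<longleftrightarrow> nullish (op L) Z (m \<odot>\<^bsub>op L\<^esub> z)"
      using op.factor_nullish[of m "sq_top (\<eta> m)" "k (c m)" _ z X] op.factor_nullish[of "k (c m)" "sq_top g" m _ z X]
        1 2 du(6) dg(6) EM_Mor(2)[OF m] kMor z s by auto
  next
    fix X u v \<xi> assume "u \<in> hom1 (op L) X (src (op L) (k (c m)))" "\<xi> \<in> hom2 (op L) u v"
      "invertible (op L) (m \<rhd>\<^bsub>op L\<^esub> \<xi>)"
    then show "invertible (op L) (k (c m) \<rhd>\<^bsub>op L\<^esub> \<xi>)"
      using op.factor_invertible[of "k (c m)" "sq_top g" m _ u X \<xi> v] 2 dg(6) EM_Mor(2)[OF m] s by auto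
  qed
  then show ?thesis using zkernel_c[OF m] by (simp add: ses_def)
qed

lemma zero_exact: "zero_exact L Z"
  by (rule zero_exactI[of M E]) (use ses_c ses_k c_E(1) k_M(1) factorization_systemD(7)[OF fs] in blast)+

end

theorem corollary3p5:
  fixes L :: "('o, 'a, 'c) twocat" and Z :: 'o
  assumes "two_category L" and "bizero L Z"
  shows
    "(\<exists>E M K C.
        factorization_system L E M \<and> proper11 L E M \<and>
        biequivalence_over L (arrow2 L E) (dom_psfun L) (arrow2 L M) (cod_psfun L) K C \<and>
        normal_psfun (arrow2 L E) (arrow2 L M) K \<and>
        normal_psfun (arrow2 L M) (arrow2 L E) C \<and>
        (\<forall>A \<in> Ob L. src L (F0 K (id1 L A)) = Z \<and> tgt L (F0 C (id1 L A)) = Z))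
     \<longleftrightarrow>
     (let N = zero_ideal L Z in
        has_kernels2 L N \<and> has_cokernels2 L N \<and>
        closed_ideal L N \<and>
        kernels2_normal L N \<and> cokernels2_normal L N \<and>
        kernel_cokernel_factorizations L N)"
proof -
  interpret pointed L Z using assms by (simp add: pointed_def pointed_axioms_def)
  show ?thesis unfolding Let_def
  proof (intro iffI, goal_cases)
    case 1
    then obtain E M K C where fs: "factorization_system L E M" and pr: "proper11 L E M"
      and be: "biequivalence_over L (arrow2 L E) (dom_psfun L) (arrow2 L M) (cod_psfun L) K C"
      and z: "\<And>A. A \<in> Ob L \<Longrightarrow> src L (F0 K (id1 L A)) = Z \<and> tgt L (F0 C (id1 L A)) = Z" by blast
    interpret EM: over_pair L "arrow2 L E" "dom_psfun L" "arrow2 L M" "cod_psfun L"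
      unfolding over_pair_def using over_base_arrow2 by blast
    interpret ME: over_pair L "arrow2 L M" "cod_psfun L" "arrow2 L E" "dom_psfun L"
      unfolding over_pair_def using over_base_arrow2 by blast
    have K: "over_psfun L (arrow2 L E) (dom_psfun L) (arrow2 L M) (cod_psfun L) K"
      using be EM.over_psfunI unfolding biequivalence_over_def by blast
    have C: "over_psfun L (arrow2 L M) (cod_psfun L) (arrow2 L E) (dom_psfun L) C"
      using be ME.over_psfunI unfolding biequivalence_over_def by blast
    obtain \<eta> \<eta>1 \<epsilon> \<epsilon>1 where
      "pseudonat_equivalence (arrow2 L M) (arrow2 L M) (id_psfun (arrow2 L M)) (comp_psfun (arrow2 L M) K C) \<eta> \<eta>1"
      "lies_over (arrow2 L M) L (cod_psfun L) \<eta> \<eta>1"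
      "pseudonat_equivalence (arrow2 L E) (arrow2 L E) (comp_psfun (arrow2 L E) C K) (id_psfun (arrow2 L E)) \<epsilon> \<epsilon>1"
      "lies_over (arrow2 L E) L (dom_psfun L) \<epsilon> \<epsilon>1"
      using be unfolding biequivalence_over_def by blast
    then interpret zero_biequivalence L Z E M K C \<eta> \<eta>1 \<epsilon> \<epsilon>1
      using fs pr K C z by unfold_locales
    show ?case using zero_exact_iff[OF refl] zero_exact by blast
  next
    case 2
    \<comment> \<open>Rigidity has to be drawn from the original clauses first, as the translation
      \<open>zero_exact_iff\<close> presupposes it.\<close>
    have "null_rigid L Z"
    proof (rule null_rigid_of_kernels[OF refl])
      fix B assume "B \<in> Ob L"
      then have "id1 L B \<in> Mor L" by simp
      then show "\<exists>k n \<alpha>. kernel2 L (zero_ideal L Z) (id1 L B) k n \<alpha> \<and> reflects_null_morphisms L (zero_ideal L Z) k"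
        using 2 unfolding has_kernels2_def closed_ideal_def is_kernel2_def by blast
    qed
    then interpret rigid_pointed L Z by unfold_locales
    show ?case using zero_exact_biequivalence zero_exact_iff[OF refl] 2 by blast
  qed
qed

end
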